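(* Let $d\ge 2$, $0<s<d/2$ and $0<\alpha\le d$. If $\beta_d(\alpha)>d-2s$, then $\gamma_d(s)\le\alpha$. Here $\beta_d(\alpha)$ is the optimal decay exponent for spherical $L^2$-averages of the Fourier transform of $\alpha$-dimensional measures, and $\gamma_d(s)$ is the supremum, over initial data $(v_0,v_1)\in\dot H^s(\mathbb{R}^d)\times\dot H^{s-1}(\mathbb{R}^d)$, of the Hausdorff dimension of the divergence set $\mathcal{D}(v_0,v_1)$ of the solution to the wave equation (all defined in the context).
   Context: Fourier transform on $\mathbb{R}^d$: $\widehat f(\xi)=(2\pi)^{-d/2}\int f(x)e^{-ix\cdot\xi}\,dx$, and similarly for measures. Decay exponent. Let $0<\alpha\le d$. A measure $\mu$ is called $\alpha$-dimensional if it is a positive Borel measure on $\mathbb{R}^d$, supported in the unit ball $B(0,1)$, such that $c_\alpha(\mu):=\sup_{x\in\mathbb{R}^d,\,r>0}r^{-\alpha}\mu(B(x,r))<\infty$. Write $\|\mu\|=\mu(\mathbb{R}^d)$. $\beta_d(\alpha)$ denotes the supremum of the numbers $\beta$ for which there is a constant $C$ (independent of $R$ and $\mu$) such that $\|\widehat{\mu}(R\,\cdot\,)\|^2_{L^2(\mathbb{S}^{d-1})}\le C\,c_{\alpha}(\mu)\|\mu\|R^{-\beta}$ for all $R>1$ and all $\alpha$-dimensional $\mu$. Homogeneous Sobolev spaces: $\dot H^s=\{I_s*f: f\in L^2(\mathbb{R}^d)\}$, where $I_s$ is the Riesz kernel, defined by $\widehat I_s(\xi)=|\xi|^{-s}$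 (for $s\le 0$, the operation $f\mapsto I_s*f$ is understood as the Fourier multiplier $|\xi|^{-s}$). The value at a point $x$ of an element $I_s*f$ of $\dot H^s$, $0<s<d/2$, is given by the convolution, where it converges. Wave equation: $\partial_{tt}v=\Delta v$ on $\mathbb{R}^{d+1}$ with $v(\cdot,0)=v_0$, $\partial_tv(\cdot,0)=v_1$. For $(v_0,v_1)\in\dot H^s\times\dot H^{s-1}$ put $f_+=\frac12(v_0-iI_1*v_1)$ and $f_-=\frac12(v_0+iI_1*v_1)$ (both in $\dot H^s$). The solution is defined pointwise by $$v(x,t):=\lim_{N\to\infty}\left(S^N_tf_+(x)+S^N_{-t}f_-(x)\right)$$ whenever the limit exists, where $$S^N_tf(x):=\int_{\mathbb{R}^d}\psi\!\left(\tfrac{|\xi|}{N}\right)\widehat f(\xi)\,e^{ix\cdot\xi+it|\xi|}\,d\xi$$ and $\psi$ is a fixed positive Schwartz function with $\psi(0)=(2\pi)^{-d/2}$. Divergence set: $\mathcal{D}(v_0,v_1):=\{x\in\mathbb{R}^d:\lim_{t\to0}v(x,t)\neq v_0(x)\}$, i.e. the set of $x$ at which it is not the case that $v(x,t)$ converges to $v_0(x)$ as $t\to0$ (including points where these quantities fail to be defined). $\gamma_d(s):=\sup_{(v_0,v_1)\in\dot H^s\times\dot H^{s-1}}\dim_H(\mathcal{D}(v_0,v_1))$, where $\dim_H$ denotes Hausdorff dimension. *)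

theory Defs
  imports "HOL-Analysis.Analysis"
begin

text \<open>
  The space \<open>\<real>\<^sup>d\<close> is rendered by a type \<open>'a\<close> of class \<open>euclidean_space\<close> with \<open>d = DIM('a)\<close>.
  Quantities depending only on the dimension take a \<open>TYPE('a)\<close> argument.
\<close>

section \<open>Decay of spherical averages\<close>

definition fourier_measure :: "'a::euclidean_space measure \<Rightarrow> 'a \<Rightarrow> complex" where
  "fourier_measure \<mu> \<xi> =
     of_real ((2 * pi) powr (- real DIM('a) / 2)) * (LINT x|\<mu>. cis (- (x \<bullet> \<xi>)))"

text \<open>
  Surface measure on the unit sphere, as a Borel measure on the ambient space. By polar coordinates
  the surface measure of \<open>A\<close> is \<open>d\<close> times the volume of the cone \<open>{r *\<^sub>R w | w \<in> A, 0 < r < 1}\<close>,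
  and \<open>sgn x = x /\<^sub>R norm x\<close> is the radial projection.
\<close>

definition sphere_measure :: "'a::euclidean_space measure" where
  "sphere_measure =
     distr (density lborel (\<lambda>x. ennreal (real DIM('a)) * indicator (ball 0 1) x)) borel sgn"

text \<open>Balls \<open>B(x,r)\<close> are closed; using open balls would give the same value of \<open>frostman_const\<close>.\<close>

definition frostman_const :: "real \<Rightarrow> 'a::euclidean_space measure \<Rightarrow> ennreal" where
  "frostman_const \<alpha> \<mu> = (SUP x. SUP r\<in>{0<..}. ennreal (r powr (- \<alpha>)) * emeasure \<mu> (cball x r))"

definition dimensional_measure :: "real \<Rightarrow> 'a::euclidean_space measure \<Rightarrow> bool" where
  "dimensional_measure \<alpha> \<mu> \<longleftrightarrow>
     sets \<mu> = sets borel \<and> emeasure \<mu> (- cball 0 1) = 0 \<and> frostman_const \<alpha> \<mu> < \<infinity>"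

text \<open>The supremum is taken in \<open>ereal\<close>, so that it is meaningful without a boundedness proof.\<close>

definition decay_exponent :: "'a::euclidean_space itself \<Rightarrow> real \<Rightarrow> ereal" where
  "decay_exponent _ \<alpha> = Sup (ereal ` {\<beta>. \<exists>C::real. \<forall>R>1. \<forall>\<mu>::'a measure.
     dimensional_measure \<alpha> \<mu> \<longrightarrow>
     (\<integral>\<^sup>+ \<omega>. ennreal ((cmod (fourier_measure \<mu> (R *\<^sub>R \<omega>)))\<^sup>2) \<partial>sphere_measure)
       \<le> ennreal C * frostman_const \<alpha> \<mu> * emeasure \<mu> UNIV * ennreal (R powr (- \<beta>))})"


section \<open>Schwartz functions and tempered distributions\<close>

fun iterated_partial ::
  "'a::euclidean_space list \<Rightarrow> ('a \<Rightarrow> 'b::real_normed_vector) \<Rightarrow> 'a \<Rightarrow> 'b" where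
  "iterated_partial [] f = f"
| "iterated_partial (b # bs) f = (\<lambda>x. frechet_derivative (iterated_partial bs f) (at x) b)"

definition schwartz :: "('a::euclidean_space \<Rightarrow> 'b::real_normed_vector) set" where
  "schwartz = {f. \<forall>bs. set bs \<subseteq> Basis \<longrightarrow>
     (\<forall>x. iterated_partial bs f differentiable (at x)) \<and>
     (\<forall>k::nat. bounded (range (\<lambda>x. (1 + norm x) ^ k *\<^sub>R iterated_partial bs f x)))}"

definition fourier :: "('a::euclidean_space \<Rightarrow> complex) \<Rightarrow> 'a \<Rightarrow> complex" where
  "fourier f \<xi> =
     of_real ((2 * pi) powr (- real DIM('a) / 2)) * (LINT x|lborel. f x * cis (- (x \<bullet> \<xi>)))"

definition inverse_fourier :: "('a::euclidean_space \<Rightarrow> complex) \<Rightarrow> 'a \<Rightarrow> complex" where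
  "inverse_fourier f x = fourier f (- x)"

text \<open>
  Tempered distributions are functionals on complex Schwartz functions; all those formed below
  take the value \<open>undefined\<close> off \<open>schwartz\<close>, so that equality of distributions is equality in HOL.
\<close>

type_synonym 'a distribution = "('a \<Rightarrow> complex) \<Rightarrow> complex"

definition tempered_function :: "('a::euclidean_space \<Rightarrow> complex) \<Rightarrow> bool" where
  "tempered_function F \<longleftrightarrow>
     F \<in> borel_measurable lborel \<and> (\<forall>\<phi>\<in>schwartz. integrable lborel (\<lambda>x. F x * \<phi> x))"

definition regular_distribution :: "('a::euclidean_space \<Rightarrow> complex) \<Rightarrow> 'a distribution" where
  "regular_distribution f = (\<lambda>\<phi>\<in>schwartz. LINT x|lborel. f x * \<phi> x)"

text \<open>
  The distributional Fourier transform of \<open>T\<close> is the function \<open>F\<close>. Such an \<open>F\<close> is unique up to null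
  sets, and \<open>fourier_function\<close> chooses a representative. It is only ever used under integrals.
\<close>

definition has_fourier :: "'a::euclidean_space distribution \<Rightarrow> ('a \<Rightarrow> complex) \<Rightarrow> bool" where
  "has_fourier T F \<longleftrightarrow>
     tempered_function F \<and> (\<forall>\<phi>\<in>schwartz. T (fourier \<phi>) = (LINT \<xi>|lborel. F \<xi> * \<phi> \<xi>))"

definition fourier_function :: "'a::euclidean_space distribution \<Rightarrow> 'a \<Rightarrow> complex" where
  "fourier_function T = (SOME F. has_fourier T F)"


section \<open>Riesz potentials and homogeneous Sobolev spaces\<close>

definition square_integrable :: "('a::euclidean_space \<Rightarrow> complex) set" where
  "square_integrable =
     {f. f \<in> borel_measurable lborel \<and> integrable lborel (\<lambda>x. (cmod (f x))\<^sup>2)}"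

text \<open>
  The operation \<open>I\<^sub>s *\<close> on distributions, i.e. the Fourier multiplier with symbol \<open>|\<xi>|\<^sup>-\<^sup>s\<close>: the result
  is the distribution whose Fourier transform is the function \<open>|\<xi>|\<^sup>-\<^sup>s\<close> times that of \<open>T\<close>, written out
  by testing against \<open>\<phi> = fourier (inverse_fourier \<phi>)\<close>.
\<close>

definition riesz_potential :: "real \<Rightarrow> 'a::euclidean_space distribution \<Rightarrow> 'a distribution" where
  "riesz_potential s T = (\<lambda>\<phi>\<in>schwartz. LINT \<xi>|lborel.
     of_real (norm \<xi> powr (- s)) * fourier_function T \<xi> * inverse_fourier \<phi> \<xi>)"

definition homogeneous_sobolev :: "real \<Rightarrow> 'a::euclidean_space distribution set" where
  "homogeneous_sobolev s = (\<lambda>f. riesz_potential s (regular_distribution f)) ` square_integrable"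

text \<open>For \<open>0 < s < d\<close> this is a constant multiple of \<open>|x|\<^sup>s\<^sup>-\<^sup>d\<close>, up to a null set.\<close>

definition riesz_kernel :: "real \<Rightarrow> 'a::euclidean_space \<Rightarrow> complex" where
  "riesz_kernel s = (SOME K. tempered_function K \<and>
     has_fourier (regular_distribution K) (\<lambda>\<xi>. of_real (norm \<xi> powr (- s))))"

text \<open>
  The value of \<open>v = I\<^sub>s * f\<close> at \<open>x\<close>, by the absolutely convergent convolution integral. With the
  Fourier transform normalised by \<open>(2\<pi>)\<^sup>-\<^sup>d\<^sup>/\<^sup>2\<close>, convolution has to carry the same factor for \<open>I\<^sub>s * f\<close>
  to have Fourier transform \<open>|\<xi>|\<^sup>-\<^sup>s\<close> times that of \<open>f\<close>. The function \<open>f\<close> is determined by \<open>v\<close> up to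
  a null set.
\<close>

definition has_value_at :: "real \<Rightarrow> 'a::euclidean_space distribution \<Rightarrow> 'a \<Rightarrow> complex \<Rightarrow> bool" where
  "has_value_at s v x c \<longleftrightarrow> (\<exists>f\<in>square_integrable.
     v = riesz_potential s (regular_distribution f) \<and>
     integrable lborel (\<lambda>y. riesz_kernel s (x - y) * f y) \<and>
     c = of_real ((2 * pi) powr (- real DIM('a) / 2)) *
           (LINT y|lborel. riesz_kernel s (x - y) * f y))"


section \<open>The wave equation and its divergence sets\<close>

definition f_plus :: "'a::euclidean_space distribution \<Rightarrow> 'a distribution \<Rightarrow> 'a distribution" where
  "f_plus v\<^sub>0 v\<^sub>1 = (\<lambda>\<phi>\<in>schwartz. (v\<^sub>0 \<phi> - \<i> * riesz_potential 1 v\<^sub>1 \<phi>) / 2)"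

definition f_minus :: "'a::euclidean_space distribution \<Rightarrow> 'a distribution \<Rightarrow> 'a distribution" where
  "f_minus v\<^sub>0 v\<^sub>1 = (\<lambda>\<phi>\<in>schwartz. (v\<^sub>0 \<phi> + \<i> * riesz_potential 1 v\<^sub>1 \<phi>) / 2)"

definition truncated_wave ::
  "(real \<Rightarrow> real) \<Rightarrow> real \<Rightarrow> real \<Rightarrow> 'a::euclidean_space distribution \<Rightarrow> 'a \<Rightarrow> complex" where
  "truncated_wave \<psi> N t f x = (LINT \<xi>|lborel.
     of_real (\<psi> (norm \<xi> / N)) * fourier_function f \<xi> * cis (x \<bullet> \<xi> + t * norm \<xi>))"

definition has_solution_value ::
  "(real \<Rightarrow> real) \<Rightarrow> 'a::euclidean_space distribution \<Rightarrow> 'a distribution \<Rightarrow> 'a \<Rightarrow> real \<Rightarrow> complex \<Rightarrow> bool"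
where
  "has_solution_value \<psi> v\<^sub>0 v\<^sub>1 x t l \<longleftrightarrow>
     ((\<lambda>N. truncated_wave \<psi> N t (f_plus v\<^sub>0 v\<^sub>1) x + truncated_wave \<psi> N (- t) (f_minus v\<^sub>0 v\<^sub>1) x)
        \<longlongrightarrow> l) at_top"

text \<open>
  A point is outside the divergence set if the value \<open>v\<^sub>0(x)\<close> is defined, the values \<open>v(x,t)\<close> are
  defined for all sufficiently small \<open>t \<noteq> 0\<close>, and they converge to \<open>v\<^sub>0(x)\<close>.
\<close>

definition divergence_set ::
  "(real \<Rightarrow> real) \<Rightarrow> real \<Rightarrow> 'a::euclidean_space distribution \<Rightarrow> 'a distribution \<Rightarrow> 'a set" where
  "divergence_set \<psi> s v\<^sub>0 v\<^sub>1 = {x. \<not> (\<exists>c u. has_value_at s v\<^sub>0 x c \<and>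
     (\<forall>\<^sub>F t in at 0. has_solution_value \<psi> v\<^sub>0 v\<^sub>1 x t (u t)) \<and> (u \<longlongrightarrow> c) (at 0))}"


section \<open>Hausdorff dimension\<close>

definition hausdorff_content :: "real \<Rightarrow> real \<Rightarrow> 'a::metric_space set \<Rightarrow> ennreal" where
  "hausdorff_content t \<delta> A =
     Inf {(\<Sum>n. ennreal (diameter (U n) powr t)) | U :: nat \<Rightarrow> 'a set.
       A \<subseteq> (\<Union>n. U n) \<and> (\<forall>n. bounded (U n) \<and> diameter (U n) \<le> \<delta>)}"

definition hausdorff_measure :: "real \<Rightarrow> 'a::metric_space set \<Rightarrow> ennreal" where
  "hausdorff_measure t A = (SUP \<delta>\<in>{0<..}. hausdorff_content t \<delta> A)"

definition hausdorff_dim :: "'a::metric_space set \<Rightarrow> ereal" where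
  "hausdorff_dim A = Inf (ereal ` {t. 0 < t \<and> hausdorff_measure t A = 0})"

definition divergence_dim :: "'a::euclidean_space itself \<Rightarrow> (real \<Rightarrow> real) \<Rightarrow> real \<Rightarrow> ereal" where
  "divergence_dim _ \<psi> s =
     (SUP (v\<^sub>0, v\<^sub>1) \<in> (homogeneous_sobolev s :: 'a distribution set) \<times> homogeneous_sobolev (s - 1).
        hausdorff_dim (divergence_set \<psi> s v\<^sub>0 v\<^sub>1))"

end

theory Submission
  imports Defs "HOL-Probability.Probability" "HOL-Real_Asymp.Real_Asymp"
begin

text \<open>
  By polar coordinates the wave \<open>S\<^sup>N\<^sub>t f\<^sub>\<plusminus>(x)\<close> is the integral over \<open>r > 0\<close> of
  \<open>\<psi>(r / N) e\<^sup>i\<^sup>t\<^sup>r\<close> times the spherical slice of \<open>|\<xi>|\<^sup>-\<^sup>s P(\<xi>) e\<^sup>i\<^sup>x\<^sup>\<xi>\<close> at radius \<open>r\<close>, so dominated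
  convergence gives both limits at every \<open>x\<close> where the slices are integrable in \<open>r\<close>. Writing
  \<open>|\<xi>|\<^sup>-\<^sup>s\<close>, and hence the Riesz kernel, as a superposition of Gaussians and using Fubini identifies
  the limit with \<open>v\<^sub>0(x)\<close> at every \<open>x\<close> where the convolution converges absolutely; the latter follows
  from summability over dyadic scales of Gaussian averages of \<open>|f|\<close>.

  Both exceptional sets are divergence sets of series of uniformly continuous functions \<open>\<Phi>\<^sub>j \<ge> 0\<close>.
  By duality, Cauchy-Schwarz and the decay of the spherical averages of Fourier transforms of measures,
  the integrals of \<open>\<Phi>\<^sub>j\<close> against normalised \<open>\<alpha>\<close>-dimensional measures decay geometrically in \<open>j\<close> since
  \<open>\<beta> > d - 2s\<close>. A discrete Frostman lemma, applied to superlevel sets at a finite dyadic scale, turns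
  this into smallness of the \<open>\<alpha>\<close>-dimensional Hausdorff content of the superlevel sets.
\<close>

section \<open>Polar coordinates\<close>

text \<open>The phase \<open>cis (t * r)\<close> is constant on the sphere of radius r, so
  integrability in r of the moduli of the slices controls all times at once and no maximal function
  in t is estimated. The threshold comes from Cauchy-Schwarz in r, where r^(d - 1 - 2s - \<beta>)
  must be integrable at infinity, that is \<beta> > d - 2s.

  A second exceptional set is forced by the meaning of v0(x): \<open>has_value_at\<close> asks for
  absolute convergence of the convolution, a condition on |f|. The Fourier transform of |f| is not
  controlled pointwise by that of f, hence a separate estimate through the transform of |f|.

  |\<xi>|^(-s) F need not be integrable over R^d, so no inversion integral for v0 is at hand;
  instead the Gamma superposition is exchanged with the radius r, in which integrability is known
  off the exceptional sets.

  Uniform continuity of each \<Phi>_j makes one finite dyadic scale enough: the test measures have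
  explicit densities, and no weak limit of measures is taken.\<close>

lemma nn_integral_lborel_scale:
  fixes f :: "'a::euclidean_space \<Rightarrow> ennreal"
  assumes [measurable]: "f \<in> borel_measurable borel" and c: "c \<noteq> 0"
  shows "(\<integral>\<^sup>+x. f x \<partial>lborel) = ennreal (\<bar>c\<bar> ^ DIM('a)) * (\<integral>\<^sup>+x. f (t + c *\<^sub>R x) \<partial>lborel)"
  by (subst lborel_affine[OF c, of t])
     (simp add: nn_integral_density nn_integral_distr nn_integral_cmult ennreal_power)

lemma borel_measurable_sgn_vector [measurable (raw)]:
  fixes f :: "'b \<Rightarrow> 'a::euclidean_space"
  assumes [measurable]: "f \<in> borel_measurable M"
  shows "(\<lambda>x. sgn (f x)) \<in> borel_measurable M"
  unfolding sgn_div_norm by measurable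

lemma pred_ball [measurable]: "Measurable.pred borel (\<lambda>x::'a::euclidean_space. x \<in> ball c r)"
  by simp

lemma sets_sphere_measure [simp, measurable_cong]: "sets sphere_measure = sets borel"
  by (simp add: sphere_measure_def)

lemma space_sphere_measure [simp]: "space sphere_measure = UNIV"
  by (simp add: sphere_measure_def)

lemma nn_integral_sphere_measure:
  fixes f :: "'a::euclidean_space \<Rightarrow> ennreal"
  assumes [measurable]: "f \<in> borel_measurable borel"
  shows "(\<integral>\<^sup>+w. f w \<partial>sphere_measure) =
    (\<integral>\<^sup>+x. ennreal (real DIM('a)) * indicator (ball 0 1) x * f (sgn x) \<partial>lborel)"
  unfolding sphere_measure_def
  by (subst nn_integral_distr, measurable, subst nn_integral_density, measurable)

lemma finite_measure_sphere: "finite_measure (sphere_measure :: 'a::euclidean_space measure)"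
proof
  have "emeasure (sphere_measure :: 'a measure) UNIV = (\<integral>\<^sup>+w. 1 \<partial>(sphere_measure :: 'a measure))"
    by simp
  also have "\<dots> = ennreal (real DIM('a)) * emeasure lborel (ball (0::'a) 1)"
    by (subst nn_integral_sphere_measure) (simp_all add: nn_integral_cmult_indicator)
  also have "\<dots> < \<infinity>"
    by (metis ennreal_less_top ennreal_mult_less_top emeasure_lborel_ball_finite infinity_ennreal_def)
  finally show "emeasure (sphere_measure :: 'a measure) (space sphere_measure) \<noteq> \<infinity>" by simp
qed

interpretation sphere: finite_measure "sphere_measure :: 'a::euclidean_space measure"
  by (rule finite_measure_sphere)

lemma AE_sphere_measure_norm: "AE w in (sphere_measure :: 'a::euclidean_space measure). norm w = 1"
proof -
  have "AE x in (lborel :: 'a measure). x \<noteq> 0" by (rule AE_lborel_singleton)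
  then show ?thesis
    unfolding sphere_measure_def
    by (subst AE_distr_iff, measurable, subst AE_density, measurable) (auto simp: norm_sgn)
qed

text \<open>In the proof of polar coordinates every point y ends up weighted by d |y|^d /
  \<rho>^(d+1) on the radii \<rho> > |y|. That this total weight is 1 shows that the cone definition
  of \<open>sphere_measure\<close> is correctly normalised.\<close>

lemma radial_weight_integral:
  fixes n :: nat
  assumes "n > 0" "a > 0"
  shows "(\<integral>\<^sup>+\<rho>. ennreal (real n * a ^ n / \<rho> ^ (n + 1)) * (if a < \<rho> then 1 else 0) \<partial>lborel) = 1"
proof -
  have "(\<integral>\<^sup>+\<rho>. ennreal (real n * a ^ n / \<rho> ^ (n + 1)) * (if a < \<rho> then 1 else 0) \<partial>lborel)
    = (\<integral>\<^sup>+\<rho>. ennreal (real n * a ^ n / \<rho> ^ (n + 1)) * indicator {a..} \<rho> \<partial>lborel)"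
    by (intro nn_integral_cong_AE eventually_mono[OF AE_lborel_singleton[of a]])
       (auto simp: indicator_def)
  also have "\<dots> = ennreal (0 - (- (a ^ n / a ^ n)))"
  proof (rule nn_integral_FTC_atLeast[where F = "\<lambda>x. - (a ^ n / x ^ n)"])
    fix x assume "a \<le> x"
    then have x: "x > 0" using assms by simp
    have m: "x * x ^ (n - Suc 0) = x ^ n" using assms(1) by (cases n) auto
    show "((\<lambda>x. - (a ^ n / x ^ n)) has_real_derivative real n * a ^ n / x ^ (n + 1)) (at x)"
      using x m by (auto intro!: derivative_eq_intros simp: field_simps power2_eq_square)
    show "0 \<le> real n * a ^ n / x ^ (n + 1)" using x assms by simp
  next
    have "((\<lambda>x. a ^ n * inverse (x ^ n)) \<longlongrightarrow> a ^ n * 0) at_top"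
      using assms by (intro tendsto_intros tendsto_inverse_0_at_top filterlim_pow_at_top filterlim_ident)
    then show "((\<lambda>x. - (a ^ n / x ^ n)) \<longlongrightarrow> 0) at_top"
      using tendsto_minus by (fastforce simp: divide_inverse)
  qed measurable
  finally show ?thesis using assms by simp
qed

text \<open>\<open>sphere_measure\<close> is an image of Lebesgue measure on the ball, so the right
  side is an integral over pairs (r, x). The scaling r = |x| \<rho> removes the projection
  \<open>sgn\<close>, then y = \<rho> x for fixed \<rho> restores f(y), and the weight that remains
  integrates to 1 in \<rho>.\<close>

theorem nn_integral_polar:
  fixes f :: "'a::euclidean_space \<Rightarrow> ennreal"
  assumes [measurable]: "f \<in> borel_measurable borel"
  shows "(\<integral>\<^sup>+x. f x \<partial>lborel) =
    (\<integral>\<^sup>+r. ennreal (indicator {0<..} r * r ^ (DIM('a) - 1)) *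
      (\<integral>\<^sup>+w. f (r *\<^sub>R w) \<partial>sphere_measure) \<partial>lborel)"
proof -
  define D where "D = DIM('a)"
  have D: "D > 0" "D = Suc (D - 1)" by (auto simp: D_def)
  have "(\<integral>\<^sup>+r. ennreal (indicator {0<..} r * r ^ (D - 1)) *
      (\<integral>\<^sup>+w. f (r *\<^sub>R w) \<partial>sphere_measure) \<partial>lborel) =
     (\<integral>\<^sup>+r. \<integral>\<^sup>+x. ennreal (indicator {0<..} r * r ^ (D - 1)) *
       (ennreal (real D) * indicator (ball 0 1) x * f (r *\<^sub>R sgn x)) \<partial>lborel \<partial>lborel)"
    by (subst nn_integral_sphere_measure) (simp_all add: nn_integral_cmult D_def)
  also have "\<dots> = (\<integral>\<^sup>+x. \<integral>\<^sup>+r. ennreal (indicator {0<..} r * r ^ (D - 1)) *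
       (ennreal (real D) * indicator (ball 0 1) x * f (r *\<^sub>R sgn x)) \<partial>lborel \<partial>lborel)"
    by (rule lborel_pair.Fubini') measurable
  \<comment> \<open>With r = |x| \<rho> the vector r sgn x becomes \<rho> x; the Jacobian |x| and
    the power r^(D-1) combine to |x|^D \<rho>^(D-1).\<close>
  also have "\<dots> = (\<integral>\<^sup>+x. \<integral>\<^sup>+\<rho>. ennreal (indicator {0<..} \<rho> * \<rho> ^ (D - 1)) * ennreal (norm x ^ D) *
       (ennreal (real D) * indicator (ball 0 1) x * f (\<rho> *\<^sub>R x)) \<partial>lborel \<partial>lborel)"
  proof (rule nn_integral_cong_AE, rule eventually_mono[OF AE_lborel_singleton[of 0]])
    fix x :: 'a assume x: "x \<noteq> 0"
    then have nx: "norm x > 0" by simp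
    have "(\<integral>\<^sup>+r. ennreal (indicator {0<..} r * r ^ (D - 1)) *
       (ennreal (real D) * indicator (ball 0 1) x * f (r *\<^sub>R sgn x)) \<partial>lborel) =
      ennreal \<bar>norm x\<bar> * (\<integral>\<^sup>+\<rho>. ennreal (indicator {0<..} (0 + norm x * \<rho>) * (0 + norm x * \<rho>) ^ (D - 1)) *
       (ennreal (real D) * indicator (ball 0 1) x * f ((0 + norm x * \<rho>) *\<^sub>R sgn x)) \<partial>lborel)"
      by (rule nn_integral_real_affine) (use nx in measurable, use nx in auto)
    also have "\<dots> = (\<integral>\<^sup>+\<rho>. ennreal (indicator {0<..} \<rho> * \<rho> ^ (D - 1)) * ennreal (norm x ^ D) *
       (ennreal (real D) * indicator (ball 0 1) x * f (\<rho> *\<^sub>R x)) \<partial>lborel)"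
    proof (subst nn_integral_cmult[symmetric], measurable, rule nn_integral_cong)
      fix \<rho> :: real
      have 1: "(0 + norm x * \<rho>) *\<^sub>R sgn x = \<rho> *\<^sub>R x" using nx by (simp add: sgn_div_norm)
      have 2: "ennreal \<bar>norm x\<bar> * ennreal (indicator {0<..} (0 + norm x * \<rho>) * (0 + norm x * \<rho>) ^ (D - 1))
        = ennreal (indicator {0<..} \<rho> * \<rho> ^ (D - 1)) * ennreal (norm x ^ D)"
      proof (cases "\<rho> > 0")
        case True
        have "norm x * (norm x * \<rho>) ^ (D - 1) = \<rho> ^ (D - 1) * norm x ^ D"
          by (subst (2) D(2)) (simp add: power_mult_distrib)
        with True nx show ?thesis by (simp add: ennreal_mult[symmetric])
      next
        case False
        with nx have "\<not> 0 < norm x * \<rho>" by (simp add: zero_less_mult_iff)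
        with False show ?thesis by simp
      qed
      show "ennreal \<bar>norm x\<bar> * (ennreal (indicator {0<..} (0 + norm x * \<rho>) * (0 + norm x * \<rho>) ^ (D - 1)) *
         (ennreal (real D) * indicator (ball 0 1) x * f ((0 + norm x * \<rho>) *\<^sub>R sgn x))) =
         ennreal (indicator {0<..} \<rho> * \<rho> ^ (D - 1)) * ennreal (norm x ^ D) *
         (ennreal (real D) * indicator (ball 0 1) x * f (\<rho> *\<^sub>R x))"
        unfolding 1 mult.assoc[symmetric] 2 by simp
    qed
    finally show "(\<integral>\<^sup>+r. ennreal (indicator {0<..} r * r ^ (D - 1)) *
       (ennreal (real D) * indicator (ball 0 1) x * f (r *\<^sub>R sgn x)) \<partial>lborel) =
       (\<integral>\<^sup>+\<rho>. ennreal (indicator {0<..} \<rho> * \<rho> ^ (D - 1)) * ennreal (norm x ^ D) *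
       (ennreal (real D) * indicator (ball 0 1) x * f (\<rho> *\<^sub>R x)) \<partial>lborel)" .
  qed
  also have "\<dots> = (\<integral>\<^sup>+\<rho>. \<integral>\<^sup>+x. ennreal (indicator {0<..} \<rho> * \<rho> ^ (D - 1)) * ennreal (norm x ^ D) *
       (ennreal (real D) * indicator (ball 0 1) x * f (\<rho> *\<^sub>R x)) \<partial>lborel \<partial>lborel)"
    by (rule lborel_pair.Fubini'[symmetric]) measurable
  \<comment> \<open>The ball condition |x| < 1 turns into |y| < \<rho>, and \<rho> \<le> 0
    contributes nothing on either side.\<close>
  also have "\<dots> = (\<integral>\<^sup>+\<rho>. \<integral>\<^sup>+y. ennreal (real D * norm y ^ D / \<rho> ^ (D + 1)) * (if norm y < \<rho> then 1 else 0) * f y \<partial>lborel \<partial>lborel)"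
  proof (rule nn_integral_cong)
    fix \<rho> :: real
    show "(\<integral>\<^sup>+x. ennreal (indicator {0<..} \<rho> * \<rho> ^ (D - 1)) * ennreal (norm x ^ D) *
       (ennreal (real D) * indicator (ball 0 1) x * f (\<rho> *\<^sub>R x)) \<partial>lborel) =
       (\<integral>\<^sup>+y. ennreal (real D * norm y ^ D / \<rho> ^ (D + 1)) * (if norm y < \<rho> then 1 else 0) * f y \<partial>lborel)"
    proof (cases "\<rho> > 0")
      case True
      have "(\<integral>\<^sup>+(y::'a). ennreal (real D * norm y ^ D / \<rho> ^ (D + 1)) * (if norm y < \<rho> then 1 else 0) * f y \<partial>lborel) =
        ennreal (\<bar>\<rho>\<bar> ^ DIM('a)) * (\<integral>\<^sup>+(x::'a). ennreal (real D * norm (0 + \<rho> *\<^sub>R x) ^ D / \<rho> ^ (D + 1)) * (if norm (0 + \<rho> *\<^sub>R x) < \<rho> then 1 else 0) * f (0 + \<rho> *\<^sub>R x) \<partial>lborel)"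
        by (rule nn_integral_lborel_scale) (use True in measurable, use True in auto)
      also have "\<dots> = (\<integral>\<^sup>+x. ennreal (indicator {0<..} \<rho> * \<rho> ^ (D - 1)) * ennreal (norm x ^ D) *
       (ennreal (real D) * indicator (ball 0 1) x * f (\<rho> *\<^sub>R x)) \<partial>lborel)"
      proof (subst nn_integral_cmult[symmetric], measurable, rule nn_integral_cong)
        fix x :: 'a
        have 1: "(if norm (0 + \<rho> *\<^sub>R x) < \<rho> then 1 else 0 :: ennreal) = indicator (ball 0 1) x"
          using True by (auto simp: indicator_def)
        have r: "\<rho> ^ D * (real D * (\<rho> ^ D * norm x ^ D) / \<rho> ^ (D + 1)) = \<rho> ^ (D - 1) * norm x ^ D * real D"
          using True D(2) by (simp add: field_simps) (metis mult.assoc mult.commute power_Suc)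
        have 2: "ennreal (\<bar>\<rho>\<bar> ^ DIM('a)) * ennreal (real D * norm (0 + \<rho> *\<^sub>R x) ^ D / \<rho> ^ (D + 1))
          = ennreal (indicator {0<..} \<rho> * \<rho> ^ (D - 1)) * ennreal (norm x ^ D) * ennreal (real D)"
          using True r by (simp add: D_def[symmetric] ennreal_mult[symmetric] power_mult_distrib)
        show "ennreal (\<bar>\<rho>\<bar> ^ DIM('a)) * (ennreal (real D * norm (0 + \<rho> *\<^sub>R x) ^ D / \<rho> ^ (D + 1)) * (if norm (0 + \<rho> *\<^sub>R x) < \<rho> then 1 else 0) * f (0 + \<rho> *\<^sub>R x)) =
         ennreal (indicator {0<..} \<rho> * \<rho> ^ (D - 1)) * ennreal (norm x ^ D) * (ennreal (real D) * indicator (ball 0 1) x * f (\<rho> *\<^sub>R x))"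
          unfolding 1 mult.assoc[symmetric] 2 by simp
      qed
      finally show ?thesis ..
    next
      case False
      then have "\<not> norm y < \<rho>" for y :: 'a
        using norm_ge_zero[of y] by linarith
      with False show ?thesis by simp
    qed
  qed
  also have "\<dots> = (\<integral>\<^sup>+y. \<integral>\<^sup>+\<rho>. ennreal (real D * norm y ^ D / \<rho> ^ (D + 1)) * (if norm y < \<rho> then 1 else 0) * f y \<partial>lborel \<partial>lborel)"
    by (rule lborel_pair.Fubini') measurable
  also have "\<dots> = (\<integral>\<^sup>+y. f y \<partial>lborel)"
  proof (rule nn_integral_cong_AE, rule eventually_mono[OF AE_lborel_singleton[of 0]])
    fix y :: 'a assume "y \<noteq> 0"
    have "(\<integral>\<^sup>+\<rho>. ennreal (real D * norm y ^ D / \<rho> ^ (D + 1)) * (if norm y < \<rho> then 1 else 0) * f y \<partial>lborel) =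
      (\<integral>\<^sup>+\<rho>. ennreal (real D * norm y ^ D / \<rho> ^ (D + 1)) * (if norm y < \<rho> then 1 else 0) \<partial>lborel) * f y"
      by (rule nn_integral_multc) measurable
    also have "\<dots> = f y"
      using radial_weight_integral[of D "norm y"] D(1) \<open>y \<noteq> 0\<close> by simp
    finally show "(\<integral>\<^sup>+\<rho>. ennreal (real D * norm y ^ D / \<rho> ^ (D + 1)) * (if norm y < \<rho> then 1 else 0) * f y \<partial>lborel) = f y" .
  qed
  finally show ?thesis by (simp add: D_def)
qed

text \<open>The half-line with density r^(d-1), kept as a measure of its own so that the product
  theorems for Bochner integrals apply to the pair (radius, direction).\<close>

definition radial_measure :: "'a::euclidean_space itself \<Rightarrow> real measure" where
  "radial_measure _ = density lborel (\<lambda>r. ennreal (indicator {0<..} r * r ^ (DIM('a) - 1)))"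

lemma sets_radial_measure [simp, measurable_cong]: "sets (radial_measure TYPE('a::euclidean_space)) = sets borel"
  by (simp add: radial_measure_def)

lemma space_radial_measure [simp]: "space (radial_measure TYPE('a::euclidean_space)) = UNIV"
  by (simp add: radial_measure_def)

lemma sigma_finite_radial: "sigma_finite_measure (radial_measure TYPE('a::euclidean_space))"
  unfolding radial_measure_def
  by (subst sigma_finite_measure.sigma_finite_iff_density_finite[OF sigma_finite_lborel]) auto

interpretation polar: pair_sigma_finite "radial_measure TYPE('a::euclidean_space)" "sphere_measure :: 'a::euclidean_space measure"
  by (simp add: pair_sigma_finite_def sigma_finite_radial sphere.sigma_finite_measure_axioms)

lemma nn_integral_radial:
  assumes [measurable]: "f \<in> borel_measurable borel"
  shows "(\<integral>\<^sup>+r. f r \<partial>radial_measure TYPE('a::euclidean_space)) =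
    (\<integral>\<^sup>+r. ennreal (indicator {0<..} r * r ^ (DIM('a) - 1)) * f r \<partial>lborel)"
  unfolding radial_measure_def by (subst nn_integral_density) measurable

text \<open>Stating polar coordinates as an equality of measures transfers them from nonnegative
  functions to integrable vector-valued ones, through the change of variables for
  \<open>distr\<close>.\<close>

lemma lborel_polar:
  "distr (radial_measure TYPE('a::euclidean_space) \<Otimes>\<^sub>M (sphere_measure :: 'a measure)) borel (\<lambda>(r, w). r *\<^sub>R w) = lborel"
proof (rule measure_eqI)
  fix A assume "A \<in> sets (distr (radial_measure TYPE('a) \<Otimes>\<^sub>M (sphere_measure :: 'a measure)) borel (\<lambda>(r, w). r *\<^sub>R w))"
  then have [measurable]: "A \<in> sets borel" by simp
  have "emeasure (distr (radial_measure TYPE('a) \<Otimes>\<^sub>M (sphere_measure :: 'a measure)) borel (\<lambda>(r, w). r *\<^sub>R w)) A =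
    (\<integral>\<^sup>+x. indicator A x \<partial>distr (radial_measure TYPE('a) \<Otimes>\<^sub>M (sphere_measure :: 'a measure)) borel (\<lambda>(r, w). r *\<^sub>R w))"
    by simp
  also have "\<dots> = (\<integral>\<^sup>+p. indicator A (fst p *\<^sub>R snd p) \<partial>(radial_measure TYPE('a) \<Otimes>\<^sub>M (sphere_measure :: 'a measure)))"
    by (subst nn_integral_distr) (auto simp: split_beta')
  also have "\<dots> = (\<integral>\<^sup>+r. \<integral>\<^sup>+w. indicator A (r *\<^sub>R w) \<partial>sphere_measure \<partial>radial_measure TYPE('a))"
    by (subst sphere.nn_integral_fst[symmetric]) auto
  also have "\<dots> = (\<integral>\<^sup>+x. indicator A x \<partial>lborel)"
    by (subst nn_integral_polar, measurable, subst nn_integral_radial, measurable)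
  finally show "emeasure (distr (radial_measure TYPE('a) \<Otimes>\<^sub>M (sphere_measure :: 'a measure)) borel (\<lambda>(r, w). r *\<^sub>R w)) A = emeasure lborel A"
    by simp
qed simp

lemma
  fixes f :: "'a::euclidean_space \<Rightarrow> 'b::{banach, second_countable_topology}"
  assumes f: "integrable lborel f"
  shows integrable_polar: "integrable (radial_measure TYPE('a)) (\<lambda>r. LINT w|sphere_measure. f (r *\<^sub>R w))"
    and AE_integrable_polar: "AE r in radial_measure TYPE('a). integrable sphere_measure (\<lambda>w. f (r *\<^sub>R w))"
    and integral_polar: "(LINT x|lborel. f x) = (LINT r|radial_measure TYPE('a). LINT w|sphere_measure. f (r *\<^sub>R w))"
proof -
  have [measurable]: "f \<in> borel_measurable borel" using borel_measurable_integrable[OF f] by simp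
  have i: "integrable (radial_measure TYPE('a) \<Otimes>\<^sub>M (sphere_measure :: 'a measure)) (\<lambda>(r, w). f (r *\<^sub>R w))"
    using f by (subst (asm) lborel_polar[symmetric], subst (asm) integrable_distr_eq) (auto simp: split_beta')
  have e: "(LINT x|lborel. f x) = (LINT p|(radial_measure TYPE('a) \<Otimes>\<^sub>M (sphere_measure :: 'a measure)). (\<lambda>(r, w). f (r *\<^sub>R w)) p)"
    by (subst lborel_polar[symmetric], subst integral_distr) (auto simp: split_beta')
  show "integrable (radial_measure TYPE('a)) (\<lambda>r. LINT w|sphere_measure. f (r *\<^sub>R w))"
    using polar.integrable_fst[OF i] .
  show "AE r in radial_measure TYPE('a). integrable sphere_measure (\<lambda>w. f (r *\<^sub>R w))"
    using polar.AE_integrable_fst[OF i] .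
  show "(LINT x|lborel. f x) = (LINT r|radial_measure TYPE('a). LINT w|sphere_measure. f (r *\<^sub>R w))"
    unfolding e by (rule polar.integral_fst[OF i, symmetric])
qed

lemma nn_integral_radial_function:
  fixes g :: "real \<Rightarrow> ennreal"
  assumes [measurable]: "g \<in> borel_measurable borel"
  shows "(\<integral>\<^sup>+x. g (norm x) \<partial>(lborel :: 'a::euclidean_space measure)) =
    emeasure (sphere_measure :: 'a measure) UNIV *
    (\<integral>\<^sup>+r. ennreal (indicator {0<..} r * r ^ (DIM('a) - 1)) * g r \<partial>lborel)"
proof -
  have "(\<integral>\<^sup>+x. g (norm x) \<partial>(lborel :: 'a measure)) =
    (\<integral>\<^sup>+r. ennreal (indicator {0<..} r * r ^ (DIM('a) - 1)) *
      (\<integral>\<^sup>+w. g (norm (r *\<^sub>R w)) \<partial>(sphere_measure :: 'a measure)) \<partial>lborel)"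
    by (subst nn_integral_polar) auto
  also have "\<dots> = (\<integral>\<^sup>+r. ennreal (indicator {0<..} r * r ^ (DIM('a) - 1)) *
      (g r * emeasure (sphere_measure :: 'a measure) UNIV) \<partial>lborel)"
  proof (rule nn_integral_cong)
    fix r :: real
    have "(\<integral>\<^sup>+w. g (norm (r *\<^sub>R w)) \<partial>(sphere_measure :: 'a measure)) = (\<integral>\<^sup>+w. g \<bar>r\<bar> \<partial>(sphere_measure :: 'a measure))"
      by (intro nn_integral_cong_AE eventually_mono[OF AE_sphere_measure_norm]) auto
    then show "ennreal (indicator {0<..} r * r ^ (DIM('a) - 1)) *
      (\<integral>\<^sup>+w. g (norm (r *\<^sub>R w)) \<partial>(sphere_measure :: 'a measure)) =
      ennreal (indicator {0<..} r * r ^ (DIM('a) - 1)) * (g r * emeasure (sphere_measure :: 'a measure) UNIV)"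
      by (cases "r > 0") auto
  qed
  also have "\<dots> = emeasure (sphere_measure :: 'a measure) UNIV *
    (\<integral>\<^sup>+r. ennreal (indicator {0<..} r * r ^ (DIM('a) - 1)) * g r \<partial>lborel)"
    by (subst nn_integral_cmult[symmetric], measurable) (simp add: mult_ac)
  finally show ?thesis .
qed

text \<open>The common majorant for the Schwartz estimates. In polar coordinates r^(d-1) is absorbed
  by d-1 of the d+1 powers of 1+r, which leaves 1/(1+r)^2.\<close>

lemma integrable_inverse_power_norm:
  "integrable lborel (\<lambda>x::'a::euclidean_space. 1 / (1 + norm x) ^ (DIM('a) + 1))"
proof (rule integrableI_nonneg)
  define S where "S = emeasure (sphere_measure :: 'a measure) UNIV"
  have "(\<integral>\<^sup>+(x::'a). ennreal (1 / (1 + norm x) ^ (DIM('a) + 1)) \<partial>lborel) = (\<integral>\<^sup>+(x::'a). ennreal (1 / (1 + \<bar>norm x\<bar>) ^ (DIM('a) + 1)) \<partial>lborel)"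
    by simp
  also have "\<dots> = S * (\<integral>\<^sup>+r. ennreal (indicator {0<..} r * r ^ (DIM('a) - 1)) * ennreal (1 / (1 + \<bar>r\<bar>) ^ (DIM('a) + 1)) \<partial>lborel)"
    unfolding S_def by (rule nn_integral_radial_function) measurable
  also have "\<dots> \<le> S * (\<integral>\<^sup>+r. ennreal (1 / (1 + r)\<^sup>2) * indicator {0..} r \<partial>lborel)"
  proof (intro mult_left_mono nn_integral_mono)
    fix r :: real
    show "ennreal (indicator {0<..} r * r ^ (DIM('a) - 1)) * ennreal (1 / (1 + \<bar>r\<bar>) ^ (DIM('a) + 1)) \<le> ennreal (1 / (1 + r)\<^sup>2) * indicator {0..} r"
    proof (cases "r > 0")
      case True
      have "r ^ (DIM('a) - 1) * (1 + r)\<^sup>2 \<le> (1 + r) ^ (DIM('a) - 1) * (1 + r)\<^sup>2"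
        using True by (intro mult_right_mono power_mono) auto
      also have "\<dots> = (1 + r) ^ (DIM('a) + 1)"
        using DIM_positive[where 'a='a] by (simp add: power_add[symmetric] del: power_Suc DIM_positive)
      finally have "r ^ (DIM('a) - 1) * (1 / (1 + r) ^ (DIM('a) + 1)) \<le> 1 / (1 + r)\<^sup>2"
        using True by (simp add: divide_simps mult.commute del: power_Suc)
      with True show ?thesis by (simp add: ennreal_mult[symmetric] del: power_Suc)
    qed (simp add: indicator_def)
  qed simp
  also have "(\<integral>\<^sup>+r. ennreal (1 / (1 + r)\<^sup>2) * indicator {0..} r \<partial>lborel) = ennreal (0 - (- 1 / (1 + 0)))"
  proof (rule nn_integral_FTC_atLeast[where F = "\<lambda>x. - 1 / (1 + x)"])
    show "((\<lambda>x. - 1 / (1 + x)) has_real_derivative 1 / (1 + x)\<^sup>2) (at x)" if "0 \<le> x" for x :: real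
      using that by (auto intro!: derivative_eq_intros simp: power2_eq_square field_simps)
    show "((\<lambda>x::real. - 1 / (1 + x)) \<longlongrightarrow> 0) at_top"
      by real_asymp
  qed auto
  also have "S * ennreal (0 - (- 1 / (1 + 0))) < \<infinity>"
    unfolding S_def using sphere.emeasure_finite[of UNIV] by (simp add: less_top[symmetric])
  finally show "(\<integral>\<^sup>+(x::'a). ennreal (1 / (1 + norm x) ^ (DIM('a) + 1)) \<partial>lborel) < \<infinity>" .
qed auto

section \<open>Gaussians\<close>

lemma norm_sq_sum_Basis: "(norm (x::'a::euclidean_space))\<^sup>2 = (\<Sum>b\<in>Basis. (x \<bullet> b)\<^sup>2)"
  by (subst euclidean_inner[of x x, folded power2_norm_eq_inner]) (simp add: power2_eq_square)

lemma cis_sum: "cis (sum f A) = (\<Prod>a\<in>A. cis (f a))"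
  by (induction A rule: infinite_finite_induct) (auto simp: cis_mult[symmetric])

lemma cis_measurable [measurable (raw)]:
  assumes [measurable]: "f \<in> borel_measurable M"
  shows "(\<lambda>z. cis (f z)) \<in> borel_measurable M"
  unfolding cis_conv_exp by measurable

text \<open>Lebesgue measure is the image of a product measure over the basis; this reduces Gaussian
  integrals on R^d to dimension one.\<close>

lemma
  fixes f :: "'a::euclidean_space \<Rightarrow> real \<Rightarrow> complex"
  assumes i: "\<And>b. b \<in> Basis \<Longrightarrow> integrable lborel (f b)"
  shows lborel_integrable_prod: "integrable lborel (\<lambda>x::'a. \<Prod>b\<in>Basis. f b (x \<bullet> b))"
    and lborel_integral_prod: "(LINT x|(lborel::'a measure). (\<Prod>b\<in>Basis. f b (x \<bullet> b))) = (\<Prod>b\<in>Basis. LINT x|lborel. f b x)"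
proof -
  interpret product_sigma_finite "\<lambda>b::'a. lborel :: real measure" ..
  have [measurable]: "f b \<in> borel_measurable borel" if "b \<in> Basis" for b
    using borel_measurable_integrable[OF i[OF that]] by simp
  have e: "(\<Sum>b\<in>Basis. g b *\<^sub>R b) \<bullet> c = g c" if "c \<in> Basis" for g :: "'a \<Rightarrow> real" and c
    using that by simp
  have [measurable]: "(\<lambda>g. \<Sum>b\<in>Basis. g b *\<^sub>R b) \<in> (\<Pi>\<^sub>M b\<in>(Basis::'a set). lborel) \<rightarrow>\<^sub>M borel"
    by measurable
  show "integrable lborel (\<lambda>x::'a. \<Prod>b\<in>Basis. f b (x \<bullet> b))"
    by (subst lborel_eq, subst integrable_distr_eq)
       (auto intro!: product_integrable_prod i simp: e cong: prod.cong)
  show "(LINT x|(lborel::'a measure). (\<Prod>b\<in>Basis. f b (x \<bullet> b))) = (\<Prod>b\<in>Basis. LINT x|lborel. f b x)"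
    by (subst lborel_eq, subst integral_distr)
       (auto intro!: product_integral_prod i simp: e cong: prod.cong)
qed

text \<open>Scaling by k = sqrt(2c) turns exp(-c x^2) into the standard normal density up to the
  factor sqrt(2 pi), and the integral into its characteristic function at u = -t/k.\<close>

lemma
  fixes c t :: real
  assumes c: "c > 0"
  shows gaussian_cis_integrable_real: "integrable lborel (\<lambda>x. of_real (exp (- c * x\<^sup>2)) * cis (- (x * t)))"
    and gaussian_cis_integral_real: "(LINT x|lborel. of_real (exp (- c * x\<^sup>2)) * cis (- (x * t))) = of_real (sqrt (pi / c) * exp (- t\<^sup>2 / (4 * c)))"
proof -
  define k where "k = sqrt (2 * c)"
  have k: "k > 0" "k\<^sup>2 = 2 * c" using c by (auto simp: k_def)
  define u where "u = - t / k"
  have std: "std_normal_density (0 + k * x) = exp (- c * x\<^sup>2) / sqrt (2 * pi)" for x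
    by (simp add: std_normal_density_def power_mult_distrib k)
  have i: "integrable lborel (\<lambda>x. of_real (std_normal_density x) * cis (u * x))"
    by (rule Bochner_Integration.integrable_bound[OF integrable_normal_density[of 1 0]]) (auto simp: norm_mult)
  have "exp (- u\<^sup>2 / 2) = char std_normal_distribution u"
    by (simp add: char_std_normal_distribution)
  also have "\<dots> = (LINT x|lborel. of_real (std_normal_density x) * cis (u * x))"
    unfolding char_def by (subst integral_density) (auto simp: scaleR_conv_of_real cis_conv_exp intro!: Bochner_Integration.integral_cong)
  finally have e: "(LINT x|lborel. of_real (std_normal_density x) * cis (u * x)) = complex_of_real (exp (- u\<^sup>2 / 2))" by simp
  have ux: "u * (0 + k * x) = - (x * t)" for x using k by (simp add: u_def)
  have i2: "integrable lborel (\<lambda>x. of_real (std_normal_density (0 + k * x)) * cis (u * (0 + k * x)))"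
    by (rule lborel_integrable_real_affine[OF i]) (use k in auto)
  have "integrable lborel (\<lambda>x. of_real (sqrt (2 * pi)) * (of_real (std_normal_density (0 + k * x)) * cis (u * (0 + k * x))))"
    using i2 by (rule integrable_mult_right)
  then show "integrable lborel (\<lambda>x. of_real (exp (- c * x\<^sup>2)) * cis (- (x * t)))"
    unfolding std ux by (simp add: mult.assoc[symmetric])
  have "complex_of_real (exp (- u\<^sup>2 / 2)) = \<bar>k\<bar> *\<^sub>R (LINT x|lborel. of_real (std_normal_density (0 + k * x)) * cis (u * (0 + k * x)))"
    unfolding e[symmetric] by (rule lborel_integral_real_affine) (use k in auto)
  also have "(LINT x|lborel. of_real (std_normal_density (0 + k * x)) * cis (u * (0 + k * x)))
     = (LINT x|lborel. of_real (1 / sqrt (2 * pi)) * (of_real (exp (- c * x\<^sup>2)) * cis (- (x * t))))"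
    unfolding std ux by (intro Bochner_Integration.integral_cong) auto
  also have "\<dots> = of_real (1 / sqrt (2 * pi)) * (LINT x|lborel. of_real (exp (- c * x\<^sup>2)) * cis (- (x * t)))"
    by (rule integral_mult_right_zero)
  finally have "(LINT x|lborel. of_real (exp (- c * x\<^sup>2)) * cis (- (x * t))) = of_real (sqrt (2 * pi) / k * exp (- u\<^sup>2 / 2))"
    using k by (simp add: scaleR_conv_of_real field_simps)
  also have "sqrt (2 * pi) / k = sqrt (pi / c)"
    using c by (simp add: k_def real_sqrt_divide[symmetric] del: real_sqrt_divide real_sqrt_mult)
  also have "- u\<^sup>2 / 2 = - t\<^sup>2 / (4 * c)"
    using k by (simp add: u_def power_divide)
  finally show "(LINT x|lborel. of_real (exp (- c * x\<^sup>2)) * cis (- (x * t))) = of_real (sqrt (pi / c) * exp (- t\<^sup>2 / (4 * c)))" .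
qed

lemma gaussian_cis_prod:
  fixes x y :: "'a::euclidean_space"
  shows "of_real (exp (- c * (norm x)\<^sup>2)) * cis (- (x \<bullet> y)) =
    (\<Prod>b\<in>Basis. of_real (exp (- c * (x \<bullet> b)\<^sup>2)) * cis (- ((x \<bullet> b) * (y \<bullet> b))))"
  by (subst euclidean_inner[of x y])
     (simp add: prod.distrib norm_sq_sum_Basis sum_distrib_left exp_sum cis_sum sum_negf[symmetric] of_real_prod[symmetric]
      del: of_real_prod)

lemma
  fixes y :: "'a::euclidean_space"
  assumes c: "c > 0"
  shows gaussian_cis_integrable: "integrable lborel (\<lambda>x. of_real (exp (- c * (norm x)\<^sup>2)) * cis (- (x \<bullet> y)))"
    and gaussian_cis_integral: "(LINT x|lborel. of_real (exp (- c * (norm x)\<^sup>2)) * cis (- (x \<bullet> y))) =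
      of_real ((pi / c) powr (real DIM('a) / 2) * exp (- (norm y)\<^sup>2 / (4 * c)))"
proof -
  note i = gaussian_cis_integrable_real[OF c]
  show "integrable lborel (\<lambda>x. of_real (exp (- c * (norm x)\<^sup>2)) * cis (- (x \<bullet> y)))"
    unfolding gaussian_cis_prod using i by (rule lborel_integrable_prod)
  have "(LINT x|lborel. of_real (exp (- c * (norm x)\<^sup>2)) * cis (- (x \<bullet> y))) =
    (\<Prod>b\<in>Basis. complex_of_real (sqrt (pi / c) * exp (- (y \<bullet> b)\<^sup>2 / (4 * c))))"
    unfolding gaussian_cis_prod by (subst lborel_integral_prod[OF i]) (simp only: gaussian_cis_integral_real[OF c])
  also have "\<dots> = of_real (sqrt (pi / c) ^ DIM('a) * exp (- (norm y)\<^sup>2 / (4 * c)))"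
    unfolding of_real_prod[symmetric]
    by (simp add: prod.distrib norm_sq_sum_Basis exp_sum[symmetric] sum_negf sum_divide_distrib)
  also have "sqrt (pi / c) ^ DIM('a) = (pi / c) powr (real DIM('a) / 2)"
    using c by (simp add: powr_half_sqrt[symmetric] powr_realpow[symmetric] powr_powr)
  finally show "(LINT x|lborel. of_real (exp (- c * (norm x)\<^sup>2)) * cis (- (x \<bullet> y))) =
      of_real ((pi / c) powr (real DIM('a) / 2) * exp (- (norm y)\<^sup>2 / (4 * c)))" .
qed

lemma gaussian_integrable: "c > 0 \<Longrightarrow> integrable lborel (\<lambda>x::'a::euclidean_space. exp (- c * (norm x)\<^sup>2))"
  using integrable_norm[OF gaussian_cis_integrable[of c "0::'a"]] by (simp add: norm_mult)

lemma gaussian_integral: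
  assumes "c > 0"
  shows "(LINT x|(lborel::'a::euclidean_space measure). exp (- c * (norm x)\<^sup>2)) = (pi / c) powr (real DIM('a) / 2)"
proof -
  have "complex_of_real (LINT x|(lborel::'a measure). exp (- c * (norm x)\<^sup>2)) = of_real ((pi / c) powr (real DIM('a) / 2))"
    using gaussian_cis_integral[OF assms, of "0::'a"] by (simp flip: integral_complex_of_real)
  then show ?thesis by (simp only: of_real_eq_iff)
qed

text \<open>The Fourier transform of exp(-\<tau>|\<xi>|^2) in the normalisation (2 pi)^(-d/2). It is
  (2 pi)^(d/2) times the heat kernel at time \<tau>, so its total mass is (2 pi)^(d/2) and not 1;
  this factor recurs in the regularisations below.\<close>

definition gauss_kernel :: "real \<Rightarrow> 'a::euclidean_space \<Rightarrow> real" where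
  "gauss_kernel \<tau> x = (2 * \<tau>) powr (- real DIM('a) / 2) * exp (- (norm x)\<^sup>2 / (4 * \<tau>))"

text \<open>For \<tau> > 0 a Schwartz function of \<xi> whose transform is the Gaussian kernel
  centred at x. Testing a distribution against it evaluates a Gaussian average at the point x from
  the Fourier side.\<close>

definition gauss_wave :: "real \<Rightarrow> 'a::euclidean_space \<Rightarrow> 'a \<Rightarrow> complex" where
  "gauss_wave \<tau> x \<xi> = of_real (exp (- \<tau> * (norm \<xi>)\<^sup>2)) * cis (x \<bullet> \<xi>)"

lemma gauss_wave_measurable [measurable (raw)]:
  assumes [measurable]: "f \<in> borel_measurable M" "g \<in> borel_measurable M" "h \<in> borel_measurable M"
  shows "(\<lambda>z. gauss_wave (f z) (g z) (h z)) \<in> borel_measurable M"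
  unfolding gauss_wave_def cis_conv_exp by measurable

lemma gauss_kernel_measurable [measurable (raw)]:
  assumes [measurable]: "f \<in> borel_measurable M" "g \<in> borel_measurable M"
  shows "(\<lambda>z. gauss_kernel (f z) (g z)) \<in> borel_measurable M"
  unfolding gauss_kernel_def by measurable

lemma gauss_wave_integrable: "\<tau> > 0 \<Longrightarrow> integrable lborel (gauss_wave \<tau> x)"
  using gaussian_cis_integrable[of \<tau> "- x"] by (simp add: gauss_wave_def[abs_def] inner_commute)

lemma norm_gauss_wave: "norm (gauss_wave \<tau> x \<xi>) = exp (- \<tau> * (norm \<xi>)\<^sup>2)"
  by (simp add: gauss_wave_def norm_mult)

lemma gauss_kernel_nonneg [simp]: "gauss_kernel \<tau> x \<ge> 0"
  by (simp add: gauss_kernel_def)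

lemma fourier_gauss_wave:
  fixes x :: "'a::euclidean_space"
  assumes "\<tau> > 0"
  shows "fourier (gauss_wave \<tau> x) y = of_real (gauss_kernel \<tau> (x - y))"
proof -
  have "(LINT \<xi>|lborel. gauss_wave \<tau> x \<xi> * cis (- (\<xi> \<bullet> y))) =
    (LINT \<xi>|lborel. of_real (exp (- \<tau> * (norm \<xi>)\<^sup>2)) * cis (- (\<xi> \<bullet> (y - x))))"
    by (intro Bochner_Integration.integral_cong)
       (auto simp: gauss_wave_def mult.assoc cis_mult inner_diff_right inner_commute)
  also have "\<dots> = of_real ((pi / \<tau>) powr (real DIM('a) / 2) * exp (- (norm (x - y))\<^sup>2 / (4 * \<tau>)))"
    using gaussian_cis_integral[OF assms, of "y - x"] by (simp add: norm_minus_commute)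
  finally have "fourier (gauss_wave \<tau> x) y = of_real ((2 * pi) powr (- real DIM('a) / 2) * (pi / \<tau>) powr (real DIM('a) / 2) * exp (- (norm (x - y))\<^sup>2 / (4 * \<tau>)))"
    by (simp add: fourier_def)
  also have "(2 * pi) powr (- real DIM('a) / 2) * (pi / \<tau>) powr (real DIM('a) / 2) = (2 * \<tau>) powr (- real DIM('a) / 2)"
    using assms by (simp add: powr_minus powr_mult powr_divide field_simps)
  finally show ?thesis by (simp add: gauss_kernel_def)
qed

lemma
  assumes "\<tau> > 0"
  shows gauss_kernel_integrable: "integrable lborel (gauss_kernel \<tau> :: 'a::euclidean_space \<Rightarrow> real)"
    and gauss_kernel_integral: "(LINT x|(lborel::'a::euclidean_space measure). gauss_kernel \<tau> x) = (2 * pi) powr (real DIM('a) / 2)"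
proof -
  have e: "gauss_kernel \<tau> = (\<lambda>x::'a. (2 * \<tau>) powr (- real DIM('a) / 2) * exp (- (1 / (4 * \<tau>)) * (norm x)\<^sup>2))"
    by (auto simp: gauss_kernel_def fun_eq_iff)
  show "integrable lborel (gauss_kernel \<tau> :: 'a \<Rightarrow> real)"
    unfolding e using assms by (intro integrable_mult_right gaussian_integrable) auto
  have "(LINT x|(lborel::'a measure). gauss_kernel \<tau> x) = (2 * \<tau>) powr (- real DIM('a) / 2) * (pi / (1 / (4 * \<tau>))) powr (real DIM('a) / 2)"
    unfolding e using assms by (subst integral_mult_right_zero, subst gaussian_integral) auto
  also have "pi / (1 / (4 * \<tau>)) = (2 * \<tau>) * (2 * pi)" by simp
  also have "(2 * \<tau>) powr (- real DIM('a) / 2) * ((2 * \<tau>) * (2 * pi)) powr (real DIM('a) / 2) = (2 * pi) powr (real DIM('a) / 2)"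
    using assms by (subst powr_mult) (auto simp: powr_minus field_simps)
  finally show "(LINT x|(lborel::'a measure). gauss_kernel \<tau> x) = (2 * pi) powr (real DIM('a) / 2)" .
qed

lemma gauss_kernel_scale:
  fixes z :: "'a::euclidean_space"
  assumes "\<tau> > 0"
  shows "gauss_kernel \<tau> (sqrt \<tau> *\<^sub>R z) * \<tau> powr (real DIM('a) / 2) = gauss_kernel 1 z"
  using assms by (simp add: gauss_kernel_def power_mult_distrib powr_mult powr_minus field_simps)

section \<open>Schwartz functions\<close>

text \<open>Iterated derivatives of members of C stay in C, so the seminorms with derivatives reduce
  to the undifferentiated bound for the whole class. Membership proofs below consist in guessing a
  class closed under partial derivatives.\<close>

lemma schwartz_coinduct:
  fixes f :: "'a::euclidean_space \<Rightarrow> 'b::real_normed_vector"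
  assumes "f \<in> C"
    and d: "\<And>f x. f \<in> C \<Longrightarrow> f differentiable (at x)"
    and p: "\<And>f b. f \<in> C \<Longrightarrow> b \<in> Basis \<Longrightarrow> (\<lambda>x. frechet_derivative f (at x) b) \<in> C"
    and b: "\<And>f k. f \<in> C \<Longrightarrow> \<exists>B. \<forall>x. (1 + norm x) ^ k * norm (f x) \<le> B"
  shows "f \<in> schwartz"
proof -
  have *: "iterated_partial bs f \<in> C" if "set bs \<subseteq> Basis" for bs
    using that by (induction bs) (auto intro: p \<open>f \<in> C\<close>)
  have "bounded (range (\<lambda>x. (1 + norm x) ^ k *\<^sub>R g x))" if g: "g \<in> C" for g k
  proof -
    obtain B where "\<forall>x. (1 + norm x) ^ k * norm (g x) \<le> B" using b[OF g] by blast
    then show ?thesis unfolding bounded_iff by (auto intro!: exI[of _ B])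
  qed
  with * d show ?thesis by (auto simp: schwartz_def)
qed

lemma schwartz_differentiable: "f \<in> schwartz \<Longrightarrow> f differentiable (at x)"
  unfolding schwartz_def by (auto dest: spec[of _ "[]"])

lemma schwartz_decay:
  assumes "f \<in> schwartz"
  shows "\<exists>B\<ge>0. \<forall>x. (1 + norm x) ^ k * norm (f x) \<le> B"
proof -
  have "bounded (range (\<lambda>x. (1 + norm x) ^ k *\<^sub>R f x))"
    using assms unfolding schwartz_def by (auto dest: spec[of _ "[]"])
  then obtain B where B: "\<forall>x. norm ((1 + norm x) ^ k *\<^sub>R f x) \<le> B"
    unfolding bounded_iff by auto
  then have "(1 + norm x) ^ k * norm (f x) \<le> B" for x by (auto dest: spec[of _ x])
  moreover have "B \<ge> 0" using B[rule_format, of 0] norm_ge_zero order_trans by blast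
  ultimately show ?thesis by blast
qed

lemma schwartz_partial:
  assumes "f \<in> schwartz" "b \<in> Basis"
  shows "(\<lambda>x. frechet_derivative f (at x) b) \<in> schwartz"
proof -
  \<comment> \<open>The last entry of the list is differentiated first, so a derivative taken
    beforehand is appended at the end.\<close>
  have "iterated_partial bs (\<lambda>x. frechet_derivative f (at x) b) = iterated_partial (bs @ [b]) f" for bs
    by (induction bs) auto
  moreover have "set (bs @ [b]) \<subseteq> Basis" if "set bs \<subseteq> Basis" for bs using that assms(2) by auto
  ultimately show ?thesis using assms(1) unfolding schwartz_def mem_Collect_eq by metis
qed

lemma schwartz_has_derivative:
  "f \<in> schwartz \<Longrightarrow> (f has_derivative frechet_derivative f (at x)) (at x)"
  using schwartz_differentiable frechet_derivative_works by blast

lemma schwartz_add: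
  assumes "f \<in> schwartz" "g \<in> schwartz"
  shows "(\<lambda>x. f x + g x) \<in> schwartz"
proof (rule schwartz_coinduct[where C = "{\<lambda>x. f x + g x |f g. f \<in> schwartz \<and> g \<in> schwartz}"])
  have d: "((\<lambda>x. f x + g x) has_derivative (\<lambda>h. frechet_derivative f (at x) h + frechet_derivative g (at x) h)) (at x)"
    if "f \<in> schwartz" "g \<in> schwartz" for f g :: "'a \<Rightarrow> 'b" and x
    using that by (intro has_derivative_add schwartz_has_derivative)
  fix h :: "'a \<Rightarrow> 'b" assume h: "h \<in> {\<lambda>x. f x + g x |f g. f \<in> schwartz \<and> g \<in> schwartz}"
  then obtain f g where fg: "f \<in> schwartz" "g \<in> schwartz" "h = (\<lambda>x. f x + g x)" by blast
  show "h differentiable (at x)" for x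
    using d[OF fg(1,2)] unfolding fg(3) differentiable_def by blast
  show "(\<lambda>x. frechet_derivative h (at x) b) \<in> {\<lambda>x. f x + g x |f g. f \<in> schwartz \<and> g \<in> schwartz}" if "b \<in> Basis" for b
    unfolding fg(3) frechet_derivative_at[OF d[OF fg(1,2)], symmetric]
    using schwartz_partial[OF fg(1) that] schwartz_partial[OF fg(2) that]
    by (intro CollectI exI[of _ "\<lambda>x. frechet_derivative f (at x) b"] exI[of _ "\<lambda>x. frechet_derivative g (at x) b"]) simp
  show "\<exists>B. \<forall>x. (1 + norm x) ^ k * norm (h x) \<le> B" for k
  proof -
    obtain B1 B2 where "\<forall>x. (1 + norm x) ^ k * norm (f x) \<le> B1" "\<forall>x. (1 + norm x) ^ k * norm (g x) \<le> B2"
      using schwartz_decay[OF fg(1)] schwartz_decay[OF fg(2)] by meson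
    then have "(1 + norm x) ^ k * (norm (f x) + norm (g x)) \<le> B1 + B2" for x
      unfolding distrib_left by (intro add_mono) auto
    moreover have "(1 + norm x) ^ k * norm (h x) \<le> (1 + norm x) ^ k * (norm (f x) + norm (g x))" for x
      unfolding fg(3) by (intro mult_left_mono norm_triangle_ineq) auto
    ultimately have "(1 + norm x) ^ k * norm (h x) \<le> B1 + B2" for x
      using order_trans by blast
    then show ?thesis by blast
  qed
qed (use assms in \<open>intro CollectI exI[of _ f] exI[of _ g], simp\<close>)

lemma schwartz_cmult:
  fixes c :: complex
  assumes "f \<in> schwartz"
  shows "(\<lambda>x. c * f x) \<in> schwartz"
proof (rule schwartz_coinduct[where C = "{\<lambda>x. c * f x |f. f \<in> schwartz}"])
  have d: "((\<lambda>x. c * f x) has_derivative (\<lambda>h. c * frechet_derivative f (at x) h)) (at x)"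
    if "f \<in> schwartz" for f :: "'a \<Rightarrow> complex" and x
    using that by (intro has_derivative_mult_right schwartz_has_derivative)
  fix h :: "'a \<Rightarrow> complex" assume h: "h \<in> {\<lambda>x. c * f x |f. f \<in> schwartz}"
  then obtain f where f: "f \<in> schwartz" "h = (\<lambda>x. c * f x)" by blast
  show "h differentiable (at x)" for x
    using d[OF f(1)] unfolding f(2) differentiable_def by blast
  show "(\<lambda>x. frechet_derivative h (at x) b) \<in> {\<lambda>x. c * f x |f. f \<in> schwartz}" if "b \<in> Basis" for b
    unfolding f(2) frechet_derivative_at[OF d[OF f(1)], symmetric]
    using schwartz_partial[OF f(1) that]
    by (intro CollectI exI[of _ "\<lambda>x. frechet_derivative f (at x) b"]) simp
  show "\<exists>B. \<forall>x. (1 + norm x) ^ k * norm (h x) \<le> B" for k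
  proof -
    obtain B where B: "\<forall>x. (1 + norm x) ^ k * norm (f x) \<le> B"
      using schwartz_decay[OF f(1)] by meson
    have "(1 + norm x) ^ k * norm (h x) \<le> norm c * B" for x
      using mult_left_mono[OF B[rule_format, of x] norm_ge_zero[of c]] by (simp add: f(2) norm_mult mult_ac)
    then show ?thesis by blast
  qed
qed (use assms in \<open>intro CollectI exI[of _ f], simp\<close>)

lemma schwartz_coord_decay:
  fixes f :: "'a::euclidean_space \<Rightarrow> complex"
  assumes "\<And>k. \<exists>B. \<forall>x. (1 + norm x) ^ k * norm (f x) \<le> B"
  shows "\<exists>B. \<forall>x. (1 + norm x) ^ k * norm (of_real (x \<bullet> c) * f x) \<le> B"
proof -
  obtain B where B: "\<And>x. (1 + norm x) ^ Suc k * norm (f x) \<le> B" using assms by blast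
  have "(1 + norm x) ^ k * norm (of_real (x \<bullet> c) * f x) \<le> norm c * B" for x
  proof -
    have "\<bar>x \<bullet> c\<bar> \<le> (1 + norm x) * norm c"
      using Cauchy_Schwarz_ineq2[of x c] by (simp add: distrib_right add_increasing)
    then have "(1 + norm x) ^ k * norm (of_real (x \<bullet> c) * f x) \<le> (1 + norm x) ^ k * (((1 + norm x) * norm c) * norm (f x))"
      by (intro mult_left_mono) (auto simp: norm_mult intro!: mult_right_mono)
    also have "\<dots> = norm c * ((1 + norm x) ^ Suc k * norm (f x))" by simp
    also have "\<dots> \<le> norm c * B" using B by (intro mult_left_mono) auto
    finally show ?thesis .
  qed
  then show ?thesis by blast
qed

lemma has_derivative_coord_mult:
  fixes f :: "'a::euclidean_space \<Rightarrow> complex"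
  assumes "(f has_derivative f') (at x)"
  shows "((\<lambda>x. of_real (x \<bullet> c) * f x) has_derivative (\<lambda>h. of_real (x \<bullet> c) * f' h + of_real (h \<bullet> c) * f x)) (at x)"
  by (rule has_derivative_mult) (auto intro!: derivative_eq_intros assms)

text \<open>The product rule produces a term without the coordinate factor, so multiples by a
  coordinate alone are not closed under differentiation; their sums with a further Schwartz function
  are.\<close>

lemma schwartz_coord:
  fixes f :: "'a::euclidean_space \<Rightarrow> complex"
  assumes "f \<in> schwartz"
  shows "(\<lambda>x. of_real (x \<bullet> c) * f x) \<in> schwartz"
proof (rule schwartz_coinduct[where C = "{\<lambda>x. of_real (x \<bullet> c) * f x + g x |f g. f \<in> schwartz \<and> g \<in> schwartz}"])
  have 0: "(\<lambda>x. 0 * f x) \<in> schwartz" using assms by (rule schwartz_cmult)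
  show "(\<lambda>x. of_real (x \<bullet> c) * f x) \<in> {\<lambda>x. of_real (x \<bullet> c) * f x + g x |f g. f \<in> schwartz \<and> g \<in> schwartz}"
    using assms 0 by (intro CollectI exI[of _ f] exI[of _ "\<lambda>x. 0 * f x"]) simp
next
  have d: "((\<lambda>x. of_real (x \<bullet> c) * f x + g x) has_derivative
      (\<lambda>h. of_real (x \<bullet> c) * frechet_derivative f (at x) h + of_real (h \<bullet> c) * f x + frechet_derivative g (at x) h)) (at x)"
    if "f \<in> schwartz" "g \<in> schwartz" for f g :: "'a \<Rightarrow> complex" and x
    using that by (intro has_derivative_add has_derivative_coord_mult schwartz_has_derivative)
  fix h :: "'a \<Rightarrow> complex" assume h: "h \<in> {\<lambda>x. of_real (x \<bullet> c) * f x + g x |f g. f \<in> schwartz \<and> g \<in> schwartz}"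
  then obtain f g where fg: "f \<in> schwartz" "g \<in> schwartz" "h = (\<lambda>x. of_real (x \<bullet> c) * f x + g x)" by blast
  show "h differentiable (at x)" for x
    using d[OF fg(1,2)] unfolding fg(3) differentiable_def by blast
  show "(\<lambda>x. frechet_derivative h (at x) b) \<in> {\<lambda>x. of_real (x \<bullet> c) * f x + g x |f g. f \<in> schwartz \<and> g \<in> schwartz}" if "b \<in> Basis" for b
  proof -
    have "(\<lambda>x. of_real (b \<bullet> c) * f x + frechet_derivative g (at x) b) \<in> schwartz"
      by (intro schwartz_add schwartz_cmult schwartz_partial fg that)
    then show ?thesis
      unfolding fg(3) frechet_derivative_at[OF d[OF fg(1,2)], symmetric] add.assoc
      using schwartz_partial[OF fg(1) that]
      by (intro CollectI exI[of _ "\<lambda>x. frechet_derivative f (at x) b"]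
          exI[of _ "\<lambda>x. of_real (b \<bullet> c) * f x + frechet_derivative g (at x) b"]) simp
  qed
  show "\<exists>B. \<forall>x. (1 + norm x) ^ k * norm (h x) \<le> B" for k
  proof -
    obtain B1 where B1: "\<forall>x. (1 + norm x) ^ k * norm (of_real (x \<bullet> c) * f x) \<le> B1"
      using schwartz_coord_decay[of f] schwartz_decay[OF fg(1)] by meson
    obtain B2 where B2: "\<forall>x. (1 + norm x) ^ k * norm (g x) \<le> B2"
      using schwartz_decay[OF fg(2)] by meson
    have "(1 + norm x) ^ k * norm (h x) \<le> B1 + B2" for x
    proof -
      have "(1 + norm x) ^ k * norm (h x) \<le> (1 + norm x) ^ k * (norm (of_real (x \<bullet> c) * f x) + norm (g x))"
        unfolding fg(3) by (intro mult_left_mono norm_triangle_ineq) auto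
      also have "\<dots> \<le> B1 + B2" using B1 B2 unfolding distrib_left by (intro add_mono) auto
      finally show ?thesis .
    qed
    then show ?thesis by blast
  qed
qed

section \<open>Gaussian waves are Schwartz functions\<close>

lemma exp_quadratic_decay:
  fixes r \<tau> :: real
  assumes "\<tau> > 0" "r \<ge> 0"
  shows "(1 + r) ^ k * exp (- \<tau> * r\<^sup>2) \<le> exp ((real k)\<^sup>2 / (4 * \<tau>))"
proof -
  have "(1 + r) ^ k \<le> exp r ^ k" using assms by (intro power_mono) auto
  then have "(1 + r) ^ k * exp (- \<tau> * r\<^sup>2) \<le> exp (real k * r) * exp (- \<tau> * r\<^sup>2)"
    by (simp add: exp_of_nat_mult mult_right_mono)
  also have "\<dots> = exp (real k * r - \<tau> * r\<^sup>2)" by (simp add: exp_diff exp_minus field_simps)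
  also have "\<dots> \<le> exp ((real k)\<^sup>2 / (4 * \<tau>))"
  proof -
    \<comment> \<open>Completing the square: the maximum of k r - \<tau> r^2 is k^2 / (4
      \<tau>).\<close>
    have "0 \<le> (2 * \<tau> * r - real k)\<^sup>2" by simp
    then have "(real k * r - \<tau> * r\<^sup>2) * (4 * \<tau>) \<le> (real k)\<^sup>2" by (simp add: power2_eq_square algebra_simps)
    then show ?thesis using assms by (simp add: pos_le_divide_eq)
  qed
  finally show ?thesis .
qed

text \<open>All derivatives of a Gaussian wave are polynomials times that wave. Closing under sums,
  scalars and coordinate multiplication describes this space without writing polynomials, and
  provides an induction over it.\<close>

inductive_set gauss_span :: "real \<Rightarrow> 'a::euclidean_space \<Rightarrow> ('a \<Rightarrow> complex) set" for \<tau> x where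
  base: "gauss_wave \<tau> x \<in> gauss_span \<tau> x"
| add: "f \<in> gauss_span \<tau> x \<Longrightarrow> g \<in> gauss_span \<tau> x \<Longrightarrow> (\<lambda>y. f y + g y) \<in> gauss_span \<tau> x"
| cmult: "f \<in> gauss_span \<tau> x \<Longrightarrow> (\<lambda>y. c * f y) \<in> gauss_span \<tau> x"
| coord: "f \<in> gauss_span \<tau> x \<Longrightarrow> (\<lambda>y. of_real (y \<bullet> c) * f y) \<in> gauss_span \<tau> x"

lemma gauss_wave_has_derivative:
  "(gauss_wave \<tau> x has_derivative (\<lambda>h. of_real (- 2 * \<tau>) * (of_real (y \<bullet> h) * gauss_wave \<tau> x y) + (\<i> * of_real (x \<bullet> h)) * gauss_wave \<tau> x y)) (at y)"
proof -
  have e: "gauss_wave \<tau> x = (\<lambda>y. exp (of_real (- \<tau> * (y \<bullet> y)) + \<i> * of_real (x \<bullet> y)))"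
    by (auto simp: gauss_wave_def fun_eq_iff cis_conv_exp exp_diff exp_minus field_simps power2_norm_eq_inner simp flip: exp_of_real)
  have d: "((\<lambda>y. of_real (- \<tau> * (y \<bullet> y)) + \<i> * of_real (x \<bullet> y)) has_derivative
    (\<lambda>h. of_real (- \<tau> * (y \<bullet> h + h \<bullet> y)) + \<i> * of_real (x \<bullet> h))) (at y)"
    by (auto intro!: derivative_eq_intros)
  show ?thesis
    unfolding e
    by (rule has_derivative_eq_rhs[OF has_derivative_compose[OF d DERIV_exp[unfolded has_field_derivative_def]]])
       (auto simp: fun_eq_iff algebra_simps inner_commute)
qed

lemma gauss_span_step:
  assumes d: "\<And>y. (f has_derivative f' y) (at y)"
    and s: "\<And>b. (\<lambda>y. f' y b) \<in> gauss_span \<tau> x"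
    and B: "\<And>k. \<exists>B. \<forall>y. (1 + norm y) ^ k * norm (f y) \<le> B"
  shows "(\<forall>y. (f has_derivative frechet_derivative f (at y)) (at y)) \<and>
    (\<forall>b. (\<lambda>y. frechet_derivative f (at y) b) \<in> gauss_span \<tau> x) \<and>
    (\<forall>k. \<exists>B. \<forall>y. (1 + norm y) ^ k * norm (f y) \<le> B)"
  unfolding frechet_derivative_at[OF d, symmetric] using d s B by blast

lemma gauss_span_properties:
  assumes "\<tau> > 0" "f \<in> gauss_span \<tau> x"
  shows "(\<forall>y. (f has_derivative frechet_derivative f (at y)) (at y)) \<and>
    (\<forall>b. (\<lambda>y. frechet_derivative f (at y) b) \<in> gauss_span \<tau> x) \<and>
    (\<forall>k. \<exists>B. \<forall>y. (1 + norm y) ^ k * norm (f y) \<le> B)"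
  using assms(2)
proof induction
  case base
  show ?case
  proof (rule gauss_span_step[OF gauss_wave_has_derivative])
    show "\<exists>B. \<forall>y. (1 + norm y) ^ k * norm (gauss_wave \<tau> x y) \<le> B" for k
      unfolding norm_gauss_wave using exp_quadratic_decay[OF assms(1) norm_ge_zero] by blast
  qed (intro gauss_span.intros)
next
  case (add f g)
  show ?case
  proof (rule gauss_span_step[OF has_derivative_add])
    fix k
    obtain B1 B2 where B: "\<forall>y. (1 + norm y) ^ k * norm (f y) \<le> B1" "\<forall>y. (1 + norm y) ^ k * norm (g y) \<le> B2"
      using add.IH by meson
    have "(1 + norm y) ^ k * norm (f y + g y) \<le> B1 + B2" for y
    proof -
      have "(1 + norm y) ^ k * norm (f y + g y) \<le> (1 + norm y) ^ k * (norm (f y) + norm (g y))"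
        by (intro mult_left_mono norm_triangle_ineq) auto
      also have "\<dots> \<le> B1 + B2" using B unfolding distrib_left by (intro add_mono) auto
      finally show ?thesis .
    qed
    then show "\<exists>B. \<forall>y. (1 + norm y) ^ k * norm (f y + g y) \<le> B" by blast
  next
    show "(f has_derivative frechet_derivative f (at y)) (at y)" for y using add.IH by blast
    show "(g has_derivative frechet_derivative g (at y)) (at y)" for y using add.IH by blast
    show "(\<lambda>y. frechet_derivative f (at y) b + frechet_derivative g (at y) b) \<in> gauss_span \<tau> x" for b
      using add.IH by (intro gauss_span.add) auto
  qed
next
  case (cmult f c)
  show ?case
  proof (rule gauss_span_step[OF has_derivative_mult_right])
    fix k
    obtain B where B: "\<forall>y. (1 + norm y) ^ k * norm (f y) \<le> B"
      using cmult.IH by meson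
    have "(1 + norm y) ^ k * norm (c * f y) \<le> norm c * B" for y
      using mult_left_mono[OF B[rule_format, of y] norm_ge_zero[of c]] by (simp add: norm_mult mult_ac)
    then show "\<exists>B. \<forall>y. (1 + norm y) ^ k * norm (c * f y) \<le> B" by blast
  next
    show "(f has_derivative frechet_derivative f (at y)) (at y)" for y using cmult.IH by blast
    show "(\<lambda>y. c * frechet_derivative f (at y) b) \<in> gauss_span \<tau> x" for b
      using cmult.IH by (intro gauss_span.cmult) auto
  qed
next
  case (coord f c)
  show ?case
  proof (rule gauss_span_step[OF has_derivative_coord_mult])
    show "(f has_derivative frechet_derivative f (at y)) (at y)" for y
      using coord.IH by blast
    show "(\<lambda>y. of_real (y \<bullet> c) * frechet_derivative f (at y) b + of_real (b \<bullet> c) * f y) \<in> gauss_span \<tau> x" for b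
      using coord.IH coord.hyps by (intro gauss_span.intros) auto
    show "\<exists>B. \<forall>y. (1 + norm y) ^ k * norm (of_real (y \<bullet> c) * f y) \<le> B" for k
      using coord.IH by (intro schwartz_coord_decay) auto
  qed
qed

lemma schwartz_gauss_wave: "\<tau> > 0 \<Longrightarrow> gauss_wave \<tau> x \<in> schwartz"
proof (rule schwartz_coinduct[of _ "gauss_span \<tau> x"])
  fix f :: "'a \<Rightarrow> complex" assume t: "\<tau> > 0" and f: "f \<in> gauss_span \<tau> x"
  note P = gauss_span_properties[OF t f]
  show "f differentiable (at y)" for y unfolding differentiable_def using P by blast
  show "(\<lambda>y. frechet_derivative f (at y) b) \<in> gauss_span \<tau> x" for b using P by blast
  show "\<exists>B. \<forall>y. (1 + norm y) ^ k * norm (f y) \<le> B" for k using P by blast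
qed (rule gauss_span.base)

lemma schwartz_continuous: "f \<in> schwartz \<Longrightarrow> continuous_on UNIV f"
  by (simp add: continuous_on_eq_continuous_at schwartz_differentiable differentiable_imp_continuous_within)

lemma schwartz_measurable: "f \<in> schwartz \<Longrightarrow> f \<in> borel_measurable borel"
  using schwartz_continuous by (rule borel_measurable_continuous_onI)

lemma decay_integrable:
  fixes f :: "'a::euclidean_space \<Rightarrow> 'b::{banach, second_countable_topology}"
  assumes [measurable]: "f \<in> borel_measurable borel"
    and B: "\<And>x. (1 + norm x) ^ (DIM('a) + 1) * norm (f x) \<le> B"
  shows "integrable lborel f"
proof (rule Bochner_Integration.integrable_bound[OF integrable_mult_right[OF integrable_inverse_power_norm, of B]])
  show "AE x in lborel. norm (f x) \<le> norm (B * (1 / (1 + norm x) ^ (DIM('a) + 1)))"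
  proof (rule AE_I2)
    fix x :: 'a
    have "0 < (1 + norm x) ^ (DIM('a) + 1)"
      by (intro zero_less_power) (simp add: add_pos_nonneg)
    moreover have "0 \<le> B" using B[of 0] norm_ge_zero[of "f 0"] by (simp del: norm_ge_zero)
    ultimately show "norm (f x) \<le> norm (B * (1 / (1 + norm x) ^ (DIM('a) + 1)))"
      using B[of x] by (simp add: field_simps del: power_Suc)
  qed
qed auto

lemma schwartz_integrable:
  fixes f :: "'a::euclidean_space \<Rightarrow> 'b::{banach, second_countable_topology}"
  assumes "f \<in> schwartz"
  shows "integrable lborel f"
proof -
  obtain B where "\<forall>x. (1 + norm x) ^ (DIM('a) + 1) * norm (f x) \<le> B"
    using schwartz_decay[OF assms] by blast
  then show ?thesis using decay_integrable schwartz_measurable[OF assms] by blast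
qed

section \<open>The Fourier transform of integrable functions\<close>

lemma cis_mult_integrable:
  fixes f :: "'a \<Rightarrow> complex"
  assumes f: "integrable M f" and [measurable]: "g \<in> borel_measurable M"
  shows "integrable M (\<lambda>x. f x * cis (g x))"
  by (rule Bochner_Integration.integrable_bound[OF f])
     (use borel_measurable_integrable[OF f] in \<open>auto simp: norm_mult\<close>)

lemma fourier_measurable [measurable]:
  assumes [measurable]: "f \<in> borel_measurable borel"
  shows "fourier f \<in> borel_measurable borel"
  unfolding fourier_def[abs_def] by measurable

lemma norm_fourier_le:
  fixes f :: "'a::euclidean_space \<Rightarrow> complex"
  shows "norm (fourier f \<xi>) \<le> (2 * pi) powr (- real DIM('a) / 2) * (LINT x|lborel. norm (f x))"
proof -
  have "norm (LINT x|lborel. f x * cis (- (x \<bullet> \<xi>))) \<le> (LINT x|lborel. norm (f x * cis (- (x \<bullet> \<xi>))))"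
    by (rule integral_norm_bound)
  then show ?thesis
    by (simp add: fourier_def norm_mult mult_left_mono)
qed

lemma fourier_add:
  assumes "integrable lborel f" "integrable lborel g"
  shows "fourier (\<lambda>x. f x + g x) \<xi> = fourier f \<xi> + fourier g \<xi>"
  unfolding fourier_def distrib_right
  by (subst Bochner_Integration.integral_add)
     (auto intro!: cis_mult_integrable assms simp: distrib_left)

lemma fourier_cmult: "fourier (\<lambda>x. c * f x) \<xi> = c * fourier f \<xi>"
  unfolding fourier_def mult.assoc integral_mult_right_zero by (simp add: mult_ac)

lemma fourier_diff:
  assumes "integrable lborel f" "integrable lborel g"
  shows "fourier (\<lambda>x. f x - g x) \<xi> = fourier f \<xi> - fourier g \<xi>"
  using fourier_add[OF assms(1) integrable_mult_right[OF assms(2), of "-1"]] fourier_cmult[of "-1" g]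
  by simp

lemma cis_taylor_bound: "norm (cis (- a) - 1 + \<i> * of_real a) \<le> a\<^sup>2 / 2"
  using iexp_approx1[of "- a" 1] by (simp add: cis_conv_exp power2_eq_square diff_diff_eq2 diff_add_eq)

text \<open>A second-order Taylor bound for the character makes the remainder at most the second
  moment of f times |h|^2, up to the normalisation, so differentiation under the integral comes with
  an explicit error.\<close>

lemma fourier_has_derivative:
  fixes f :: "'a::euclidean_space \<Rightarrow> complex"
  assumes f: "f \<in> schwartz"
  shows "(fourier f has_derivative (\<lambda>h. fourier (\<lambda>x. (- \<i>) * (of_real (x \<bullet> h) * f x)) \<xi>)) (at \<xi>)"
proof -
  define c where "c = (2 * pi) powr (- real DIM('a) / 2)"
  have c: "c \<ge> 0" by (simp add: c_def)
  define L where "L h = fourier (\<lambda>x. (- \<i>) * (of_real (x \<bullet> h) * f x)) \<xi>" for h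
  have [measurable]: "f \<in> borel_measurable borel" by (rule schwartz_measurable[OF f])
  have i1: "integrable lborel (\<lambda>x. of_real (x \<bullet> h) * f x)" for h
    by (intro schwartz_integrable schwartz_coord f)
  have i0: "integrable lborel f" by (intro schwartz_integrable f)
  define B where "B = (LINT x|lborel. (norm x)\<^sup>2 * norm (f x))"
  have iB: "integrable lborel (\<lambda>x. (norm x)\<^sup>2 * norm (f x))"
  proof -
    \<comment> \<open>Two powers beyond d+1 pay for the factor |x|^2.\<close>
    obtain C where C: "\<And>x. (1 + norm x) ^ (DIM('a) + 3) * norm (f x) \<le> C"
      using schwartz_decay[OF f] by blast
    show ?thesis
    proof (rule decay_integrable)
      fix x :: 'a
      have "(1 + norm x) ^ (DIM('a) + 1) * norm ((norm x)\<^sup>2 * norm (f x)) \<le>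
        (1 + norm x) ^ (DIM('a) + 1) * ((1 + norm x)\<^sup>2 * norm (f x))"
        by (intro mult_left_mono) (auto simp: abs_mult intro!: mult_right_mono power_mono)
      also have "\<dots> = (1 + norm x) ^ (DIM('a) + 3) * norm (f x)"
        by (simp add: power_add power2_eq_square power3_eq_cube)
      finally show "(1 + norm x) ^ (DIM('a) + 1) * norm ((norm x)\<^sup>2 * norm (f x)) \<le> C" using C[of x] by simp
    qed measurable
  qed
  have lin: "bounded_linear L"
  proof (intro linear_conv_bounded_linear[THEN iffD1] linearI)
    show "L (a + b) = L a + L b" for a b
      unfolding L_def inner_add_right of_real_add distrib_right distrib_left
      by (rule fourier_add) (intro integrable_mult_right i1)+
    show "L (r *\<^sub>R b) = r *\<^sub>R L b" for r b
    proof -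
      have "(\<lambda>x. (- \<i>) * (of_real (x \<bullet> (r *\<^sub>R b)) * f x)) = (\<lambda>x. of_real r * ((- \<i>) * (of_real (x \<bullet> b) * f x)))"
        by (auto simp: fun_eq_iff)
      then show ?thesis unfolding L_def by (simp only: fourier_cmult scaleR_conv_of_real)
    qed
  qed
  have est: "norm (fourier f (\<xi> + h) - fourier f \<xi> - L h) \<le> c * B * (norm h)\<^sup>2" for h
  proof -
    have "fourier f (\<xi> + h) - fourier f \<xi> - L h = of_real c *
      (LINT x|lborel. f x * cis (- (x \<bullet> (\<xi> + h))) - f x * cis (- (x \<bullet> \<xi>)) - ((- \<i>) * (of_real (x \<bullet> h) * f x)) * cis (- (x \<bullet> \<xi>)))"
    proof -
      have "integrable lborel (\<lambda>x. f x * cis (- (x \<bullet> a)))" for a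
        by (intro cis_mult_integrable i0) measurable
      moreover have "integrable lborel (\<lambda>x. ((- \<i>) * (of_real (x \<bullet> h) * f x)) * cis (- (x \<bullet> \<xi>)))"
        by (intro cis_mult_integrable integrable_mult_right i1) measurable
      ultimately show ?thesis
        unfolding L_def fourier_def c_def[symmetric]
        by (simp only: Bochner_Integration.integral_diff Bochner_Integration.integrable_diff right_diff_distrib)
    qed
    also have "norm \<dots> \<le> c * (LINT x|lborel. (norm h)\<^sup>2 * ((norm x)\<^sup>2 * norm (f x)))"
    proof -
      have "norm (LINT x|lborel. f x * cis (- (x \<bullet> (\<xi> + h))) - f x * cis (- (x \<bullet> \<xi>)) - ((- \<i>) * (of_real (x \<bullet> h) * f x)) * cis (- (x \<bullet> \<xi>)))
        \<le> (LINT x|lborel. (norm h)\<^sup>2 * ((norm x)\<^sup>2 * norm (f x)))"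
      proof (rule Bochner_Integration.integral_norm_bound_integral)
        show "integrable lborel (\<lambda>x. f x * cis (- (x \<bullet> (\<xi> + h))) - f x * cis (- (x \<bullet> \<xi>)) - ((- \<i>) * (of_real (x \<bullet> h) * f x)) * cis (- (x \<bullet> \<xi>)))"
          by (intro Bochner_Integration.integrable_diff cis_mult_integrable i0 integrable_mult_right i1) measurable
        show "integrable lborel (\<lambda>x. (norm h)\<^sup>2 * ((norm x)\<^sup>2 * norm (f x)))"
          by (intro integrable_mult_right iB)
        fix x
        have "f x * cis (- (x \<bullet> (\<xi> + h))) - f x * cis (- (x \<bullet> \<xi>)) - ((- \<i>) * (of_real (x \<bullet> h) * f x)) * cis (- (x \<bullet> \<xi>))
          = f x * cis (- (x \<bullet> \<xi>)) * (cis (- (x \<bullet> h)) - 1 + \<i> * of_real (x \<bullet> h))"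
          by (simp add: inner_add_right cis_mult algebra_simps)
        also have "norm \<dots> \<le> norm (f x) * ((x \<bullet> h)\<^sup>2 / 2)"
          using mult_left_mono[OF cis_taylor_bound[of "x \<bullet> h"] norm_ge_zero[of "f x"]] by (simp add: norm_mult)
        also have "\<dots> \<le> norm (f x) * ((norm x)\<^sup>2 * (norm h)\<^sup>2)"
        proof (rule mult_left_mono)
          have "(x \<bullet> h)\<^sup>2 \<le> (norm x)\<^sup>2 * (norm h)\<^sup>2"
            using Cauchy_Schwarz_ineq[of x h] by (simp add: power2_norm_eq_inner)
          then show "(x \<bullet> h)\<^sup>2 / 2 \<le> (norm x)\<^sup>2 * (norm h)\<^sup>2" using zero_le_power2[of "x \<bullet> h"] by linarith
        qed simp
        finally show "norm (f x * cis (- (x \<bullet> (\<xi> + h))) - f x * cis (- (x \<bullet> \<xi>)) - ((- \<i>) * (of_real (x \<bullet> h) * f x)) * cis (- (x \<bullet> \<xi>)))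
          \<le> (norm h)\<^sup>2 * ((norm x)\<^sup>2 * norm (f x))" by (simp add: mult_ac)
      qed
      then show ?thesis using c by (simp add: norm_mult mult_left_mono)
    qed
    also have "\<dots> = c * B * (norm h)\<^sup>2" by (simp add: B_def)
    finally show ?thesis .
  qed
  have "((\<lambda>h::'a. c * B * norm h) \<longlongrightarrow> c * B * norm (0::'a)) (at 0)"
    by (intro tendsto_mult tendsto_const tendsto_norm tendsto_ident_at)
  then have lim0: "((\<lambda>h::'a. c * B * norm h) \<longlongrightarrow> 0) (at 0)" by simp
  have "((\<lambda>h. norm (fourier f (\<xi> + h) - fourier f \<xi> - L h) / norm h) \<longlongrightarrow> 0) (at 0)"
  proof (rule Lim_null_comparison[where g = "\<lambda>h. c * B * norm h"])
    show "\<forall>\<^sub>F h in at 0. norm (norm (fourier f (\<xi> + h) - fourier f \<xi> - L h) / norm h) \<le> c * B * norm h"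
    proof -
      have "norm (norm (fourier f (\<xi> + h) - fourier f \<xi> - L h) / norm h) \<le> c * B * norm h" if "h \<noteq> 0" for h
        using est[of h] that by (simp add: pos_divide_le_eq power2_eq_square mult.assoc)
      then show ?thesis unfolding eventually_at_filter by (simp add: always_eventually)
    qed
  qed (rule lim0)
  with lin show ?thesis
    unfolding has_derivative_at L_def[symmetric] by simp
qed

section \<open>Fourier decay of Schwartz functions\<close>

lemma vector_derivative_quotient:
  assumes "(g has_vector_derivative v) (at (0::real))"
  shows "((\<lambda>u. (g u - g 0) /\<^sub>R u) \<longlongrightarrow> v) (at 0)"
proof -
  have "((\<lambda>h. norm (g (0 + h) - g 0 - h *\<^sub>R v) / norm h) \<longlongrightarrow> 0) (at 0)"
    using assms unfolding has_vector_derivative_def has_derivative_at by simp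
  then have "((\<lambda>u. norm ((g u - g 0) /\<^sub>R u - v)) \<longlongrightarrow> 0) (at 0)"
  proof (rule Lim_transform_eventually)
    have "norm (g (0 + u) - g 0 - u *\<^sub>R v) / norm u = norm ((g u - g 0) /\<^sub>R u - v)" if "u \<noteq> 0" for u
    proof -
      have "(g u - g 0) /\<^sub>R u - v = (g u - g 0 - u *\<^sub>R v) /\<^sub>R u"
        using that by (simp add: scaleR_diff_right)
      then show ?thesis by (simp add: divide_inverse mult.commute)
    qed
    then show "\<forall>\<^sub>F u in at 0. norm (g (0 + u) - g 0 - u *\<^sub>R v) / norm u = norm ((g u - g 0) /\<^sub>R u - v)"
      unfolding eventually_at_filter by (auto intro!: always_eventually)
  qed
  then show ?thesis by (subst Lim_null) (simp add: tendsto_norm_zero_iff)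
qed

text \<open>The integrable majorant for the limit in \<open>fourier_partial\<close>: the mean value
  inequality bounds the difference quotient by the derivative on a unit segment, along which 1+|x|
  changes by a factor of at most 2. This gives the constant 2^(d+1) C.\<close>

lemma schwartz_translate_bound:
  fixes f :: "'a::euclidean_space \<Rightarrow> complex"
  assumes f: "f \<in> schwartz" and b: "b \<in> Basis"
  shows "\<exists>w. integrable lborel w \<and> (\<forall>x. \<forall>t\<in>{0<..1}. norm ((f (x + t *\<^sub>R b) - f x) /\<^sub>R t) \<le> w x)"
proof -
  define D where "D x = frechet_derivative f (at x) b" for x
  obtain C where C: "\<And>x. (1 + norm x) ^ (DIM('a) + 1) * norm (D x) \<le> C"
    using schwartz_decay[OF schwartz_partial[OF f b], folded D_def] by blast
  define K where "K = 2 ^ (DIM('a) + 1) * C"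
  have D: "norm (D (x + u *\<^sub>R b)) \<le> K * (1 / (1 + norm x) ^ (DIM('a) + 1))" if "u \<in> {0..1}" for x u
  proof -
    have "norm x \<le> norm (x + u *\<^sub>R b) + norm (u *\<^sub>R b)"
      using norm_triangle_ineq4[of "x + u *\<^sub>R b" "u *\<^sub>R b"] by simp
    then have "1 + norm x \<le> 2 * (1 + norm (x + u *\<^sub>R b))"
      using that b norm_ge_zero[of "x + u *\<^sub>R b"] by (simp del: norm_ge_zero)
    then have "(1 + norm x) ^ (DIM('a) + 1) \<le> (2 * (1 + norm (x + u *\<^sub>R b))) ^ (DIM('a) + 1)"
      by (intro power_mono) auto
    then have "(1 + norm x) ^ (DIM('a) + 1) * norm (D (x + u *\<^sub>R b)) \<le>
       2 ^ (DIM('a) + 1) * (1 + norm (x + u *\<^sub>R b)) ^ (DIM('a) + 1) * norm (D (x + u *\<^sub>R b))"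
      unfolding power_mult_distrib by (rule mult_right_mono) simp
    also have "\<dots> \<le> K"
      unfolding K_def mult.assoc by (intro mult_left_mono C) simp
    finally have "(1 + norm x) ^ (DIM('a) + 1) * norm (D (x + u *\<^sub>R b)) \<le> K" .
    moreover have "0 < (1 + norm x) ^ (DIM('a) + 1)" by (intro zero_less_power) (simp add: add_pos_nonneg)
    ultimately show ?thesis by (simp add: field_simps del: power_Suc)
  qed
  have "norm ((f (x + t *\<^sub>R b) - f x) /\<^sub>R t) \<le> K * (1 / (1 + norm x) ^ (DIM('a) + 1))" if t: "t \<in> {0<..1}" for x t
  proof -
    have "norm (f (x + t *\<^sub>R b) - f (x + 0 *\<^sub>R b)) \<le> K * (1 / (1 + norm x) ^ (DIM('a) + 1)) * norm (t - 0)"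
    proof (rule differentiable_bound[where S = "{0..1}" and f' = "\<lambda>u h. h *\<^sub>R D (x + u *\<^sub>R b)"])
      fix u :: real assume u: "u \<in> {0..1}"
      have g: "((\<lambda>u. x + u *\<^sub>R b) has_derivative (\<lambda>h. h *\<^sub>R b)) (at u)"
        by (auto intro!: derivative_eq_intros)
      have "((\<lambda>u. f (x + u *\<^sub>R b)) has_derivative (\<lambda>h. frechet_derivative f (at (x + u *\<^sub>R b)) (h *\<^sub>R b))) (at u)"
        by (rule has_derivative_compose[OF g schwartz_has_derivative[OF f]])
      moreover have "frechet_derivative f (at (x + u *\<^sub>R b)) (h *\<^sub>R b) = h *\<^sub>R D (x + u *\<^sub>R b)" for h
        unfolding D_def by (rule linear_scale[OF linear_frechet_derivative[OF schwartz_differentiable[OF f]]])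
      ultimately show "((\<lambda>u. f (x + u *\<^sub>R b)) has_derivative (\<lambda>h. h *\<^sub>R D (x + u *\<^sub>R b))) (at u within {0..1})"
        by (simp add: has_derivative_at_withinI)
      show "onorm (\<lambda>h. h *\<^sub>R D (x + u *\<^sub>R b)) \<le> K * (1 / (1 + norm x) ^ (DIM('a) + 1))"
      proof (rule onorm_le)
        show "norm (h *\<^sub>R D (x + u *\<^sub>R b)) \<le> K * (1 / (1 + norm x) ^ (DIM('a) + 1)) * norm h" for h
          using mult_right_mono[OF D[OF u, of x] abs_ge_zero[of h]] by (simp add: mult.commute del: power_Suc)
      qed
    qed (use t in auto)
    moreover have "norm ((f (x + t *\<^sub>R b) - f x) /\<^sub>R t) = norm (f (x + t *\<^sub>R b) - f x) / t"
      using t by (simp add: divide_inverse mult.commute)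
    ultimately show ?thesis using t by (simp add: pos_divide_le_eq del: power_Suc)
  qed
  moreover have "integrable lborel (\<lambda>x::'a. K * (1 / (1 + norm x) ^ (DIM('a) + 1)))"
    by (rule integrable_mult_right[OF integrable_inverse_power_norm])
  ultimately show ?thesis by blast
qed

lemma fourier_translate:
  fixes f :: "'a::euclidean_space \<Rightarrow> complex"
  assumes [measurable]: "f \<in> borel_measurable borel"
  shows "fourier (\<lambda>x. f (x + a)) \<xi> = cis (a \<bullet> \<xi>) * fourier f \<xi>"
proof -
  have "(LINT x|lborel. f x * cis (- (x \<bullet> \<xi>))) = (LINT x|distr lborel borel ((+) a). f x * cis (- (x \<bullet> \<xi>)))"
    by (simp add: lborel_distr_plus)
  also have "\<dots> = (LINT x|lborel. f (a + x) * cis (- ((a + x) \<bullet> \<xi>)))"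
    by (subst integral_distr) auto
  also have "\<dots> = (LINT x|lborel. cis (- (a \<bullet> \<xi>)) * (f (x + a) * cis (- (x \<bullet> \<xi>))))"
    by (intro Bochner_Integration.integral_cong) (auto simp: inner_add_left cis_mult add.commute)
  also have "\<dots> = cis (- (a \<bullet> \<xi>)) * (LINT x|lborel. f (x + a) * cis (- (x \<bullet> \<xi>)))" by simp
  finally show ?thesis by (simp add: fourier_def cis_mult mult.left_commute flip: mult.assoc[of "cis _" "cis _"])
qed

text \<open>Translation multiplies the transform by a character, so the transform of a difference
  quotient is explicit; letting t tend to 0 on both sides takes the place of an integration by
  parts.\<close>

lemma fourier_partial:
  fixes f :: "'a::euclidean_space \<Rightarrow> complex"
  assumes f: "f \<in> schwartz" and b: "b \<in> Basis"
  shows "fourier (\<lambda>x. frechet_derivative f (at x) b) \<xi> = \<i> * of_real (b \<bullet> \<xi>) * fourier f \<xi>"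
proof -
  have [measurable]: "f \<in> borel_measurable borel" by (rule schwartz_measurable[OF f])
  have [measurable]: "(\<lambda>x. frechet_derivative f (at x) b) \<in> borel_measurable borel"
    by (rule schwartz_measurable[OF schwartz_partial[OF f b]])
  have i0: "integrable lborel f" by (rule schwartz_integrable[OF f])
  have i1: "integrable lborel (\<lambda>x. f (x + a))" for a
    using i0 by (subst (asm) lborel_distr_plus[of a, symmetric], subst (asm) integrable_distr_eq) (auto simp: add.commute)
  define t where "t n = 1 / real (Suc n)" for n
  have t: "t n \<in> {0<..1}" "t n \<noteq> 0" for n by (auto simp: t_def)
  have t0: "filterlim t (at 0) sequentially"
    unfolding t_def filterlim_at using lim_inverse_n'[THEN LIMSEQ_Suc] by (auto simp: inverse_eq_divide)
  obtain w where w: "integrable lborel w" "\<And>x t. t \<in> {0<..1} \<Longrightarrow> norm ((f (x + t *\<^sub>R b) - f x) /\<^sub>R t) \<le> w x"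
    using schwartz_translate_bound[OF f b] by blast
  have e: "fourier (\<lambda>x. (f (x + t n *\<^sub>R b) - f x) /\<^sub>R t n) \<xi> = ((cis (t n * (b \<bullet> \<xi>)) - 1) / of_real (t n)) * fourier f \<xi>" for n
  proof -
    have "(\<lambda>x. (f (x + t n *\<^sub>R b) - f x) /\<^sub>R t n) = (\<lambda>x. of_real (inverse (t n)) * (f (x + t n *\<^sub>R b) - f x))"
      by (simp add: scaleR_conv_of_real)
    then show ?thesis using t[of n]
      by (simp only: fourier_cmult fourier_diff[OF i1 i0] fourier_translate[OF \<open>f \<in> borel_measurable borel\<close>])
         (simp add: field_simps)
  qed
  have "(\<lambda>n. fourier (\<lambda>x. (f (x + t n *\<^sub>R b) - f x) /\<^sub>R t n) \<xi>) \<longlonglongrightarrow> fourier (\<lambda>x. frechet_derivative f (at x) b) \<xi>"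
    unfolding fourier_def
  proof (intro tendsto_mult tendsto_const integral_dominated_convergence[where w = w])
    show "AE x in lborel. (\<lambda>n. (f (x + t n *\<^sub>R b) - f x) /\<^sub>R t n * cis (- (x \<bullet> \<xi>))) \<longlonglongrightarrow> frechet_derivative f (at x) b * cis (- (x \<bullet> \<xi>))"
    proof (intro AE_I2 tendsto_mult tendsto_const)
      fix x
      have g: "((\<lambda>u. x + u *\<^sub>R b) has_derivative (\<lambda>h. h *\<^sub>R b)) (at 0)"
        by (auto intro!: derivative_eq_intros)
      have "((\<lambda>u. f (x + u *\<^sub>R b)) has_derivative (\<lambda>h. frechet_derivative f (at (x + 0 *\<^sub>R b)) (h *\<^sub>R b))) (at 0)"
        by (rule has_derivative_compose[OF g schwartz_has_derivative[OF f]])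
      moreover have "frechet_derivative f (at x) (h *\<^sub>R b) = h *\<^sub>R frechet_derivative f (at x) b" for h
        by (rule linear_scale[OF linear_frechet_derivative[OF schwartz_differentiable[OF f]]])
      ultimately have "((\<lambda>u. f (x + u *\<^sub>R b)) has_vector_derivative frechet_derivative f (at x) b) (at 0)"
        by (simp add: has_vector_derivative_def)
      then have "((\<lambda>u. (f (x + u *\<^sub>R b) - f x) /\<^sub>R u) \<longlongrightarrow> frechet_derivative f (at x) b) (at 0)"
        using vector_derivative_quotient by fastforce
      then show "(\<lambda>n. (f (x + t n *\<^sub>R b) - f x) /\<^sub>R t n) \<longlonglongrightarrow> frechet_derivative f (at x) b"
        by (rule filterlim_compose[OF _ t0])
    qed
    show "AE x in lborel. norm ((f (x + t n *\<^sub>R b) - f x) /\<^sub>R t n * cis (- (x \<bullet> \<xi>))) \<le> w x" for n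
      using w(2)[OF t(1)] by (auto simp: norm_mult)
  qed (use w in measurable)
  moreover have "(\<lambda>n. ((cis (t n * (b \<bullet> \<xi>)) - 1) / of_real (t n)) * fourier f \<xi>) \<longlonglongrightarrow> \<i> * of_real (b \<bullet> \<xi>) * fourier f \<xi>"
  proof (intro tendsto_mult tendsto_const)
    have d: "((\<lambda>u::real. \<i> * of_real (u * (b \<bullet> \<xi>))) has_derivative (\<lambda>h. \<i> * of_real (h * (b \<bullet> \<xi>)))) (at 0)"
      by (auto intro!: derivative_eq_intros)
    have "((\<lambda>u::real. cis (u * (b \<bullet> \<xi>))) has_vector_derivative (\<i> * of_real (b \<bullet> \<xi>))) (at 0)"
      unfolding cis_conv_exp has_vector_derivative_def
      by (rule has_derivative_eq_rhs[OF has_derivative_compose[OF d DERIV_exp[unfolded has_field_derivative_def]]])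
         (auto simp: fun_eq_iff scaleR_conv_of_real)
    then have "((\<lambda>u. (cis (u * (b \<bullet> \<xi>)) - 1) /\<^sub>R u) \<longlongrightarrow> \<i> * of_real (b \<bullet> \<xi>)) (at 0)"
      using vector_derivative_quotient by fastforce
    then have "((\<lambda>u. (cis (u * (b \<bullet> \<xi>)) - 1) / of_real u) \<longlongrightarrow> \<i> * of_real (b \<bullet> \<xi>)) (at 0)"
      by (simp add: scaleR_conv_of_real divide_inverse mult.commute)
    then show "(\<lambda>n. (cis (t n * (b \<bullet> \<xi>)) - 1) / of_real (t n)) \<longlonglongrightarrow> \<i> * of_real (b \<bullet> \<xi>)"
      by (rule filterlim_compose[OF _ t0])
  qed
  ultimately show ?thesis unfolding e by (rule LIMSEQ_unique)
qed

text \<open>Induction on the power: one factor 1+|\<xi>| is at most 1 plus the sum of the moduli of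
  the coordinates of \<xi>, and each coordinate turns f into a partial derivative, to which the
  induction hypothesis applies.\<close>

lemma fourier_schwartz_decay:
  fixes f :: "'a::euclidean_space \<Rightarrow> complex"
  assumes "f \<in> schwartz"
  shows "\<exists>B. \<forall>\<xi>. (1 + norm \<xi>) ^ k * norm (fourier f \<xi>) \<le> B"
  using assms
proof (induction k arbitrary: f)
  case 0
  then show ?case using norm_fourier_le[of f] by auto
next
  case (Suc k)
  obtain B where B: "\<And>\<xi>. (1 + norm \<xi>) ^ k * norm (fourier f \<xi>) \<le> B" using Suc by blast
  have "\<forall>b\<in>Basis. \<exists>B. \<forall>\<xi>. (1 + norm \<xi>) ^ k * norm (fourier (\<lambda>x. frechet_derivative f (at x) b) \<xi>) \<le> B"
    using Suc.IH[OF schwartz_partial[OF Suc.prems]] by blast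
  then obtain C where C: "\<And>b \<xi>. b \<in> Basis \<Longrightarrow> (1 + norm \<xi>) ^ k * norm (fourier (\<lambda>x. frechet_derivative f (at x) b) \<xi>) \<le> C b"
    by metis
  have "(1 + norm \<xi>) ^ Suc k * norm (fourier f \<xi>) \<le> B + (\<Sum>b\<in>Basis. C b)" for \<xi>
  proof -
    have "(1 + norm \<xi>) ^ Suc k * norm (fourier f \<xi>) \<le> (1 + (\<Sum>b\<in>Basis. \<bar>b \<bullet> \<xi>\<bar>)) * ((1 + norm \<xi>) ^ k * norm (fourier f \<xi>))"
      unfolding power_Suc mult.assoc using norm_le_l1[of \<xi>] by (intro mult_right_mono) (auto simp: inner_commute)
    also have "\<dots> = (1 + norm \<xi>) ^ k * norm (fourier f \<xi>) + (\<Sum>b\<in>Basis. \<bar>b \<bullet> \<xi>\<bar> * ((1 + norm \<xi>) ^ k * norm (fourier f \<xi>)))"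
      by (simp only: distrib_right sum_distrib_right mult_1)
    also have "\<dots> = (1 + norm \<xi>) ^ k * norm (fourier f \<xi>) + (\<Sum>b\<in>Basis. (1 + norm \<xi>) ^ k * norm (fourier (\<lambda>x. frechet_derivative f (at x) b) \<xi>))"
      by (simp add: fourier_partial[OF Suc.prems] norm_mult mult_ac)
    also have "\<dots> \<le> B + (\<Sum>b\<in>Basis. C b)"
      by (intro add_mono sum_mono B C)
    finally show ?thesis .
  qed
  then show ?case by blast
qed

text \<open>The image of \<open>schwartz\<close> is closed under derivatives, because a derivative
  of a transform is the transform of a coordinate multiple.\<close>

lemma schwartz_fourier:
  assumes "f \<in> schwartz"
  shows "fourier f \<in> schwartz"
proof (rule schwartz_coinduct[where C = "fourier ` schwartz"])
  fix g :: "'a \<Rightarrow> complex" assume "g \<in> fourier ` schwartz"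
  then obtain f where f: "f \<in> schwartz" "g = fourier f" by blast
  show "g differentiable (at x)" for x
    unfolding f(2) differentiable_def using fourier_has_derivative[OF f(1)] by blast
  show "(\<lambda>x. frechet_derivative g (at x) b) \<in> fourier ` schwartz" for b
    unfolding f(2) frechet_derivative_at[OF fourier_has_derivative[OF f(1)], symmetric]
    by (intro image_eqI[OF refl] schwartz_cmult schwartz_coord f)
  show "\<exists>B. \<forall>x. (1 + norm x) ^ k * norm (g x) \<le> B" for k
    unfolding f(2) by (rule fourier_schwartz_decay[OF f(1)])
qed (use assms in blast)

section \<open>Multiplication formula, Gaussian regularisation and inversion\<close>

lemma (in pair_sigma_finite) integrable_cis_product:
  fixes h :: "'a \<Rightarrow> complex" and k :: "'b \<Rightarrow> complex"
  assumes h: "integrable M1 h" and k: "integrable M2 k"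
    and [measurable]: "(\<lambda>(x, y). g x y) \<in> borel_measurable (M1 \<Otimes>\<^sub>M M2)"
  shows "integrable (M1 \<Otimes>\<^sub>M M2) (\<lambda>(x, y). h x * k y * cis (g x y))"
proof (rule Fubini_integrable)
  have [measurable]: "h \<in> borel_measurable M1" "k \<in> borel_measurable M2"
    using h k by auto
  show "(\<lambda>(x, y). h x * k y * cis (g x y)) \<in> borel_measurable (M1 \<Otimes>\<^sub>M M2)" by measurable
  have "(\<lambda>x. LINT y|M2. norm (case (x, y) of (x, y) \<Rightarrow> h x * k y * cis (g x y))) = (\<lambda>x. norm (h x) * (LINT y|M2. norm (k y)))"
    by (simp add: norm_mult)
  then show "integrable M1 (\<lambda>x. LINT y|M2. norm (case (x, y) of (x, y) \<Rightarrow> h x * k y * cis (g x y)))"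
    using h by simp
  show "AE x in M1. integrable M2 (\<lambda>y. case (x, y) of (x, y) \<Rightarrow> h x * k y * cis (g x y))"
  proof (rule AE_I2)
    fix x assume "x \<in> space M1"
    then have [measurable]: "g x \<in> borel_measurable M2"
      using measurable_Pair2[OF assms(3)] by simp
    show "integrable M2 (\<lambda>y. case (x, y) of (x, y) \<Rightarrow> h x * k y * cis (g x y))"
      unfolding case_prod_conv by (intro cis_mult_integrable integrable_mult_right k) measurable
  qed
qed

lemma fourier_multiplication:
  fixes h k :: "'a::euclidean_space \<Rightarrow> complex"
  assumes h: "integrable lborel h" and k: "integrable lborel k"
  shows "(LINT \<xi>|lborel. fourier h \<xi> * k \<xi>) = (LINT x|lborel. h x * fourier k x)"
proof -
  define c where "c = complex_of_real ((2 * pi) powr (- real DIM('a) / 2))"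
  have i: "integrable (lborel \<Otimes>\<^sub>M lborel) (\<lambda>(x, y). h x * k y * cis (- (x \<bullet> y)))"
    by (rule lborel_pair.integrable_cis_product[OF h k]) measurable
  have "(LINT \<xi>|lborel. fourier h \<xi> * k \<xi>) = (LINT \<xi>|lborel. c * (LINT x|lborel. h x * k \<xi> * cis (- (x \<bullet> \<xi>))))"
    by (intro Bochner_Integration.integral_cong) (auto simp: fourier_def c_def mult_ac simp flip: integral_mult_right_zero integral_mult_left_zero)
  also have "\<dots> = c * (LINT \<xi>|lborel. LINT x|lborel. h x * k \<xi> * cis (- (x \<bullet> \<xi>)))"
    by simp
  also have "(LINT \<xi>|lborel. LINT x|lborel. h x * k \<xi> * cis (- (x \<bullet> \<xi>))) = (LINT x|lborel. LINT \<xi>|lborel. h x * k \<xi> * cis (- (x \<bullet> \<xi>)))"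
    by (rule lborel_pair.Fubini_integral[OF i])
  also have "c * \<dots> = (LINT x|lborel. c * (LINT \<xi>|lborel. h x * k \<xi> * cis (- (x \<bullet> \<xi>))))" by simp
  also have "\<dots> = (LINT x|lborel. h x * fourier k x)"
    by (intro Bochner_Integration.integral_cong) (auto simp: fourier_def c_def mult_ac inner_commute simp flip: integral_mult_right_zero)
  finally show ?thesis .
qed

text \<open>The common source of inversion, uniqueness and the Bessel inequality: damping the
  inversion integral by a Gaussian amounts to averaging h around x with a Gaussian.\<close>

lemma fourier_gauss_regularisation:
  assumes "integrable lborel h" "\<tau> > 0"
  shows "(LINT \<xi>|lborel. fourier h \<xi> * gauss_wave \<tau> x \<xi>) = (LINT y|lborel. h y * of_real (gauss_kernel \<tau> (x - y)))"
  unfolding fourier_multiplication[OF assms(1) gauss_wave_integrable[OF assms(2)]] fourier_gauss_wave[OF assms(2)] ..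

lemma lborel_integral_affine:
  fixes f :: "'a::euclidean_space \<Rightarrow> 'b::{banach, second_countable_topology}"
  assumes [measurable]: "f \<in> borel_measurable borel" and c: "c \<noteq> 0"
  shows "(LINT x|lborel. f x) = \<bar>c\<bar> ^ DIM('a) *\<^sub>R (LINT x|lborel. f (t + c *\<^sub>R x))"
  by (subst lborel_affine[OF c, of t]) (simp add: integral_density integral_distr)

lemma
  fixes f :: "'a::euclidean_space \<Rightarrow> 'b::{banach, second_countable_topology}"
  assumes f: "integrable lborel f"
  shows lborel_integrable_translate: "integrable lborel (\<lambda>x. f (a + x))"
    and lborel_integral_translate: "(LINT x|lborel. f (a + x)) = (LINT x|lborel. f x)"
proof -
  have [measurable]: "f \<in> borel_measurable borel" using borel_measurable_integrable[OF f] by simp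
  have "integrable (distr lborel borel ((+) a)) f" using f by (simp add: lborel_distr_plus)
  then show "integrable lborel (\<lambda>x. f (a + x))" by (subst (asm) integrable_distr_eq) auto
  have "(LINT x|lborel. f x) = (LINT x|distr lborel borel ((+) a). f x)" by (simp add: lborel_distr_plus)
  then show "(LINT x|lborel. f (a + x)) = (LINT x|lborel. f x)" by (subst (asm) integral_distr) auto
qed

lemma gauss_kernel_approx:
  fixes f :: "'a::euclidean_space \<Rightarrow> complex"
  assumes [measurable]: "f \<in> borel_measurable borel" and B: "\<And>x. norm (f x) \<le> B"
    and c: "isCont f x"
  shows "(\<lambda>n. LINT y|lborel. f y * of_real (gauss_kernel (1 / real (Suc n)) (x - y))) \<longlonglongrightarrow> f x * of_real ((2 * pi) powr (real DIM('a) / 2))"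
proof -
  define s where "s n = sqrt (1 / real (Suc n))" for n
  have s: "s n > 0" "(s n)\<^sup>2 = 1 / real (Suc n)" for n by (auto simp: s_def)
  have s0: "s \<longlonglongrightarrow> 0"
    unfolding s_def using tendsto_real_sqrt[OF lim_inverse_n'[THEN LIMSEQ_Suc]] by simp
  \<comment> \<open>The substitution y = x - sqrt(\<tau>) z moves the scale from the kernel into the
    argument of f, so that continuity at x and dominated convergence apply.\<close>
  have e: "(LINT y|lborel. f y * of_real (gauss_kernel (1 / real (Suc n)) (x - y))) = (LINT z|lborel. f (x + (- s n) *\<^sub>R z) * of_real (gauss_kernel 1 z))" for n
  proof -
    have "(LINT y|lborel. f y * of_real (gauss_kernel (1 / real (Suc n)) (x - y))) = \<bar>- s n\<bar> ^ DIM('a) *\<^sub>R (LINT z|lborel. f (x + (- s n) *\<^sub>R z) * of_real (gauss_kernel (1 / real (Suc n)) (x - (x + (- s n) *\<^sub>R z))))"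
      using s(1)[of n] by (intro lborel_integral_affine) auto
    also have "\<dots> = (LINT z|lborel. f (x + (- s n) *\<^sub>R z) * of_real (gauss_kernel 1 z))"
      unfolding integral_scaleR_right[symmetric]
    proof (intro Bochner_Integration.integral_cong refl)
      fix z :: 'a
      have "\<bar>- s n\<bar> ^ DIM('a) = (1 / real (Suc n)) powr (real DIM('a) / 2)"
        using s(1)[of n] by (simp add: s_def powr_half_sqrt[symmetric] powr_realpow[symmetric] powr_powr)
      then have "\<bar>- s n\<bar> ^ DIM('a) * gauss_kernel (1 / real (Suc n)) (s n *\<^sub>R z) = gauss_kernel 1 z"
        using gauss_kernel_scale[of "1 / real (Suc n)" z] by (simp add: s_def mult.commute)
      then show "\<bar>- s n\<bar> ^ DIM('a) *\<^sub>R (f (x + (- s n) *\<^sub>R z) * of_real (gauss_kernel (1 / real (Suc n)) (x - (x + (- s n) *\<^sub>R z)))) = f (x + (- s n) *\<^sub>R z) * of_real (gauss_kernel 1 z)"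
        by (simp add: scaleR_conv_of_real mult_ac flip: of_real_mult of_real_power)
    qed
    finally show ?thesis .
  qed
  have "(\<lambda>n. LINT z|lborel. f (x + (- s n) *\<^sub>R z) * of_real (gauss_kernel 1 z)) \<longlonglongrightarrow> (LINT z|lborel. f x * of_real (gauss_kernel 1 (z::'a)))"
  proof (rule integral_dominated_convergence[where w = "\<lambda>z. B * gauss_kernel 1 z"])
    show "integrable lborel (\<lambda>z::'a. B * gauss_kernel 1 z)"
      by (intro integrable_mult_right gauss_kernel_integrable) auto
    show "AE z in lborel. norm (f (x + (- s n) *\<^sub>R z) * of_real (gauss_kernel 1 z)) \<le> B * gauss_kernel 1 z" for n
      using B by (auto simp: norm_mult intro!: mult_right_mono)
    show "AE z in lborel. (\<lambda>n. f (x + (- s n) *\<^sub>R z) * of_real (gauss_kernel 1 z)) \<longlonglongrightarrow> f x * of_real (gauss_kernel 1 z)"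
    proof (intro AE_I2 tendsto_mult tendsto_const)
      fix z
      have "(\<lambda>n. x + (- s n) *\<^sub>R z) \<longlonglongrightarrow> x + (- 0) *\<^sub>R z" by (intro tendsto_intros s0)
      then show "(\<lambda>n. f (x + (- s n) *\<^sub>R z)) \<longlonglongrightarrow> f x"
        using isCont_tendsto_compose[OF c] by simp
    qed
  qed measurable
  also have "(LINT z|lborel. f x * of_real (gauss_kernel 1 (z::'a))) = f x * of_real ((2 * pi) powr (real DIM('a) / 2))"
    by (simp add: gauss_kernel_integral)
  finally show ?thesis unfolding e .
qed

text \<open>Both ends of the Gaussian regularisation converge as \<tau> tends to 0: the damped
  inversion integral by dominated convergence, the Gaussian average by continuity of f at x.\<close>

lemma fourier_inversion:
  fixes f :: "'a::euclidean_space \<Rightarrow> complex"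
  assumes f: "f \<in> schwartz"
  shows "inverse_fourier (fourier f) x = f x"
proof -
  have [measurable]: "f \<in> borel_measurable borel" "fourier f \<in> borel_measurable borel"
    by (intro schwartz_measurable schwartz_fourier f)+
  have iF: "integrable lborel (fourier f)" by (intro schwartz_integrable schwartz_fourier f)
  obtain B where B: "\<And>x. norm (f x) \<le> B" using schwartz_decay[OF f, of 0] by auto
  have t0: "(\<lambda>n. 1 / real (Suc n)) \<longlonglongrightarrow> 0" using lim_inverse_n'[THEN LIMSEQ_Suc] by simp
  have "(\<lambda>n. LINT \<xi>|lborel. fourier f \<xi> * gauss_wave (1 / real (Suc n)) x \<xi>) \<longlonglongrightarrow> (LINT \<xi>|lborel. fourier f \<xi> * cis (x \<bullet> \<xi>))"
  proof (rule integral_dominated_convergence[where w = "\<lambda>\<xi>. norm (fourier f \<xi>)"])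
    show "AE \<xi> in lborel. norm (fourier f \<xi> * gauss_wave (1 / real (Suc n)) x \<xi>) \<le> norm (fourier f \<xi>)" for n
      by (auto simp: norm_mult norm_gauss_wave intro!: mult_left_le)
    show "AE \<xi> in lborel. (\<lambda>n. fourier f \<xi> * gauss_wave (1 / real (Suc n)) x \<xi>) \<longlonglongrightarrow> fourier f \<xi> * cis (x \<bullet> \<xi>)"
    proof (intro AE_I2 tendsto_mult tendsto_const)
      fix \<xi>
      have "(\<lambda>n. gauss_wave (1 / real (Suc n)) x \<xi>) \<longlonglongrightarrow> of_real (exp (- 0 * (norm \<xi>)\<^sup>2)) * cis (x \<bullet> \<xi>)"
        unfolding gauss_wave_def by (intro tendsto_intros t0)
      then show "(\<lambda>n. gauss_wave (1 / real (Suc n)) x \<xi>) \<longlonglongrightarrow> cis (x \<bullet> \<xi>)" by simp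
    qed
  qed (use iF in auto)
  moreover have "(\<lambda>n. LINT \<xi>|lborel. fourier f \<xi> * gauss_wave (1 / real (Suc n)) x \<xi>) \<longlonglongrightarrow> f x * of_real ((2 * pi) powr (real DIM('a) / 2))"
    by (subst fourier_gauss_regularisation[OF schwartz_integrable[OF f]], simp)
       (intro gauss_kernel_approx[OF _ B] differentiable_imp_continuous_within schwartz_differentiable f, measurable)
  ultimately have e: "(LINT \<xi>|lborel. fourier f \<xi> * cis (x \<bullet> \<xi>)) = f x * of_real ((2 * pi) powr (real DIM('a) / 2))"
    by (rule LIMSEQ_unique)
  have "inverse_fourier (fourier f) x = of_real ((2 * pi) powr (- real DIM('a) / 2)) * (LINT \<xi>|lborel. fourier f \<xi> * cis (x \<bullet> \<xi>))"
    by (simp add: inverse_fourier_def fourier_def[of "fourier f"] inner_commute)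
  also have "\<dots> = f x * of_real ((2 * pi) powr (- real DIM('a) / 2) * (2 * pi) powr (real DIM('a) / 2))"
    unfolding e by (simp add: mult_ac)
  also have "(2 * pi) powr (- real DIM('a) / 2) * (2 * pi) powr (real DIM('a) / 2) = 1"
    by (simp flip: powr_add)
  finally show ?thesis by simp
qed

section \<open>Uniqueness\<close>

lemma gauss_kernel_le:
  assumes "\<tau> > 0"
  shows "gauss_kernel \<tau> (x::'a::euclidean_space) \<le> (2 * \<tau>) powr (- real DIM('a) / 2)"
  unfolding gauss_kernel_def using assms by (intro mult_left_le) auto

lemma gauss_kernel_minus: "gauss_kernel \<tau> (x - y) = gauss_kernel \<tau> (y - x)"
  by (simp add: gauss_kernel_def norm_minus_commute)

text \<open>Fubini and the symmetry of the kernel move the Gaussian from f onto the indicator of the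
  box, so f integrates to zero against every mollified indicator. These converge to (2 pi)^(d/2)
  times the indicator off the boundary of the box, a null set.\<close>

lemma integral_box_zero:
  fixes f :: "'a::euclidean_space \<Rightarrow> complex"
  assumes f: "integrable lborel f"
    and z: "\<And>x \<tau>. \<tau> > 0 \<Longrightarrow> (LINT y|lborel. f y * of_real (gauss_kernel \<tau> (x - y))) = 0"
  shows "(LINT y|lborel. f y * indicator (box a b) y) = 0"
proof -
  have [measurable]: "f \<in> borel_measurable borel" using borel_measurable_integrable[OF f] by simp
  define I where "I = (indicator (box a b) :: 'a \<Rightarrow> complex)"
  have [measurable]: "I \<in> borel_measurable borel" unfolding I_def by measurable
  have iI: "integrable lborel I"
    by (rule Bochner_Integration.integrable_bound[OF integrable_real_indicator[of "box a b" lborel]])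
       (use emeasure_bounded_finite[OF bounded_box[of a b]] in \<open>auto simp: I_def indicator_def\<close>)
  define J where "J n y = (LINT x|lborel. I x * of_real (gauss_kernel (1 / real (Suc n)) (y - x)))" for n y
  have J0: "(LINT y|lborel. f y * J n y) = 0" for n
  proof -
    define \<tau> where "\<tau> = 1 / real (Suc n)"
    have t: "\<tau> > 0" by (simp add: \<tau>_def)
    have i: "integrable (lborel \<Otimes>\<^sub>M lborel) (\<lambda>(x, y). I x * f y * of_real (gauss_kernel \<tau> (x - y)))"
    proof (rule Bochner_Integration.integrable_bound)
      show "integrable (lborel \<Otimes>\<^sub>M lborel) (\<lambda>p. (2 * \<tau>) powr (- real DIM('a) / 2) * norm ((\<lambda>(x, y). I x * f y * cis 0) p))"
        by (intro integrable_mult_right integrable_norm lborel_pair.integrable_cis_product iI f) measurable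
      show "AE p in lborel \<Otimes>\<^sub>M lborel. norm (case p of (x, y) \<Rightarrow> I x * f y * of_real (gauss_kernel \<tau> (x - y))) \<le> norm ((2 * \<tau>) powr (- real DIM('a) / 2) * norm ((\<lambda>(x, y). I x * f y * cis 0) p))"
        using gauss_kernel_le[OF t] by (intro AE_I2) (auto simp: norm_mult mult_ac intro!: mult_left_mono)
    qed measurable
    have "(LINT y|lborel. f y * J n y) = (LINT y|lborel. LINT x|lborel. I x * f y * of_real (gauss_kernel \<tau> (x - y)))"
      by (intro Bochner_Integration.integral_cong) (auto simp: J_def \<tau>_def gauss_kernel_minus mult_ac simp flip: integral_mult_right_zero)
    also have "\<dots> = (LINT x|lborel. LINT y|lborel. I x * f y * of_real (gauss_kernel \<tau> (x - y)))"
      by (rule lborel_pair.Fubini_integral[OF i])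
    also have "\<dots> = 0" using z[OF t] by (simp add: mult.assoc)
    finally show ?thesis .
  qed
  have "(\<lambda>n. LINT y|lborel. f y * J n y) \<longlonglongrightarrow> (LINT y|lborel. f y * (I y * of_real ((2 * pi) powr (real DIM('a) / 2))))"
  proof (rule integral_dominated_convergence[where w = "\<lambda>y. norm (f y) * (2 * pi) powr (real DIM('a) / 2)"])
    show "integrable lborel (\<lambda>y. norm (f y) * (2 * pi) powr (real DIM('a) / 2))" using f by simp
    show "AE y in lborel. norm (f y * J n y) \<le> norm (f y) * (2 * pi) powr (real DIM('a) / 2)" for n
    proof (rule AE_I2)
      fix y :: 'a
      have k: "integrable lborel (\<lambda>x. gauss_kernel (1 / real (Suc n)) (y - x))" "(LINT x|lborel. gauss_kernel (1 / real (Suc n)) (y - x)) = (2 * pi) powr (real DIM('a) / 2)"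
      proof -
        note g = gauss_kernel_integrable[of "1 / real (Suc n)", where 'a = 'a] gauss_kernel_integral[of "1 / real (Suc n)", where 'a = 'a]
        show "integrable lborel (\<lambda>x. gauss_kernel (1 / real (Suc n)) (y - x))"
          using lborel_integrable_translate[OF g(1), of "- y"] by (subst gauss_kernel_minus) simp
        show "(LINT x|lborel. gauss_kernel (1 / real (Suc n)) (y - x)) = (2 * pi) powr (real DIM('a) / 2)"
          using lborel_integral_translate[OF g(1), of "- y"] g(2) by (subst gauss_kernel_minus) simp
      qed
      have "norm (J n y) \<le> (LINT x|lborel. gauss_kernel (1 / real (Suc n)) (y - x))"
        unfolding J_def
        by (rule Bochner_Integration.integral_norm_bound_integral)
           (auto simp: I_def norm_mult indicator_def intro!: k(1) Bochner_Integration.integrable_bound[OF k(1)])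
      then show "norm (f y * J n y) \<le> norm (f y) * (2 * pi) powr (real DIM('a) / 2)"
        unfolding k(2) norm_mult by (rule mult_left_mono) simp
    qed
    have "AE y in lborel. y \<notin> cbox a b - box a b"
    proof (rule AE_not_in)
      have "emeasure lborel (cbox a b - box a b) = emeasure lborel (cbox a b) - emeasure lborel (box a b)"
        using emeasure_bounded_finite[OF bounded_box[of a b]] by (intro emeasure_Diff) (auto simp: box_subset_cbox)
      also have "\<dots> = 0" by (simp add: emeasure_lborel_cbox_eq emeasure_lborel_box_eq)
      finally show "cbox a b - box a b \<in> null_sets lborel" by (simp add: null_sets_def)
    qed
    then show "AE y in lborel. (\<lambda>n. f y * J n y) \<longlonglongrightarrow> f y * (I y * of_real ((2 * pi) powr (real DIM('a) / 2)))"
    proof eventually_elim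
      fix y assume y: "y \<notin> cbox a b - box a b"
      have "isCont I y"
      proof (cases "y \<in> box a b")
        case True
        then have "\<forall>\<^sub>F z in nhds y. z \<in> box a b" by (intro eventually_nhds_in_open) auto
        then have "\<forall>\<^sub>F z in nhds y. I z = 1" by eventually_elim (auto simp: I_def)
        then show ?thesis by (subst isCont_cong) auto
      next
        case False
        then have "\<forall>\<^sub>F z in nhds y. z \<in> - cbox a b" using y by (intro eventually_nhds_in_open) auto
        then have "\<forall>\<^sub>F z in nhds y. I z = 0"
          by eventually_elim (use box_subset_cbox[of a b] in \<open>auto simp: I_def indicator_def\<close>)
        then show ?thesis by (subst isCont_cong) auto
      qed
      moreover have "norm (I x) \<le> 1" for x by (simp add: I_def indicator_def)
      ultimately show "(\<lambda>n. f y * J n y) \<longlonglongrightarrow> f y * (I y * of_real ((2 * pi) powr (real DIM('a) / 2)))"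
        unfolding J_def by (intro tendsto_mult tendsto_const gauss_kernel_approx[where B = 1]) auto
    qed
  qed (auto simp: J_def)
  then have "(LINT y|lborel. f y * (I y * of_real ((2 * pi) powr (real DIM('a) / 2)))) = 0"
    unfolding J0 by (rule LIMSEQ_unique[OF _ tendsto_const])
  then show ?thesis by (simp add: I_def flip: mult.assoc)
qed

lemma integrable_mult_indicator_complex:
  fixes f :: "'a \<Rightarrow> complex"
  assumes "integrable M f" "A \<in> sets M"
  shows "integrable M (\<lambda>x. f x * indicator A x)"
  using integrable_mult_indicator[OF assms(2,1)]
  by (simp add: scaleR_conv_of_real mult.commute of_real_indicator)

text \<open>Gaussian averages of f vanish everywhere, hence so do its integrals over boxes; boxes
  are stable under intersection and generate the Borel sets.\<close>

theorem fourier_L1_unique: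
  fixes f :: "'a::euclidean_space \<Rightarrow> complex"
  assumes f: "integrable lborel f" and z: "\<And>\<xi>. fourier f \<xi> = 0"
  shows "AE x in lborel. f x = 0"
proof (rule sigma_finite_measure.density_zero[OF sigma_finite_lborel f])
  fix A :: "'a set" assume "A \<in> sets lborel"
  have k: "(LINT y|lborel. f y * of_real (gauss_kernel \<tau> (x - y))) = 0" if "\<tau> > 0" for x \<tau>
    unfolding fourier_gauss_regularisation[OF f that, symmetric] z by simp
  \<comment> \<open>The transform at 0 is the full integral up to a constant; the complement case of
    the induction over Borel sets rests on its vanishing.\<close>
  have f0: "(LINT y|lborel. f y) = 0"
    using z[of 0] by (simp add: fourier_def)
  have "Int_stable (range (\<lambda>(a, b). box a b :: 'a set))"
    by (auto simp: Int_stable_def box_Int_box)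
  moreover have "range (\<lambda>(a, b). box a b :: 'a set) \<subseteq> Pow UNIV" by simp
  moreover have "A \<in> sigma_sets UNIV (range (\<lambda>(a, b). box a b :: 'a set))"
    using \<open>A \<in> sets lborel\<close> by (simp add: borel_eq_box)
  ultimately have "(LINT y|lborel. f y * indicator A y) = 0"
  proof (induction rule: sigma_sets_induct_disjoint)
    case (basic A)
    then show ?case using integral_box_zero[OF f k] by auto
  next
    case empty
    then show ?case by simp
  next
    case (compl A)
    then have A: "A \<in> sets lborel" by (simp add: borel_eq_box)
    have "(LINT y|lborel. f y * indicator (UNIV - A) y) = (LINT y|lborel. f y - f y * indicator A y)"
      by (intro Bochner_Integration.integral_cong) (auto simp: indicator_def)
    also have "\<dots> = 0"
      using compl f0 f integrable_mult_indicator_complex[OF f A] by (subst Bochner_Integration.integral_diff) auto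
    finally show ?case .
  next
    case (union A)
    then have A: "A i \<in> sets lborel" for i by (auto simp: borel_eq_box)
    have "set_integrable lborel (\<Union>i. A i) f"
      unfolding set_integrable_def using A f by (intro integrable_mult_indicator) auto
    then have "set_lebesgue_integral lborel (\<Union>i. A i) f = (\<Sum>i. set_lebesgue_integral lborel (A i) f)"
      using A union(1) by (intro lebesgue_integral_countable_add) (auto simp: disjoint_family_on_def)
    then show ?case
      using union(3) by (simp add: set_lebesgue_integral_def scaleR_conv_of_real mult.commute of_real_indicator)
  qed
  then show "set_lebesgue_integral lborel A f = 0"
    by (simp add: set_lebesgue_integral_def scaleR_conv_of_real mult.commute of_real_indicator)
qed

text \<open>Multiplication by a Gaussian makes F integrable, and a Gaussian times a character is
  again Schwartz, so the transform of the product vanishes. The Gaussian has no zeros and can be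
  removed.\<close>

lemma tempered_unique:
  fixes F :: "'a::euclidean_space \<Rightarrow> complex"
  assumes F: "tempered_function F" and z: "\<And>\<phi>. \<phi> \<in> schwartz \<Longrightarrow> (LINT x|lborel. F x * \<phi> x) = 0"
  shows "AE x in lborel. F x = 0"
proof -
  have "AE x in lborel. F x * gauss_wave 1 0 x = 0"
  proof (rule fourier_L1_unique)
    show "integrable lborel (\<lambda>x. F x * gauss_wave 1 0 x)"
      using F schwartz_gauss_wave[of 1 0] by (auto simp: tempered_function_def)
    fix \<xi>
    have "(LINT x|lborel. F x * gauss_wave 1 0 x * cis (- (x \<bullet> \<xi>))) = (LINT x|lborel. F x * gauss_wave 1 (- \<xi>) x)"
      by (intro Bochner_Integration.integral_cong) (auto simp: gauss_wave_def inner_commute)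
    then show "fourier (\<lambda>x. F x * gauss_wave 1 0 x) \<xi> = 0"
      by (simp add: fourier_def z schwartz_gauss_wave)
  qed
  then show ?thesis by (rule eventually_mono) (auto simp: gauss_wave_def)
qed

lemma tempered_diff:
  assumes "tempered_function F" "tempered_function G"
  shows "tempered_function (\<lambda>x. F x - G x)"
  using assms unfolding tempered_function_def by (auto simp: left_diff_distrib)

lemma has_fourier_unique:
  assumes "has_fourier T F" "has_fourier T G"
  shows "AE x in lborel. F x = G x"
proof -
  have t: "tempered_function F" "tempered_function G" using assms by (auto simp: has_fourier_def)
  have "AE x in lborel. F x - G x = 0"
  proof (rule tempered_unique[OF tempered_diff[OF t]])
    fix \<phi> :: "'a \<Rightarrow> complex" assume p: "\<phi> \<in> schwartz"
    then show "(LINT x|lborel. (F x - G x) * \<phi> x) = 0"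
      using assms t unfolding has_fourier_def tempered_function_def left_diff_distrib
      by (subst Bochner_Integration.integral_diff) auto
  qed
  then show ?thesis by (rule eventually_mono) auto
qed

lemma fourier_function_unique:
  assumes "has_fourier T F"
  shows "AE x in lborel. fourier_function T x = F x"
  by (rule has_fourier_unique[OF _ assms]) (unfold fourier_function_def, rule someI[of "has_fourier T"], rule assms)

lemma schwartz_reflect:
  fixes f :: "'a::euclidean_space \<Rightarrow> complex"
  assumes "f \<in> schwartz"
  shows "(\<lambda>x. f (- x)) \<in> schwartz"
proof (rule schwartz_coinduct[where C = "{\<lambda>x. f (- x) |f. f \<in> schwartz}"])
  have d: "((\<lambda>x. f (- x)) has_derivative (\<lambda>h. frechet_derivative f (at (- x)) (- h))) (at x)"
    if "f \<in> schwartz" for f :: "'a \<Rightarrow> complex" and x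
    by (rule has_derivative_compose[OF _ schwartz_has_derivative[OF that]]) (auto intro!: derivative_eq_intros)
  fix h :: "'a \<Rightarrow> complex" assume h: "h \<in> {\<lambda>x. f (- x) |f. f \<in> schwartz}"
  then obtain f where f: "f \<in> schwartz" "h = (\<lambda>x. f (- x))" by blast
  show "h differentiable (at x)" for x
    using d[OF f(1)] unfolding f(2) differentiable_def by blast
  show "(\<lambda>x. frechet_derivative h (at x) b) \<in> {\<lambda>x. f (- x) |f. f \<in> schwartz}" if b: "b \<in> Basis" for b
  proof -
    have "frechet_derivative h (at x) b = (-1) * frechet_derivative f (at (- x)) b" for x
      unfolding f(2) frechet_derivative_at[OF d[OF f(1)], symmetric]
      using linear_neg[OF linear_frechet_derivative[OF schwartz_differentiable[OF f(1)]]] by simp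
    then show ?thesis
      using schwartz_cmult[OF schwartz_partial[OF f(1) b], of "-1"]
      by (intro CollectI exI[of _ "\<lambda>x. (-1) * frechet_derivative f (at x) b"]) auto
  qed
  show "\<exists>B. \<forall>x. (1 + norm x) ^ k * norm (h x) \<le> B" for k
    using schwartz_decay[OF f(1), of k] unfolding f(2) by (metis norm_minus_cancel)
qed (use assms in \<open>intro CollectI exI[of _ f], simp\<close>)

text \<open>\<open>has_fourier\<close> tests a distribution on transforms of Schwartz functions;
  surjectivity makes these all of \<open>schwartz\<close>. The preimage is the reflected
  transform.\<close>

lemma fourier_surj_schwartz:
  assumes "\<phi> \<in> schwartz"
  shows "\<exists>\<eta>\<in>schwartz. \<phi> = fourier \<eta>"
proof
  define \<eta> where "\<eta> = (\<lambda>x. fourier \<phi> (- x))"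
  show "\<eta> \<in> schwartz" unfolding \<eta>_def by (intro schwartz_reflect schwartz_fourier assms)
  have "fourier \<eta> \<xi> = \<phi> \<xi>" for \<xi>
  proof -
    have [measurable]: "fourier \<phi> \<in> borel_measurable borel"
      by (intro schwartz_measurable schwartz_fourier assms)
    have "(LINT x|lborel. fourier \<phi> x * cis (- (x \<bullet> (- \<xi>)))) = \<bar>-1\<bar> ^ DIM('a) *\<^sub>R (LINT x|lborel. fourier \<phi> (0 + (-1) *\<^sub>R x) * cis (- ((0 + (-1) *\<^sub>R x) \<bullet> (- \<xi>))))"
      by (rule lborel_integral_affine) auto
    then have "fourier \<eta> \<xi> = inverse_fourier (fourier \<phi>) \<xi>"
      by (simp add: inverse_fourier_def fourier_def[of "\<lambda>x. fourier \<phi> (- x)"] fourier_def[of "fourier \<phi>"] \<eta>_def)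
    then show ?thesis using fourier_inversion[OF assms] by simp
  qed
  then show "\<phi> = fourier \<eta>" by auto
qed

section \<open>The Fourier transform of square integrable functions\<close>

lemma nn_integral_Cauchy_Schwarz:
  assumes [measurable]: "f \<in> borel_measurable M" "g \<in> borel_measurable M"
    and A: "(\<integral>\<^sup>+x. (f x)\<^sup>2 \<partial>M) \<le> ennreal A" and B: "(\<integral>\<^sup>+x. (g x)\<^sup>2 \<partial>M) \<le> ennreal B"
    and nonneg: "0 \<le> A" "0 \<le> B"
  shows "(\<integral>\<^sup>+x. f x * g x \<partial>M) \<le> ennreal (sqrt (A * B))"
proof -
  define I where "I = (\<integral>\<^sup>+x. f x * g x \<partial>M)"
  have "I\<^sup>2 \<le> ennreal A * ennreal B"
    unfolding I_def by (rule order_trans[OF Cauchy_Schwarz_nn_integral mult_mono[OF A B]]) auto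
  then have I2: "I\<^sup>2 \<le> ennreal (A * B)" using nonneg by (simp add: ennreal_mult)
  have "I \<noteq> \<top>" using I2 by (auto simp: top_power_ennreal top_unique)
  then obtain r where r: "I = ennreal r" "r \<ge> 0" by (metis ennreal_cases)
  have "r\<^sup>2 \<le> A * B" using I2 nonneg r by (simp add: ennreal_power)
  then have "r \<le> sqrt (A * B)" by (rule real_le_rsqrt)
  then show ?thesis using r by (simp add: I_def[symmetric] ennreal_leI)
qed

lemma norm_integral_le_nn_integral:
  fixes f :: "'a \<Rightarrow> 'b::{banach, second_countable_topology}"
  shows "ennreal (norm (LINT x|M. f x)) \<le> (\<integral>\<^sup>+x. ennreal (norm (f x)) \<partial>M)"
  by (cases "integrable M f") (auto simp: integral_norm_bound_ennreal not_integrable_integral_eq)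

text \<open>Fatou's lemma, in the form used to remove a Gaussian damping or a truncation.\<close>

lemma nn_integral_le_tendsto:
  fixes u :: "nat \<Rightarrow> 'a \<Rightarrow> ennreal"
  assumes "\<And>n. u n \<in> borel_measurable M" "\<And>n. (\<integral>\<^sup>+x. u n x \<partial>M) \<le> C"
    and "AE x in M. (\<lambda>n. u n x) \<longlonglongrightarrow> v x"
  shows "(\<integral>\<^sup>+x. v x \<partial>M) \<le> C"
proof -
  have "(\<integral>\<^sup>+x. v x \<partial>M) = (\<integral>\<^sup>+x. liminf (\<lambda>n. u n x) \<partial>M)"
    by (intro nn_integral_cong_AE eventually_mono[OF assms(3)]) (auto simp: lim_imp_Liminf)
  also have "\<dots> \<le> liminf (\<lambda>n. \<integral>\<^sup>+x. u n x \<partial>M)"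
    using assms(1) by (rule nn_integral_liminf)
  also have "\<dots> \<le> C"
    by (rule Liminf_le) (auto simp: assms(2))
  finally show ?thesis .
qed

lemma nn_integral_gauss_kernel:
  fixes y :: "'a::euclidean_space"
  assumes "\<tau> > 0"
  shows "(\<integral>\<^sup>+x. ennreal (gauss_kernel \<tau> (y - x)) \<partial>lborel) = ennreal ((2 * pi) powr (real DIM('a) / 2))"
proof -
  note g = gauss_kernel_integrable[OF assms, where 'a = 'a]
  have "(\<integral>\<^sup>+x. ennreal (gauss_kernel \<tau> (- y + x)) \<partial>lborel) = ennreal (LINT x|lborel. gauss_kernel \<tau> (- y + x))"
    by (rule nn_integral_eq_integral[OF lborel_integrable_translate[OF g]]) simp
  then show ?thesis
    unfolding lborel_integral_translate[OF g] gauss_kernel_integral[OF assms]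
    by (subst gauss_kernel_minus) simp
qed

text \<open>Schur's test: 2ab \<le> a^2 + b^2 under the double integral, where the kernel has the
  same integral (2 pi)^(d/2) in either variable.\<close>

lemma gauss_schur_bound:
  fixes h :: "'a::euclidean_space \<Rightarrow> ennreal"
  assumes [measurable]: "h \<in> borel_measurable borel" and t: "\<tau> > 0"
  shows "(\<integral>\<^sup>+y. h y * (\<integral>\<^sup>+x. h x * ennreal (gauss_kernel \<tau> (y - x)) \<partial>lborel) \<partial>lborel) \<le>
    ennreal ((2 * pi) powr (real DIM('a) / 2)) * (\<integral>\<^sup>+x. (h x)\<^sup>2 \<partial>lborel)"
proof -
  define c where "c = ennreal ((2 * pi) powr (real DIM('a) / 2))"
  have k: "(\<integral>\<^sup>+x. ennreal (gauss_kernel \<tau> (y - x)) \<partial>lborel) = c" for y :: 'a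
    unfolding c_def by (rule nn_integral_gauss_kernel[OF t])
  have amgm: "2 * (a * b) \<le> a\<^sup>2 + b\<^sup>2" for a b :: ennreal
  proof (cases "a = \<top> \<or> b = \<top>")
    case True
    then show ?thesis by (auto simp: top_power_ennreal)
  next
    case False
    then obtain p q where "a = ennreal p" "b = ennreal q" "p \<ge> 0" "q \<ge> 0" by (metis ennreal_cases)
    then show ?thesis
      using sum_squares_bound[of p q]
      by (simp add: ennreal_power ennreal_mult[symmetric] ennreal_plus[symmetric] ennreal_leI mult.assoc
          del: ennreal_plus flip: ennreal_numeral)
  qed
  have 1: "(\<integral>\<^sup>+y. (\<integral>\<^sup>+x. (h y)\<^sup>2 * ennreal (gauss_kernel \<tau> (y - x)) \<partial>lborel) \<partial>lborel) = c * (\<integral>\<^sup>+x. (h x)\<^sup>2 \<partial>lborel)"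
    by (subst nn_integral_cmult, measurable) (simp add: k nn_integral_multc nn_integral_cmult mult.commute[of _ c])
  have "(\<integral>\<^sup>+y. (\<integral>\<^sup>+x. (h x)\<^sup>2 * ennreal (gauss_kernel \<tau> (y - x)) \<partial>lborel) \<partial>lborel) =
    (\<integral>\<^sup>+x. (\<integral>\<^sup>+y. (h x)\<^sup>2 * ennreal (gauss_kernel \<tau> (x - y)) \<partial>lborel) \<partial>lborel)"
    by (subst lborel_pair.Fubini') (simp_all add: gauss_kernel_minus[of \<tau> _ "_::'a"])
  then have 2: "(\<integral>\<^sup>+y. (\<integral>\<^sup>+x. (h x)\<^sup>2 * ennreal (gauss_kernel \<tau> (y - x)) \<partial>lborel) \<partial>lborel) = c * (\<integral>\<^sup>+x. (h x)\<^sup>2 \<partial>lborel)"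
    using 1 by simp
  have "2 * (\<integral>\<^sup>+y. h y * (\<integral>\<^sup>+x. h x * ennreal (gauss_kernel \<tau> (y - x)) \<partial>lborel) \<partial>lborel) =
    (\<integral>\<^sup>+y. (\<integral>\<^sup>+x. 2 * (h y * h x) * ennreal (gauss_kernel \<tau> (y - x)) \<partial>lborel) \<partial>lborel)"
    by (simp add: nn_integral_cmult[symmetric] mult.assoc)
  also have "\<dots> \<le> (\<integral>\<^sup>+y. (\<integral>\<^sup>+x. ((h y)\<^sup>2 + (h x)\<^sup>2) * ennreal (gauss_kernel \<tau> (y - x)) \<partial>lborel) \<partial>lborel)"
    by (intro nn_integral_mono mult_right_mono amgm) auto
  also have "\<dots> = (\<integral>\<^sup>+y. (\<integral>\<^sup>+x. (h y)\<^sup>2 * ennreal (gauss_kernel \<tau> (y - x)) \<partial>lborel) + (\<integral>\<^sup>+x. (h x)\<^sup>2 * ennreal (gauss_kernel \<tau> (y - x)) \<partial>lborel) \<partial>lborel)"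
    by (simp add: distrib_right nn_integral_add)
  also have "\<dots> = c * (\<integral>\<^sup>+x. (h x)\<^sup>2 \<partial>lborel) + c * (\<integral>\<^sup>+x. (h x)\<^sup>2 \<partial>lborel)"
    by (subst nn_integral_add) (simp_all add: 1 2)
  also have "\<dots> = 2 * (c * (\<integral>\<^sup>+x. (h x)\<^sup>2 \<partial>lborel))" by (simp add: mult_2)
  finally show ?thesis
    unfolding c_def[symmetric] by (subst (asm) ennreal_mult_le_mult_iff) auto
qed

lemma cnj_fourier:
  fixes h :: "'a::euclidean_space \<Rightarrow> complex"
  shows "cnj (fourier h \<xi>) = of_real ((2 * pi) powr (- real DIM('a) / 2)) * (LINT y|lborel. cnj (h y) * cis (y \<bullet> \<xi>))"
  unfolding fourier_def complex_cnj_mult by (subst Bochner_Integration.integral_cnj[symmetric]) (simp add: cis_cnj del: Bochner_Integration.integral_cnj)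

text \<open>With Gaussian damping the left side becomes a double integral of h and its conjugate
  against the Gaussian kernel, which Schur's test bounds uniformly in \<tau>; the prefactor (2
  pi)^(-d/2) cancels the mass of the kernel. Fatou's lemma removes the damping.\<close>

lemma fourier_bessel:
  fixes h :: "'a::euclidean_space \<Rightarrow> complex"
  assumes h: "integrable lborel h"
  shows "(\<integral>\<^sup>+\<xi>. ennreal ((cmod (fourier h \<xi>))\<^sup>2) \<partial>lborel) \<le> (\<integral>\<^sup>+x. ennreal ((cmod (h x))\<^sup>2) \<partial>lborel)"
proof -
  have [measurable]: "h \<in> borel_measurable borel" using borel_measurable_integrable[OF h] by simp
  define c where "c = (2 * pi) powr (- real DIM('a) / 2)"
  have c: "c \<ge> 0" "c * (2 * pi) powr (real DIM('a) / 2) = 1"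
    by (auto simp: c_def simp flip: powr_add)
  obtain K where K: "\<And>\<xi>. norm (fourier h \<xi>) \<le> K" using norm_fourier_le by blast
  have K0: "K \<ge> 0" using K[of 0] norm_ge_zero order_trans by blast
  have *: "(\<integral>\<^sup>+\<xi>. ennreal ((cmod (fourier h \<xi>))\<^sup>2 * exp (- \<tau> * (norm \<xi>)\<^sup>2)) \<partial>lborel) \<le> (\<integral>\<^sup>+x. ennreal ((cmod (h x))\<^sup>2) \<partial>lborel)"
    if t: "\<tau> > 0" for \<tau>
  proof -
    define k where "k \<xi> = fourier h \<xi> * of_real (exp (- \<tau> * (norm \<xi>)\<^sup>2))" for \<xi>
    have ik: "integrable lborel k"
      unfolding k_def
    proof (rule Bochner_Integration.integrable_bound[OF integrable_mult_right[OF gaussian_integrable[OF t], of K]])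
      show "AE \<xi> in lborel. norm (fourier h \<xi> * of_real (exp (- \<tau> * (norm \<xi>)\<^sup>2))) \<le> norm (K * exp (- \<tau> * (norm \<xi>)\<^sup>2))"
        using K K0 by (auto simp: norm_mult intro!: mult_right_mono)
    qed measurable
    have ir: "integrable lborel (\<lambda>\<xi>. (cmod (fourier h \<xi>))\<^sup>2 * exp (- \<tau> * (norm \<xi>)\<^sup>2))"
    proof (rule Bochner_Integration.integrable_bound[OF integrable_mult_right[OF gaussian_integrable[OF t], of "K\<^sup>2"]])
      show "AE \<xi> in lborel. norm ((cmod (fourier h \<xi>))\<^sup>2 * exp (- \<tau> * (norm \<xi>)\<^sup>2)) \<le> norm (K\<^sup>2 * exp (- \<tau> * (norm \<xi>)\<^sup>2))"
        using K K0 by (auto simp: abs_mult intro!: mult_right_mono power_mono)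
    qed measurable
    have ic: "integrable lborel (\<lambda>y. cnj (h y))" using h by simp
    have "of_real (LINT \<xi>|lborel. (cmod (fourier h \<xi>))\<^sup>2 * exp (- \<tau> * (norm \<xi>)\<^sup>2)) = (LINT \<xi>|lborel. k \<xi> * cnj (fourier h \<xi>))"
      unfolding integral_complex_of_real[symmetric]
      by (intro Bochner_Integration.integral_cong) (auto simp: k_def complex_norm_square mult_ac simp flip: of_real_power)
    also have "\<dots> = of_real c * (LINT \<xi>|lborel. LINT y|lborel. k \<xi> * cnj (h y) * cis (y \<bullet> \<xi>))"
      unfolding cnj_fourier c_def[symmetric] integral_mult_right_zero[symmetric]
      by (intro Bochner_Integration.integral_cong refl) (simp add: mult_ac)
    also have "(LINT \<xi>|lborel. LINT y|lborel. k \<xi> * cnj (h y) * cis (y \<bullet> \<xi>)) = (LINT y|lborel. LINT \<xi>|lborel. k \<xi> * cnj (h y) * cis (y \<bullet> \<xi>))"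
      by (rule lborel_pair.Fubini_integral[symmetric], rule lborel_pair.integrable_cis_product[OF ik ic]) measurable
    also have "\<dots> = (LINT y|lborel. cnj (h y) * (LINT \<xi>|lborel. fourier h \<xi> * gauss_wave \<tau> y \<xi>))"
      unfolding integral_mult_right_zero[symmetric]
      by (intro Bochner_Integration.integral_cong refl) (simp add: k_def gauss_wave_def mult_ac)
    also have "\<dots> = (LINT y|lborel. cnj (h y) * (LINT x|lborel. h x * of_real (gauss_kernel \<tau> (y - x))))"
      unfolding fourier_gauss_regularisation[OF h t] ..
    finally have e: "of_real (LINT \<xi>|lborel. (cmod (fourier h \<xi>))\<^sup>2 * exp (- \<tau> * (norm \<xi>)\<^sup>2)) =
      of_real c * (LINT y|lborel. cnj (h y) * (LINT x|lborel. h x * of_real (gauss_kernel \<tau> (y - x))))" .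
    have "(\<integral>\<^sup>+\<xi>. ennreal ((cmod (fourier h \<xi>))\<^sup>2 * exp (- \<tau> * (norm \<xi>)\<^sup>2)) \<partial>lborel) = ennreal (LINT \<xi>|lborel. (cmod (fourier h \<xi>))\<^sup>2 * exp (- \<tau> * (norm \<xi>)\<^sup>2))"
      by (rule nn_integral_eq_integral[OF ir]) auto
    also have "\<dots> \<le> ennreal (norm (complex_of_real (LINT \<xi>|lborel. (cmod (fourier h \<xi>))\<^sup>2 * exp (- \<tau> * (norm \<xi>)\<^sup>2))))"
      by (intro ennreal_leI) simp
    also have "\<dots> = ennreal c * ennreal (norm (LINT y|lborel. cnj (h y) * (LINT x|lborel. h x * of_real (gauss_kernel \<tau> (y - x)))))"
      unfolding e norm_mult using c by (simp add: ennreal_mult)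
    also have "\<dots> \<le> ennreal c * (\<integral>\<^sup>+y. ennreal (norm (h y)) * (\<integral>\<^sup>+x. ennreal (norm (h x)) * ennreal (gauss_kernel \<tau> (y - x)) \<partial>lborel) \<partial>lborel)"
    proof (intro mult_left_mono order_trans[OF norm_integral_le_nn_integral] nn_integral_mono)
      show "ennreal (norm (cnj (h y) * (LINT x|lborel. h x * of_real (gauss_kernel \<tau> (y - x))))) \<le> ennreal (norm (h y)) * (\<integral>\<^sup>+x. ennreal (norm (h x)) * ennreal (gauss_kernel \<tau> (y - x)) \<partial>lborel)" for y
      proof -
        have "ennreal (norm (LINT x|lborel. h x * of_real (gauss_kernel \<tau> (y - x)))) \<le> (\<integral>\<^sup>+x. ennreal (norm (h x)) * ennreal (gauss_kernel \<tau> (y - x)) \<partial>lborel)"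
          by (rule order_trans[OF norm_integral_le_nn_integral]) (simp add: norm_mult ennreal_mult)
        then show ?thesis by (simp add: norm_mult ennreal_mult mult_left_mono)
      qed
    qed auto
    also have "\<dots> \<le> ennreal c * (ennreal ((2 * pi) powr (real DIM('a) / 2)) * (\<integral>\<^sup>+x. (ennreal (norm (h x)))\<^sup>2 \<partial>lborel))"
      by (intro mult_left_mono gauss_schur_bound t) auto
    also have "\<dots> = (\<integral>\<^sup>+x. ennreal ((cmod (h x))\<^sup>2) \<partial>lborel)"
      using c by (simp add: ennreal_power mult.assoc[symmetric] ennreal_mult[symmetric])
    finally show ?thesis .
  qed
  have t0: "(\<lambda>n. 1 / real (Suc n)) \<longlonglongrightarrow> 0" using lim_inverse_n'[THEN LIMSEQ_Suc] by simp
  show ?thesis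
  proof (rule nn_integral_le_tendsto)
    show "(\<integral>\<^sup>+\<xi>. ennreal ((cmod (fourier h \<xi>))\<^sup>2 * exp (- (1 / real (Suc n)) * (norm \<xi>)\<^sup>2)) \<partial>lborel) \<le> (\<integral>\<^sup>+x. ennreal ((cmod (h x))\<^sup>2) \<partial>lborel)" for n
      by (rule *) simp
    show "AE \<xi> in lborel. (\<lambda>n. ennreal ((cmod (fourier h \<xi>))\<^sup>2 * exp (- (1 / real (Suc n)) * (norm \<xi>)\<^sup>2))) \<longlonglongrightarrow> ennreal ((cmod (fourier h \<xi>))\<^sup>2)"
    proof (intro AE_I2 tendsto_ennrealI)
      fix \<xi> :: 'a
      have "(\<lambda>n. (cmod (fourier h \<xi>))\<^sup>2 * exp (- (1 / real (Suc n)) * (norm \<xi>)\<^sup>2)) \<longlonglongrightarrow> (cmod (fourier h \<xi>))\<^sup>2 * exp (- 0 * (norm \<xi>)\<^sup>2)"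
        by (intro tendsto_intros t0)
      then show "(\<lambda>n. (cmod (fourier h \<xi>))\<^sup>2 * exp (- (1 / real (Suc n)) * (norm \<xi>)\<^sup>2)) \<longlonglongrightarrow> (cmod (fourier h \<xi>))\<^sup>2" by simp
    qed
  qed measurable
qed

section \<open>Products and truncations of square integrable functions\<close>

lemma square_integrableD:
  assumes "f \<in> square_integrable"
  shows "f \<in> borel_measurable borel" "integrable lborel (\<lambda>x. (cmod (f x))\<^sup>2)"
    "(\<integral>\<^sup>+x. (ennreal (cmod (f x)))\<^sup>2 \<partial>lborel) = ennreal (LINT x|lborel. (cmod (f x))\<^sup>2)"
    "(LINT x|lborel. (cmod (f x))\<^sup>2) \<ge> 0"
proof -
  show m: "f \<in> borel_measurable borel" and i: "integrable lborel (\<lambda>x. (cmod (f x))\<^sup>2)"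
    using assms by (auto simp: square_integrable_def)
  show "(\<integral>\<^sup>+x. (ennreal (cmod (f x)))\<^sup>2 \<partial>lborel) = ennreal (LINT x|lborel. (cmod (f x))\<^sup>2)"
    using nn_integral_eq_integral[OF i] by (simp add: ennreal_power)
qed simp

lemma square_integrableI:
  assumes [measurable]: "f \<in> borel_measurable borel" and "(\<integral>\<^sup>+x. (ennreal (cmod (f x)))\<^sup>2 \<partial>lborel) < \<infinity>"
  shows "f \<in> square_integrable"
  using assms(2) unfolding square_integrable_def
  by (auto intro!: integrableI_bounded simp: ennreal_power)

lemma
  assumes f: "f \<in> square_integrable" and g: "g \<in> square_integrable"
  shows square_integrable_mult: "integrable lborel (\<lambda>x. f x * g x)"
    and square_integrable_mult_bound: "norm (LINT x|lborel. f x * g x) \<le>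
      sqrt ((LINT x|lborel. (cmod (f x))\<^sup>2) * (LINT x|lborel. (cmod (g x))\<^sup>2))"
proof -
  note [measurable] = square_integrableD(1)[OF f] square_integrableD(1)[OF g]
  have b: "(\<integral>\<^sup>+x. ennreal (norm (f x * g x)) \<partial>lborel) \<le> ennreal (sqrt ((LINT x|lborel. (cmod (f x))\<^sup>2) * (LINT x|lborel. (cmod (g x))\<^sup>2)))"
    unfolding norm_mult by (subst ennreal_mult, simp, simp, rule nn_integral_Cauchy_Schwarz)
      (use square_integrableD(3,4)[OF f] square_integrableD(3,4)[OF g] in auto)
  then show "integrable lborel (\<lambda>x. f x * g x)"
    using le_less_trans[OF b] by (intro integrableI_bounded) auto
  show "norm (LINT x|lborel. f x * g x) \<le> sqrt ((LINT x|lborel. (cmod (f x))\<^sup>2) * (LINT x|lborel. (cmod (g x))\<^sup>2))"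
    using order_trans[OF norm_integral_le_nn_integral b] square_integrableD(4)[OF f] square_integrableD(4)[OF g]
    by (subst (asm) ennreal_le_iff) auto
qed

lemma schwartz_square_integrable:
  fixes \<phi> :: "'a::euclidean_space \<Rightarrow> complex"
  assumes "\<phi> \<in> schwartz"
  shows "\<phi> \<in> square_integrable"
proof -
  have [measurable]: "\<phi> \<in> borel_measurable borel" by (rule schwartz_measurable[OF assms])
  obtain B where B: "\<And>x. norm (\<phi> x) \<le> B" using schwartz_decay[OF assms, of 0] by auto
  have "integrable lborel (\<lambda>x. (cmod (\<phi> x))\<^sup>2)"
  proof (rule Bochner_Integration.integrable_bound[OF integrable_mult_right[OF integrable_norm[OF schwartz_integrable[OF assms]], of B]])
    show "AE x in lborel. norm ((cmod (\<phi> x))\<^sup>2) \<le> norm (B * norm (\<phi> x))"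
      using B by (auto simp: power2_eq_square abs_mult intro!: mult_right_mono order_trans[OF B abs_ge_self])
  qed measurable
  then show ?thesis by (simp add: square_integrable_def)
qed

lemma square_integrable_tempered: "f \<in> square_integrable \<Longrightarrow> tempered_function f"
  unfolding tempered_function_def
  using square_integrable_mult schwartz_square_integrable by (auto dest: square_integrableD(1))

lemma square_integrable_truncation:
  fixes f :: "'a::euclidean_space \<Rightarrow> complex"
  assumes f: "f \<in> square_integrable"
  shows "integrable lborel (\<lambda>x. f x * indicator (ball 0 r) x)"
proof (rule Bochner_Integration.integrable_bound)
  note [measurable] = square_integrableD(1)[OF f]
  have "integrable lborel (\<lambda>x. indicator (ball (0::'a) r) x :: real)"
    using emeasure_bounded_finite[OF bounded_ball[of "0::'a" r]] by (intro integrable_real_indicator) auto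
  then show "integrable lborel (\<lambda>x. indicator (ball 0 r) x + (cmod (f x))\<^sup>2)"
    using square_integrableD(2)[OF f] by (rule Bochner_Integration.integrable_add)
  have "t \<le> 1 + t\<^sup>2" for t :: real
  proof -
    have "0 \<le> (t - 1)\<^sup>2" by simp
    then have "2 * t \<le> 1 + t\<^sup>2" by (simp add: power2_eq_square algebra_simps)
    then show ?thesis using zero_le_power2[of t] by linarith
  qed
  then show "AE x in lborel. norm (f x * indicator (ball 0 r) x) \<le> norm (indicator (ball 0 r) x + (cmod (f x))\<^sup>2)"
    by (auto simp: indicator_def norm_mult)
qed (use square_integrableD(1)[OF f] in measurable)

lemma summable_ennreal_geometric:
  "(\<Sum>k. ennreal (2 ^ k) * ennreal ((1 / 8) ^ k)) < \<infinity>"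
proof -
  have "(\<Sum>k. ennreal (2 ^ k) * ennreal ((1 / 8) ^ k)) = (\<Sum>k. ennreal ((1 / 4) ^ k))"
    by (simp add: ennreal_mult[symmetric] power_mult_distrib[symmetric])
  also have "\<dots> = ennreal (\<Sum>k. (1 / 4) ^ k)"
    by (rule suminf_ennreal2) (auto intro: summable_geometric)
  finally show ?thesis by simp
qed

lemma ennreal_suminf_term_le: "f k \<le> (\<Sum>n. f n :: ennreal)"
  using sum_le_suminf[of f "{k}"] by simp

text \<open>The weights 2^k turn a bound on squares into geometric decay: each increment is at most
  sqrt(C) 2^(-k/2), so the telescoping series converges absolutely.\<close>

lemma convergent_of_weighted_squares:
  fixes a :: "nat \<Rightarrow> 'a::banach"
  assumes "(\<Sum>k. ennreal (2 ^ k * (norm (a (Suc k) - a k))\<^sup>2)) \<noteq> \<infinity>"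
  shows "convergent a"
proof -
  define S where "S = (\<Sum>k. ennreal (2 ^ k * (norm (a (Suc k) - a k))\<^sup>2))"
  have "S \<noteq> \<top>" using assms by (simp add: S_def)
  then obtain C where C: "S = ennreal C" "C \<ge> 0" by (cases S) auto
  have b: "norm (a (Suc k) - a k) \<le> sqrt C * (1 / sqrt 2) ^ k" for k
  proof (rule power2_le_imp_le)
    have "ennreal (2 ^ k * (norm (a (Suc k) - a k))\<^sup>2) \<le> S"
      unfolding S_def by (rule ennreal_suminf_term_le)
    then have "2 ^ k * (norm (a (Suc k) - a k))\<^sup>2 \<le> C" using C by simp
    moreover have "((1 / sqrt 2) ^ k)\<^sup>2 = ((1 / sqrt 2)\<^sup>2) ^ k"
      by (simp only: power_mult[symmetric] mult.commute)
    then have "(sqrt C * (1 / sqrt 2) ^ k)\<^sup>2 = C / 2 ^ k"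
      using C(2) by (simp add: power_mult_distrib power_divide del: power_divide) (simp add: power_divide)
    ultimately show "(norm (a (Suc k) - a k))\<^sup>2 \<le> (sqrt C * (1 / sqrt 2) ^ k)\<^sup>2"
      by (simp add: pos_le_divide_eq mult.commute)
  qed (use C in auto)
  have "summable (\<lambda>k. sqrt C * (1 / sqrt 2) ^ k)"
    by (intro summable_mult summable_geometric) auto
  then have "summable (\<lambda>k. a (Suc k) - a k)"
    using b by (rule summable_comparison_test'[of _ 0])
  then have "convergent (\<lambda>n. \<Sum>k<n. a (Suc k) - a k)" by (simp add: summable_iff_convergent)
  then have "convergent (\<lambda>n. (\<Sum>k<n. a (Suc k) - a k) + a 0)" by (intro convergent_add convergent_const)
  then show ?thesis by (simp add: sum_lessThan_telescope)
qed

text \<open>The transform arises as an almost everywhere limit of transforms of truncations to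
  balls. The squared L2 error is pushed below 8^(-k) because the weights 2^k that enforce pointwise
  convergence must still leave a convergent sum.\<close>

theorem plancherel:
  fixes f :: "'a::euclidean_space \<Rightarrow> complex"
  assumes f: "f \<in> square_integrable"
  shows "\<exists>F\<in>square_integrable. has_fourier (regular_distribution f) F"
proof -
  note fm [measurable] = square_integrableD(1)[OF f]
  define t where "t r x = f x * indicator (ball 0 r) x" for r x
  have [measurable]: "t r \<in> borel_measurable borel" for r unfolding t_def by measurable
  have it: "integrable lborel (t r)" for r unfolding t_def by (rule square_integrable_truncation[OF f])
  have "(\<lambda>n. LINT x|lborel. (cmod (f x - t (real n) x))\<^sup>2) \<longlonglongrightarrow> (LINT x|(lborel :: 'a measure). 0 :: real)"
  proof (rule integral_dominated_convergence[OF _ _ square_integrableD(2)[OF f]])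
    show "AE x in lborel. (\<lambda>n. (cmod (f x - t (real n) x))\<^sup>2) \<longlonglongrightarrow> 0"
    proof (rule AE_I2)
      fix x :: 'a
      obtain m where "norm x < real m" using reals_Archimedean2 by blast
      then have "\<forall>\<^sub>F n in sequentially. norm x < real n"
        by (intro eventually_sequentiallyI[of m]) linarith
      then have "\<forall>\<^sub>F n in sequentially. (cmod (f x - t (real n) x))\<^sup>2 = 0"
        by eventually_elim (simp add: t_def)
      then show "(\<lambda>n. (cmod (f x - t (real n) x))\<^sup>2) \<longlonglongrightarrow> 0" by (rule tendsto_eventually)
    qed
    show "AE x in lborel. norm ((cmod (f x - t (real n) x))\<^sup>2) \<le> (cmod (f x))\<^sup>2" for n
      by (auto simp: t_def indicator_def)
  qed measurable
  then have lim: "(\<lambda>n. LINT x|lborel. (cmod (f x - t (real n) x))\<^sup>2) \<longlonglongrightarrow> 0" by simp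
  have "\<exists>N. \<forall>n\<ge>N. (LINT x|lborel. (cmod (f x - t (real n) x))\<^sup>2) < (1 / 8) ^ k" for k :: nat
    using order_tendstoD(2)[OF lim, of "(1 / 8) ^ k"] by (simp add: eventually_sequentially)
  then obtain N where N: "\<And>k n. n \<ge> N k \<Longrightarrow> (LINT x|lborel. (cmod (f x - t (real n) x))\<^sup>2) < (1 / 8) ^ k"
    by metis
  \<comment> \<open>Adding all N j up to k makes the radii increasing and at least N k, and the
    summand k sends them to infinity.\<close>
  define r where "r k = k + (\<Sum>j\<le>k. N j)" for k
  have rN: "r k \<ge> N k" for k unfolding r_def by (rule trans_le_add2, rule member_le_sum) auto
  have r_mono: "r m \<le> r n" if "m \<le> n" for m n
    unfolding r_def using that by (intro add_mono sum_mono2) auto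
  define g where "g k = t (real (r k))" for k
  have [measurable]: "g k \<in> borel_measurable borel" for k unfolding g_def by measurable
  have ig: "integrable lborel (g k)" for k unfolding g_def by (rule it)
  have fg: "(\<integral>\<^sup>+x. ennreal ((cmod (f x - g k x))\<^sup>2) \<partial>lborel) \<le> ennreal ((1 / 8) ^ k)" for k
  proof -
    have "integrable lborel (\<lambda>x. (cmod (f x - g k x))\<^sup>2)"
      by (rule Bochner_Integration.integrable_bound[OF square_integrableD(2)[OF f]]) (auto simp: g_def t_def indicator_def)
    then have "(\<integral>\<^sup>+x. ennreal ((cmod (f x - g k x))\<^sup>2) \<partial>lborel) = ennreal (LINT x|lborel. (cmod (f x - g k x))\<^sup>2)"
      by (rule nn_integral_eq_integral) auto
    also have "\<dots> \<le> ennreal ((1 / 8) ^ k)"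
      using N[OF rN] unfolding g_def by (intro ennreal_leI) (auto intro: less_imp_le)
    finally show ?thesis .
  qed
  \<comment> \<open>The balls are nested, so g m - g k is a piece of f - g k; the Bessel inequality
    carries its size over to the transforms.\<close>
  have gg: "(\<integral>\<^sup>+\<xi>. ennreal ((cmod (fourier (g m) \<xi> - fourier (g k) \<xi>))\<^sup>2) \<partial>lborel) \<le> ennreal ((1 / 8) ^ k)" if "k \<le> m" for k m
  proof -
    have "(\<integral>\<^sup>+\<xi>. ennreal ((cmod (fourier (g m) \<xi> - fourier (g k) \<xi>))\<^sup>2) \<partial>lborel) \<le> (\<integral>\<^sup>+x. ennreal ((cmod (g m x - g k x))\<^sup>2) \<partial>lborel)"
      unfolding fourier_diff[OF ig ig, symmetric] by (rule fourier_bessel) (intro Bochner_Integration.integrable_diff ig)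
    also have "\<dots> \<le> (\<integral>\<^sup>+x. ennreal ((cmod (f x - g k x))\<^sup>2) \<partial>lborel)"
      using r_mono[OF that] by (intro nn_integral_mono ennreal_leI) (auto simp: g_def t_def indicator_def)
    finally show ?thesis using fg[of k] by (rule order_trans)
  qed
  have conv: "AE \<xi> in lborel. convergent (\<lambda>k. fourier (g k) \<xi>)"
  proof -
    have "(\<integral>\<^sup>+\<xi>. (\<Sum>k. ennreal (2 ^ k * (cmod (fourier (g (Suc k)) \<xi> - fourier (g k) \<xi>))\<^sup>2)) \<partial>lborel)
      = (\<Sum>k. ennreal (2 ^ k) * (\<integral>\<^sup>+\<xi>. ennreal ((cmod (fourier (g (Suc k)) \<xi> - fourier (g k) \<xi>))\<^sup>2) \<partial>lborel))"
      by (subst nn_integral_suminf, measurable) (simp add: ennreal_mult nn_integral_cmult)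
    also have "\<dots> \<le> (\<Sum>k. ennreal (2 ^ k) * ennreal ((1 / 8) ^ k))"
      by (intro suminf_le mult_left_mono gg) auto
    finally have "(\<integral>\<^sup>+\<xi>. (\<Sum>k. ennreal (2 ^ k * (cmod (fourier (g (Suc k)) \<xi> - fourier (g k) \<xi>))\<^sup>2)) \<partial>lborel) \<noteq> \<infinity>"
      using summable_ennreal_geometric by auto
    then have "AE \<xi> in lborel. (\<Sum>k. ennreal (2 ^ k * (cmod (fourier (g (Suc k)) \<xi> - fourier (g k) \<xi>))\<^sup>2)) \<noteq> \<infinity>"
      by (intro nn_integral_PInf_AE) auto
    then show ?thesis by (rule eventually_mono) (rule convergent_of_weighted_squares)
  qed
  define F where "F \<xi> = lim (\<lambda>k. fourier (g k) \<xi>)" for \<xi>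
  have [measurable]: "F \<in> borel_measurable borel" unfolding F_def by measurable
  have F: "AE \<xi> in lborel. (\<lambda>k. fourier (g k) \<xi>) \<longlonglongrightarrow> F \<xi>"
    using conv by (rule eventually_mono) (simp add: F_def convergent_LIMSEQ_iff)
  have Fg: "(\<integral>\<^sup>+\<xi>. ennreal ((cmod (F \<xi> - fourier (g k) \<xi>))\<^sup>2) \<partial>lborel) \<le> ennreal ((1 / 8) ^ k)" for k
  proof (rule nn_integral_le_tendsto)
    show "(\<integral>\<^sup>+\<xi>. ennreal ((cmod (fourier (g (m + k)) \<xi> - fourier (g k) \<xi>))\<^sup>2) \<partial>lborel) \<le> ennreal ((1 / 8) ^ k)" for m
      by (rule gg) simp
    show "AE \<xi> in lborel. (\<lambda>m. ennreal ((cmod (fourier (g (m + k)) \<xi> - fourier (g k) \<xi>))\<^sup>2)) \<longlonglongrightarrow> ennreal ((cmod (F \<xi> - fourier (g k) \<xi>))\<^sup>2)"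
      using F by (rule eventually_mono) (intro tendsto_ennrealI tendsto_intros LIMSEQ_ignore_initial_segment)
  qed measurable
  have F2: "F \<in> square_integrable"
  proof (rule square_integrableI)
    have "(\<integral>\<^sup>+\<xi>. ennreal ((cmod (F \<xi>))\<^sup>2) \<partial>lborel) \<le> (\<integral>\<^sup>+x. ennreal ((cmod (f x))\<^sup>2) \<partial>lborel)"
    proof (rule nn_integral_le_tendsto)
      show "(\<integral>\<^sup>+\<xi>. ennreal ((cmod (fourier (g k) \<xi>))\<^sup>2) \<partial>lborel) \<le> (\<integral>\<^sup>+x. ennreal ((cmod (f x))\<^sup>2) \<partial>lborel)" for k
        by (rule order_trans[OF fourier_bessel[OF ig]]) (intro nn_integral_mono ennreal_leI, auto simp: g_def t_def indicator_def)
      show "AE \<xi> in lborel. (\<lambda>m. ennreal ((cmod (fourier (g m) \<xi>))\<^sup>2)) \<longlonglongrightarrow> ennreal ((cmod (F \<xi>))\<^sup>2)"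
        using F by (rule eventually_mono) (intro tendsto_ennrealI tendsto_intros)
    qed measurable
    also have "\<dots> < \<infinity>" using square_integrableD(3)[OF f] by (simp add: ennreal_power)
    finally show "(\<integral>\<^sup>+x. (ennreal (cmod (F x)))\<^sup>2 \<partial>lborel) < \<infinity>" by (simp add: ennreal_power)
  qed measurable
  have "regular_distribution f (fourier \<phi>) = (LINT \<xi>|lborel. F \<xi> * \<phi> \<xi>)" if \<phi>: "\<phi> \<in> schwartz" for \<phi>
  proof -
    note p2 = schwartz_square_integrable[OF \<phi>]
    note ip = schwartz_integrable[OF \<phi>]
    note pf = schwartz_fourier[OF \<phi>]
    have [measurable]: "\<phi> \<in> borel_measurable borel" by (rule schwartz_measurable[OF \<phi>])
    define Q where "Q = (LINT x|lborel. (cmod (\<phi> x))\<^sup>2)"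
    have iF: "integrable lborel (\<lambda>\<xi>. F \<xi> * \<phi> \<xi>)" by (rule square_integrable_mult[OF F2 p2])
    have iFg: "integrable lborel (\<lambda>\<xi>. fourier (g k) \<xi> * \<phi> \<xi>)" for k
    proof -
      obtain K where K: "\<And>\<xi>. norm (fourier (g k) \<xi>) \<le> K" using norm_fourier_le by blast
      show ?thesis
        by (rule Bochner_Integration.integrable_bound[OF integrable_mult_right[OF integrable_norm[OF ip], of K]])
           (auto simp: norm_mult abs_mult intro!: AE_I2 mult_right_mono order_trans[OF K abs_ge_self])
    qed
    have "(\<lambda>k. (LINT \<xi>|lborel. F \<xi> * \<phi> \<xi>) - (LINT \<xi>|lborel. fourier (g k) \<xi> * \<phi> \<xi>)) \<longlonglongrightarrow> 0"
    proof (rule Lim_null_comparison)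
      have "norm ((LINT \<xi>|lborel. F \<xi> * \<phi> \<xi>) - (LINT \<xi>|lborel. fourier (g k) \<xi> * \<phi> \<xi>)) \<le> sqrt ((1 / 8) ^ k * Q)" for k
      proof -
        have d2: "(\<lambda>\<xi>. F \<xi> - fourier (g k) \<xi>) \<in> square_integrable"
        proof (rule square_integrableI)
          show "(\<integral>\<^sup>+\<xi>. (ennreal (cmod (F \<xi> - fourier (g k) \<xi>)))\<^sup>2 \<partial>lborel) < \<infinity>"
            using le_less_trans[OF Fg[of k]] by (simp add: ennreal_power)
        qed measurable
        have "(LINT \<xi>|lborel. (cmod (F \<xi> - fourier (g k) \<xi>))\<^sup>2) \<le> (1 / 8) ^ k"
          using Fg[of k] square_integrableD(3)[OF d2] by (simp add: ennreal_power)
        then have A: "sqrt ((LINT \<xi>|lborel. (cmod (F \<xi> - fourier (g k) \<xi>))\<^sup>2) * Q) \<le> sqrt ((1 / 8) ^ k * Q)"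
          using square_integrableD(4)[OF p2] by (intro real_sqrt_le_mono mult_right_mono) (auto simp: Q_def)
        have B: "norm (LINT \<xi>|lborel. (F \<xi> - fourier (g k) \<xi>) * \<phi> \<xi>) \<le> sqrt ((LINT \<xi>|lborel. (cmod (F \<xi> - fourier (g k) \<xi>))\<^sup>2) * Q)"
          unfolding Q_def by (rule square_integrable_mult_bound[OF d2 p2])
        have C: "(LINT \<xi>|lborel. (F \<xi> - fourier (g k) \<xi>) * \<phi> \<xi>) = (LINT \<xi>|lborel. F \<xi> * \<phi> \<xi>) - (LINT \<xi>|lborel. fourier (g k) \<xi> * \<phi> \<xi>)"
          unfolding left_diff_distrib by (rule Bochner_Integration.integral_diff[OF iF iFg])
        show ?thesis using order_trans[OF B A] unfolding C .
      qed
      then show "\<forall>\<^sub>F k in sequentially. norm ((LINT \<xi>|lborel. F \<xi> * \<phi> \<xi>) - (LINT \<xi>|lborel. fourier (g k) \<xi> * \<phi> \<xi>)) \<le> sqrt ((1 / 8) ^ k * Q)"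
        by simp
      have "(\<lambda>k. sqrt ((1 / 8) ^ k * Q)) \<longlonglongrightarrow> sqrt (0 * Q)"
        by (intro tendsto_intros LIMSEQ_power_zero) auto
      then show "(\<lambda>k. sqrt ((1 / 8) ^ k * Q)) \<longlonglongrightarrow> 0" by simp
    qed
    note lim0 = this
    have l1: "(\<lambda>k. LINT \<xi>|lborel. fourier (g k) \<xi> * \<phi> \<xi>) \<longlonglongrightarrow> (LINT \<xi>|lborel. F \<xi> * \<phi> \<xi>)"
      using tendsto_diff[OF tendsto_const[of "LINT \<xi>|lborel. F \<xi> * \<phi> \<xi>"] lim0] by simp
    have l2: "(\<lambda>k. LINT x|lborel. g k x * fourier \<phi> x) \<longlonglongrightarrow> (LINT x|lborel. f x * fourier \<phi> x)"
    proof (rule integral_dominated_convergence[where w = "\<lambda>x. norm (f x * fourier \<phi> x)"])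
      show "integrable lborel (\<lambda>x. norm (f x * fourier \<phi> x))"
        by (intro integrable_norm square_integrable_mult f schwartz_square_integrable pf)
      show "AE x in lborel. (\<lambda>k. g k x * fourier \<phi> x) \<longlonglongrightarrow> f x * fourier \<phi> x"
      proof (intro AE_I2 tendsto_mult tendsto_const)
        fix x :: 'a
        obtain k where k: "norm x < real k" using reals_Archimedean2 by blast
        have "g m x = f x" if "m \<ge> k" for m
        proof -
          have "k \<le> r m" using that by (simp add: r_def trans_le_add1)
          then have "real k \<le> real (r m)" by simp
          then show ?thesis using k by (simp add: g_def t_def)
        qed
        then show "(\<lambda>k. g k x) \<longlonglongrightarrow> f x"
          by (intro tendsto_eventually eventually_sequentiallyI[of k]) auto
      qed
      show "AE x in lborel. norm (g k x * fourier \<phi> x) \<le> norm (f x * fourier \<phi> x)" for k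
        by (auto simp: g_def t_def indicator_def)
    qed measurable
    have "(LINT x|lborel. f x * fourier \<phi> x) = (LINT \<xi>|lborel. F \<xi> * \<phi> \<xi>)"
      using l2 l1[unfolded fourier_multiplication[OF ig ip]] by (rule LIMSEQ_unique)
    then show ?thesis using pf by (simp add: regular_distribution_def)
  qed
  then have "has_fourier (regular_distribution f) F"
    by (simp add: has_fourier_def square_integrable_tempered[OF F2])
  with F2 show ?thesis by blast
qed

section \<open>Sobolev weights and Riesz potentials\<close>

lemma nn_integral_powr_0_1:
  assumes "p > -1"
  shows "(\<integral>\<^sup>+r. ennreal (indicator {0..1} r * r powr p) \<partial>lborel) < \<infinity>"
proof -
  have "((\<lambda>r. r powr p) has_integral (1 powr (p + 1) / (p + 1))) {0..1}"
    using has_integral_powr_from_0[OF assms, of 1] by simp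
  then have "(\<integral>\<^sup>+r. ennreal (indicator {0..1} r * r powr p) \<partial>lborel) = ennreal (1 powr (p + 1) / (p + 1))"
    by (intro nn_integral_has_integral_lebesgue) auto
  then show ?thesis by simp
qed

lemma nn_integral_powr_1_inf:
  assumes "p < -1" "a > 0"
  shows "(\<integral>\<^sup>+r. ennreal (indicator {a..} r * r powr p) \<partial>lborel) = ennreal (a powr (p + 1) / (- (p + 1)))"
proof -
  have "((\<lambda>r. r powr p) has_integral (- (a powr (p + 1)) / (p + 1))) {a..}"
    by (rule has_integral_powr_to_inf[OF assms])
  then have "(\<integral>\<^sup>+r. ennreal (indicator {a..} r * r powr p) \<partial>lborel) = ennreal (- (a powr (p + 1)) / (p + 1))"
    by (intro nn_integral_has_integral_lebesgue) auto
  also have "- (a powr (p + 1)) / (p + 1) = a powr (p + 1) / (- (p + 1))"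
    by (simp only: divide_minus_right minus_divide_left)
  finally show ?thesis .
qed

text \<open>The condition a < d/2 is square integrability of |x|^(-a) at the origin; the power k
  takes care of infinity. Negative a occurs too, for v1 in the space of order s - 1 and for an extra
  factor |\<xi>|.\<close>

lemma sobolev_weight_finite:
  fixes a :: real
  assumes a: "a < real DIM('a::euclidean_space) / 2"
  shows "\<exists>k. (\<integral>\<^sup>+x. (ennreal (norm x powr (- a) / (1 + norm x) ^ k))\<^sup>2 \<partial>(lborel :: 'a measure)) < \<infinity>"
proof -
  define D where "D = DIM('a)"
  have D: "D \<ge> 1" by (simp add: D_def Suc_le_eq)
  obtain k :: nat where k: "real D + 2 * \<bar>a\<bar> + 2 < real k" using reals_Archimedean2 by blast
  define p where "p = real D - 1 - 2 * a"
  have p: "p > -1" using a by (simp add: p_def D_def)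
  have "(\<integral>\<^sup>+x. (ennreal (norm x powr (- a) / (1 + norm x) ^ k))\<^sup>2 \<partial>(lborel :: 'a measure)) =
    (\<integral>\<^sup>+x. (ennreal (norm x powr (- a) / (1 + \<bar>norm x\<bar>) ^ k))\<^sup>2 \<partial>(lborel :: 'a measure))"
    by simp
  also have "\<dots> = emeasure (sphere_measure :: 'a measure) UNIV *
     (\<integral>\<^sup>+r. ennreal (indicator {0<..} r * r ^ (D - 1)) * (ennreal (r powr (- a) / (1 + \<bar>r\<bar>) ^ k))\<^sup>2 \<partial>lborel)"
    unfolding D_def by (rule nn_integral_radial_function) measurable
  also have "(\<integral>\<^sup>+r. ennreal (indicator {0<..} r * r ^ (D - 1)) * (ennreal (r powr (- a) / (1 + \<bar>r\<bar>) ^ k))\<^sup>2 \<partial>lborel)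
     \<le> (\<integral>\<^sup>+r. ennreal (indicator {0..1} r * r powr p) + ennreal (indicator {1..} r * r powr (-2)) \<partial>lborel)"
  proof (rule nn_integral_mono)
    fix r :: real
    show "ennreal (indicator {0<..} r * r ^ (D - 1)) * (ennreal (r powr (- a) / (1 + \<bar>r\<bar>) ^ k))\<^sup>2
      \<le> ennreal (indicator {0..1} r * r powr p) + ennreal (indicator {1..} r * r powr (-2))"
    proof (cases "r > 0")
      case True
      have e: "r ^ (D - 1) * (r powr (- a))\<^sup>2 = r powr p"
        using True D by (simp add: powr_realpow[symmetric] powr_powr powr_add[symmetric] p_def of_nat_diff algebra_simps)
      have "ennreal (indicator {0<..} r * r ^ (D - 1)) * (ennreal (r powr (- a) / (1 + \<bar>r\<bar>) ^ k))\<^sup>2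
        = ennreal (r ^ (D - 1) * (r powr (- a))\<^sup>2 / ((1 + r) ^ k)\<^sup>2)"
        using True by (simp add: ennreal_power ennreal_mult[symmetric] power_divide)
      also have "\<dots> = ennreal (r powr p / ((1 + r) ^ k)\<^sup>2)" unfolding e ..
      also have "\<dots> \<le> ennreal (indicator {0..1} r * r powr p + indicator {1..} r * r powr (-2))"
      proof (rule ennreal_leI, cases "r \<le> 1")
        case r1: True
        have "1 \<le> ((1 + r) ^ k)\<^sup>2" using True by (intro one_le_power) auto
        then have "r powr p / ((1 + r) ^ k)\<^sup>2 \<le> r powr p / 1" using True by (intro divide_left_mono) auto
        also have "\<dots> \<le> indicator {0..1} r * r powr p + indicator {1..} r * r powr (-2)"
          using True r1 by (auto simp: indicator_def)
        finally show "r powr p / ((1 + r) ^ k)\<^sup>2 \<le> indicator {0..1} r * r powr p + indicator {1..} r * r powr (-2)" .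
      next
        case False
        have "r powr (real (2 * k)) \<le> ((1 + r) ^ k)\<^sup>2"
        proof -
          have "r powr (real (2 * k)) = r ^ (k * 2)" using True by (simp only: powr_realpow mult.commute)
          also have "\<dots> \<le> (1 + r) ^ (k * 2)" using True by (intro power_mono) auto
          finally show ?thesis by (simp only: power_mult)
        qed
        then have "r powr p / ((1 + r) ^ k)\<^sup>2 \<le> r powr p / r powr (real (2 * k))"
          using True by (intro divide_left_mono) auto
        also have "\<dots> = r powr (p - real (2 * k))" by (simp add: powr_diff)
        also have "\<dots> \<le> r powr (-2)" using False k by (intro powr_mono) (auto simp: p_def)
        finally show "r powr p / ((1 + r) ^ k)\<^sup>2 \<le> indicator {0..1} r * r powr p + indicator {1..} r * r powr (-2)"
          using False by (auto simp: indicator_def)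
      qed
      finally show ?thesis by (simp add: ennreal_plus)
    qed (simp add: indicator_def)
  qed
  also have "\<dots> = (\<integral>\<^sup>+r. ennreal (indicator {0..1} r * r powr p) \<partial>lborel) + (\<integral>\<^sup>+r. ennreal (indicator {1..} r * r powr (-2)) \<partial>lborel)"
    by (rule nn_integral_add) auto
  also have "emeasure (sphere_measure :: 'a measure) UNIV * \<dots> < \<infinity>"
  proof -
    have "emeasure (sphere_measure :: 'a measure) UNIV < \<top>"
      using sphere.emeasure_finite[of "UNIV :: 'a set"] by (simp add: less_top[symmetric])
    moreover have "(\<integral>\<^sup>+r. ennreal (indicator {0..1} r * r powr p) \<partial>lborel) + (\<integral>\<^sup>+r. ennreal (indicator {1..} r * r powr (-2)) \<partial>lborel) < \<top>"
      using nn_integral_powr_0_1[OF p] nn_integral_powr_1_inf[of "-2" 1] by simp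
    ultimately show ?thesis unfolding infinity_ennreal_def ennreal_mult_less_top by blast
  qed
  finally show ?thesis by (auto simp: mult_left_mono)
qed

lemma sobolev_integrable:
  fixes h :: "'a::euclidean_space \<Rightarrow> complex"
  assumes h: "h \<in> square_integrable" and a: "a < real DIM('a) / 2"
  shows "\<exists>k. integrable lborel (\<lambda>x. norm x powr (- a) * norm (h x) / (1 + norm x) ^ k)"
proof -
  note [measurable] = square_integrableD(1)[OF h]
  obtain k where k: "(\<integral>\<^sup>+x. (ennreal (norm x powr (- a) / (1 + norm x) ^ k))\<^sup>2 \<partial>(lborel :: 'a measure)) < \<infinity>"
    using sobolev_weight_finite[OF a] by blast
  have e: "cmod (complex_of_real (norm x powr (- a) / (1 + norm x) ^ k)) = norm x powr (- a) / (1 + norm x) ^ k" for x :: 'a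
    unfolding norm_of_real by (intro abs_of_nonneg divide_nonneg_nonneg) auto
  have w: "(\<lambda>x. complex_of_real (norm x powr (- a) / (1 + norm x) ^ k)) \<in> (square_integrable :: ('a \<Rightarrow> complex) set)"
    using k by (intro square_integrableI) (auto simp only: e, measurable)
  have "integrable lborel (\<lambda>x. norm (complex_of_real (norm x powr (- a) / (1 + norm x) ^ k) * h x))"
    by (intro integrable_norm square_integrable_mult w h)
  then have "integrable lborel (\<lambda>x. norm x powr (- a) / (1 + norm x) ^ k * norm (h x))"
    unfolding norm_mult e .
  then show ?thesis by (intro exI[of _ k]) simp
qed

text \<open>\<open>sobolev_integrable\<close> supplies a power k that is not explicit, which is why
  decay of g is assumed for every power.\<close>

lemma sobolev_integrable_mult:
  fixes h g :: "'a::euclidean_space \<Rightarrow> complex"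
  assumes h: "h \<in> square_integrable" and a: "a < real DIM('a) / 2"
    and [measurable]: "g \<in> borel_measurable borel" and g: "\<And>k. \<exists>B. \<forall>x. (1 + norm x) ^ k * norm (g x) \<le> B"
  shows "integrable lborel (\<lambda>x. of_real (norm x powr (- a)) * h x * g x)"
proof -
  note [measurable] = square_integrableD(1)[OF h]
  obtain k where k: "integrable lborel (\<lambda>x. norm x powr (- a) * norm (h x) / (1 + norm x) ^ k)"
    using sobolev_integrable[OF h a] by blast
  obtain B where B: "\<And>x. (1 + norm x) ^ k * norm (g x) \<le> B" using g by blast
  show ?thesis
  proof (rule Bochner_Integration.integrable_bound[OF integrable_mult_right[OF k, of B]])
    show "AE x in lborel. norm (of_real (norm x powr (- a)) * h x * g x) \<le> norm (B * (norm x powr (- a) * norm (h x) / (1 + norm x) ^ k))"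
    proof (rule AE_I2)
      fix x :: 'a
      have pos: "0 < (1 + norm x) ^ k" by (intro zero_less_power) (simp add: add_pos_nonneg)
      have "0 \<le> B" using B[of x] pos by (meson mult_nonneg_nonneg norm_ge_zero order_trans less_imp_le)
      have "norm (g x) \<le> B / (1 + norm x) ^ k" using B[of x] pos by (simp add: pos_le_divide_eq mult.commute)
      then have "norm x powr (- a) * norm (h x) * norm (g x) \<le> norm x powr (- a) * norm (h x) * (B / (1 + norm x) ^ k)"
        by (intro mult_left_mono) auto
      then show "norm (of_real (norm x powr (- a)) * h x * g x) \<le> norm (B * (norm x powr (- a) * norm (h x) / (1 + norm x) ^ k))"
        using \<open>0 \<le> B\<close> pos by (simp add: norm_mult abs_mult mult_ac)
    qed
  qed measurable
qed

lemma sobolev_tempered: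
  fixes h :: "'a::euclidean_space \<Rightarrow> complex"
  assumes h: "h \<in> square_integrable" and a: "a < real DIM('a) / 2"
  shows "tempered_function (\<lambda>x. of_real (norm x powr (- a)) * h x)"
  unfolding tempered_function_def
proof (intro conjI ballI)
  note [measurable] = square_integrableD(1)[OF h]
  show "(\<lambda>x. of_real (norm x powr (- a)) * h x) \<in> borel_measurable lborel" by measurable
  show "integrable lborel (\<lambda>x. of_real (norm x powr (- a)) * h x * \<phi> x)" if "\<phi> \<in> schwartz" for \<phi>
    using schwartz_decay[OF that] by (intro sobolev_integrable_mult h a schwartz_measurable that) blast
qed

section \<open>The wave data on the Fourier side\<close>

lemma has_fourier_fourier_function:
  assumes "has_fourier T F"
  shows "has_fourier T (fourier_function T)"
  unfolding fourier_function_def by (rule someI[of "has_fourier T"], rule assms)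

lemma has_fourier_measurable: "has_fourier T F \<Longrightarrow> F \<in> borel_measurable borel"
  by (simp add: has_fourier_def tempered_function_def)

text \<open>\<open>riesz_potential\<close> is defined through the chosen
  \<open>fourier_function T\<close>, which agrees with F almost everywhere, and through the inverse
  transform of the test function, which undoes the transform in \<open>has_fourier\<close>.\<close>

lemma has_fourier_riesz_potential:
  fixes F :: "'a::euclidean_space \<Rightarrow> complex"
  assumes F: "has_fourier T F" and t: "tempered_function (\<lambda>\<xi>. of_real (norm \<xi> powr (- s)) * F \<xi>)"
  shows "has_fourier (riesz_potential s T) (\<lambda>\<xi>. of_real (norm \<xi> powr (- s)) * F \<xi>)"
  unfolding has_fourier_def
proof (intro conjI t ballI)
  fix \<phi> :: "'a \<Rightarrow> complex" assume \<phi>: "\<phi> \<in> schwartz"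
  note [measurable] = has_fourier_measurable[OF F] has_fourier_measurable[OF has_fourier_fourier_function[OF F]] schwartz_measurable[OF \<phi>]
  have "riesz_potential s T (fourier \<phi>) = (LINT \<xi>|lborel. of_real (norm \<xi> powr (- s)) * fourier_function T \<xi> * \<phi> \<xi>)"
    using schwartz_fourier[OF \<phi>] by (simp add: riesz_potential_def fourier_inversion[OF \<phi>])
  also have "\<dots> = (LINT \<xi>|lborel. of_real (norm \<xi> powr (- s)) * F \<xi> * \<phi> \<xi>)"
    by (rule integral_cong_AE) (use fourier_function_unique[OF F] in \<open>auto\<close>)
  finally show "riesz_potential s T (fourier \<phi>) = (LINT \<xi>|lborel. of_real (norm \<xi> powr (- s)) * F \<xi> * \<phi> \<xi>)" .
qed

lemma has_fourier_half_combination: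
  fixes F G :: "'a::euclidean_space \<Rightarrow> complex"
  assumes F: "has_fourier S F" and G: "has_fourier T G"
    and T': "\<And>\<phi>. \<phi> \<in> schwartz \<Longrightarrow> T' \<phi> = (S \<phi> + c * T \<phi>) / 2"
  shows "has_fourier T' (\<lambda>\<xi>. (F \<xi> + c * G \<xi>) / 2)"
  unfolding has_fourier_def tempered_function_def
proof (intro conjI ballI)
  note [measurable] = has_fourier_measurable[OF F] has_fourier_measurable[OF G]
  show "(\<lambda>\<xi>. (F \<xi> + c * G \<xi>) / 2) \<in> borel_measurable lborel" by measurable
  fix \<phi> :: "'a \<Rightarrow> complex" assume \<phi>: "\<phi> \<in> schwartz"
  have i: "integrable lborel (\<lambda>\<xi>. F \<xi> * \<phi> \<xi>)" "integrable lborel (\<lambda>\<xi>. G \<xi> * \<phi> \<xi>)"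
    using F G \<phi> by (auto simp: has_fourier_def tempered_function_def)
  have e: "(\<lambda>\<xi>. (F \<xi> + c * G \<xi>) / 2 * \<phi> \<xi>) = (\<lambda>\<xi>. (1 / 2) * (F \<xi> * \<phi> \<xi>) + (c / 2) * (G \<xi> * \<phi> \<xi>))"
    by (simp add: fun_eq_iff field_simps)
  show "integrable lborel (\<lambda>\<xi>. (F \<xi> + c * G \<xi>) / 2 * \<phi> \<xi>)"
    unfolding e by (intro Bochner_Integration.integrable_add integrable_mult_right i)
  have "(LINT \<xi>|lborel. (F \<xi> + c * G \<xi>) / 2 * \<phi> \<xi>) = (1 / 2) * (LINT \<xi>|lborel. F \<xi> * \<phi> \<xi>) + (c / 2) * (LINT \<xi>|lborel. G \<xi> * \<phi> \<xi>)"
    unfolding e integral_mult_right_zero[symmetric]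
    by (rule Bochner_Integration.integral_add) (intro integrable_mult_right i)+
  also have "\<dots> = T' (fourier \<phi>)"
    using F G \<phi> schwartz_fourier[OF \<phi>] by (simp add: T' has_fourier_def field_simps)
  finally show "T' (fourier \<phi>) = (LINT \<xi>|lborel. (F \<xi> + c * G \<xi>) / 2 * \<phi> \<xi>)" ..
qed

lemma homogeneous_sobolev_fourier:
  fixes v :: "'a::euclidean_space distribution"
  assumes v: "v = riesz_potential a (regular_distribution f)" and f: "f \<in> square_integrable"
    and F: "has_fourier (regular_distribution f) F" "F \<in> square_integrable"
    and a: "a < real DIM('a) / 2"
  shows "has_fourier v (\<lambda>\<xi>. of_real (norm \<xi> powr (- a)) * F \<xi>)"
  unfolding v by (rule has_fourier_riesz_potential[OF F(1) sobolev_tempered[OF F(2) a]])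

lemma square_integrable_half_combination:
  fixes F G :: "'a::euclidean_space \<Rightarrow> complex"
  assumes F: "F \<in> square_integrable" and G: "G \<in> square_integrable" and c: "cmod c = 1"
  shows "(\<lambda>\<xi>. (F \<xi> + c * G \<xi>) / 2) \<in> square_integrable"
proof -
  note [measurable] = square_integrableD(1)[OF F] square_integrableD(1)[OF G]
  have "integrable lborel (\<lambda>\<xi>. (cmod ((F \<xi> + c * G \<xi>) / 2))\<^sup>2)"
  proof (rule Bochner_Integration.integrable_bound[OF Bochner_Integration.integrable_add[OF square_integrableD(2)[OF F] square_integrableD(2)[OF G]]])
    show "AE \<xi> in lborel. norm ((cmod ((F \<xi> + c * G \<xi>) / 2))\<^sup>2) \<le> norm ((cmod (F \<xi>))\<^sup>2 + (cmod (G \<xi>))\<^sup>2)"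
    proof (rule AE_I2)
      fix \<xi>
      have "cmod (F \<xi> + c * G \<xi>) \<le> cmod (F \<xi>) + cmod (G \<xi>)"
        using norm_triangle_ineq[of "F \<xi>" "c * G \<xi>"] c by (simp add: norm_mult)
      then have "(cmod (F \<xi> + c * G \<xi>))\<^sup>2 \<le> (cmod (F \<xi>) + cmod (G \<xi>))\<^sup>2" by (intro power_mono) auto
      also have "\<dots> \<le> 2 * ((cmod (F \<xi>))\<^sup>2 + (cmod (G \<xi>))\<^sup>2)"
        using sum_squares_bound[of "cmod (F \<xi>)" "cmod (G \<xi>)"] by (simp add: power2_sum)
      finally have "(cmod (F \<xi> + c * G \<xi>))\<^sup>2 \<le> 2 * ((cmod (F \<xi>))\<^sup>2 + (cmod (G \<xi>))\<^sup>2)" .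
      moreover have "x / 4 \<le> y" if "x \<le> 2 * y" "0 \<le> y" for x y :: real using that by simp
      ultimately have "(cmod (F \<xi> + c * G \<xi>))\<^sup>2 / 4 \<le> (cmod (F \<xi>))\<^sup>2 + (cmod (G \<xi>))\<^sup>2"
        by (metis add_nonneg_nonneg zero_le_power2)
      then show "norm ((cmod ((F \<xi> + c * G \<xi>) / 2))\<^sup>2) \<le> norm ((cmod (F \<xi>))\<^sup>2 + (cmod (G \<xi>))\<^sup>2)"
        by (simp add: norm_divide power_divide)
    qed
  qed measurable
  then show ?thesis by (simp add: square_integrable_def)
qed

text \<open>Applying \<open>riesz_potential 1\<close> to v1 multiplies |\<xi>|^(1-s) by
  |\<xi>|^(-1), so both halves of the data carry the weight |\<xi>|^(-s), with profiles (F - iG)/2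
  and (F + iG)/2. Their sum is F: at time 0 the contributions of v1 cancel.\<close>

theorem wave_data_fourier:
  fixes v0 v1 :: "'a::euclidean_space distribution"
  assumes s: "s < real DIM('a) / 2"
    and v0: "v0 = riesz_potential s (regular_distribution f)" "f \<in> square_integrable"
    and F: "has_fourier (regular_distribution f) F" "F \<in> square_integrable"
    and v1: "v1 \<in> homogeneous_sobolev (s - 1)"
  shows "\<exists>P\<in>square_integrable. \<exists>Q\<in>square_integrable.
     has_fourier (f_plus v0 v1) (\<lambda>\<xi>. of_real (norm \<xi> powr (- s)) * P \<xi>) \<and>
     has_fourier (f_minus v0 v1) (\<lambda>\<xi>. of_real (norm \<xi> powr (- s)) * Q \<xi>) \<and>
     (\<forall>\<xi>. P \<xi> + Q \<xi> = F \<xi>)"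
proof -
  obtain g where g: "g \<in> square_integrable" "v1 = riesz_potential (s - 1) (regular_distribution g)"
    using v1 unfolding homogeneous_sobolev_def by blast
  obtain G where G: "G \<in> square_integrable" "has_fourier (regular_distribution g) G"
    using plancherel[OF g(1)] by blast
  note [measurable] = square_integrableD(1)[OF G(1)] square_integrableD(1)[OF F(2)]
  have h0: "has_fourier v0 (\<lambda>\<xi>. of_real (norm \<xi> powr (- s)) * F \<xi>)"
    by (rule homogeneous_sobolev_fourier[OF v0 F s])
  have h1: "has_fourier v1 (\<lambda>\<xi>. of_real (norm \<xi> powr (- (s - 1))) * G \<xi>)"
    using s by (intro homogeneous_sobolev_fourier[OF g(2,1) G(2,1)]) simp
  have e: "of_real (norm \<xi> powr (- 1)) * (of_real (norm \<xi> powr (- (s - 1))) * G \<xi>) = of_real (norm \<xi> powr (- s)) * G \<xi>" for \<xi>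
  proof -
    have "norm \<xi> powr (- 1) * norm \<xi> powr (- (s - 1)) = norm \<xi> powr (- s)"
      by (simp only: powr_add[symmetric]) simp
    then show ?thesis by (simp only: mult.assoc[symmetric] of_real_mult[symmetric])
  qed
  have h2: "has_fourier (riesz_potential 1 v1) (\<lambda>\<xi>. of_real (norm \<xi> powr (- s)) * G \<xi>)"
    using has_fourier_riesz_potential[OF h1, of 1] sobolev_tempered[OF G(1) s] unfolding e by blast
  define P where "P \<xi> = (F \<xi> + (- \<i>) * G \<xi>) / 2" for \<xi>
  define Q where "Q \<xi> = (F \<xi> + \<i> * G \<xi>) / 2" for \<xi>
  have e2: "(of_real (norm \<xi> powr (- s)) * F \<xi> + c * (of_real (norm \<xi> powr (- s)) * G \<xi>)) / 2 = of_real (norm \<xi> powr (- s)) * ((F \<xi> + c * G \<xi>) / 2)" for \<xi> c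
    by (simp add: algebra_simps)
  show ?thesis
  proof (rule bexI[of _ P], rule bexI[of _ Q], intro conjI allI)
    show "P \<in> square_integrable" "Q \<in> square_integrable"
      unfolding P_def Q_def by (intro square_integrable_half_combination F G; simp)+
    show "P \<xi> + Q \<xi> = F \<xi>" for \<xi> by (simp add: P_def Q_def field_simps)
    show "has_fourier (f_plus v0 v1) (\<lambda>\<xi>. of_real (norm \<xi> powr (- s)) * P \<xi>)"
      unfolding P_def e2[symmetric]
      by (rule has_fourier_half_combination[OF h0 h2]) (simp add: f_plus_def)
    show "has_fourier (f_minus v0 v1) (\<lambda>\<xi>. of_real (norm \<xi> powr (- s)) * Q \<xi>)"
      unfolding Q_def e2[symmetric]
      by (rule has_fourier_half_combination[OF h0 h2]) (simp add: f_minus_def)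
  qed
qed

text \<open>The Riesz kernel is a superposition of Gaussians: \<open>|\<xi>|\<^sup>-\<^sup>s\<close> is the integral of
  \<open>exp (- \<tau> |\<xi>|\<^sup>2)\<close> against the following measure.\<close>

definition gamma_measure :: "real \<Rightarrow> real measure" where
  "gamma_measure s = density lborel (\<lambda>\<tau>. ennreal (indicator {0<..} \<tau> * \<tau> powr (s / 2 - 1) / Gamma (s / 2)))"

lemma sets_gamma_measure [simp, measurable_cong]: "sets (gamma_measure s) = sets borel"
  by (simp add: gamma_measure_def)

lemma space_gamma_measure [simp]: "space (gamma_measure s) = UNIV"
  by (simp add: gamma_measure_def)

lemma sigma_finite_gamma_measure: "sigma_finite_measure (gamma_measure s)"
  unfolding gamma_measure_def
  by (subst sigma_finite_measure.sigma_finite_iff_density_finite[OF sigma_finite_lborel]) auto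

interpretation gamma_pair: pair_sigma_finite "gamma_measure s" "lborel :: 'a::euclidean_space measure"
  by (simp add: pair_sigma_finite_def sigma_finite_gamma_measure sigma_finite_lborel)

lemma AE_gamma_measure_pos: "AE \<tau> in gamma_measure s. \<tau> > 0"
  unfolding gamma_measure_def by (subst AE_density) (auto simp: indicator_def)

lemma nn_integral_gamma_measure:
  assumes [measurable]: "f \<in> borel_measurable borel"
  shows "(\<integral>\<^sup>+\<tau>. f \<tau> \<partial>gamma_measure s) =
    (\<integral>\<^sup>+\<tau>. ennreal (indicator {0<..} \<tau> * \<tau> powr (s / 2 - 1) / Gamma (s / 2)) * f \<tau> \<partial>lborel)"
  unfolding gamma_measure_def by (subst nn_integral_density) auto

text \<open>Euler's integral for \<open>Gamma (s / 2)\<close> after the substitution t = a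
  \<tau>.\<close>

lemma gamma_measure_exp:
  assumes s: "s > 0" and a: "a > 0"
  shows "(\<integral>\<^sup>+\<tau>. ennreal (exp (- \<tau> * a)) \<partial>gamma_measure s) = ennreal (a powr (- s / 2))"
proof -
  define p where "p = s / 2"
  have p: "p > 0" "Gamma p > 0" using s by (auto simp: p_def Gamma_real_pos)
  have Gnz: "Gamma p \<noteq> 0" by (rule less_imp_neq[OF p(2), symmetric])
  have "ennreal (Gamma p) = (\<integral>\<^sup>+t. ennreal (indicator {0..} t * t powr (p - 1) / exp t) \<partial>lborel)"
    by (rule Gamma_conv_nn_integral_real[OF p(1)])
  also have "\<dots> = ennreal \<bar>a\<bar> * (\<integral>\<^sup>+\<tau>. ennreal (indicator {0..} (0 + a * \<tau>) * (0 + a * \<tau>) powr (p - 1) / exp (0 + a * \<tau>)) \<partial>lborel)"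
    using a by (intro nn_integral_real_affine) auto
  also have "\<dots> = (\<integral>\<^sup>+\<tau>. ennreal (a powr p * Gamma p) * (ennreal (indicator {0<..} \<tau> * \<tau> powr (p - 1) / Gamma p) * ennreal (exp (- \<tau> * a))) \<partial>lborel)"
  proof (subst nn_integral_cmult[symmetric], measurable, rule nn_integral_cong)
    fix \<tau> :: real
    show "ennreal \<bar>a\<bar> * ennreal (indicator {0..} (0 + a * \<tau>) * (0 + a * \<tau>) powr (p - 1) / exp (0 + a * \<tau>)) =
      ennreal (a powr p * Gamma p) * (ennreal (indicator {0<..} \<tau> * \<tau> powr (p - 1) / Gamma p) * ennreal (exp (- \<tau> * a)))"
    proof (cases "\<tau> > 0")
      case True
      have "a * a powr (p - 1) = a powr p" using a by (simp add: powr_diff)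
      then have "\<bar>a\<bar> * (indicator {0..} (0 + a * \<tau>) * (0 + a * \<tau>) powr (p - 1) / exp (0 + a * \<tau>)) =
        a powr p * g * ((indicator {0<..} \<tau> * \<tau> powr (p - 1) / g) * exp (- \<tau> * a))" if "g \<noteq> 0" for g
        using True a that by (simp add: powr_mult exp_minus field_simps)
      from this[OF Gnz] have "\<bar>a\<bar> * (indicator {0..} (0 + a * \<tau>) * (0 + a * \<tau>) powr (p - 1) / exp (0 + a * \<tau>)) =
        a powr p * Gamma p * ((indicator {0<..} \<tau> * \<tau> powr (p - 1) / Gamma p) * exp (- \<tau> * a))" .
      note eq = this
      have E: "ennreal x * ennreal y = ennreal c * (ennreal u * ennreal v)"
        if "x * y = c * (u * v)" "0 \<le> x" "0 \<le> y" "0 \<le> c" "0 \<le> u" "0 \<le> v" for x y c u v :: real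
        using that by (simp add: ennreal_mult[symmetric])
      show ?thesis
      proof (rule E[OF eq])
        show "0 \<le> a powr p * Gamma p"
          by (intro mult_nonneg_nonneg less_imp_le[OF p(2)] powr_ge_zero)
        show "0 \<le> indicator {0<..} \<tau> * \<tau> powr (p - 1) / Gamma p"
          by (intro divide_nonneg_nonneg mult_nonneg_nonneg less_imp_le[OF p(2)] powr_ge_zero) simp
      qed (simp_all add: indicator_def)
    next
      case False
      then show ?thesis using a by (cases "\<tau> = 0") (auto simp: indicator_def zero_le_mult_iff)
    qed
  qed
  also have "\<dots> = ennreal (a powr p * Gamma p) * (\<integral>\<^sup>+\<tau>. ennreal (exp (- \<tau> * a)) \<partial>gamma_measure s)"
    by (subst nn_integral_cmult, measurable, subst nn_integral_gamma_measure) (auto simp: p_def)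
  finally have e: "ennreal (Gamma p) = ennreal (a powr p * Gamma p) * (\<integral>\<^sup>+\<tau>. ennreal (exp (- \<tau> * a)) \<partial>gamma_measure s)" .
  have "ennreal (a powr (- p)) = ennreal (a powr (- p) / Gamma p) * ennreal (Gamma p)"
  proof -
    have "ennreal x = ennreal (x / g) * ennreal g" if "g > 0" "x \<ge> 0" for x g :: real
      using that by (simp add: ennreal_mult[symmetric])
    from this[OF p(2)] show ?thesis by simp
  qed
  also have "\<dots> = (ennreal (a powr (- p) / Gamma p) * ennreal (a powr p * Gamma p)) * (\<integral>\<^sup>+\<tau>. ennreal (exp (- \<tau> * a)) \<partial>gamma_measure s)"
    unfolding e by (simp add: mult.assoc)
  also have "ennreal (a powr (- p) / Gamma p) * ennreal (a powr p * Gamma p) = 1"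
  proof -
    have "ennreal (x / g) * ennreal (y * g) = 1" if "g > 0" "x * y = 1" "x \<ge> 0" "y \<ge> 0" for x y g :: real
      using that by (simp add: ennreal_mult[symmetric])
    from this[OF p(2), of "a powr (- p)" "a powr p"] a show ?thesis by (simp add: powr_minus)
  qed
  finally show ?thesis by (simp add: p_def)
qed

lemma gamma_measure_exp_norm:
  assumes s: "s > 0" and x: "\<xi> \<noteq> (0::'a::euclidean_space)"
  shows "(\<integral>\<^sup>+\<tau>. ennreal (exp (- \<tau> * (norm \<xi>)\<^sup>2)) \<partial>gamma_measure s) = ennreal (norm \<xi> powr (- s))"
proof -
  have "(norm \<xi>)\<^sup>2 powr (- s / 2) = norm \<xi> powr (- s)"
  proof -
    have "(norm \<xi>)\<^sup>2 = norm \<xi> powr 2" using x by simp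
    then show ?thesis by (simp only: powr_powr) simp
  qed
  then show ?thesis using gamma_measure_exp[OF s, of "(norm \<xi>)\<^sup>2"] x by simp
qed

text \<open>For 0 < s < d and x \<noteq> 0 a multiple of |x|^(s-d). It is kept as an integral over
  Gaussians because each Gaussian passes to the Fourier side exactly.\<close>

definition gauss_riesz_kernel :: "real \<Rightarrow> 'a::euclidean_space \<Rightarrow> complex" where
  "gauss_riesz_kernel s x = (LINT \<tau>|gamma_measure s. of_real (gauss_kernel \<tau> x))"

lemma gauss_riesz_kernel_measurable [measurable]: "gauss_riesz_kernel s \<in> borel_measurable borel"
proof -
  interpret sigma_finite_measure "gamma_measure s" by (rule sigma_finite_gamma_measure)
  show ?thesis unfolding gauss_riesz_kernel_def[abs_def] by measurable
qed

text \<open>At large \<tau> the density \<tau>^(s/2-1) is beaten by \<tau>^(-q) with q > s/2. The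
  integral over (0,1] stays a hypothesis since its finiteness has different reasons in different
  uses: boundedness of a test function, or the choice of the point x.\<close>

lemma gamma_measure_split_finite:
  fixes H :: "real \<Rightarrow> ennreal"
  assumes s: "0 < s" "s / 2 < q" and [measurable]: "H \<in> borel_measurable borel"
    and H1: "(\<integral>\<^sup>+\<tau>. ennreal (indicator {0<..1} \<tau> * \<tau> powr (s / 2 - 1)) * H \<tau> \<partial>lborel) < \<infinity>"
    and H2: "\<And>\<tau>. \<tau> \<ge> 1 \<Longrightarrow> H \<tau> \<le> ennreal (C * \<tau> powr (- q))" and C: "C \<ge> 0"
  shows "(\<integral>\<^sup>+\<tau>. H \<tau> \<partial>gamma_measure s) < \<infinity>"
proof -
  have G: "Gamma (s / 2) > 0" using s by (simp add: Gamma_real_pos)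
  have "(\<integral>\<^sup>+\<tau>. H \<tau> \<partial>gamma_measure s) = (\<integral>\<^sup>+\<tau>. ennreal (indicator {0<..} \<tau> * \<tau> powr (s / 2 - 1) / Gamma (s / 2)) * H \<tau> \<partial>lborel)"
    by (rule nn_integral_gamma_measure) measurable
  also have "\<dots> \<le> (\<integral>\<^sup>+\<tau>. ennreal (1 / Gamma (s / 2)) * (ennreal (indicator {0<..1} \<tau> * \<tau> powr (s / 2 - 1)) * H \<tau> + ennreal C * ennreal (indicator {1..} \<tau> * \<tau> powr (s / 2 - 1 - q))) \<partial>lborel)"
  proof (rule nn_integral_mono)
    fix \<tau> :: real
    have "ennreal (indicator {0<..} \<tau> * \<tau> powr (s / 2 - 1)) * H \<tau> \<le> ennreal (indicator {0<..1} \<tau> * \<tau> powr (s / 2 - 1)) * H \<tau> + ennreal C * ennreal (indicator {1..} \<tau> * \<tau> powr (s / 2 - 1 - q))"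
    proof (cases "\<tau> \<le> 1")
      case True
      then show ?thesis by (auto simp: indicator_def)
    next
      case False
      then have "ennreal (indicator {0<..} \<tau> * \<tau> powr (s / 2 - 1)) * H \<tau> \<le> ennreal (\<tau> powr (s / 2 - 1)) * ennreal (C * \<tau> powr (- q))"
        using H2[of \<tau>] by (intro mult_mono) auto
      also have "\<dots> = ennreal C * ennreal (\<tau> powr (s / 2 - 1) * \<tau> powr (- q))"
        using C by (simp add: ennreal_mult[symmetric] mult.left_commute)
      also have "\<tau> powr (s / 2 - 1) * \<tau> powr (- q) = indicator {1..} \<tau> * \<tau> powr (s / 2 - 1 - q)"
        using False by (simp add: powr_add[symmetric])
      finally show ?thesis by (simp add: add_increasing)
    qed
    then have "ennreal (1 / Gamma (s / 2)) * (ennreal (indicator {0<..} \<tau> * \<tau> powr (s / 2 - 1)) * H \<tau>) \<le>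
      ennreal (1 / Gamma (s / 2)) * (ennreal (indicator {0<..1} \<tau> * \<tau> powr (s / 2 - 1)) * H \<tau> + ennreal C * ennreal (indicator {1..} \<tau> * \<tau> powr (s / 2 - 1 - q)))"
      by (rule mult_left_mono) simp
    moreover have "ennreal (1 / Gamma (s / 2)) * ennreal (indicator {0<..} \<tau> * \<tau> powr (s / 2 - 1)) = ennreal (indicator {0<..} \<tau> * \<tau> powr (s / 2 - 1) / Gamma (s / 2))"
      using G by (subst ennreal_mult[symmetric]) auto
    ultimately show "ennreal (indicator {0<..} \<tau> * \<tau> powr (s / 2 - 1) / Gamma (s / 2)) * H \<tau> \<le>
      ennreal (1 / Gamma (s / 2)) * (ennreal (indicator {0<..1} \<tau> * \<tau> powr (s / 2 - 1)) * H \<tau> + ennreal C * ennreal (indicator {1..} \<tau> * \<tau> powr (s / 2 - 1 - q)))"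
      by (simp add: mult.assoc[symmetric])
  qed
  also have "\<dots> = ennreal (1 / Gamma (s / 2)) * ((\<integral>\<^sup>+\<tau>. ennreal (indicator {0<..1} \<tau> * \<tau> powr (s / 2 - 1)) * H \<tau> \<partial>lborel) + ennreal C * (\<integral>\<^sup>+\<tau>. ennreal (indicator {1..} \<tau> * \<tau> powr (s / 2 - 1 - q)) \<partial>lborel))"
    by (simp add: nn_integral_cmult nn_integral_add)
  also have "\<dots> < \<infinity>"
  proof -
    have "ennreal C * (\<integral>\<^sup>+\<tau>. ennreal (indicator {1..} \<tau> * \<tau> powr (s / 2 - 1 - q)) \<partial>lborel) < \<top>"
      using s by (subst nn_integral_powr_1_inf) (auto simp: ennreal_mult_less_top)
    then have "(\<integral>\<^sup>+\<tau>. ennreal (indicator {0<..1} \<tau> * \<tau> powr (s / 2 - 1)) * H \<tau> \<partial>lborel) + ennreal C * (\<integral>\<^sup>+\<tau>. ennreal (indicator {1..} \<tau> * \<tau> powr (s / 2 - 1 - q)) \<partial>lborel) < \<top>"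
      using H1 by simp
    then show ?thesis unfolding infinity_ennreal_def by (subst ennreal_mult_less_top) auto
  qed
  finally show ?thesis .
qed

text \<open>Two bounds for the Gaussian average of |g|: for small \<tau> the kernel has fixed mass
  and g is bounded; for large \<tau> the kernel is at most \<tau>^(-d/2) and g is integrable. The
  latter beats \<tau>^(s/2-1) since s < d.\<close>

lemma gauss_kernel_test_integrable:
  fixes g :: "'a::euclidean_space \<Rightarrow> complex"
  assumes s: "0 < s" "s < real DIM('a)" and g: "integrable lborel g" and B: "\<And>x. norm (g x) \<le> B"
  shows "integrable (gamma_measure s \<Otimes>\<^sub>M lborel) (\<lambda>(\<tau>, x). g x * of_real (gauss_kernel \<tau> x))"
proof -
  have [measurable]: "g \<in> borel_measurable borel" using borel_measurable_integrable[OF g] by simp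
  define H where "H \<tau> = (\<integral>\<^sup>+x. ennreal (norm (g x) * gauss_kernel \<tau> x) \<partial>lborel)" for \<tau>
  have [measurable]: "H \<in> borel_measurable borel" unfolding H_def by measurable
  define N where "N = (LINT x|lborel. norm (g x))"
  have N: "N \<ge> 0" by (simp add: N_def)
  have B0: "B \<ge> 0" using B[of 0] norm_ge_zero order_trans by blast
  have Hs: "H \<tau> \<le> ennreal (B * (2 * pi) powr (real DIM('a) / 2))" if "\<tau> > 0" for \<tau>
  proof -
    have "H \<tau> \<le> (\<integral>\<^sup>+x. ennreal B * ennreal (gauss_kernel \<tau> (0 - x)) \<partial>(lborel :: 'a measure))"
      unfolding H_def by (intro nn_integral_mono) (auto simp: gauss_kernel_def ennreal_mult[symmetric] B0 intro!: ennreal_leI mult_right_mono B)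
    also have "\<dots> = ennreal (B * (2 * pi) powr (real DIM('a) / 2))"
      using B0 by (subst nn_integral_cmult, measurable, subst nn_integral_gauss_kernel[OF that]) (simp add: ennreal_mult)
    finally show ?thesis .
  qed
  have Hl: "H \<tau> \<le> ennreal (N * \<tau> powr (- (real DIM('a) / 2)))" if "\<tau> \<ge> 1" for \<tau>
  proof -
    have "H \<tau> \<le> (\<integral>\<^sup>+x. ennreal (\<tau> powr (- (real DIM('a) / 2))) * ennreal (norm (g x)) \<partial>lborel)"
      unfolding H_def
    proof (rule nn_integral_mono)
      fix x :: 'a
      have "gauss_kernel \<tau> x \<le> (2 * \<tau>) powr (- real DIM('a) / 2)" using that by (intro gauss_kernel_le) simp
      also have "\<dots> \<le> \<tau> powr (- real DIM('a) / 2)" using that by (intro powr_mono2') auto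
      finally have "norm (g x) * gauss_kernel \<tau> x \<le> norm (g x) * \<tau> powr (- real DIM('a) / 2)"
        by (rule mult_left_mono) simp
      then have "norm (g x) * gauss_kernel \<tau> x \<le> \<tau> powr (- (real DIM('a) / 2)) * norm (g x)"
        by (simp add: mult.commute)
      then show "ennreal (norm (g x) * gauss_kernel \<tau> x) \<le> ennreal (\<tau> powr (- (real DIM('a) / 2))) * ennreal (norm (g x))"
        by (simp add: ennreal_mult[symmetric] ennreal_leI)
    qed
    also have "\<dots> = ennreal (\<tau> powr (- (real DIM('a) / 2))) * ennreal N"
      using nn_integral_eq_integral[OF integrable_norm[OF g]] by (simp add: nn_integral_cmult N_def)
    finally show ?thesis using N by (simp add: ennreal_mult mult.commute)
  qed
  have "(\<integral>\<^sup>+\<tau>. H \<tau> \<partial>gamma_measure s) < \<infinity>"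
  proof (rule gamma_measure_split_finite[where q = "real DIM('a) / 2" and C = N])
    have "(\<integral>\<^sup>+\<tau>. ennreal (indicator {0<..1} \<tau> * \<tau> powr (s / 2 - 1)) * H \<tau> \<partial>lborel) \<le>
      (\<integral>\<^sup>+\<tau>. ennreal (B * (2 * pi) powr (real DIM('a) / 2)) * ennreal (indicator {0..1} \<tau> * \<tau> powr (s / 2 - 1)) \<partial>lborel)"
    proof (rule nn_integral_mono)
      fix \<tau> :: real
      show "ennreal (indicator {0<..1} \<tau> * \<tau> powr (s / 2 - 1)) * H \<tau> \<le> ennreal (B * (2 * pi) powr (real DIM('a) / 2)) * ennreal (indicator {0..1} \<tau> * \<tau> powr (s / 2 - 1))"
      proof (cases "0 < \<tau> \<and> \<tau> \<le> 1")
        case True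
        then have "ennreal (\<tau> powr (s / 2 - 1)) * H \<tau> \<le> ennreal (\<tau> powr (s / 2 - 1)) * ennreal (B * (2 * pi) powr (real DIM('a) / 2))"
          by (intro mult_left_mono Hs) auto
        also have "\<dots> = ennreal (B * (2 * pi) powr (real DIM('a) / 2)) * ennreal (\<tau> powr (s / 2 - 1))"
          by (rule mult.commute)
        finally show ?thesis using True by (simp add: indicator_def)
      qed (auto simp: indicator_def)
    qed
    also have "\<dots> < \<infinity>"
      using nn_integral_powr_0_1[of "s / 2 - 1"] s by (subst nn_integral_cmult) (auto simp: ennreal_mult_less_top)
    finally show "(\<integral>\<^sup>+\<tau>. ennreal (indicator {0<..1} \<tau> * \<tau> powr (s / 2 - 1)) * H \<tau> \<partial>lborel) < \<infinity>" .
  qed (use s N Hl in auto)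
  then have fin: "(\<integral>\<^sup>+p. ennreal (norm (case p of (\<tau>, x) \<Rightarrow> g x * of_real (gauss_kernel \<tau> x))) \<partial>(gamma_measure s \<Otimes>\<^sub>M lborel)) < \<infinity>"
    by (subst lborel.nn_integral_fst[symmetric]) (auto simp: H_def norm_mult)
  show ?thesis by (rule integrableI_bounded[OF _ fin]) measurable
qed

lemma fourier_gauss_kernel:
  assumes "\<tau> > 0"
  shows "fourier (\<lambda>x. of_real (gauss_kernel \<tau> x)) (\<xi> :: 'a::euclidean_space) = of_real (exp (- \<tau> * (norm \<xi>)\<^sup>2))"
proof -
  have "fourier (gauss_wave \<tau> (0::'a)) = (\<lambda>x. of_real (gauss_kernel \<tau> x))"
    by (auto simp: fourier_gauss_wave[OF assms] gauss_kernel_def fun_eq_iff)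
  then show ?thesis
    using fourier_inversion[OF schwartz_gauss_wave[OF assms, of 0], of "- \<xi>"] by (simp add: inverse_fourier_def gauss_wave_def)
qed

text \<open>\<open>sobolev_integrable_mult\<close> wants a square integrable factor, so the weight
  (1+|x|)^(-d-1) is inserted and compensated in the Schwartz factor.\<close>

lemma riesz_weight_test_integrable:
  fixes \<phi> :: "'a::euclidean_space \<Rightarrow> complex"
  assumes s: "s < real DIM('a) / 2" and \<phi>: "\<phi> \<in> schwartz"
  shows "integrable lborel (\<lambda>\<xi>. of_real (norm \<xi> powr (- s)) * \<phi> \<xi>)"
proof -
  define w where "w x = complex_of_real (1 / (1 + norm (x::'a)) ^ (DIM('a) + 1))" for x
  define n where "n = DIM('a) + 1"
  note [measurable] = schwartz_measurable[OF \<phi>]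
  have pos: "0 < (1 + norm x) ^ m" for x :: 'a and m by (intro zero_less_power) (simp add: add_pos_nonneg)
  have nw: "cmod (w x) = 1 / (1 + norm x) ^ n" for x
    unfolding w_def n_def norm_of_real using pos by (intro abs_of_nonneg) (simp add: less_imp_le)
  have w: "w \<in> square_integrable"
    unfolding square_integrable_def
  proof (intro CollectI conjI)
    show "w \<in> borel_measurable lborel" unfolding w_def by measurable
    show "integrable lborel (\<lambda>x. (cmod (w x))\<^sup>2)"
      unfolding nw
    proof (rule Bochner_Integration.integrable_bound[OF integrable_inverse_power_norm])
      show "AE x in (lborel :: 'a measure). norm ((1 / (1 + norm x) ^ n)\<^sup>2) \<le> norm (1 / (1 + norm x) ^ (DIM('a) + 1))"
      proof (rule AE_I2)
        fix x :: 'a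
        have "1 \<le> (1 + norm x) ^ n" by (intro one_le_power) simp
        moreover define u where "u = 1 / (1 + norm x) ^ n"
        ultimately have "0 \<le> u" "u \<le> 1" using pos[of x n] by (auto simp: u_def less_imp_le)
        then have "u * u \<le> u" by (rule mult_left_le[rotated])
        with \<open>0 \<le> u\<close> show "norm ((1 / (1 + norm x) ^ n)\<^sup>2) \<le> norm (1 / (1 + norm x) ^ (DIM('a) + 1))"
          unfolding n_def[symmetric] u_def[symmetric] power2_eq_square by simp
      qed
    qed measurable
  qed
  have "integrable lborel (\<lambda>x. of_real (norm x powr (- s)) * w x * (of_real ((1 + norm x) ^ n) * \<phi> x))"
  proof (rule sobolev_integrable_mult[OF w s])
    fix k
    obtain B where "\<And>x. (1 + norm x) ^ (k + n) * norm (\<phi> x) \<le> B" using schwartz_decay[OF \<phi>] by blast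
    then show "\<exists>B. \<forall>x. (1 + norm x) ^ k * norm (of_real ((1 + norm x) ^ n) * \<phi> x) \<le> B"
      by (intro exI[of _ B]) (simp add: norm_mult norm_power power_add mult.assoc norm_of_real[of "1 + norm _", simplified])
  qed measurable
  moreover have w1: "w x * of_real ((1 + norm x) ^ n) = 1" for x
  proof -
    have "1 / P * P = 1" if "P > 0" for P :: real using that by simp
    from this[OF pos[of x n]] show ?thesis
      unfolding w_def n_def[symmetric] of_real_mult[symmetric] by (simp only: of_real_1)
  qed
  moreover have "of_real (norm x powr (- s)) * w x * (of_real ((1 + norm x) ^ n) * \<phi> x) = of_real (norm x powr (- s)) * \<phi> x" for x
  proof -
    have "of_real (norm x powr (- s)) * w x * (of_real ((1 + norm x) ^ n) * \<phi> x) = of_real (norm x powr (- s)) * (w x * of_real ((1 + norm x) ^ n)) * \<phi> x"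
      by (simp only: mult.assoc)
    then show ?thesis by (simp only: w1 mult_1_right)
  qed
  ultimately show ?thesis by (simp only:)
qed

text \<open>For each \<tau> the multiplication formula trades the kernel for exp(-\<tau>|\<xi>|^2).
  Fubini is applied on both sides of this identity, and integrating the Gaussians in \<tau> gives
  |\<xi>|^(-s).\<close>

lemma gauss_riesz_kernel_fourier:
  assumes s: "0 < s" "s < real DIM('a::euclidean_space) / 2"
  shows "tempered_function (gauss_riesz_kernel s :: 'a \<Rightarrow> complex)"
    and "has_fourier (regular_distribution (gauss_riesz_kernel s :: 'a \<Rightarrow> complex)) (\<lambda>\<xi>. of_real (norm \<xi> powr (- s)))"
proof -
  have s': "s < real DIM('a)" using s by simp
  have i: "integrable (gamma_measure s \<Otimes>\<^sub>M lborel) (\<lambda>(\<tau>, x). \<phi> x * of_real (gauss_kernel \<tau> x))" if \<phi>: "\<phi> \<in> schwartz" for \<phi> :: "'a \<Rightarrow> complex"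
    using schwartz_decay[OF \<phi>, of 0] by (auto intro!: gauss_kernel_test_integrable s s' schwartz_integrable \<phi>)
  show t: "tempered_function (gauss_riesz_kernel s :: 'a \<Rightarrow> complex)"
    unfolding tempered_function_def
  proof (intro conjI ballI)
    fix \<phi> :: "'a \<Rightarrow> complex" assume \<phi>: "\<phi> \<in> schwartz"
    have "integrable lborel (\<lambda>x. LINT \<tau>|gamma_measure s. \<phi> x * of_real (gauss_kernel \<tau> x))"
      by (rule gamma_pair.integrable_snd[OF i[OF \<phi>]])
    then show "integrable lborel (\<lambda>x. gauss_riesz_kernel s x * \<phi> x)"
      by (simp add: gauss_riesz_kernel_def mult.commute)
  qed measurable
  show "has_fourier (regular_distribution (gauss_riesz_kernel s :: 'a \<Rightarrow> complex)) (\<lambda>\<xi>. of_real (norm \<xi> powr (- s)))"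
    unfolding has_fourier_def
  proof (intro conjI ballI)
    show "tempered_function (\<lambda>\<xi>::'a. complex_of_real (norm \<xi> powr (- s)))"
      unfolding tempered_function_def using riesz_weight_test_integrable[OF s(2)] by auto
    fix \<phi> :: "'a \<Rightarrow> complex" assume \<phi>: "\<phi> \<in> schwartz"
    note [measurable] = schwartz_measurable[OF \<phi>]
    define W where "W \<tau> \<xi> = \<phi> \<xi> * of_real (exp (- \<tau> * (norm \<xi>)\<^sup>2))" for \<tau> \<xi>
    have [measurable]: "(\<lambda>(\<tau>, \<xi>). W \<tau> \<xi>) \<in> borel_measurable (gamma_measure s \<Otimes>\<^sub>M lborel)" unfolding W_def by measurable
    have iW: "integrable (gamma_measure s \<Otimes>\<^sub>M lborel) (\<lambda>(\<tau>, \<xi>). W \<tau> \<xi>)"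
    proof (rule integrableI_bounded)
      have "(\<integral>\<^sup>+p. ennreal (norm (case p of (\<tau>, \<xi>) \<Rightarrow> W \<tau> \<xi>)) \<partial>(gamma_measure s \<Otimes>\<^sub>M lborel)) = (\<integral>\<^sup>+\<xi>. \<integral>\<^sup>+\<tau>. ennreal (norm (W \<tau> \<xi>)) \<partial>gamma_measure s \<partial>lborel)"
        by (subst gamma_pair.nn_integral_snd[symmetric]) auto
      also have "\<dots> = (\<integral>\<^sup>+\<xi>. ennreal (norm (of_real (norm \<xi> powr (- s)) * \<phi> \<xi>)) \<partial>lborel)"
      proof (rule nn_integral_cong_AE, rule eventually_mono[OF AE_lborel_singleton[of 0]])
        fix \<xi> :: 'a assume x: "\<xi> \<noteq> 0"
        have "(\<integral>\<^sup>+\<tau>. ennreal (norm (W \<tau> \<xi>)) \<partial>gamma_measure s) = (\<integral>\<^sup>+\<tau>. ennreal (norm (\<phi> \<xi>)) * ennreal (exp (- \<tau> * (norm \<xi>)\<^sup>2)) \<partial>gamma_measure s)"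
          by (intro nn_integral_cong) (simp add: W_def norm_mult ennreal_mult)
        also have "\<dots> = ennreal (norm (\<phi> \<xi>)) * ennreal (norm \<xi> powr (- s))"
          by (subst nn_integral_cmult, measurable) (simp only: gamma_measure_exp_norm[OF s(1) x])
        finally show "(\<integral>\<^sup>+\<tau>. ennreal (norm (W \<tau> \<xi>)) \<partial>gamma_measure s) = ennreal (norm (of_real (norm \<xi> powr (- s)) * \<phi> \<xi>))"
          by (simp add: norm_mult ennreal_mult mult.commute)
      qed
      also have "\<dots> < \<infinity>"
        using riesz_weight_test_integrable[OF s(2) \<phi>] by (simp add: integrable_iff_bounded)
      finally show "(\<integral>\<^sup>+p. ennreal (norm (case p of (\<tau>, \<xi>) \<Rightarrow> W \<tau> \<xi>)) \<partial>(gamma_measure s \<Otimes>\<^sub>M lborel)) < \<infinity>" .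
    qed measurable
    have "regular_distribution (gauss_riesz_kernel s :: 'a \<Rightarrow> complex) (fourier \<phi>) = (LINT x|lborel. LINT \<tau>|gamma_measure s. fourier \<phi> x * of_real (gauss_kernel \<tau> x))"
      using schwartz_fourier[OF \<phi>] by (simp add: regular_distribution_def gauss_riesz_kernel_def mult.commute)
    also have "\<dots> = (LINT \<tau>|gamma_measure s. LINT x|lborel. fourier \<phi> x * of_real (gauss_kernel \<tau> x))"
      by (rule gamma_pair.Fubini_integral[OF i[OF schwartz_fourier[OF \<phi>]]])
    also have "\<dots> = (LINT \<tau>|gamma_measure s. LINT \<xi>|lborel. W \<tau> \<xi>)"
    proof (rule integral_cong_AE)
      show "AE \<tau> in gamma_measure s. (LINT x|lborel. fourier \<phi> x * of_real (gauss_kernel \<tau> x)) = (LINT \<xi>|lborel. W \<tau> \<xi>)"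
        using AE_gamma_measure_pos
      proof eventually_elim
        fix \<tau> :: real assume t: "\<tau> > 0"
        have ik: "integrable lborel (\<lambda>x::'a. complex_of_real (gauss_kernel \<tau> x))"
          unfolding complex_of_real_integrable_eq by (rule gauss_kernel_integrable[OF t])
        show "(LINT x|lborel. fourier \<phi> x * of_real (gauss_kernel \<tau> x)) = (LINT \<xi>|lborel. W \<tau> \<xi>)"
          unfolding fourier_multiplication[OF schwartz_integrable[OF \<phi>] ik] W_def fourier_gauss_kernel[OF t] ..
      qed
    qed (use schwartz_measurable[OF schwartz_fourier[OF \<phi>]] in measurable)
    also have "\<dots> = (LINT \<xi>|lborel. LINT \<tau>|gamma_measure s. W \<tau> \<xi>)"
      by (rule gamma_pair.Fubini_integral[OF iW, symmetric])
    also have "\<dots> = (LINT \<xi>|lborel. of_real (norm \<xi> powr (- s)) * \<phi> \<xi>)"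
    proof (rule integral_cong_AE)
      show "AE \<xi> in lborel. (LINT \<tau>|gamma_measure s. W \<tau> \<xi>) = of_real (norm \<xi> powr (- s)) * \<phi> \<xi>"
      proof (rule eventually_mono[OF AE_lborel_singleton[of 0]])
        fix \<xi> :: 'a assume x: "\<xi> \<noteq> 0"
        have "(LINT \<tau>|gamma_measure s. exp (- \<tau> * (norm \<xi>)\<^sup>2)) = norm \<xi> powr (- s)"
          by (rule integral_eq_nn_integral[THEN trans]) (auto simp: gamma_measure_exp_norm[OF s(1) x, simplified])
        then show "(LINT \<tau>|gamma_measure s. W \<tau> \<xi>) = of_real (norm \<xi> powr (- s)) * \<phi> \<xi>"
          unfolding W_def integral_mult_right_zero integral_complex_of_real by (simp add: mult.commute)
      qed
    qed measurable
    finally show "regular_distribution (gauss_riesz_kernel s) (fourier \<phi>) = (LINT \<xi>|lborel. of_real (norm \<xi> powr (- s)) * \<phi> \<xi>)" .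
  qed
qed

text \<open>\<open>riesz_kernel\<close> is a choice; \<open>gauss_riesz_kernel\<close> shows that
  something satisfies the defining property, and functions with the same transform agree almost
  everywhere.\<close>

lemma riesz_kernel_eq:
  assumes s: "0 < s" "s < real DIM('a::euclidean_space) / 2"
  shows "AE x in (lborel :: 'a measure). riesz_kernel s x = gauss_riesz_kernel s x"
    and "(riesz_kernel s :: 'a \<Rightarrow> complex) \<in> borel_measurable borel"
proof -
  define W where "W = (\<lambda>\<xi>::'a. complex_of_real (norm \<xi> powr (- s)))"
  define K where "K = (gauss_riesz_kernel s :: 'a \<Rightarrow> complex)"
  define R where "R = (riesz_kernel s :: 'a \<Rightarrow> complex)"
  have K: "tempered_function K \<and> has_fourier (regular_distribution K) W"
    using gauss_riesz_kernel_fourier[OF s] by (simp add: K_def W_def)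
  have R: "tempered_function R \<and> has_fourier (regular_distribution R) W"
    unfolding R_def riesz_kernel_def W_def[symmetric] by (rule someI[of _ K]) (rule K)
  show "(riesz_kernel s :: 'a \<Rightarrow> complex) \<in> borel_measurable borel"
    using R by (simp add: R_def tempered_function_def)
  have "AE x in lborel. R x - K x = 0"
  proof (rule tempered_unique)
    show "tempered_function (\<lambda>x. R x - K x)" using K R by (intro tempered_diff) auto
    fix \<phi> :: "'a \<Rightarrow> complex" assume \<phi>: "\<phi> \<in> schwartz"
    obtain \<eta> where e: "\<eta> \<in> schwartz" "\<phi> = fourier \<eta>" using fourier_surj_schwartz[OF \<phi>] by blast
    have "(LINT x|lborel. R x * \<phi> x) = regular_distribution R (fourier \<eta>)" "(LINT x|lborel. K x * \<phi> x) = regular_distribution K (fourier \<eta>)"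
      using \<phi> e by (auto simp: regular_distribution_def)
    then have "(LINT x|lborel. R x * \<phi> x) = (LINT x|lborel. K x * \<phi> x)"
      using K R e by (simp add: has_fourier_def)
    then show "(LINT x|lborel. (R x - K x) * \<phi> x) = 0"
      using K R \<phi> unfolding left_diff_distrib tempered_function_def
      by (subst Bochner_Integration.integral_diff) auto
  qed
  then show "AE x in (lborel :: 'a measure). riesz_kernel s x = gauss_riesz_kernel s x"
    by (simp add: R_def K_def)
qed

lemma AE_lborel_reflect:
  fixes x :: "'a::euclidean_space"
  assumes "AE z in lborel. P z"
  shows "AE y in lborel. P (x - y)"
proof -
  have e: "distr lborel borel (\<lambda>y::'a. x - y) = lborel"
    using lborel_affine[of "-1" x] by (simp add: density_1)
  have "AE z in distr lborel borel (\<lambda>y::'a. x - y). P z" unfolding e by (rule assms)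
  then show ?thesis by (rule AE_distrD[rotated]) measurable
qed

section \<open>Dyadic cubes\<close>

text \<open>Half-open cubes of side 2^(-m), addressed by any of their points through the integer
  parts of the scaled coordinates; cubes of one scale coincide or are disjoint.\<close>

definition dcube :: "nat \<Rightarrow> 'a::euclidean_space \<Rightarrow> 'a set" where
  "dcube m x = {y. \<forall>b\<in>Basis. \<lfloor>2 ^ m * (y \<bullet> b)\<rfloor> = \<lfloor>2 ^ m * (x \<bullet> b)\<rfloor>}"

lemma dcube_self [simp]: "x \<in> dcube m x"
  by (simp add: dcube_def)

lemma dcube_eq: "y \<in> dcube m x \<Longrightarrow> dcube m y = dcube m x"
  by (auto simp: dcube_def)

lemma floor_eq_of_floor_double:
  fixes u v :: real
  assumes "\<lfloor>2 * u\<rfloor> = \<lfloor>2 * v\<rfloor>"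
  shows "\<lfloor>u\<rfloor> = \<lfloor>v\<rfloor>"
proof -
  have le: "\<lfloor>u\<rfloor> \<le> \<lfloor>v\<rfloor>" if e: "\<lfloor>2 * u\<rfloor> = \<lfloor>2 * v\<rfloor>" for u v :: real
  proof -
    have "of_int (2 * \<lfloor>u\<rfloor>) \<le> 2 * u" by simp
    then have "2 * \<lfloor>u\<rfloor> \<le> \<lfloor>2 * v\<rfloor>" unfolding e[symmetric] by (simp only: le_floor_iff)
    then have "of_int (2 * \<lfloor>u\<rfloor>) \<le> 2 * v" by (simp only: le_floor_iff)
    then show ?thesis by (simp add: le_floor_iff)
  qed
  show ?thesis using le[OF assms] le[OF assms[symmetric]] by simp
qed

lemma dcube_Suc_subset: "dcube (Suc m) x \<subseteq> dcube m x"
proof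
  fix y assume y: "y \<in> dcube (Suc m) x"
  show "y \<in> dcube m x"
    unfolding dcube_def mem_Collect_eq
  proof
    fix b :: 'a assume "b \<in> Basis"
    with y have "\<lfloor>2 * (2 ^ m * (y \<bullet> b))\<rfloor> = \<lfloor>2 * (2 ^ m * (x \<bullet> b))\<rfloor>" by (simp add: dcube_def mult.assoc)
    then show "\<lfloor>2 ^ m * (y \<bullet> b)\<rfloor> = \<lfloor>2 ^ m * (x \<bullet> b)\<rfloor>" by (rule floor_eq_of_floor_double)
  qed
qed

lemma dcube_mono: "m \<le> n \<Longrightarrow> dcube n x \<subseteq> dcube m x"
  by (induction n rule: dec_induct) (use dcube_Suc_subset in blast)+

lemma dcube_measurable [measurable]: "dcube m (x::'a::euclidean_space) \<in> sets borel"
proof -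
  have "dcube m x = (\<Inter>b\<in>Basis. {y. \<lfloor>2 ^ m * (y \<bullet> b)\<rfloor> = \<lfloor>2 ^ m * (x \<bullet> b)\<rfloor>})" by (auto simp: dcube_def)
  also have "\<dots> \<in> sets borel"
  proof (intro sets.finite_INT)
    fix b :: 'a
    have "{y \<in> space borel. \<lfloor>2 ^ m * (y \<bullet> b)\<rfloor> = \<lfloor>2 ^ m * (x \<bullet> b)\<rfloor>} \<in> sets borel" by measurable
    then show "{y. \<lfloor>2 ^ m * (y \<bullet> b)\<rfloor> = \<lfloor>2 ^ m * (x \<bullet> b)\<rfloor>} \<in> sets borel" by simp
  qed auto
  finally show ?thesis .
qed

lemma dcube_coord_dist:
  assumes "y \<in> dcube m x" "z \<in> dcube m x" "b \<in> Basis"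
  shows "\<bar>(y - z) \<bullet> b\<bar> \<le> 1 / 2 ^ m"
proof -
  have "\<lfloor>2 ^ m * (y \<bullet> b)\<rfloor> = \<lfloor>2 ^ m * (z \<bullet> b)\<rfloor>" using assms by (simp add: dcube_def)
  then have "\<bar>2 ^ m * (y \<bullet> b) - 2 ^ m * (z \<bullet> b)\<bar> \<le> 1" by linarith
  then have "2 ^ m * \<bar>(y - z) \<bullet> b\<bar> \<le> 1"
    by (simp add: inner_diff_left right_diff_distrib[symmetric] abs_mult)
  then show ?thesis by (simp add: pos_le_divide_eq mult.commute)
qed

lemma dcube_dist:
  fixes x :: "'a::euclidean_space"
  assumes "y \<in> dcube m x" "z \<in> dcube m x"
  shows "dist y z \<le> real DIM('a) / 2 ^ m"
proof -
  have "dist y z \<le> (\<Sum>b\<in>Basis. \<bar>(y - z) \<bullet> b\<bar>)" unfolding dist_norm by (rule norm_le_l1)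
  also have "\<dots> \<le> (\<Sum>b\<in>(Basis::'a set). 1 / 2 ^ m)" by (intro sum_mono dcube_coord_dist[OF assms])
  finally show ?thesis by simp
qed

lemma bounded_dcube: "bounded (dcube m (x::'a::euclidean_space))"
proof -
  have "dcube m x \<subseteq> cball x (real DIM('a) / 2 ^ m)" using dcube_dist[OF dcube_self] by auto
  then show ?thesis using bounded_cball bounded_subset by blast
qed

lemma diameter_dcube: "diameter (dcube m (x::'a::euclidean_space)) \<le> real DIM('a) / 2 ^ m"
proof -
  have ne: "dcube m x \<noteq> {}" using dcube_self by blast
  show ?thesis unfolding diameter_def using ne dcube_dist by (auto intro!: cSUP_least)
qed

lemma emeasure_dcube: "emeasure lborel (dcube m (x::'a::euclidean_space)) = ennreal (1 / 2 ^ (m * DIM('a)))"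
proof -
  define l where "l = (\<Sum>b\<in>Basis. (of_int \<lfloor>2 ^ m * (x \<bullet> b)\<rfloor> / 2 ^ m) *\<^sub>R b)"
  define u where "u = l + (1 / 2 ^ m) *\<^sub>R One"
  have lb: "l \<bullet> b = of_int \<lfloor>2 ^ m * (x \<bullet> b)\<rfloor> / 2 ^ m" if "b \<in> Basis" for b using that by (simp add: l_def)
  have ub: "u \<bullet> b = l \<bullet> b + 1 / 2 ^ m" if "b \<in> Basis" for b using that by (simp add: u_def inner_add_left)
  have *: "(\<lfloor>2 ^ m * t\<rfloor> = k) \<longleftrightarrow> (of_int k / 2 ^ m \<le> t \<and> t < of_int k / 2 ^ m + 1 / 2 ^ m)" for k and t :: real
    unfolding floor_eq_iff by (simp add: field_simps)
  have "box l u \<subseteq> dcube m x" "dcube m x \<subseteq> cbox l u"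
    unfolding dcube_def * using lb ub by (auto simp: mem_box less_imp_le)
  moreover have "emeasure lborel (box l u) = ennreal (1 / 2 ^ (m * DIM('a)))" "emeasure lborel (cbox l u) = ennreal (1 / 2 ^ (m * DIM('a)))"
    by (simp_all add: emeasure_lborel_box_eq emeasure_lborel_cbox_eq ub inner_diff_left power_mult power_one_over cong: prod.cong)
  ultimately show ?thesis
    using emeasure_mono[of "box l u" "dcube m x" lborel] emeasure_mono[of "dcube m x" "cbox l u" lborel]
    by (simp add: antisym)
qed

text \<open>Two admissible integer parts per coordinate leave at most 2^d cubes. This serves the
  children of a cube as well as the cubes met by a small ball.\<close>

lemma
  fixes Y :: "'a::euclidean_space set"
  assumes "\<And>y b. y \<in> Y \<Longrightarrow> b \<in> Basis \<Longrightarrow> \<lfloor>2 ^ m * (y \<bullet> b)\<rfloor> \<in> {p b, p b + 1}"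
  shows finite_dcube_image: "finite (dcube m ` Y)"
    and card_dcube_image: "card (dcube m ` Y) \<le> 2 ^ DIM('a)"
proof -
  define P where "P = PiE (Basis::'a set) (\<lambda>b. {p b, p b + 1})"
  define h where "h g = {z::'a. \<forall>b\<in>Basis. \<lfloor>2 ^ m * (z \<bullet> b)\<rfloor> = g b}" for g
  have P: "finite P" "card P = 2 ^ DIM('a)"
    unfolding P_def by (auto intro!: finite_PiE simp: card_PiE numeral_2_eq_2)
  have "dcube m ` Y \<subseteq> h ` P"
  proof
    fix Q assume "Q \<in> dcube m ` Y"
    then obtain y where y: "y \<in> Y" "Q = dcube m y" by blast
    have "(\<lambda>b\<in>Basis. \<lfloor>2 ^ m * (y \<bullet> b)\<rfloor>) \<in> P" using assms[OF y(1)] by (auto simp: P_def)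
    moreover have "Q = h (\<lambda>b\<in>Basis. \<lfloor>2 ^ m * (y \<bullet> b)\<rfloor>)" by (auto simp: y(2) h_def dcube_def)
    ultimately show "Q \<in> h ` P" by blast
  qed
  then show "finite (dcube m ` Y)" "card (dcube m ` Y) \<le> 2 ^ DIM('a)"
    using P finite_subset[of "dcube m ` Y" "h ` P"] card_mono[of "h ` P" "dcube m ` Y"] card_image_le[of P h] by auto
qed

lemma finite_dcube_children: "finite (dcube (Suc m) ` dcube m x)"
proof (rule finite_dcube_image)
  fix y b :: 'a assume "y \<in> dcube m x" "b \<in> Basis"
  then have "\<lfloor>2 ^ m * (y \<bullet> b)\<rfloor> = \<lfloor>2 ^ m * (x \<bullet> b)\<rfloor>" by (simp add: dcube_def)
  moreover have "\<lfloor>2 * u\<rfloor> \<in> {2 * \<lfloor>u\<rfloor>, 2 * \<lfloor>u\<rfloor> + 1}" for u :: real by (simp, linarith)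
  ultimately show "\<lfloor>2 ^ Suc m * (y \<bullet> b)\<rfloor> \<in> {2 * \<lfloor>2 ^ m * (x \<bullet> b)\<rfloor>, 2 * \<lfloor>2 ^ m * (x \<bullet> b)\<rfloor> + 1}"
    by (metis mult.assoc power_Suc)
qed

section \<open>A discrete Frostman lemma\<close>

text \<open>A certificate of max-flow min-cut type for the tree of cubes below
  \<open>dcube j x\<close>: w is a flow with capacity 2^(-i \<alpha>) on every cube of scale i, and
  C lists a cover whose cost does not exceed the mass of w. The pointwise bound is the capacity of a
  finest cube divided by its volume 2^(-m d); it controls balls below the finest scale.\<close>

definition frostman_density ::
  "real \<Rightarrow> nat \<Rightarrow> 'a::euclidean_space set \<Rightarrow> nat \<Rightarrow> 'a \<Rightarrow> ('a \<Rightarrow> ennreal) \<Rightarrow> (nat \<times> 'a) list \<Rightarrow> bool" where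
  "frostman_density \<alpha> m A j x w C \<longleftrightarrow>
     w \<in> borel_measurable borel \<and> (\<forall>y. y \<notin> A \<inter> dcube j x \<longrightarrow> w y = 0) \<and>
     (\<forall>y. w y \<le> ennreal (2 powr (real m * (real DIM('a) - \<alpha>)))) \<and>
     (\<forall>i y. j \<le> i \<and> i \<le> m \<longrightarrow> (\<integral>\<^sup>+z. w z * indicator (dcube i y) z \<partial>lborel) \<le> ennreal (2 powr (- real i * \<alpha>))) \<and>
     A \<inter> dcube j x \<subseteq> (\<Union>(i, y)\<in>set C. dcube i y) \<and>
     ennreal (\<Sum>(i, y)\<leftarrow>C. 2 powr (- real i * \<alpha>)) \<le> (\<integral>\<^sup>+z. w z \<partial>lborel)"

text \<open>Induction from the finest scale upwards: the densities of the children of a cube are added, and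
  the sum is scaled down if it puts too much mass on the cube.\<close>

lemma frostman_density_base:
  fixes x :: "'a::euclidean_space"
  assumes A: "\<And>y. y \<in> A \<Longrightarrow> dcube m y \<subseteq> A"
  shows "\<exists>w C. frostman_density \<alpha> m A m x w C"
proof (cases "x \<in> A")
  case True
  define c where "c = ennreal (2 powr (real m * (real DIM('a) - \<alpha>)))"
  define w where "w z = c * indicator (dcube m x) z" for z :: 'a
  have "c * emeasure lborel (dcube m x) = ennreal (2 powr (- real m * \<alpha>))"
  proof -
    have "1 / 2 ^ (m * DIM('a)) = (2::real) powr (- (real m * real DIM('a)))"
      by (simp add: powr_minus powr_realpow[symmetric] divide_inverse)
    then show ?thesis
      by (simp add: c_def emeasure_dcube ennreal_mult[symmetric] powr_add[symmetric] algebra_simps)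
  qed
  then have I: "(\<integral>\<^sup>+z. w z \<partial>lborel) = ennreal (2 powr (- real m * \<alpha>))"
    by (simp add: w_def nn_integral_cmult_indicator)
  have le: "(\<integral>\<^sup>+z. w z * indicator (dcube i y) z \<partial>lborel) \<le> (\<integral>\<^sup>+z. w z \<partial>lborel)" for i y
    by (intro nn_integral_mono) (auto simp: indicator_def)
  have "w \<in> borel_measurable borel" unfolding w_def by measurable
  moreover have "w y = 0" if "y \<notin> A \<inter> dcube m x" for y
    using that A[OF True] by (auto simp: w_def indicator_def)
  moreover have "w y \<le> ennreal (2 powr (real m * (real DIM('a) - \<alpha>)))" for y
    by (simp add: w_def c_def indicator_def)
  moreover have "(\<integral>\<^sup>+z. w z * indicator (dcube i y) z \<partial>lborel) \<le> ennreal (2 powr (- real i * \<alpha>))" if "m \<le> i \<and> i \<le> m" for i y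
  proof -
    have "i = m" using that by simp
    then show ?thesis using le[of i y] unfolding I by simp
  qed
  ultimately have "frostman_density \<alpha> m A m x w [(m, x)]"
    unfolding frostman_density_def by (simp add: I)
  then show ?thesis by blast
next
  case False
  \<comment> \<open>A contains the whole finest cube around each of its points, so a finest cube
    addressed by a point outside A misses A.\<close>
  have "A \<inter> dcube m x = {}"
    using A False dcube_eq dcube_self by blast
  then have "frostman_density \<alpha> m A m x (\<lambda>_. 0) []" by (simp add: frostman_density_def)
  then show ?thesis by blast
qed

lemma frostman_density_step:
  fixes x :: "'a::euclidean_space"
  assumes IH: "\<And>y. \<exists>w C. frostman_density \<alpha> m A (Suc j) y w C" and j: "j < m"
  shows "\<exists>w C. frostman_density \<alpha> m A j x w C"
proof -
  define K where "K = dcube (Suc j) ` dcube j x"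
  have fK: "finite K" unfolding K_def by (rule finite_dcube_children)
  have "\<forall>Q\<in>K. \<exists>y. y \<in> dcube j x \<and> Q = dcube (Suc j) y" unfolding K_def by blast
  from bchoice[OF this] obtain Y where Y: "\<And>Q. Q \<in> K \<Longrightarrow> Y Q \<in> dcube j x" "\<And>Q. Q \<in> K \<Longrightarrow> Q = dcube (Suc j) (Y Q)"
    by blast
  have "\<forall>Q. \<exists>w C. frostman_density \<alpha> m A (Suc j) (Y Q) w C" using IH by blast
  from choice[OF this] obtain W where "\<forall>Q. \<exists>C. frostman_density \<alpha> m A (Suc j) (Y Q) (W Q) C" by blast
  from choice[OF this] obtain L where F: "\<And>Q. Q \<in> K \<Longrightarrow> frostman_density \<alpha> m A (Suc j) (Y Q) (W Q) (L Q)" by blast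
  have Wm: "W Q \<in> borel_measurable borel" if "Q \<in> K" for Q using F[OF that] by (simp add: frostman_density_def)
  have W0: "W Q z = 0" if "Q \<in> K" "z \<notin> A \<inter> Q" for Q z
  proof -
    have "z \<notin> A \<inter> dcube (Suc j) (Y Q)" using that(2) Y(2)[OF that(1)] by simp
    then show ?thesis using F[OF that(1)] unfolding frostman_density_def by blast
  qed
  define w0 where "w0 z = (\<Sum>Q\<in>K. W Q z)" for z
  have w0m [measurable]: "w0 \<in> borel_measurable borel"
    unfolding w0_def by (rule borel_measurable_sum) (rule Wm)
  \<comment> \<open>The children are disjoint, so at each point at most one summand is nonzero, and
    bounds for the single densities pass to the sum without a factor.\<close>
  have w0_eq: "w0 z = (if dcube (Suc j) z \<in> K then W (dcube (Suc j) z) z else 0)" for z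
  proof -
    have z0: "W Q z = 0" if "Q \<in> K" "Q \<noteq> dcube (Suc j) z" for Q
    proof (rule W0[OF that(1)])
      show "z \<notin> A \<inter> Q"
        using that Y(2)[OF that(1)] dcube_eq[of z "Suc j" "Y Q"] by auto
    qed
    show ?thesis
    proof (cases "dcube (Suc j) z \<in> K")
      case True
      have "w0 z = (\<Sum>Q\<in>{dcube (Suc j) z}. W Q z)"
        unfolding w0_def using True z0 fK by (intro sum.mono_neutral_right) auto
      then show ?thesis using True by simp
    next
      case False
      then show ?thesis unfolding w0_def using z0 by (auto intro!: sum.neutral)
    qed
  qed
  have w0_supp: "w0 y = 0" if "y \<notin> A \<inter> dcube j x" for y
  proof (cases "dcube (Suc j) y \<in> K")
    case True
    then obtain z where z: "z \<in> dcube j x" "dcube (Suc j) y = dcube (Suc j) z" by (auto simp: K_def)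
    then have "y \<in> dcube j z" using dcube_Suc_subset[of j z] dcube_self[of y "Suc j"] by blast
    then have "y \<in> dcube j x" using dcube_eq[OF z(1)] by blast
    then show ?thesis using that True W0[OF True, of y] by (auto simp: w0_eq)
  qed (simp add: w0_eq)
  have w0_le: "w0 y \<le> ennreal (2 powr (real m * (real DIM('a) - \<alpha>)))" for y
    using F[of "dcube (Suc j) y"] by (auto simp: w0_eq frostman_density_def)
  have w0_cube: "(\<integral>\<^sup>+z. w0 z * indicator (dcube i y) z \<partial>lborel) \<le> ennreal (2 powr (- real i * \<alpha>))" if i: "Suc j \<le> i" "i \<le> m" for i y
  proof -
    have eq: "dcube (Suc j) z = dcube (Suc j) y" if "z \<in> dcube i y" for z
      using that dcube_mono[OF i(1), of y] dcube_eq by blast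
    show ?thesis
    proof (cases "dcube (Suc j) y \<in> K")
      case True
      have "w0 z = W (dcube (Suc j) y) z" if "z \<in> dcube i y" for z
        using eq[OF that] True by (simp add: w0_eq[of z])
      then have "(\<integral>\<^sup>+z. w0 z * indicator (dcube i y) z \<partial>lborel) = (\<integral>\<^sup>+z. W (dcube (Suc j) y) z * indicator (dcube i y) z \<partial>lborel)"
        by (intro nn_integral_cong) (auto simp: indicator_def)
      also have "\<dots> \<le> ennreal (2 powr (- real i * \<alpha>))"
        using F[OF True] i by (simp add: frostman_density_def)
      finally show ?thesis .
    next
      case False
      have "w0 z = 0" if "z \<in> dcube i y" for z
        using eq[OF that] False by (simp add: w0_eq[of z])
      then have "(\<integral>\<^sup>+z. w0 z * indicator (dcube i y) z \<partial>lborel) = (\<integral>\<^sup>+z. 0 \<partial>(lborel :: 'a measure))"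
        by (intro nn_integral_cong) (auto simp: indicator_def)
      then show ?thesis by simp
    qed
  qed
  obtain Ks where Ks: "set Ks = K" "distinct Ks" using finite_distinct_list[OF fK] by blast
  define C0 where "C0 = concat (map L Ks)"
  have C0_cover: "A \<inter> dcube j x \<subseteq> (\<Union>(i, y)\<in>set C0. dcube i y)"
  proof
    fix z assume z: "z \<in> A \<inter> dcube j x"
    define Q where "Q = dcube (Suc j) z"
    have Q: "Q \<in> K" using z by (auto simp: K_def Q_def)
    have "z \<in> A \<inter> dcube (Suc j) (Y Q)" using z Y(2)[OF Q] by (auto simp: Q_def)
    then have "z \<in> (\<Union>(i, y)\<in>set (L Q). dcube i y)" using F[OF Q] unfolding frostman_density_def by blast
    then show "z \<in> (\<Union>(i, y)\<in>set C0. dcube i y)" using Q Ks by (auto simp: C0_def)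
  qed
  have I0: "(\<integral>\<^sup>+z. w0 z \<partial>lborel) = (\<Sum>Q\<in>K. \<integral>\<^sup>+z. W Q z \<partial>lborel)"
    unfolding w0_def using Wm by (intro nn_integral_sum) auto
  define f where "f = (\<lambda>(i, y::'a). 2 powr (- real i * \<alpha>))"
  have f0: "f p \<ge> 0" for p by (simp add: f_def split: prod.split)
  have sf: "(\<Sum>p\<leftarrow>xs. f p) \<ge> 0" for xs by (intro sum_list_nonneg) (auto simp: f0)
  have FL: "ennreal (\<Sum>p\<leftarrow>L Q. f p) \<le> (\<integral>\<^sup>+z. W Q z \<partial>lborel)" if "Q \<in> K" for Q
    using F[OF that] by (simp add: frostman_density_def f_def)
  have C0_sum: "ennreal (\<Sum>p\<leftarrow>C0. f p) \<le> (\<integral>\<^sup>+z. w0 z \<partial>lborel)"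
  proof -
    have "(\<Sum>p\<leftarrow>C0. f p) = (\<Sum>Q\<leftarrow>Ks. \<Sum>p\<leftarrow>L Q. f p)"
      unfolding C0_def by (induction Ks) auto
    also have "\<dots> = (\<Sum>Q\<in>K. \<Sum>p\<leftarrow>L Q. f p)"
      using Ks by (simp add: sum_list_distinct_conv_sum_set)
    finally have "ennreal (\<Sum>p\<leftarrow>C0. f p) = (\<Sum>Q\<in>K. ennreal (\<Sum>p\<leftarrow>L Q. f p))"
      using sf by simp
    also have "\<dots> \<le> (\<integral>\<^sup>+z. w0 z \<partial>lborel)"
      unfolding I0 by (intro sum_mono FL)
    finally show ?thesis .
  qed
  define T where "T = (\<integral>\<^sup>+z. w0 z \<partial>lborel)"
  \<comment> \<open>If the mass fits into the cube, density and cover of the children are kept.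
    Otherwise the density is scaled to mass exactly 2^(-j \<alpha>), and the saturated cube itself,
    of the same cost, replaces the cover.\<close>
  show ?thesis
  proof (cases "T \<le> ennreal (2 powr (- real j * \<alpha>))")
    case True
    have "(\<integral>\<^sup>+z. w0 z * indicator (dcube i y) z \<partial>lborel) \<le> ennreal (2 powr (- real i * \<alpha>))" if i: "j \<le> i" "i \<le> m" for i y
    proof (cases "i = j")
      case True
      have "(\<integral>\<^sup>+z. w0 z * indicator (dcube i y) z \<partial>lborel) \<le> T"
        unfolding T_def by (intro nn_integral_mono) (auto simp: indicator_def)
      then show ?thesis using \<open>T \<le> _\<close> True by simp
    next
      case False
      then show ?thesis using w0_cube i by simp
    qed
    then have "frostman_density \<alpha> m A j x w0 C0"
      unfolding frostman_density_def f_def[symmetric] using w0_supp w0_le C0_cover C0_sum by auto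
    then show ?thesis by blast
  next
    case False
    have "T < top"
    proof -
      have "(\<integral>\<^sup>+z. W Q z \<partial>lborel) < top" if Q: "Q \<in> K" for Q
      proof -
        have "(\<integral>\<^sup>+z. W Q z \<partial>lborel) = (\<integral>\<^sup>+z. W Q z * indicator (dcube (Suc j) (Y Q)) z \<partial>lborel)"
          using W0[OF Q] Y(2)[OF Q] by (intro nn_integral_cong) (auto simp: indicator_def)
        also have "\<dots> \<le> ennreal (2 powr (- real (Suc j) * \<alpha>))"
        proof -
          have "\<forall>i y. Suc j \<le> i \<and> i \<le> m \<longrightarrow> (\<integral>\<^sup>+z. W Q z * indicator (dcube i y) z \<partial>lborel) \<le> ennreal (2 powr (- real i * \<alpha>))"
            using F[OF Q] unfolding frostman_density_def by blast
          then show ?thesis using j Suc_leI by blast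
        qed
        finally show ?thesis by (rule le_less_trans) simp
      qed
      then show ?thesis unfolding T_def I0 using fK by (simp add: ennreal_sum_less_top less_top)
    qed
    then obtain t where t: "T = ennreal t" "t \<ge> 0" by (cases T) auto
    define l where "l = 2 powr (- real j * \<alpha>) / t"
    have lt: "2 powr (- real j * \<alpha>) < t" using False t by (simp add: not_le)
    have tp: "t > 0" by (rule less_trans[OF _ lt]) simp
    have l: "0 \<le> l" "l \<le> 1" "l * t = 2 powr (- real j * \<alpha>)" using lt tp by (auto simp: l_def)
    define w where "w z = ennreal l * w0 z" for z
    have ww0: "w z \<le> w0 z" for z
      using mult_right_mono[of "ennreal l" 1 "w0 z"] l by (simp add: w_def)
    have Iw: "(\<integral>\<^sup>+z. w z \<partial>lborel) = ennreal (2 powr (- real j * \<alpha>))"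
      unfolding w_def using l t by (simp add: nn_integral_cmult T_def[symmetric] ennreal_mult[symmetric])
    have "(\<integral>\<^sup>+z. w z * indicator (dcube i y) z \<partial>lborel) \<le> ennreal (2 powr (- real i * \<alpha>))" if i: "j \<le> i" "i \<le> m" for i y
    proof (cases "i = j")
      case True
      have "(\<integral>\<^sup>+z. w z * indicator (dcube i y) z \<partial>lborel) \<le> (\<integral>\<^sup>+z. w z \<partial>lborel)"
        by (intro nn_integral_mono) (auto simp: indicator_def)
      then show ?thesis using True by (simp add: Iw)
    next
      case False
      have "(\<integral>\<^sup>+z. w z * indicator (dcube i y) z \<partial>lborel) \<le> (\<integral>\<^sup>+z. w0 z * indicator (dcube i y) z \<partial>lborel)"
        by (intro nn_integral_mono mult_right_mono ww0) auto
      also have "\<dots> \<le> ennreal (2 powr (- real i * \<alpha>))" using w0_cube False i by simp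
      finally show ?thesis .
    qed
    moreover have "w \<in> borel_measurable borel" unfolding w_def by measurable
    moreover have "w y \<le> ennreal (2 powr (real m * (real DIM('a) - \<alpha>)))" for y
      using ww0 w0_le order_trans by blast
    moreover have "w y = 0" if "y \<notin> A \<inter> dcube j x" for y using w0_supp[OF that] by (simp add: w_def)
    ultimately have "frostman_density \<alpha> m A j x w [(j, x)]"
      unfolding frostman_density_def using Iw by auto
    then show ?thesis by blast
  qed
qed

lemma frostman_density_exists:
  fixes x :: "'a::euclidean_space"
  assumes A: "\<And>y. y \<in> A \<Longrightarrow> dcube m y \<subseteq> A" and "j \<le> m"
  shows "\<exists>w C. frostman_density \<alpha> m A j x w C"
  using assms(2)
proof (induction arbitrary: x rule: inc_induct)
  case base
  show ?case by (rule frostman_density_base[OF A])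
next
  case (step n)
  show ?case by (rule frostman_density_step[OF step.IH]) (use step in auto)
qed

text \<open>A scale at which every cube has diameter at most 1 and so lies in a unit ball around
  each of its points, as \<open>frostman_class\<close> requires.\<close>

definition dyadic_unit :: "'a::euclidean_space itself \<Rightarrow> nat" where
  "dyadic_unit _ = (LEAST j. real DIM('a) \<le> 2 ^ j)"

lemma dyadic_unit: "real DIM('a::euclidean_space) / 2 ^ dyadic_unit TYPE('a) \<le> 1"
proof -
  have "\<exists>j::nat. real DIM('a) \<le> 2 ^ j"
    using real_arch_pow[of 2 "real DIM('a)"] by (auto intro: less_imp_le)
  then have "real DIM('a) \<le> 2 ^ dyadic_unit TYPE('a)" unfolding dyadic_unit_def by (rule LeastI_ex)
  then show ?thesis by simp
qed

text \<open>The measures to which the decay hypothesis is applied: up to a translation they are supported in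
  the unit ball.\<close>

definition frostman_class :: "real \<Rightarrow> real \<Rightarrow> 'a::euclidean_space measure \<Rightarrow> bool" where
  "frostman_class \<alpha> K \<mu> \<longleftrightarrow> sets \<mu> = sets borel \<and> (\<exists>x. emeasure \<mu> (- cball x 1) = 0) \<and>
     frostman_const \<alpha> \<mu> \<le> ennreal K"

text \<open>A ball of radius r is compared with cubes of side between 2r and 4r, of which it meets
  at most 2^d; this is the origin of 2^d 4^\<alpha>. Balls too large for this are bounded by the
  total mass of the starting cube, balls below the finest scale by the pointwise bound times their
  volume.\<close>

lemma frostman_density_cball:
  fixes z :: "'a::euclidean_space"
  assumes w: "frostman_density \<alpha> m A j x w C" and \<alpha>: "0 < \<alpha>" "\<alpha> \<le> real DIM('a)" and r: "r > 0" and j: "j \<le> m"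
  shows "(\<integral>\<^sup>+y. w y * indicator (cball z r) y \<partial>lborel) \<le> ennreal (2 ^ DIM('a) * 4 powr \<alpha> * r powr \<alpha>)"
proof -
  have [measurable]: "w \<in> borel_measurable borel" using w by (simp add: frostman_density_def)
  have supp: "w y = 0" if "y \<notin> dcube j x" for y using w that unfolding frostman_density_def by blast
  have sup: "w y \<le> ennreal (2 powr (real m * (real DIM('a) - \<alpha>)))" for y using w unfolding frostman_density_def by blast
  have cube: "(\<integral>\<^sup>+y. w y * indicator (dcube i u) y \<partial>lborel) \<le> ennreal (2 powr (- real i * \<alpha>))" if "j \<le> i" "i \<le> m" for i u
    using w that unfolding frostman_density_def by blast
  have one: "(1::real) \<le> 2 ^ DIM('a)" by (rule one_le_power) simp
  have "0 < 2 * r" "(1 / 2 :: real) < 1" using r by auto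
  from real_arch_pow_inv[OF this] have ex: "\<exists>n::nat. (1 / 2) ^ n < 2 * r" .
  \<comment> \<open>The first scale with side below 2r; if it is beyond j, its predecessor i = n - 1
    satisfies 2r \<le> 2^(-i) < 4r.\<close>
  define n where "n = (LEAST n::nat. (1 / 2) ^ n < 2 * r)"
  have n1: "(1 / 2) ^ n < 2 * r" unfolding n_def by (rule LeastI_ex[OF ex])
  have n2: "2 * r \<le> (1 / 2) ^ k" if "k < n" for k
    using not_less_Least[OF that[unfolded n_def]] by (simp only: not_less)
  have pw: "2 powr (- real i * \<alpha>) = ((1 / 2) ^ i) powr \<alpha>" for i
  proof -
    have "(1 / 2 :: real) ^ i = 2 powr (- real i)"
      by (simp add: powr_minus_divide powr_realpow power_one_over)
    then show ?thesis by (simp only: powr_powr)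
  qed
  show ?thesis
  proof (cases "n \<le> j")
    case True
    have "(\<integral>\<^sup>+y. w y * indicator (cball z r) y \<partial>lborel) \<le> (\<integral>\<^sup>+y. w y * indicator (dcube j x) y \<partial>lborel)"
      using supp by (intro nn_integral_mono) (auto simp: indicator_def)
    also have "\<dots> \<le> ennreal (2 powr (- real j * \<alpha>))" using cube[of j x] j by simp
    also have "2 powr (- real j * \<alpha>) \<le> (4 * r) powr \<alpha>"
    proof -
      have "(1 / 2) ^ j \<le> (1 / 2 :: real) ^ n" using True by (intro power_decreasing) auto
      then have "(1 / 2) ^ j \<le> 4 * r" using n1 r by linarith
      then show ?thesis unfolding pw using \<alpha> by (intro powr_mono2) auto
    qed
    also have "(4 * r) powr \<alpha> \<le> 2 ^ DIM('a) * 4 powr \<alpha> * r powr \<alpha>"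
      using r one mult_right_mono[OF one, of "4 powr \<alpha> * r powr \<alpha>"] by (simp add: powr_mult mult.assoc)
    finally show ?thesis by (simp add: ennreal_leI)
  next
    case False
    define i where "i = n - 1"
    have i: "j \<le> i" "i < n" "n = Suc i" using False by (auto simp: i_def)
    have ri: "2 * r \<le> (1 / 2) ^ i" by (rule n2[OF i(2)])
    have ir: "(1 / 2) ^ i < 4 * r" using n1 i(3) by simp
    show ?thesis
    proof (cases "i \<le> m")
      case True
      define p where "p b = \<lfloor>2 ^ i * (z \<bullet> b - r)\<rfloor>" for b
      have fl: "\<lfloor>2 ^ i * (y \<bullet> b)\<rfloor> \<in> {p b, p b + 1}" if y: "y \<in> cball z r" and b: "b \<in> Basis" for y b
      proof -
        have "\<bar>(y - z) \<bullet> b\<bar> \<le> r" using Basis_le_norm[OF b, of "y - z"] y by (simp add: dist_norm norm_minus_commute)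
        then have "z \<bullet> b - r \<le> y \<bullet> b" "y \<bullet> b \<le> (z \<bullet> b - r) + 2 * r" by (auto simp: inner_diff_left)
        then have "2 ^ i * (z \<bullet> b - r) \<le> 2 ^ i * (y \<bullet> b)" "2 ^ i * (y \<bullet> b) \<le> 2 ^ i * ((z \<bullet> b - r) + 2 * r)"
          by (auto intro!: mult_left_mono)
        \<comment> \<open>In units of the side the ball spans length at most 1 in each direction, so
          integer parts take at most two consecutive values.\<close>
        moreover have "2 ^ i * (2 * r) \<le> 1"
          using ri by (simp add: power_one_over pos_le_divide_eq mult.commute)
        ultimately have "2 ^ i * (z \<bullet> b - r) \<le> 2 ^ i * (y \<bullet> b)" "2 ^ i * (y \<bullet> b) \<le> 2 ^ i * (z \<bullet> b - r) + 1"
          unfolding distrib_left[of "2 ^ i" "z \<bullet> b - r" "2 * r"] by linarith+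
        then show ?thesis unfolding p_def by (simp, linarith)
      qed
      define K where "K = dcube i ` cball z r"
      have K: "finite K" "card K \<le> 2 ^ DIM('a)"
        unfolding K_def by (rule finite_dcube_image, erule fl, assumption, rule card_dcube_image, erule fl, assumption)
      have "(\<integral>\<^sup>+y. w y * indicator (cball z r) y \<partial>lborel) \<le> (\<integral>\<^sup>+y. (\<Sum>Q\<in>K. w y * indicator Q y) \<partial>lborel)"
      proof (rule nn_integral_mono)
        fix y
        show "w y * indicator (cball z r) y \<le> (\<Sum>Q\<in>K. w y * indicator Q y)"
        proof (cases "y \<in> cball z r")
          case True
          then have "dcube i y \<in> K" by (simp add: K_def)
          then have "w y * indicator (dcube i y) y \<le> (\<Sum>Q\<in>K. w y * indicator Q y)"
            using K(1) by (intro member_le_sum) auto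
          then show ?thesis using True by simp
        qed simp
      qed
      also have "\<dots> = (\<Sum>Q\<in>K. \<integral>\<^sup>+y. w y * indicator Q y \<partial>lborel)"
        by (rule nn_integral_sum) (auto simp: K_def)
      also have "\<dots> \<le> (\<Sum>Q\<in>K. ennreal (2 powr (- real i * \<alpha>)))"
        using cube i(1) True by (intro sum_mono) (auto simp: K_def)
      also have "\<dots> = ennreal (real (card K) * 2 powr (- real i * \<alpha>))"
        by (simp add: ennreal_mult ennreal_of_nat_eq_real_of_nat)
      also have "real (card K) * 2 powr (- real i * \<alpha>) \<le> 2 ^ DIM('a) * (4 * r) powr \<alpha>"
      proof (rule mult_mono)
        show "real (card K) \<le> 2 ^ DIM('a)" using K(2) by (metis of_nat_le_iff of_nat_numeral of_nat_power)
        show "2 powr (- real i * \<alpha>) \<le> (4 * r) powr \<alpha>" unfolding pw using \<alpha> ir by (intro powr_mono2) auto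
      qed auto
      finally show ?thesis using r by (simp add: ennreal_leI powr_mult mult.assoc)
    next
      case False
      have rm: "2 * r \<le> (1 / 2) ^ m"
        by (rule order_trans[OF ri], rule power_decreasing) (use False in auto)
      have "(\<integral>\<^sup>+y. w y * indicator (cball z r) y \<partial>lborel) \<le> (\<integral>\<^sup>+y. ennreal (2 powr (real m * (real DIM('a) - \<alpha>))) * indicator (cball z r) y \<partial>lborel)"
        by (intro nn_integral_mono mult_right_mono sup) auto
      also have "\<dots> = ennreal (2 powr (real m * (real DIM('a) - \<alpha>))) * emeasure lborel (cball z r)"
        by (rule nn_integral_cmult_indicator) simp
      also have "\<dots> \<le> ennreal (2 powr (real m * (real DIM('a) - \<alpha>))) * ennreal ((2 * r) ^ DIM('a))"
      proof (rule mult_left_mono)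
        have "cball z r \<subseteq> cbox (z - r *\<^sub>R One) (z + r *\<^sub>R One)"
        proof
          fix y assume y: "y \<in> cball z r"
          have "\<bar>(y - z) \<bullet> b\<bar> \<le> r" if "b \<in> Basis" for b
            using Basis_le_norm[OF that, of "y - z"] y by (simp add: dist_norm norm_minus_commute)
          then show "y \<in> cbox (z - r *\<^sub>R One) (z + r *\<^sub>R One)"
            unfolding mem_box by (auto simp: inner_diff_left inner_add_left abs_le_iff algebra_simps) 
        qed
        then have "emeasure lborel (cball z r) \<le> emeasure lborel (cbox (z - r *\<^sub>R One) (z + r *\<^sub>R One))"
          by (rule emeasure_mono) simp
        also have "\<dots> = ennreal ((2 * r) ^ DIM('a))"
          using r by (simp add: emeasure_lborel_cbox_eq inner_diff_left inner_add_left cong: prod.cong)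
        finally show "emeasure lborel (cball z r) \<le> ennreal ((2 * r) ^ DIM('a))" .
      qed simp
      also have "\<dots> = ennreal (2 powr (real m * (real DIM('a) - \<alpha>)) * (2 * r) ^ DIM('a))"
        using r by (simp add: ennreal_mult)
      \<comment> \<open>With e = d - \<alpha> \<ge> 0 the claim reduces to (2^m 2r)^e \<le> 1; this
        is where \<alpha> \<le> d enters.\<close>
      also have "2 powr (real m * (real DIM('a) - \<alpha>)) * (2 * r) ^ DIM('a) \<le> (2 * r) powr \<alpha>"
      proof -
        define e where "e = real DIM('a) - \<alpha>"
        have e: "e \<ge> 0" using \<alpha> by (simp add: e_def)
        have "(2 * r) ^ DIM('a) = (2 * r) powr e * (2 * r) powr \<alpha>"
        proof -
          have "(2 * r) ^ DIM('a) = (2 * r) powr (e + \<alpha>)"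
            using powr_realpow[of "2 * r" "DIM('a)"] r by (simp add: e_def)
          then show ?thesis by (simp only: powr_add)
        qed
        moreover have "2 powr (real m * e) * (2 * r) powr e \<le> 1"
        proof -
          have "2 powr (real m * e) = (2 ^ m) powr e" by (simp add: powr_powr[symmetric] powr_realpow)
          then have "2 powr (real m * e) * (2 * r) powr e = (2 ^ m * (2 * r)) powr e" using r by (simp add: powr_mult)
          also have "\<dots> \<le> 1 powr e"
            using rm e r by (intro powr_mono2) (auto simp: power_one_over pos_le_divide_eq mult.commute)
          finally show ?thesis by simp
        qed
        ultimately show ?thesis
          using mult_right_mono[of "2 powr (real m * e) * (2 * r) powr e" 1 "(2 * r) powr \<alpha>"] by (simp add: e_def[symmetric] mult.assoc)
      qed
      also have "(2 * r) powr \<alpha> \<le> 2 ^ DIM('a) * 4 powr \<alpha> * r powr \<alpha>"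
      proof -
        have "(2 * r) powr \<alpha> \<le> (4 * r) powr \<alpha>" using r \<alpha> by (intro powr_mono2) auto
        also have "\<dots> \<le> 2 ^ DIM('a) * 4 powr \<alpha> * r powr \<alpha>"
          using r one mult_right_mono[OF one, of "4 powr \<alpha> * r powr \<alpha>"] by (simp add: powr_mult mult.assoc)
        finally show ?thesis .
      qed
      finally show ?thesis by (simp add: ennreal_leI)
    qed
  qed
qed

lemma frostman_class_density:
  fixes x :: "'a::euclidean_space"
  assumes w: "frostman_density \<alpha> m A j x w C" and \<alpha>: "0 < \<alpha>" "\<alpha> \<le> real DIM('a)" and j: "j = dyadic_unit TYPE('a)" "j \<le> m"
  shows "frostman_class \<alpha> (2 ^ DIM('a) * 4 powr \<alpha>) (density lborel w)"
proof -
  have [measurable]: "w \<in> borel_measurable borel" using w by (simp add: frostman_density_def)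
  have supp: "w y = 0" if "y \<notin> dcube j x" for y using w that unfolding frostman_density_def by blast
  have "dcube j x \<subseteq> cball x 1"
  proof
    fix y assume "y \<in> dcube j x"
    then have "dist x y \<le> real DIM('a) / 2 ^ j" by (rule dcube_dist[OF dcube_self])
    from order_trans[OF this[unfolded j(1)] dyadic_unit] show "y \<in> cball x 1" by simp
  qed
  then have "w y * indicator (- cball x 1) y = 0" for y
    using supp[of y] by (cases "y \<in> dcube j x") (auto simp: indicator_def)
  then have "(\<integral>\<^sup>+y. w y * indicator (- cball x 1) y \<partial>lborel) = (\<integral>\<^sup>+y. 0 \<partial>(lborel :: 'a measure))"
    by (intro nn_integral_cong)
  then have "emeasure (density lborel w) (- cball x 1) = 0" by (subst emeasure_density) auto
  moreover have "frostman_const \<alpha> (density lborel w) \<le> ennreal (2 ^ DIM('a) * 4 powr \<alpha>)"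
    unfolding frostman_const_def
  proof (intro SUP_least)
    fix z :: 'a and r :: real assume "r \<in> {0<..}"
    then have r: "r > 0" by simp
    have "ennreal (r powr - \<alpha>) * emeasure (density lborel w) (cball z r) \<le> ennreal (r powr - \<alpha>) * ennreal (2 ^ DIM('a) * 4 powr \<alpha> * r powr \<alpha>)"
      using frostman_density_cball[OF w \<alpha> r j(2), of z] by (intro mult_left_mono) (auto simp: emeasure_density)
    also have "\<dots> = ennreal (2 ^ DIM('a) * 4 powr \<alpha>)"
    proof -
      have "r powr - \<alpha> * (K * r powr \<alpha>) = K" for K
        using r by (simp add: powr_minus)
      then show ?thesis by (simp only: ennreal_mult[symmetric] powr_ge_zero zero_le_power zero_le_numeral mult_nonneg_nonneg)
    qed
    finally show "ennreal (r powr - \<alpha>) * emeasure (density lborel w) (cball z r) \<le> ennreal (2 ^ DIM('a) * 4 powr \<alpha>)" .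
  qed
  ultimately show ?thesis by (auto simp: frostman_class_def)
qed

section \<open>Null sets of the Hausdorff content\<close>

text \<open>An upper bound for Hausdorff content, without restriction on diameters. Finite families
  count as sequences padded with empty sets, whose diameter 0 costs nothing as
  \<open>0 powr \<alpha> = 0\<close>.\<close>

definition covered :: "real \<Rightarrow> 'a::metric_space set \<Rightarrow> ennreal \<Rightarrow> bool" where
  "covered \<alpha> E c \<longleftrightarrow> (\<exists>U :: nat \<Rightarrow> 'a set. E \<subseteq> (\<Union>n. U n) \<and> (\<forall>n. bounded (U n)) \<and>
     (\<Sum>n. ennreal (diameter (U n) powr \<alpha>)) \<le> c)"

lemma coveredI:
  fixes U :: "nat \<Rightarrow> 'a::metric_space set"
  assumes "E \<subseteq> (\<Union>n. U n)" "\<And>n. bounded (U n)" "(\<Sum>n. ennreal (diameter (U n) powr \<alpha>)) \<le> c"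
  shows "covered \<alpha> E c"
  unfolding covered_def by (intro exI[of _ U] conjI allI assms)

lemma coveredE:
  assumes "covered \<alpha> E c"
  obtains U :: "nat \<Rightarrow> 'a::metric_space set" where "E \<subseteq> (\<Union>n. U n)" "\<And>n. bounded (U n)"
    "(\<Sum>n. ennreal (diameter (U n) powr \<alpha>)) \<le> c"
proof -
  from assms[unfolded covered_def] obtain U :: "nat \<Rightarrow> 'a set" where U: "E \<subseteq> (\<Union>n. U n) \<and> (\<forall>n. bounded (U n)) \<and>
     (\<Sum>n. ennreal (diameter (U n) powr \<alpha>)) \<le> c"
    by (rule exE)
  show thesis
    by (rule that[of U, OF conjunct1[OF U] spec[OF conjunct1[OF conjunct2[OF U]]] conjunct2[OF conjunct2[OF U]]])
qed

lemma covered_mono: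
  assumes "covered \<alpha> E c" and FE: "F \<subseteq> E" and c: "c \<le> c'"
  shows "covered \<alpha> F c'"
proof -
  from assms(1) obtain U where U: "E \<subseteq> (\<Union>n. U n)" "\<And>n. bounded (U n)" "(\<Sum>n. ennreal (diameter (U n) powr \<alpha>)) \<le> c"
    by (rule coveredE) (rule that)
  show ?thesis by (rule coveredI[OF order_trans[OF FE U(1)] U(2) order_trans[OF U(3) c]])
qed

lemma covered_UN:
  assumes "\<And>n::nat. covered \<alpha> (E n) (c n)"
  shows "covered \<alpha> (\<Union>n. E n) (\<Sum>n. c n)"
proof -
  have "\<forall>n. \<exists>U :: nat \<Rightarrow> 'a set. E n \<subseteq> (\<Union>k. U k) \<and> (\<forall>k. bounded (U k)) \<and> (\<Sum>k. ennreal (diameter (U k) powr \<alpha>)) \<le> c n"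
    using assms unfolding covered_def by (rule allI)
  from choice[OF this]
  obtain U where "\<forall>n. E n \<subseteq> (\<Union>k. U n k) \<and> (\<forall>k. bounded (U n k)) \<and> (\<Sum>k. ennreal (diameter (U n k) powr \<alpha>)) \<le> c n"
    by (elim exE)
  then have U: "\<And>n. E n \<subseteq> (\<Union>k. U n k)" "\<And>n k. bounded (U n k)" "\<And>n. (\<Sum>k. ennreal (diameter (U n k) powr \<alpha>)) \<le> c n"
    by simp_all
  define V where "V i = (case prod_decode i of (n, k) \<Rightarrow> U n k)" for i
  have "(\<Union>n. E n) \<subseteq> (\<Union>i. V i)"
  proof
    fix x assume "x \<in> (\<Union>n. E n)"
    then obtain n k where "x \<in> U n k" using U(1) by blast
    then have "x \<in> V (prod_encode (n, k))" by (simp add: V_def)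
    then show "x \<in> (\<Union>i. V i)" by blast
  qed
  moreover have "\<And>i. bounded (V i)" using U(2) by (simp add: V_def split: prod.split)
  moreover have "(\<Sum>i. ennreal (diameter (V i) powr \<alpha>)) \<le> (\<Sum>n. c n)"
  proof -
    define f where "f p = ennreal (diameter (U (fst p) (snd p)) powr \<alpha>)" for p
    have "(\<Sum>i. ennreal (diameter (V i) powr \<alpha>)) = (\<Sum>i. f (prod_decode i))"
      by (simp add: V_def f_def split_beta)
    also have "\<dots> = (\<Sum>n. \<Sum>k. f (n, k))"
      by (rule suminf_ennreal_2dimen) simp
    also have "\<dots> \<le> (\<Sum>n. c n)"
      using U(3) by (intro suminf_le) (auto simp: f_def)
    finally show ?thesis .
  qed
  ultimately show ?thesis by (rule coveredI)
qed

definition content_null :: "real \<Rightarrow> 'a::metric_space set \<Rightarrow> bool" where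
  "content_null \<alpha> E \<longleftrightarrow> (\<forall>\<epsilon>>0. covered \<alpha> E (ennreal \<epsilon>))"

lemma content_null_subset: "content_null \<alpha> E \<Longrightarrow> F \<subseteq> E \<Longrightarrow> content_null \<alpha> F"
  unfolding content_null_def using covered_mono[OF _ _ order_refl] by blast

lemma content_null_UN:
  assumes "\<And>n::nat. content_null \<alpha> (E n)"
  shows "content_null \<alpha> (\<Union>n. E n)"
  unfolding content_null_def
proof (intro allI impI)
  fix \<epsilon> :: real assume e: "\<epsilon> > 0"
  have "covered \<alpha> (E n) (ennreal (\<epsilon> * (1 / 2) ^ Suc n))" for n
    using assms e unfolding content_null_def by simp
  then have "covered \<alpha> (\<Union>n. E n) (\<Sum>n. ennreal (\<epsilon> * (1 / 2) ^ Suc n))" by (rule covered_UN)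
  moreover have "(\<Sum>n. ennreal (\<epsilon> * (1 / 2) ^ Suc n)) = ennreal \<epsilon>"
  proof -
    have "(\<lambda>n. \<epsilon> * (1 / 2) ^ Suc n) sums (\<epsilon> * 1)" by (intro sums_mult power_half_series)
    then show ?thesis using e by (subst suminf_ennreal2) (auto simp: sums_iff)
  qed
  ultimately show "covered \<alpha> (\<Union>n. E n) (ennreal \<epsilon>)" by simp
qed

lemma content_null_Un: "content_null \<alpha> E \<Longrightarrow> content_null \<alpha> F \<Longrightarrow> content_null \<alpha> (E \<union> F)"
  using content_null_UN[of \<alpha> "\<lambda>n. if n = 0 then E else F"]
  by (rule content_null_subset) (auto split: if_splits intro: exI[of _ "1::nat"])

text \<open>A cover of total cost at most \<delta>^\<alpha> has no member of diameter above
  \<delta>, so vanishing content forces vanishing Hausdorff measure.\<close>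

lemma content_null_hausdorff_dim:
  fixes E :: "'a::metric_space set"
  assumes E: "content_null \<alpha> E" and \<alpha>: "\<alpha> > 0"
  shows "hausdorff_dim E \<le> ereal \<alpha>"
proof -
  have "hausdorff_content \<alpha> \<delta> E \<le> 0" if d: "\<delta> > 0" for \<delta>
  proof (rule ennreal_le_epsilon)
    fix e :: real assume e: "e > 0"
    define \<epsilon> where "\<epsilon> = min e (\<delta> powr \<alpha>)"
    have eps: "\<epsilon> > 0" using e d by (simp add: \<epsilon>_def)
    have "covered \<alpha> E (ennreal \<epsilon>)" using E eps unfolding content_null_def by simp
    then obtain U where U: "E \<subseteq> (\<Union>n. U n)" "\<And>n. bounded (U n)" "(\<Sum>n. ennreal (diameter (U n) powr \<alpha>)) \<le> ennreal \<epsilon>"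
      by (rule coveredE) (rule that)
    have "diameter (U n) \<le> \<delta>" for n
    proof (rule ccontr)
      assume "\<not> diameter (U n) \<le> \<delta>"
      then have "\<delta> powr \<alpha> < diameter (U n) powr \<alpha>" using d \<alpha> by (intro powr_less_mono2) auto
      moreover have "ennreal (diameter (U n) powr \<alpha>) \<le> (\<Sum>n. ennreal (diameter (U n) powr \<alpha>))"
        by (rule ennreal_suminf_term_le)
      then have "ennreal (diameter (U n) powr \<alpha>) \<le> ennreal \<epsilon>" using U(3) by (rule order_trans)
      then have "diameter (U n) powr \<alpha> \<le> \<epsilon>" using eps by (simp add: ennreal_le_iff)
      ultimately show False by (simp add: \<epsilon>_def)
    qed
    then have "hausdorff_content \<alpha> \<delta> E \<le> (\<Sum>n. ennreal (diameter (U n) powr \<alpha>))"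
      unfolding hausdorff_content_def using U(1,2) by (intro Inf_lower CollectI exI[of _ U]) simp
    also have "\<dots> \<le> ennreal e" using U(3) by (rule order_trans) (simp add: \<epsilon>_def ennreal_leI)
    finally show "hausdorff_content \<alpha> \<delta> E \<le> 0 + ennreal e" by simp
  qed
  then have "hausdorff_measure \<alpha> E = 0"
    unfolding hausdorff_measure_def by (auto intro!: antisym SUP_least)
  then show ?thesis unfolding hausdorff_dim_def using \<alpha> by (intro Inf_lower) auto
qed

section \<open>Superlevel sets have small content\<close>

text \<open>Chebyshev's inequality for content. At a scale m where \<Phi> varies by less than l on a
  cube, the union A of the cubes meeting the set \<Phi> \<ge> 2l still has \<Phi> \<ge> l. The
  Frostman density on A then has mass at most \<eta> / l, and this bounds the cost of its
  cover.\<close>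

lemma covered_superlevel:
  fixes x :: "'a::euclidean_space" and \<Phi> :: "'a \<Rightarrow> real"
  assumes \<alpha>: "0 < \<alpha>" "\<alpha> \<le> real DIM('a)" and nonneg: "\<And>y. \<Phi> y \<ge> 0" and uc: "uniformly_continuous_on UNIV \<Phi>"
    and bound: "\<And>\<mu>. frostman_class \<alpha> (2 ^ DIM('a) * 4 powr \<alpha>) \<mu> \<Longrightarrow> (\<integral>\<^sup>+y. ennreal (\<Phi> y) \<partial>\<mu>) \<le> ennreal \<eta>"
    and l: "l > 0" and \<eta>: "\<eta> \<ge> 0"
  shows "covered \<alpha> ({y. \<Phi> y \<ge> 2 * l} \<inter> dcube (dyadic_unit TYPE('a)) x) (ennreal (real DIM('a) powr \<alpha> * \<eta> / l))"
proof -
  define j where "j = dyadic_unit TYPE('a)"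
  define d where "d = real DIM('a)"
  have d: "d > 0" by (simp add: d_def)
  have [measurable]: "\<Phi> \<in> borel_measurable borel"
    by (intro borel_measurable_continuous_onI uniformly_continuous_imp_continuous uc)
  obtain e where e: "e > 0" "\<And>y z. dist y z < e \<Longrightarrow> dist (\<Phi> y) (\<Phi> z) < l"
    using uc l unfolding uniformly_continuous_on_def by (metis UNIV_I)
  obtain m0 :: nat where m0: "(1 / 2) ^ m0 < e / d" using real_arch_pow_inv[of "e / d" "1 / 2"] e d by auto
  \<comment> \<open>At least j, so that the Frostman construction can end at the cube of scale
    j.\<close>
  define m where "m = max m0 j"
  have "(1 / 2 :: real) ^ m \<le> (1 / 2) ^ m0" unfolding m_def by (intro power_decreasing) auto
  then have "(1 / 2) ^ m < e / d" using m0 by linarith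
  then have md: "d / 2 ^ m < e" using d by (simp add: power_one_over field_simps)
  have mj: "j \<le> m" by (simp add: m_def)
  define A where "A = (\<Union>y\<in>{y. \<Phi> y \<ge> 2 * l}. dcube m y)"
  have A: "dcube m y \<subseteq> A" if "y \<in> A" for y
    using that dcube_eq unfolding A_def by blast
  have A1: "\<Phi> y \<ge> l" if yA: "y \<in> A" for y
  proof -
    obtain z where z: "\<Phi> z \<ge> 2 * l" "y \<in> dcube m z" using yA unfolding A_def by blast
    have "dist z y \<le> d / 2 ^ m" unfolding d_def by (rule dcube_dist[OF dcube_self z(2)])
    then have "dist (\<Phi> z) (\<Phi> y) < l" using md by (intro e(2)) simp
    then show ?thesis using z(1) by (simp add: dist_real_def)
  qed
  obtain w C where w: "frostman_density \<alpha> m A j x w C" using frostman_density_exists[OF A mj] by blast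
  have [measurable]: "w \<in> borel_measurable borel" using w by (simp add: frostman_density_def)
  have supp: "w y = 0" if "y \<notin> A" for y using w that unfolding frostman_density_def by blast
  have "ennreal l * (\<integral>\<^sup>+y. w y \<partial>lborel) = (\<integral>\<^sup>+y. ennreal l * w y \<partial>lborel)" by (simp add: nn_integral_cmult)
  also have "\<dots> \<le> (\<integral>\<^sup>+y. w y * ennreal (\<Phi> y) \<partial>lborel)"
  proof (rule nn_integral_mono)
    fix y
    show "ennreal l * w y \<le> w y * ennreal (\<Phi> y)"
    proof (cases "y \<in> A")
      case True
      then have "w y * ennreal l \<le> w y * ennreal (\<Phi> y)" using A1 by (intro mult_left_mono ennreal_leI) auto
      then show ?thesis by (simp add: mult.commute)
    qed (simp add: supp)
  qed
  also have "\<dots> = (\<integral>\<^sup>+y. ennreal (\<Phi> y) \<partial>density lborel w)" by (subst nn_integral_density) auto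
  also have "\<dots> \<le> ennreal \<eta>" by (rule bound[OF frostman_class_density[OF w \<alpha> j_def mj]])
  finally have I: "ennreal l * (\<integral>\<^sup>+y. w y \<partial>lborel) \<le> ennreal \<eta>" .
  define S where "S = (\<Sum>(i, y)\<leftarrow>C. 2 powr (- real i * \<alpha>))"
  have S0: "S \<ge> 0" unfolding S_def by (intro sum_list_nonneg) auto
  have "ennreal S \<le> (\<integral>\<^sup>+y. w y \<partial>lborel)" using w unfolding frostman_density_def S_def by blast
  then have "ennreal l * ennreal S \<le> ennreal \<eta>" using I by (meson mult_left_mono order_trans zero_le)
  then have "l * S \<le> \<eta>" using l S0 \<eta> by (simp add: ennreal_mult[symmetric])
  then have S: "S \<le> \<eta> / l" using l by (simp add: pos_le_divide_eq mult.commute)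
  define U where "U n = (if n < length C then (case C ! n of (i, y) \<Rightarrow> dcube i y) else {})" for n
  have "{y. \<Phi> y \<ge> 2 * l} \<inter> dcube j x \<subseteq> (\<Union>n. U n)"
  proof
    fix y assume "y \<in> {y. \<Phi> y \<ge> 2 * l} \<inter> dcube j x"
    then have "y \<in> A \<inter> dcube j x" unfolding A_def using dcube_self by blast
    then have "y \<in> (\<Union>(i, y)\<in>set C. dcube i y)" using w unfolding frostman_density_def by blast
    then obtain i z where "(i, z) \<in> set C" "y \<in> dcube i z" by blast
    then obtain n where "n < length C" "C ! n = (i, z)" by (auto simp: in_set_conv_nth)
    then have "y \<in> U n" using \<open>y \<in> dcube i z\<close> by (simp add: U_def)
    then show "y \<in> (\<Union>n. U n)" by blast
  qed
  moreover have "\<And>n. bounded (U n)" using bounded_dcube by (auto simp: U_def split: prod.split)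
  \<comment> \<open>A cube of scale i has diameter at most d 2^(-i), whence the factor
    d^\<alpha>.\<close>
  moreover have "(\<Sum>n. ennreal (diameter (U n) powr \<alpha>)) \<le> ennreal (d powr \<alpha> * \<eta> / l)"
  proof -
    have "(\<Sum>n. ennreal (diameter (U n) powr \<alpha>)) = (\<Sum>n<length C. ennreal (diameter (U n) powr \<alpha>))"
      by (rule suminf_finite) (auto simp: U_def)
    also have "\<dots> \<le> (\<Sum>n<length C. ennreal (d powr \<alpha> * (case C ! n of (i, y) \<Rightarrow> 2 powr (- real i * \<alpha>))))"
    proof (intro sum_mono ennreal_leI)
      fix n assume n: "n \<in> {..<length C}"
      obtain i y where c: "C ! n = (i, y)" by force
      have "diameter (U n) powr \<alpha> \<le> (d / 2 ^ i) powr \<alpha>"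
        using n c diameter_dcube[of i y] \<alpha> diameter_ge_0[OF bounded_dcube[of i y]] by (intro powr_mono2) (auto simp: U_def d_def)
      also have "\<dots> = d powr \<alpha> * 2 powr (- real i * \<alpha>)"
      proof -
        have "(2 ^ i) powr \<alpha> = 2 powr (real i * \<alpha>)" by (simp add: powr_realpow[symmetric] powr_powr)
        then show ?thesis using d by (simp add: powr_divide powr_minus_divide)
      qed
      finally show "diameter (U n) powr \<alpha> \<le> d powr \<alpha> * (case C ! n of (i, y) \<Rightarrow> 2 powr (- real i * \<alpha>))" using c by simp
    qed
    also have "\<dots> = ennreal (d powr \<alpha> * S)"
      by (subst sum_ennreal) (auto simp: S_def sum_list_sum_nth atLeast0LessThan sum_distrib_left split: prod.split)
    also have "\<dots> \<le> ennreal (d powr \<alpha> * \<eta> / l)"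
      using S mult_left_mono[OF S, of "d powr \<alpha>"] by (intro ennreal_leI) simp
    finally show ?thesis .
  qed
  ultimately show ?thesis unfolding j_def[symmetric] d_def[symmetric] by (rule coveredI)
qed

lemma countable_dcubes: "countable (range (dcube m :: 'a::euclidean_space \<Rightarrow> 'a set))"
proof -
  define h where "h g = {z::'a. \<forall>b\<in>Basis. \<lfloor>2 ^ m * (z \<bullet> b)\<rfloor> = g b}" for g
  have "range (dcube m) \<subseteq> h ` PiE Basis (\<lambda>_. UNIV)"
  proof
    fix Q :: "'a set" assume "Q \<in> range (dcube m)"
    then obtain y where y: "Q = dcube m y" by blast
    have inP: "(\<lambda>b\<in>Basis. \<lfloor>2 ^ m * (y \<bullet> b)\<rfloor>) \<in> PiE Basis (\<lambda>_. UNIV)" by auto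
    have eqQ: "Q = h (\<lambda>b\<in>Basis. \<lfloor>2 ^ m * (y \<bullet> b)\<rfloor>)" by (auto simp: y h_def dcube_def)
    show "Q \<in> h ` PiE Basis (\<lambda>_. UNIV)" unfolding eqQ by (rule imageI[OF inP])
  qed
  moreover have "countable (PiE (Basis :: 'a set) (\<lambda>_. UNIV :: int set))" by (intro countable_PiE) auto
  ultimately show ?thesis by (rule countable_subset[OF _ countable_image])
qed

text \<open>The thresholds 2 q^j are summable, so divergence forces \<Phi>_j(y) \<ge> 2 q^j for
  arbitrarily large j. As the integrals decay like q^(2j), the superlevel set at this height has
  content of order q^j in each cube, and tails of this geometric series are small.\<close>

theorem content_null_divergent_series:
  fixes \<Phi> :: "nat \<Rightarrow> 'a::euclidean_space \<Rightarrow> real"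
  assumes \<alpha>: "0 < \<alpha>" "\<alpha> \<le> real DIM('a)" and nonneg: "\<And>j y. \<Phi> j y \<ge> 0"
    and uc: "\<And>j. uniformly_continuous_on UNIV (\<Phi> j)"
    and bound: "\<And>j \<mu>. frostman_class \<alpha> (2 ^ DIM('a) * 4 powr \<alpha>) \<mu> \<Longrightarrow> (\<integral>\<^sup>+y. ennreal (\<Phi> j y) \<partial>\<mu>) \<le> ennreal (B * q ^ (2 * j))"
    and q: "0 < q" "q < 1" and B: "B \<ge> 0"
  shows "content_null \<alpha> {y. \<not> summable (\<lambda>j. \<Phi> j y)}"
proof -
  define u where "u = dyadic_unit TYPE('a)"
  define E where "E = {y. \<not> summable (\<lambda>j. \<Phi> j y)}"
  define M where "M = real DIM('a) powr \<alpha> * B"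
  have M: "M \<ge> 0" using B by (simp add: M_def)
  have E_sub: "E \<subseteq> (\<Union>j. {y. \<Phi> (j + J) y \<ge> 2 * q ^ (j + J)})" for J
  proof
    fix y assume y: "y \<in> E"
    show "y \<in> (\<Union>j. {y. \<Phi> (j + J) y \<ge> 2 * q ^ (j + J)})"
    proof (rule ccontr)
      assume "y \<notin> (\<Union>j. {y. \<Phi> (j + J) y \<ge> 2 * q ^ (j + J)})"
      then have lt: "\<Phi> (i + J) y < 2 * q ^ (i + J)" for i by (auto simp: not_le)
      have le: "norm (\<Phi> j y) \<le> 2 * q ^ j" if "j \<ge> J" for j
        using lt[of "j - J"] nonneg[of j y] that by simp
      have "summable (\<lambda>j. 2 * q ^ j)" using q by (intro summable_mult summable_geometric) auto
      then have "summable (\<lambda>j. \<Phi> j y)" using le by (rule summable_comparison_test')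
      then show False using y by (simp add: E_def)
    qed
  qed
  have cube: "content_null \<alpha> (E \<inter> dcube u x)" for x
    unfolding content_null_def
  proof (intro allI impI)
    fix \<epsilon> :: real assume eps: "\<epsilon> > 0"
    have "(\<lambda>J. M * (q ^ J / (1 - q))) \<longlonglongrightarrow> M * (0 / (1 - q))"
      using q by (intro tendsto_intros LIMSEQ_power_zero) auto
    then have "(\<lambda>J. M * (q ^ J / (1 - q))) \<longlonglongrightarrow> 0" by simp
    from order_tendstoD(2)[OF this eps] obtain J where J: "M * (q ^ J / (1 - q)) < \<epsilon>"
      by (auto simp: eventually_sequentially)
    have "covered \<alpha> ({y. \<Phi> (j + J) y \<ge> 2 * q ^ (j + J)} \<inter> dcube u x) (ennreal (M * q ^ (j + J)))" for j
    proof -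
      have "covered \<alpha> ({y. \<Phi> (j + J) y \<ge> 2 * q ^ (j + J)} \<inter> dcube u x) (ennreal (real DIM('a) powr \<alpha> * (B * q ^ (2 * (j + J))) / q ^ (j + J)))"
        unfolding u_def using q B by (intro covered_superlevel \<alpha> nonneg uc bound) auto
      moreover have "real DIM('a) powr \<alpha> * (B * q ^ (2 * (j + J))) / q ^ (j + J) = M * q ^ (j + J)"
        using q by (simp add: M_def mult_2 power_add)
      ultimately show ?thesis by simp
    qed
    then have "covered \<alpha> (\<Union>j. {y. \<Phi> (j + J) y \<ge> 2 * q ^ (j + J)} \<inter> dcube u x) (\<Sum>j. ennreal (M * q ^ (j + J)))"
      by (rule covered_UN)
    moreover have "(\<Sum>j. ennreal (M * q ^ (j + J))) = ennreal (M * (q ^ J / (1 - q)))"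
    proof -
      have "(\<lambda>j. (M * q ^ J) * q ^ j) sums ((M * q ^ J) * (1 / (1 - q)))"
        using q by (intro sums_mult geometric_sums) auto
      then have "(\<lambda>j. M * q ^ (j + J)) sums (M * (q ^ J / (1 - q)))" by (simp add: power_add mult_ac)
      then show ?thesis using q M by (subst suminf_ennreal2) (auto simp: sums_iff)
    qed
    ultimately show "covered \<alpha> (E \<inter> dcube u x) (ennreal \<epsilon>)"
      using J by (elim covered_mono) (use E_sub[of J] in \<open>auto intro!: ennreal_leI\<close>)
  qed
  \<comment> \<open>Countably many cubes of scale u exhaust the space, and content null sets are
    stable under countable unions.\<close>
  define g where "g = from_nat_into (range (dcube u :: 'a \<Rightarrow> 'a set))"
  have g: "range g = range (dcube u)"
    unfolding g_def by (rule range_from_nat_into[OF _ countable_dcubes]) simp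
  have "content_null \<alpha> (\<Union>n. E \<inter> g n)"
  proof (rule content_null_UN)
    fix n
    have "g n \<in> range (dcube u)" unfolding g[symmetric] by simp
    then obtain x where "g n = dcube u x" by blast
    then show "content_null \<alpha> (E \<inter> g n)" using cube by simp
  qed
  moreover have "E \<subseteq> (\<Union>n. E \<inter> g n)"
  proof
    fix y assume "y \<in> E"
    moreover have "dcube u y \<in> range g" unfolding g by simp
    then obtain n where "g n = dcube u y" by auto
    ultimately show "y \<in> (\<Union>n. E \<inter> g n)" using dcube_self[of y u] by blast
  qed
  ultimately show ?thesis unfolding E_def[symmetric] by (rule content_null_subset)
qed

section \<open>Consequences of the decay of spherical averages\<close>

lemma frostman_const_upper: "r > 0 \<Longrightarrow> ennreal (r powr - \<alpha>) * emeasure \<mu> (cball x r) \<le> frostman_const \<alpha> \<mu>"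
  unfolding frostman_const_def by (rule SUP_upper2[of x], simp) (rule SUP_upper, simp)

lemma frostman_class_emeasure:
  fixes \<mu> :: "'a::euclidean_space measure"
  assumes "frostman_class \<alpha> K \<mu>"
  shows "emeasure \<mu> UNIV \<le> ennreal K"
proof -
  obtain x where x: "emeasure \<mu> (- cball x 1) = 0" and s: "sets \<mu> = sets borel" and c: "frostman_const \<alpha> \<mu> \<le> ennreal K"
    using assms by (auto simp: frostman_class_def)
  have "emeasure \<mu> UNIV = emeasure \<mu> (cball x 1 \<union> - cball x 1)" by simp
  also have "\<dots> \<le> emeasure \<mu> (cball x 1) + emeasure \<mu> (- cball x 1)"
    by (rule emeasure_subadditive) (simp_all add: s)
  also have "\<dots> = ennreal (1 powr - \<alpha>) * emeasure \<mu> (cball x 1)" using x by simp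
  also have "\<dots> \<le> frostman_const \<alpha> \<mu>" by (rule frostman_const_upper) simp
  finally show ?thesis using c by (rule order_trans)
qed

lemma frostman_class_finite: "frostman_class \<alpha> K \<mu> \<Longrightarrow> finite_measure \<mu>"
  using frostman_class_emeasure[of \<alpha> K \<mu>]
  by (intro finite_measureI) (auto simp: frostman_class_def sets_eq_imp_space_eq[of \<mu> borel] top_unique)

text \<open>The transform of the restriction of \<mu> to A, with the sign of the wave integral and
  without the factor (2 pi)^(-d/2). The set A is the test object of the duality in
  \<open>nn_integral_norm_by_sets\<close>; restricting to it does not increase the Frostman
  constant.\<close>

definition wave_transform :: "'a::euclidean_space measure \<Rightarrow> 'a set \<Rightarrow> 'a \<Rightarrow> complex" where
  "wave_transform \<mu> A \<xi> = (LINT x|\<mu>. indicator A x * cis (x \<bullet> \<xi>))"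

text \<open>The decay hypothesis only concerns measures on the unit ball; a translation changes the Fourier
  transform by a unimodular factor.\<close>

lemma wave_transform_decay:
  fixes \<mu> :: "'a::euclidean_space measure"
  assumes dec: "\<And>R \<mu>. R > 1 \<Longrightarrow> dimensional_measure \<alpha> (\<mu> :: 'a measure) \<Longrightarrow>
     (\<integral>\<^sup>+ \<omega>. ennreal ((cmod (fourier_measure \<mu> (R *\<^sub>R \<omega>)))\<^sup>2) \<partial>sphere_measure)
       \<le> ennreal C * frostman_const \<alpha> \<mu> * emeasure \<mu> UNIV * ennreal (R powr (- \<beta>))"
    and \<mu>: "frostman_class \<alpha> K \<mu>" and A [measurable]: "A \<in> sets borel" and R: "R > 1"
  shows "(\<integral>\<^sup>+ \<omega>. ennreal ((cmod (wave_transform \<mu> A (R *\<^sub>R \<omega>)))\<^sup>2) \<partial>sphere_measure)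
    \<le> ennreal ((2 * pi) powr real DIM('a) * \<bar>C\<bar> * \<bar>K\<bar>\<^sup>2 * R powr (- \<beta>))"
proof -
  obtain x0 where x0: "emeasure \<mu> (- cball x0 1) = 0" and s [simp, measurable_cong]: "sets \<mu> = sets borel" and c: "frostman_const \<alpha> \<mu> \<le> ennreal K"
    using \<mu> by (auto simp: frostman_class_def)
  have sp [simp]: "space \<mu> = UNIV" using sets_eq_imp_space_eq[OF s] by simp
  interpret finite_measure \<mu> by (rule frostman_class_finite[OF \<mu>])
  define M where "M = density \<mu> (\<lambda>x. ennreal (indicator A x))"
  have [simp, measurable_cong]: "sets M = sets borel" by (simp add: M_def)
  have [simp]: "space M = UNIV" by (simp add: M_def)
  \<comment> \<open>The restriction of \<mu> to A, moved so that it lives on the unit ball around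
    0.\<close>
  define \<nu> where "\<nu> = distr M borel (\<lambda>x. x - x0)"
  have le: "emeasure \<nu> B \<le> emeasure \<mu> ((\<lambda>x. x - x0) -` B)" if [measurable]: "B \<in> sets borel" for B
  proof -
    have m [measurable]: "(\<lambda>x. x - x0) -` B \<in> sets borel"
      using measurable_sets[of "\<lambda>x. x - x0" borel borel B] by simp
    have "emeasure \<nu> B = emeasure M ((\<lambda>x. x - x0) -` B)"
      unfolding \<nu>_def by (subst emeasure_distr) auto
    also have "\<dots> = (\<integral>\<^sup>+x. ennreal (indicator A x) * indicator ((\<lambda>x. x - x0) -` B) x \<partial>\<mu>)"
      unfolding M_def by (rule emeasure_density) auto
    also have "\<dots> \<le> (\<integral>\<^sup>+x. indicator ((\<lambda>x. x - x0) -` B) x \<partial>\<mu>)"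
      by (intro nn_integral_mono) (auto simp: indicator_def)
    finally show ?thesis by simp
  qed
  have v1: "(\<lambda>x. x - x0) -` cball z r = cball (z + x0) r" for z r
  proof -
    have "dist z (x - x0) = dist (z + x0) x" for x by (simp add: dist_norm algebra_simps)
    then show ?thesis by auto
  qed
  have v2: "(\<lambda>x. x - x0) -` (- cball 0 1) = - cball x0 1"
    using v1[of 0 1] by (simp add: vimage_Compl)
  have fc: "frostman_const \<alpha> \<nu> \<le> ennreal K"
    unfolding frostman_const_def
  proof (intro SUP_least)
    fix z :: 'a and r :: real assume "r \<in> {0<..}"
    then have "ennreal (r powr - \<alpha>) * emeasure \<nu> (cball z r) \<le> ennreal (r powr - \<alpha>) * emeasure \<mu> (cball (z + x0) r)"
      using le[of "cball z r"] by (intro mult_left_mono) (auto simp: v1)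
    also have "\<dots> \<le> frostman_const \<alpha> \<mu>" using \<open>r \<in> {0<..}\<close> by (intro frostman_const_upper) simp
    finally show "ennreal (r powr - \<alpha>) * emeasure \<nu> (cball z r) \<le> ennreal K" using c by (rule order_trans)
  qed
  have "emeasure \<nu> (- cball 0 1) \<le> 0" using le[of "- cball 0 1"] x0 by (simp add: v2)
  then have dim: "dimensional_measure \<alpha> \<nu>"
    unfolding dimensional_measure_def using le_less_trans[OF fc] by (auto simp: \<nu>_def)
  have mass: "emeasure \<nu> UNIV \<le> ennreal K"
    using le[of UNIV] frostman_class_emeasure[OF \<mu>] by simp
  define k where "k = (2 * pi) powr (- real DIM('a) / 2)"
  have k: "k > 0" by (simp add: k_def)
  have eq: "cmod (fourier_measure \<nu> \<xi>) = k * cmod (wave_transform \<mu> A \<xi>)" for \<xi>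
  proof -
    have "(LINT x|\<nu>. cis (- (x \<bullet> \<xi>))) = (LINT x|M. cis (- ((x - x0) \<bullet> \<xi>)))"
      unfolding \<nu>_def by (subst integral_distr) auto
    also have "\<dots> = (LINT x|\<mu>. indicator A x *\<^sub>R cis (- ((x - x0) \<bullet> \<xi>)))"
      unfolding M_def by (subst integral_density) auto
    also have "\<dots> = (LINT x|\<mu>. cis (x0 \<bullet> \<xi>) * cnj (indicator A x * cis (x \<bullet> \<xi>)))"
      by (intro Bochner_Integration.integral_cong) (auto simp: indicator_def cis_cnj cis_mult inner_diff_left)
    also have "\<dots> = cis (x0 \<bullet> \<xi>) * cnj (wave_transform \<mu> A \<xi>)"
      unfolding wave_transform_def integral_mult_right_zero Bochner_Integration.integral_cnj ..
    finally show ?thesis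
      unfolding fourier_measure_def k_def[symmetric] using k by (simp add: norm_mult)
  qed
  have meas [measurable]: "wave_transform \<mu> A \<in> borel_measurable borel"
    unfolding wave_transform_def[abs_def] by measurable
  have "(\<integral>\<^sup>+ \<omega>. ennreal ((cmod (wave_transform \<mu> A (R *\<^sub>R \<omega>)))\<^sup>2) \<partial>sphere_measure)
    = (\<integral>\<^sup>+ \<omega>. ennreal (1 / k\<^sup>2) * ennreal ((cmod (fourier_measure \<nu> (R *\<^sub>R \<omega>)))\<^sup>2) \<partial>sphere_measure)"
    unfolding eq using k by (intro nn_integral_cong) (simp add: ennreal_mult[symmetric] power_mult_distrib)
  also have "\<dots> = ennreal (1 / k\<^sup>2) * (\<integral>\<^sup>+ \<omega>. ennreal ((cmod (fourier_measure \<nu> (R *\<^sub>R \<omega>)))\<^sup>2) \<partial>sphere_measure)"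
    unfolding eq by (rule nn_integral_cmult) measurable
  also have "\<dots> \<le> ennreal (1 / k\<^sup>2) * (ennreal C * frostman_const \<alpha> \<nu> * emeasure \<nu> UNIV * ennreal (R powr (- \<beta>)))"
    by (intro mult_left_mono dec R dim) simp
  \<comment> \<open>One factor K bounds the Frostman constant and one the mass; the modulus of C is
    taken because C may be negative.\<close>
  also have "\<dots> \<le> ennreal (1 / k\<^sup>2) * (ennreal \<bar>C\<bar> * ennreal \<bar>K\<bar> * ennreal \<bar>K\<bar> * ennreal (R powr (- \<beta>)))"
    by (intro mult_left_mono mult_right_mono mult_mono order_trans[OF fc] order_trans[OF mass] ennreal_leI) auto
  also have "\<dots> = ennreal (1 / k\<^sup>2 * (\<bar>C\<bar> * \<bar>K\<bar> * \<bar>K\<bar> * R powr (- \<beta>)))"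
    using k by (simp add: ennreal_mult[symmetric])
  also have "1 / k\<^sup>2 = (2 * pi) powr real DIM('a)"
  proof -
    have "k\<^sup>2 = (2 * pi) powr (- real DIM('a))"
      unfolding k_def power2_eq_square powr_add[symmetric] by simp
    then show ?thesis by (simp add: powr_minus_divide)
  qed
  finally show ?thesis by (simp add: power2_eq_square mult_ac)
qed

lemma integral_abs_le_by_sets:
  fixes g :: "'b \<Rightarrow> real"
  assumes g: "integrable M g" and B: "\<And>A. A \<in> sets M \<Longrightarrow> \<bar>LINT x|M. indicator A x * g x\<bar> \<le> B"
  shows "(LINT x|M. \<bar>g x\<bar>) \<le> 2 * B"
proof -
  have [measurable]: "g \<in> borel_measurable M" using g by auto
  define P where "P = {x \<in> space M. g x \<ge> 0}"
  have P: "P \<in> sets M" "space M - P \<in> sets M" unfolding P_def by measurable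
  have i: "integrable M (\<lambda>x. indicator A x * g x)" if "A \<in> sets M" for A
    using integrable_mult_indicator[OF that g] by simp
  have "(LINT x|M. \<bar>g x\<bar>) = (LINT x|M. indicator P x * g x - indicator (space M - P) x * g x)"
    by (intro Bochner_Integration.integral_cong) (auto simp: P_def indicator_def)
  also have "\<dots> = (LINT x|M. indicator P x * g x) - (LINT x|M. indicator (space M - P) x * g x)"
    by (rule Bochner_Integration.integral_diff[OF i[OF P(1)] i[OF P(2)]])
  also have "\<dots> \<le> 2 * B" using B[OF P(1)] B[OF P(2)] by linarith
  finally show ?thesis .
qed

text \<open>Indicator functions take the role of the dual unimodular function: real and imaginary
  part, each split by its sign, give four sets and the factor 4. Indicators keep the test within
  restrictions of one measure.\<close>

lemma nn_integral_norm_by_sets: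
  fixes f :: "'b \<Rightarrow> complex"
  assumes f: "integrable M f" and B: "\<And>A. A \<in> sets M \<Longrightarrow> cmod (LINT x|M. indicator A x * f x) \<le> B"
  shows "(\<integral>\<^sup>+x. ennreal (cmod (f x)) \<partial>M) \<le> ennreal (4 * B)"
proof -
  have iA: "integrable M (\<lambda>x. indicator A x * f x)" if "A \<in> sets M" for A
    using integrable_mult_indicator_complex[OF f that] by (simp add: mult.commute)
  have re: "\<bar>LINT x|M. indicator A x * Re (f x)\<bar> \<le> B" if A: "A \<in> sets M" for A
  proof -
    have "(LINT x|M. indicator A x * Re (f x)) = (LINT x|M. Re (indicator A x * f x))"
      by (intro Bochner_Integration.integral_cong) (auto simp: indicator_def)
    also have "\<dots> = Re (LINT x|M. indicator A x * f x)" by (rule integral_Re[OF iA[OF A]])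
    finally show ?thesis using abs_Re_le_cmod B[OF A] order_trans by metis
  qed
  have im: "\<bar>LINT x|M. indicator A x * Im (f x)\<bar> \<le> B" if A: "A \<in> sets M" for A
  proof -
    have "(LINT x|M. indicator A x * Im (f x)) = (LINT x|M. Im (indicator A x * f x))"
      by (intro Bochner_Integration.integral_cong) (auto simp: indicator_def)
    also have "\<dots> = Im (LINT x|M. indicator A x * f x)" by (rule integral_Im[OF iA[OF A]])
    finally show ?thesis using abs_Im_le_cmod B[OF A] order_trans by metis
  qed
  have iR: "integrable M (\<lambda>x. Re (f x))" and iI: "integrable M (\<lambda>x. Im (f x))" using f by auto
  have "(\<integral>\<^sup>+x. ennreal (cmod (f x)) \<partial>M) = ennreal (LINT x|M. cmod (f x))"
    using f by (intro nn_integral_eq_integral) auto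
  also have "(LINT x|M. cmod (f x)) \<le> (LINT x|M. \<bar>Re (f x)\<bar> + \<bar>Im (f x)\<bar>)"
    using f iR iI by (intro integral_mono) (auto simp: cmod_le)
  also have "\<dots> = (LINT x|M. \<bar>Re (f x)\<bar>) + (LINT x|M. \<bar>Im (f x)\<bar>)"
    using iR iI by (intro Bochner_Integration.integral_add) auto
  also have "\<dots> \<le> 4 * B"
    using integral_abs_le_by_sets[OF iR re] integral_abs_le_by_sets[OF iI im] by linarith
  finally show ?thesis by (simp add: ennreal_leI)
qed

section \<open>Spherical slices\<close>

text \<open>One sphere of the inversion integral, over unit directions; the weight r^(d-1) sits in
  \<open>radial_measure\<close>.\<close>

definition slice :: "('a::euclidean_space \<Rightarrow> complex) \<Rightarrow> 'a \<Rightarrow> real \<Rightarrow> complex" where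
  "slice g x r = (LINT w|sphere_measure. g (r *\<^sub>R w) * cis (x \<bullet> (r *\<^sub>R w)))"

text \<open>Controls the wave at x uniformly in time: multiplying g by a radial factor of modulus at
  most 1, such as the phase exp(itr), does not increase it.\<close>

definition slice_norm :: "('a::euclidean_space \<Rightarrow> complex) \<Rightarrow> 'a \<Rightarrow> real" where
  "slice_norm g x = (LINT r|radial_measure TYPE('a). cmod (slice g x r))"

lemma slice_measurable [measurable (raw)]:
  assumes [measurable]: "g \<in> borel_measurable borel" "u \<in> borel_measurable M" "v \<in> borel_measurable M"
  shows "(\<lambda>z. slice g (u z) (v z)) \<in> borel_measurable M"
  unfolding slice_def by measurable

lemma
  fixes g :: "'a::euclidean_space \<Rightarrow> complex"
  assumes g: "integrable lborel g"
  shows slice_integrable: "integrable (radial_measure TYPE('a)) (slice g x)"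
    and integral_slice: "(LINT r|radial_measure TYPE('a). slice g x r) = (LINT \<xi>|lborel. g \<xi> * cis (x \<bullet> \<xi>))"
proof -
  have i: "integrable lborel (\<lambda>\<xi>. g \<xi> * cis (x \<bullet> \<xi>))" by (rule cis_mult_integrable[OF g]) measurable
  show "integrable (radial_measure TYPE('a)) (slice g x)"
    unfolding slice_def[abs_def] using integrable_polar[OF i] .
  show "(LINT r|radial_measure TYPE('a). slice g x r) = (LINT \<xi>|lborel. g \<xi> * cis (x \<bullet> \<xi>))"
    unfolding slice_def using integral_polar[OF i] ..
qed

lemma slice_norm_nonneg [simp]: "slice_norm g x \<ge> 0"
  by (simp add: slice_norm_def)

lemma norm_cis_diff_le: "cmod (cis a - cis b) \<le> \<bar>a - b\<bar>"
proof -
  have "cis a - cis b = cis b * (cis (a - b) - 1)"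
    by (simp add: right_diff_distrib cis_mult)
  then have "cmod (cis a - cis b) = cmod (cis (a - b) - 1)" by (simp add: norm_mult)
  also have "\<dots> \<le> \<bar>a - b\<bar>" using iexp_approx1[of "a - b" 0] by (simp add: cis_conv_exp)
  finally show ?thesis .
qed

lemma lipschitz_uniformly_continuous:
  fixes \<Phi> :: "'a::metric_space \<Rightarrow> real"
  assumes "\<And>x y. \<bar>\<Phi> x - \<Phi> y\<bar> \<le> L * dist x y"
  shows "uniformly_continuous_on UNIV \<Phi>"
  unfolding uniformly_continuous_on_def
proof (intro allI impI)
  fix e :: real assume e: "e > 0"
  have "\<bar>\<Phi> x - \<Phi> y\<bar> < e" if "dist x y < e / (\<bar>L\<bar> + 1)" for x y
  proof -
    have "\<bar>\<Phi> x - \<Phi> y\<bar> \<le> \<bar>L\<bar> * dist x y"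
      by (rule order_trans[OF assms]) (simp add: mult_right_mono)
    also have "\<dots> \<le> (\<bar>L\<bar> + 1) * dist x y" by (simp add: mult_right_mono)
    also have "\<dots> < e" using that by (simp add: pos_less_divide_eq mult.commute)
    finally show ?thesis .
  qed
  then show "\<exists>d>0. \<forall>x\<in>UNIV. \<forall>x'\<in>UNIV. dist x' x < d \<longrightarrow> dist (\<Phi> x') (\<Phi> x) < e"
    using e by (intro exI[of _ "e / (\<bar>L\<bar> + 1)"]) (auto simp: dist_real_def)
qed

text \<open>Compact frequency support bounds the phase difference by \<rho> |x - y|. The constant
  may grow with \<rho>, as it serves the uniform continuity of one term at a time.\<close>

lemma slice_norm_lipschitz:
  fixes g :: "'a::euclidean_space \<Rightarrow> complex"
  assumes g: "integrable lborel g" and supp: "\<And>\<xi>. norm \<xi> > \<rho> \<Longrightarrow> g \<xi> = 0" and \<rho>: "\<rho> \<ge> 0"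
  shows "\<bar>slice_norm g x - slice_norm g y\<bar> \<le> (\<rho> * (LINT \<xi>|lborel. cmod (g \<xi>))) * dist x y"
proof -
  have ig: "integrable lborel (\<lambda>\<xi>. cmod (g \<xi>))" using g by simp
  have [measurable]: "g \<in> borel_measurable borel" using borel_measurable_integrable[OF g] by simp
  have iN: "integrable (radial_measure TYPE('a)) (\<lambda>r. LINT w|sphere_measure. cmod (g (r *\<^sub>R w)))"
    by (rule integrable_polar[OF ig])
  have "\<bar>slice_norm g x - slice_norm g y\<bar> = \<bar>LINT r|radial_measure TYPE('a). cmod (slice g x r) - cmod (slice g y r)\<bar>"
    unfolding slice_norm_def using slice_integrable[OF g]
    by (subst Bochner_Integration.integral_diff) auto
  also have "\<dots> \<le> (LINT r|radial_measure TYPE('a). \<bar>cmod (slice g x r) - cmod (slice g y r)\<bar>)"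
    by (rule integral_abs_bound)
  also have "\<dots> \<le> (LINT r|radial_measure TYPE('a). (\<rho> * dist x y) * (LINT w|sphere_measure. cmod (g (r *\<^sub>R w))))"
  proof (rule integral_mono_AE)
    show "integrable (radial_measure TYPE('a)) (\<lambda>r. \<bar>cmod (slice g x r) - cmod (slice g y r)\<bar>)"
      using slice_integrable[OF g] by auto
    show "integrable (radial_measure TYPE('a)) (\<lambda>r. (\<rho> * dist x y) * (LINT w|sphere_measure. cmod (g (r *\<^sub>R w))))"
      using iN by simp
    show "AE r in radial_measure TYPE('a). \<bar>cmod (slice g x r) - cmod (slice g y r)\<bar> \<le> (\<rho> * dist x y) * (LINT w|sphere_measure. cmod (g (r *\<^sub>R w)))"
      using AE_integrable_polar[OF g]
    proof eventually_elim
      fix r assume i: "integrable sphere_measure (\<lambda>w::'a. g (r *\<^sub>R w))"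
      have ii: "integrable sphere_measure (\<lambda>w::'a. g (r *\<^sub>R w) * cis (z \<bullet> (r *\<^sub>R w)))" for z
        by (rule cis_mult_integrable[OF i]) measurable
      have "\<bar>cmod (slice g x r) - cmod (slice g y r)\<bar> \<le> cmod (slice g x r - slice g y r)" by (rule norm_triangle_ineq3)
      also have "slice g x r - slice g y r = (LINT w|sphere_measure. g (r *\<^sub>R w) * cis (x \<bullet> (r *\<^sub>R w)) - g (r *\<^sub>R w) * cis (y \<bullet> (r *\<^sub>R w)))"
        unfolding slice_def by (rule Bochner_Integration.integral_diff[OF ii ii, symmetric])
      also have "cmod \<dots> \<le> (LINT w|sphere_measure. (\<rho> * dist x y) * cmod (g (r *\<^sub>R w)))"
      proof (rule Bochner_Integration.integral_norm_bound_integral)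
        show "integrable sphere_measure (\<lambda>w::'a. g (r *\<^sub>R w) * cis (x \<bullet> (r *\<^sub>R w)) - g (r *\<^sub>R w) * cis (y \<bullet> (r *\<^sub>R w)))"
          by (rule Bochner_Integration.integrable_diff[OF ii ii])
        show "integrable sphere_measure (\<lambda>w::'a. (\<rho> * dist x y) * cmod (g (r *\<^sub>R w)))" using i by simp
        fix w :: 'a
        show "cmod (g (r *\<^sub>R w) * cis (x \<bullet> (r *\<^sub>R w)) - g (r *\<^sub>R w) * cis (y \<bullet> (r *\<^sub>R w))) \<le> (\<rho> * dist x y) * cmod (g (r *\<^sub>R w))"
        proof (cases "norm (r *\<^sub>R w) > \<rho>")
          case True
          then show ?thesis using supp[OF True] by simp
        next
          case False
          have "cmod (g (r *\<^sub>R w) * cis (x \<bullet> (r *\<^sub>R w)) - g (r *\<^sub>R w) * cis (y \<bullet> (r *\<^sub>R w))) = cmod (g (r *\<^sub>R w)) * cmod (cis (x \<bullet> (r *\<^sub>R w)) - cis (y \<bullet> (r *\<^sub>R w)))"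
            by (simp only: right_diff_distrib[symmetric] norm_mult)
          also have "\<dots> \<le> cmod (g (r *\<^sub>R w)) * \<bar>(x - y) \<bullet> (r *\<^sub>R w)\<bar>"
            using norm_cis_diff_le[of "x \<bullet> (r *\<^sub>R w)" "y \<bullet> (r *\<^sub>R w)"] by (intro mult_left_mono) (simp_all only: inner_diff_left norm_ge_zero)
          also have "\<dots> \<le> cmod (g (r *\<^sub>R w)) * (norm (x - y) * norm (r *\<^sub>R w))"
            by (intro mult_left_mono Cauchy_Schwarz_ineq2) simp
          also have "\<dots> \<le> cmod (g (r *\<^sub>R w)) * (norm (x - y) * \<rho>)"
            using False by (intro mult_left_mono) (simp_all only: norm_ge_zero not_less)
          finally show ?thesis by (simp only: dist_norm mult_ac)
        qed
      qed
      finally show "\<bar>cmod (slice g x r) - cmod (slice g y r)\<bar> \<le> (\<rho> * dist x y) * (LINT w|sphere_measure. cmod (g (r *\<^sub>R w)))"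
        by simp
    qed
  qed
  also have "\<dots> = (\<rho> * dist x y) * (LINT \<xi>|lborel. cmod (g \<xi>))"
    by (simp only: integral_mult_right_zero integral_polar[OF ig])
  finally show ?thesis by (simp only: mult_ac)
qed

text \<open>On a fixed sphere Fubini turns the integral of the slice over A into a pairing of g with
  the transform of \<mu> restricted to A. Cauchy-Schwarz on the sphere then meets the spherical
  averages of the decay hypothesis.\<close>

lemma slice_duality:
  fixes g :: "'a::euclidean_space \<Rightarrow> complex" and \<mu> :: "'a measure"
  assumes [measurable]: "g \<in> borel_measurable borel" and s [simp, measurable_cong]: "sets \<mu> = sets borel" and fin: "finite_measure \<mu>"
    and i: "integrable sphere_measure (\<lambda>w::'a. g (r *\<^sub>R w))"
    and n: "(\<integral>\<^sup>+w. (ennreal (cmod (g (r *\<^sub>R w))))\<^sup>2 \<partial>sphere_measure) \<le> ennreal n" "n \<ge> 0"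
    and E: "\<And>A. A \<in> sets borel \<Longrightarrow> (\<integral>\<^sup>+w. ennreal ((cmod (wave_transform \<mu> A (r *\<^sub>R w)))\<^sup>2) \<partial>sphere_measure) \<le> ennreal E" "E \<ge> 0"
  shows "(\<integral>\<^sup>+x. ennreal (cmod (slice g x r)) \<partial>\<mu>) \<le> ennreal (4 * sqrt (n * E))"
proof (rule nn_integral_norm_by_sets)
  interpret finite_measure \<mu> by (rule fin)
  interpret P: pair_sigma_finite \<mu> "sphere_measure :: 'a measure"
    by (simp add: pair_sigma_finite_def sphere.sigma_finite_measure_axioms sigma_finite_measure_axioms)
  show "integrable \<mu> (\<lambda>x. slice g x r)"
  proof (rule integrable_const_bound[where B = "LINT w|sphere_measure. cmod (g (r *\<^sub>R (w::'a)))"])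
    show "AE x in \<mu>. cmod (slice g x r) \<le> (LINT w|sphere_measure. cmod (g (r *\<^sub>R (w::'a))))"
      unfolding slice_def by (intro AE_I2 order_trans[OF integral_norm_bound]) (simp add: norm_mult)
  qed measurable
  fix A assume "A \<in> sets \<mu>"
  then have [measurable]: "A \<in> sets borel" by simp
  have [measurable]: "wave_transform \<mu> A \<in> borel_measurable borel"
    unfolding wave_transform_def[abs_def] by measurable
  have iA: "integrable \<mu> (\<lambda>x. indicator A x :: complex)"
    by (rule integrable_const_bound[where B = 1]) (auto simp: indicator_def)
  have ip: "integrable (\<mu> \<Otimes>\<^sub>M sphere_measure) (\<lambda>(x, w). indicator A x * g (r *\<^sub>R w) * cis (x \<bullet> (r *\<^sub>R w)))"
    by (rule P.integrable_cis_product[OF iA i]) measurable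
  have "(LINT x|\<mu>. indicator A x * slice g x r) = (LINT x|\<mu>. LINT w|sphere_measure. indicator A x * g (r *\<^sub>R w) * cis (x \<bullet> (r *\<^sub>R w)))"
    unfolding slice_def by (simp only: integral_mult_right_zero[symmetric] mult.assoc)
  also have "\<dots> = (LINT w|sphere_measure. LINT x|\<mu>. indicator A x * g (r *\<^sub>R w) * cis (x \<bullet> (r *\<^sub>R w)))"
    by (rule P.Fubini_integral[OF ip, symmetric])
  also have "\<dots> = (LINT w|sphere_measure. g (r *\<^sub>R w) * wave_transform \<mu> A (r *\<^sub>R w))"
    unfolding wave_transform_def integral_mult_right_zero[symmetric]
    by (intro Bochner_Integration.integral_cong refl) (simp only: mult_ac)
  finally have e: "(LINT x|\<mu>. indicator A x * slice g x r) = (LINT w|sphere_measure. g (r *\<^sub>R w) * wave_transform \<mu> A (r *\<^sub>R w))" .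
  have "ennreal (cmod (LINT x|\<mu>. indicator A x * slice g x r)) \<le> (\<integral>\<^sup>+w. ennreal (cmod (g (r *\<^sub>R w))) * ennreal (cmod (wave_transform \<mu> A (r *\<^sub>R w))) \<partial>sphere_measure)"
    unfolding e by (rule order_trans[OF norm_integral_le_nn_integral]) (simp add: norm_mult ennreal_mult)
  also have "\<dots> \<le> ennreal (sqrt (n * E))"
  proof (rule nn_integral_Cauchy_Schwarz[OF _ _ n(1) _ n(2) E(2)])
    show "(\<integral>\<^sup>+w. (ennreal (cmod (wave_transform \<mu> A (r *\<^sub>R w))))\<^sup>2 \<partial>sphere_measure) \<le> ennreal E"
      using E(1)[of A] by (simp add: ennreal_power)
  qed measurable
  finally show "cmod (LINT x|\<mu>. indicator A x * slice g x r) \<le> sqrt (n * E)"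
    using n(2) E(2) by (simp add: ennreal_le_iff)
qed

lemma AE_radial_pos: "AE r in radial_measure TYPE('a::euclidean_space). r > 0"
  unfolding radial_measure_def by (subst AE_density) (auto simp: indicator_def)

lemma nn_integral_polar_radial:
  fixes f :: "'a::euclidean_space \<Rightarrow> ennreal"
  assumes [measurable]: "f \<in> borel_measurable borel"
  shows "(\<integral>\<^sup>+x. f x \<partial>lborel) = (\<integral>\<^sup>+r. (\<integral>\<^sup>+w. f (r *\<^sub>R w) \<partial>sphere_measure) \<partial>radial_measure TYPE('a))"
  by (subst nn_integral_polar, measurable, subst nn_integral_radial, measurable)

lemma nn_integral_radial_powr:
  assumes p: "real DIM('a::euclidean_space) + p < 0" and a: "a > 0"
  shows "(\<integral>\<^sup>+r. ennreal (indicator {a..} r * r powr p) \<partial>radial_measure TYPE('a)) = ennreal (a powr (real DIM('a) + p) / (- (real DIM('a) + p)))"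
proof -
  define q where "q = real DIM('a) - 1 + p"
  have "(\<integral>\<^sup>+r. ennreal (indicator {a..} r * r powr p) \<partial>radial_measure TYPE('a)) =
    (\<integral>\<^sup>+r. ennreal (indicator {0<..} r * r ^ (DIM('a) - 1)) * ennreal (indicator {a..} r * r powr p) \<partial>lborel)"
    by (rule nn_integral_radial) measurable
  also have "\<dots> = (\<integral>\<^sup>+r. ennreal (indicator {a..} r * r powr q) \<partial>lborel)"
  proof (rule nn_integral_cong)
    fix r :: real
    show "ennreal (indicator {0<..} r * r ^ (DIM('a) - 1)) * ennreal (indicator {a..} r * r powr p) = ennreal (indicator {a..} r * r powr q)"
    proof (cases "r \<ge> a")
      case True
      then have r: "r > 0" using a by simp
      have "r ^ (DIM('a) - 1) = r powr (real DIM('a) - 1)"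
        using powr_realpow[OF r, of "DIM('a) - 1"] by (simp add: of_nat_diff Suc_le_eq)
      then have "r ^ (DIM('a) - 1) * r powr p = r powr q" by (simp only: powr_add[symmetric] q_def)
      then show ?thesis using True r by (simp add: ennreal_mult[symmetric])
    qed (simp add: indicator_def)
  qed
  also have "\<dots> = ennreal (a powr (q + 1) / (- (q + 1)))"
    by (rule nn_integral_powr_1_inf) (use p a in \<open>simp_all add: q_def\<close>)
  also have "q + 1 = real DIM('a) + p" by (simp add: q_def)
  finally show ?thesis .
qed

text \<open>After duality on each sphere, Cauchy-Schwarz in r pairs r^(-t-\<beta>/2) with r^t times
  the L2 norm of g on the sphere. Against r^(d-1) dr the square of the first factor has integral
  a^(-\<kappa>) / \<kappa> over [a, \<infinity>), as \<kappa> > 0. Here t is a smoothness exponent,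
  not time.\<close>

lemma slice_norm_bound:
  fixes g :: "'a::euclidean_space \<Rightarrow> complex" and \<mu> :: "'a measure"
  assumes g: "integrable lborel g" and s [simp, measurable_cong]: "sets \<mu> = sets borel" and fin: "finite_measure \<mu>"
    and E: "\<And>A R. A \<in> sets borel \<Longrightarrow> R > 1 \<Longrightarrow>
      (\<integral>\<^sup>+w. ennreal ((cmod (wave_transform \<mu> A (R *\<^sub>R w)))\<^sup>2) \<partial>sphere_measure) \<le> ennreal (D * R powr (- \<beta>))" and D: "D \<ge> 0"
    and supp: "\<And>\<xi>. norm \<xi> \<le> a \<Longrightarrow> g \<xi> = 0" and a: "a \<ge> 1"
    and N: "(\<integral>\<^sup>+\<xi>. (ennreal (norm \<xi> powr t * cmod (g \<xi>)))\<^sup>2 \<partial>lborel) \<le> ennreal N" "N \<ge> 0"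
    and \<kappa>: "\<kappa> = 2 * t + \<beta> - real DIM('a)" "\<kappa> > 0"
  shows "(\<integral>\<^sup>+x. ennreal (slice_norm g x) \<partial>\<mu>) \<le> ennreal (4 * sqrt D * sqrt (a powr (- \<kappa>) / \<kappa> * N))"
proof -
  have [measurable]: "g \<in> borel_measurable borel" using borel_measurable_integrable[OF g] by simp
  interpret finite_measure \<mu> by (rule fin)
  interpret P: pair_sigma_finite \<mu> "radial_measure TYPE('a)"
    by (simp add: pair_sigma_finite_def sigma_finite_radial sigma_finite_measure_axioms)
  define n where "n r = (\<integral>\<^sup>+w. (ennreal (cmod (g (r *\<^sub>R w))))\<^sup>2 \<partial>(sphere_measure :: 'a measure))" for r
  have [measurable]: "n \<in> borel_measurable borel" unfolding n_def by measurable
  define m where "m r = r powr t * sqrt (enn2real (n r))" for r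
  have m0: "m r \<ge> 0" for r by (simp add: m_def)
  have N': "(\<integral>\<^sup>+r. ennreal ((r powr t)\<^sup>2) * n r \<partial>radial_measure TYPE('a)) \<le> ennreal N"
  proof -
    have "(\<integral>\<^sup>+r. ennreal ((r powr t)\<^sup>2) * n r \<partial>radial_measure TYPE('a)) = (\<integral>\<^sup>+r. (\<integral>\<^sup>+w. (ennreal (norm (r *\<^sub>R w) powr t * cmod (g (r *\<^sub>R w))))\<^sup>2 \<partial>(sphere_measure :: 'a measure)) \<partial>radial_measure TYPE('a))"
    proof (intro nn_integral_cong_AE eventually_mono[OF AE_radial_pos])
      fix r :: real assume r: "r > 0"
      have "ennreal ((r powr t)\<^sup>2) * n r = (\<integral>\<^sup>+w. ennreal ((r powr t)\<^sup>2) * (ennreal (cmod (g (r *\<^sub>R w))))\<^sup>2 \<partial>(sphere_measure :: 'a measure))"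
        unfolding n_def by (rule nn_integral_cmult[symmetric]) measurable
      also have "\<dots> = (\<integral>\<^sup>+w. (ennreal (norm (r *\<^sub>R w) powr t * cmod (g (r *\<^sub>R w))))\<^sup>2 \<partial>(sphere_measure :: 'a measure))"
        by (intro nn_integral_cong_AE eventually_mono[OF AE_sphere_measure_norm])
           (use r in \<open>auto simp: ennreal_mult power_mult_distrib ennreal_power\<close>)
      finally show "ennreal ((r powr t)\<^sup>2) * n r = (\<integral>\<^sup>+w. (ennreal (norm (r *\<^sub>R w) powr t * cmod (g (r *\<^sub>R w))))\<^sup>2 \<partial>(sphere_measure :: 'a measure))" .
    qed
    also have "\<dots> = (\<integral>\<^sup>+\<xi>. (ennreal (norm \<xi> powr t * cmod (g \<xi>)))\<^sup>2 \<partial>lborel)"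
      by (rule nn_integral_polar_radial[symmetric]) measurable
    finally show ?thesis using N(1) by simp
  qed
  \<comment> \<open>g is square integrable on almost every sphere; on the others
    \<open>enn2real\<close> would return 0 and \<open>m r\<close> would bound nothing.\<close>
  have nfin: "AE r in radial_measure TYPE('a). n r \<noteq> \<infinity>"
  proof -
    have "(\<integral>\<^sup>+r. ennreal ((r powr t)\<^sup>2) * n r \<partial>radial_measure TYPE('a)) \<noteq> \<infinity>"
      using N' by (auto simp: top_unique)
    then have "AE r in radial_measure TYPE('a). ennreal ((r powr t)\<^sup>2) * n r \<noteq> \<infinity>"
      by (intro nn_integral_PInf_AE) auto
    then show ?thesis using AE_radial_pos
    proof eventually_elim
      fix r :: real assume "ennreal ((r powr t)\<^sup>2) * n r \<noteq> \<infinity>" "r > 0"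
      then show "n r \<noteq> \<infinity>" by (auto simp: ennreal_mult_eq_top_iff)
    qed
  qed
  have inner: "AE r in radial_measure TYPE('a). (\<integral>\<^sup>+x. ennreal (cmod (slice g x r)) \<partial>\<mu>) \<le>
     ennreal (4 * sqrt D) * (ennreal (indicator {a..} r * r powr (- t - \<beta> / 2)) * ennreal (m r))"
    using nfin AE_radial_pos AE_integrable_polar[OF g]
  proof eventually_elim
    fix r assume nr: "n r \<noteq> \<infinity>" and r: "r > 0" and i: "integrable sphere_measure (\<lambda>w::'a. g (r *\<^sub>R w))"
    show "(\<integral>\<^sup>+x. ennreal (cmod (slice g x r)) \<partial>\<mu>) \<le> ennreal (4 * sqrt D) * (ennreal (indicator {a..} r * r powr (- t - \<beta> / 2)) * ennreal (m r))"
    proof (cases "r \<le> a")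
      \<comment> \<open>Radii up to a \<ge> 1, among them those where the decay hypothesis is
        silent, carry no part of g.\<close>
      case True
      have "slice g x r = 0" for x
      proof -
        have "slice g x r = (LINT w|(sphere_measure :: 'a measure). 0)"
          unfolding slice_def
          by (intro integral_cong_AE) (auto intro!: eventually_mono[OF AE_sphere_measure_norm] simp: supp True r less_imp_le)
        then show ?thesis by simp
      qed
      then show ?thesis by simp
    next
      case False
      then have ra: "r > 1" "r \<ge> a" using a by auto
      have "(\<integral>\<^sup>+x. ennreal (cmod (slice g x r)) \<partial>\<mu>) \<le> ennreal (4 * sqrt (enn2real (n r) * (D * r powr (- \<beta>))))"
      proof (rule slice_duality[OF _ s fin i])
        show "(\<integral>\<^sup>+w. (ennreal (cmod (g (r *\<^sub>R w))))\<^sup>2 \<partial>sphere_measure) \<le> ennreal (enn2real (n r))"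
          using nr unfolding n_def[symmetric] by (simp add: less_top)
        show "(\<integral>\<^sup>+w. ennreal ((cmod (wave_transform \<mu> A (r *\<^sub>R w)))\<^sup>2) \<partial>sphere_measure) \<le> ennreal (D * r powr (- \<beta>))" if "A \<in> sets borel" for A
          by (rule E[OF that ra(1)])
      qed (use D in auto)
      also have "4 * sqrt (enn2real (n r) * (D * r powr (- \<beta>))) = 4 * sqrt D * (indicator {a..} r * r powr (- t - \<beta> / 2) * m r)"
      proof -
        have "sqrt (r powr (- \<beta>)) = r powr (- \<beta> / 2)" using r by (simp add: powr_half_sqrt[symmetric] powr_powr)
        moreover have "r powr (- t - \<beta> / 2) * r powr t = r powr (- \<beta> / 2)" by (simp add: powr_add[symmetric])
        ultimately show ?thesis using ra(2) by (simp add: real_sqrt_mult m_def mult_ac)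
      qed
      finally show ?thesis using D m0[of r] by (simp add: ennreal_mult)
    qed
  qed
  have "(\<integral>\<^sup>+x. ennreal (slice_norm g x) \<partial>\<mu>) = (\<integral>\<^sup>+x. (\<integral>\<^sup>+r. ennreal (cmod (slice g x r)) \<partial>radial_measure TYPE('a)) \<partial>\<mu>)"
    unfolding slice_norm_def using slice_integrable[OF g]
    by (intro nn_integral_cong nn_integral_eq_integral[symmetric]) auto
  also have "\<dots> = (\<integral>\<^sup>+r. (\<integral>\<^sup>+x. ennreal (cmod (slice g x r)) \<partial>\<mu>) \<partial>radial_measure TYPE('a))"
    by (rule P.Fubini'[symmetric]) measurable
  also have "\<dots> \<le> (\<integral>\<^sup>+r. ennreal (4 * sqrt D) * (ennreal (indicator {a..} r * r powr (- t - \<beta> / 2)) * ennreal (m r)) \<partial>radial_measure TYPE('a))"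
    by (rule nn_integral_mono_AE[OF inner])
  also have "\<dots> = ennreal (4 * sqrt D) * (\<integral>\<^sup>+r. ennreal (indicator {a..} r * r powr (- t - \<beta> / 2)) * ennreal (m r) \<partial>radial_measure TYPE('a))"
    by (rule nn_integral_cmult) (simp add: m_def, measurable)
  also have "\<dots> \<le> ennreal (4 * sqrt D) * ennreal (sqrt (a powr (- \<kappa>) / \<kappa> * N))"
  proof (intro mult_left_mono nn_integral_Cauchy_Schwarz)
    have "(\<integral>\<^sup>+r. (ennreal (indicator {a..} r * r powr (- t - \<beta> / 2)))\<^sup>2 \<partial>radial_measure TYPE('a)) = (\<integral>\<^sup>+r. ennreal (indicator {a..} r * r powr (- 2 * t - \<beta>)) \<partial>radial_measure TYPE('a))"
    proof (rule nn_integral_cong)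
      fix r :: real
      have "(r powr (- t - \<beta> / 2))\<^sup>2 = r powr (- 2 * t - \<beta>)" by (simp add: power2_eq_square powr_add[symmetric])
      then show "(ennreal (indicator {a..} r * r powr (- t - \<beta> / 2)))\<^sup>2 = ennreal (indicator {a..} r * r powr (- 2 * t - \<beta>))"
        by (simp add: ennreal_power power_mult_distrib indicator_def)
    qed
    also have "\<dots> = ennreal (a powr (real DIM('a) + (- 2 * t - \<beta>)) / (- (real DIM('a) + (- 2 * t - \<beta>))))"
      using \<kappa> a by (intro nn_integral_radial_powr) auto
    also have "real DIM('a) + (- 2 * t - \<beta>) = - \<kappa>" using \<kappa>(1) by simp
    finally show "(\<integral>\<^sup>+r. (ennreal (indicator {a..} r * r powr (- t - \<beta> / 2)))\<^sup>2 \<partial>radial_measure TYPE('a)) \<le> ennreal (a powr (- \<kappa>) / \<kappa>)" by simp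
    have "(\<integral>\<^sup>+r. (ennreal (m r))\<^sup>2 \<partial>radial_measure TYPE('a)) = (\<integral>\<^sup>+r. ennreal ((r powr t)\<^sup>2) * n r \<partial>radial_measure TYPE('a))"
    proof (intro nn_integral_cong_AE eventually_mono[OF nfin])
      fix r :: real assume "n r \<noteq> \<infinity>"
      then have "n r = ennreal (enn2real (n r))" by (simp add: less_top)
      moreover have "(ennreal (m r))\<^sup>2 = ennreal ((r powr t)\<^sup>2) * ennreal (enn2real (n r))"
        using m0[of r] by (simp add: ennreal_power m_def power_mult_distrib ennreal_mult)
      ultimately show "(ennreal (m r))\<^sup>2 = ennreal ((r powr t)\<^sup>2) * n r" by simp
    qed
    then show "(\<integral>\<^sup>+r. (ennreal (m r))\<^sup>2 \<partial>radial_measure TYPE('a)) \<le> ennreal N" using N' by simp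
  qed (use N(2) \<kappa>(2) in \<open>auto simp: m_def\<close>)
  also have "\<dots> = ennreal (4 * sqrt D * sqrt (a powr (- \<kappa>) / \<kappa> * N))"
    using D N(2) \<kappa>(2) by (intro ennreal_mult[symmetric]) auto
  finally show ?thesis .
qed

section \<open>The exceptional sets\<close>

text \<open>The shells are half-open so that each radius above 1 lies in exactly one of
  them.\<close>

definition annulus_part :: "real \<Rightarrow> ('a::euclidean_space \<Rightarrow> complex) \<Rightarrow> nat \<Rightarrow> 'a \<Rightarrow> complex" where
  "annulus_part s h j \<xi> = of_bool (2 ^ j < norm \<xi> \<and> norm \<xi> \<le> 2 ^ Suc j) * (of_real (norm \<xi> powr (- s)) * h \<xi>)"

lemma sobolev_integrable_ball:
  fixes h :: "'a::euclidean_space \<Rightarrow> complex"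
  assumes h: "h \<in> square_integrable" and s: "s < real DIM('a) / 2" and P: "\<And>\<xi>. P \<xi> \<Longrightarrow> norm \<xi> \<le> \<rho>"
    and [measurable]: "Measurable.pred borel P"
  shows "integrable lborel (\<lambda>\<xi>. of_bool (P \<xi>) * (of_real (norm \<xi> powr (- s)) * h \<xi>))"
proof -
  have "integrable lborel (\<lambda>\<xi>. of_real (norm \<xi> powr (- s)) * h \<xi> * of_bool (P \<xi>))"
  proof (rule sobolev_integrable_mult[OF h s])
    show "(\<lambda>\<xi>. of_bool (P \<xi>) :: complex) \<in> borel_measurable borel" by measurable
    fix k
    have "(1 + norm \<xi>) ^ k * norm (of_bool (P \<xi>) :: complex) \<le> (1 + \<bar>\<rho>\<bar>) ^ k" for \<xi> :: 'a
    proof (cases "P \<xi>")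
      case True
      then have "1 + norm \<xi> \<le> 1 + \<bar>\<rho>\<bar>" using P[OF True] by linarith
      then show ?thesis using True by (auto intro!: power_mono)
    qed simp
    then show "\<exists>B. \<forall>\<xi>::'a. (1 + norm \<xi>) ^ k * norm (of_bool (P \<xi>) :: complex) \<le> B" by (intro exI allI)
  qed
  then show ?thesis by (simp only: mult.commute)
qed

lemma annulus_part_integrable:
  fixes h :: "'a::euclidean_space \<Rightarrow> complex"
  assumes h: "h \<in> square_integrable" and s: "s < real DIM('a) / 2"
  shows "integrable lborel (annulus_part s h j)"
  unfolding annulus_part_def[abs_def] by (rule sobolev_integrable_ball[OF h s, where \<rho> = "2 ^ Suc j"]) auto

lemma slice_local:
  fixes g g' :: "'a::euclidean_space \<Rightarrow> complex"
  assumes "\<And>\<xi>. norm \<xi> = r \<Longrightarrow> g \<xi> = g' \<xi>" "r > 0"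
    and [measurable]: "g \<in> borel_measurable borel" "g' \<in> borel_measurable borel"
  shows "slice g x r = slice g' x r"
  unfolding slice_def
  by (intro integral_cong_AE) (auto intro!: eventually_mono[OF AE_sphere_measure_norm] simp: assms(1,2) less_imp_le)

text \<open>Frequencies up to 1 are integrable outright since s < d/2. Above 1 each sphere lies in a
  single shell, so the modulus of the full slice is at most the sum of the moduli over the
  shells.\<close>

lemma slice_integrable_of_summable:
  fixes h :: "'a::euclidean_space \<Rightarrow> complex"
  assumes h: "h \<in> square_integrable" and s: "s < real DIM('a) / 2"
    and sm: "summable (\<lambda>j. slice_norm (annulus_part s h j) x)"
  shows "integrable (radial_measure TYPE('a)) (slice (\<lambda>\<xi>. of_real (norm \<xi> powr (- s)) * h \<xi>) x)"
proof -
  note [measurable] = square_integrableD(1)[OF h]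
  define F where "F \<xi> = of_real (norm \<xi> powr (- s)) * h \<xi>" for \<xi>
  define g0 where "g0 \<xi> = of_bool (norm \<xi> \<le> 1) * F \<xi>" for \<xi>
  define g where "g j = annulus_part s h j" for j
  have i0: "integrable lborel g0"
    unfolding g0_def F_def by (rule sobolev_integrable_ball[OF h s, where \<rho> = 1]) auto
  have ig: "integrable lborel (g j)" for j unfolding g_def by (rule annulus_part_integrable[OF h s])
  have [measurable]: "F \<in> borel_measurable borel" unfolding F_def by measurable
  have [measurable]: "annulus_part s h j \<in> borel_measurable borel" for j
    using borel_measurable_integrable[OF annulus_part_integrable[OF h s]] by simp
  have [measurable]: "g0 \<in> borel_measurable borel" "\<And>j. g j \<in> borel_measurable borel"
    using i0 ig by (auto dest: borel_measurable_integrable)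
  have le: "ennreal (cmod (slice F x r)) \<le> ennreal (cmod (slice g0 x r)) + (\<Sum>j. ennreal (cmod (slice (g j) x r)))" if r: "r > 0" for r
  proof (cases "r \<le> 1")
    case True
    have "slice F x r = slice g0 x r" using True r by (intro slice_local) (auto simp: g0_def)
    then show ?thesis by simp
  next
    case False
    have ex: "\<exists>k. r \<le> 2 ^ k" using real_arch_pow[of 2 r] by (auto intro: less_imp_le)
    \<comment> \<open>The least k with r \<le> 2^k gives r > 2^(k-1), that is shell k - 1; r > 1
      makes k positive.\<close>
    define k where "k = (LEAST k. r \<le> 2 ^ k)"
    have k: "r \<le> 2 ^ k" unfolding k_def by (rule LeastI_ex[OF ex])
    have k0: "k \<noteq> 0" using k False by (intro notI) simp
    have "\<not> r \<le> 2 ^ (k - 1)" using not_less_Least[of "k - 1" "\<lambda>k. r \<le> 2 ^ k"] k0 unfolding k_def[symmetric] by simp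
    then have "slice F x r = slice (g (k - 1)) x r"
      using k k0 r by (intro slice_local) (auto simp: g_def annulus_part_def F_def)
    then have "ennreal (cmod (slice F x r)) = ennreal (cmod (slice (g (k - 1)) x r))" by simp
    also have "\<dots> \<le> (\<Sum>j. ennreal (cmod (slice (g j) x r)))" by (rule ennreal_suminf_term_le)
    finally show ?thesis by (rule order_trans) simp
  qed
  have "(\<integral>\<^sup>+r. ennreal (cmod (slice F x r)) \<partial>radial_measure TYPE('a)) \<le> (\<integral>\<^sup>+r. ennreal (cmod (slice g0 x r)) + (\<Sum>j. ennreal (cmod (slice (g j) x r))) \<partial>radial_measure TYPE('a))"
    by (intro nn_integral_mono_AE eventually_mono[OF AE_radial_pos] le)
  also have "\<dots> = (\<integral>\<^sup>+r. ennreal (cmod (slice g0 x r)) \<partial>radial_measure TYPE('a)) + (\<Sum>j. \<integral>\<^sup>+r. ennreal (cmod (slice (g j) x r)) \<partial>radial_measure TYPE('a))"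
    by (subst nn_integral_add, measurable, subst nn_integral_suminf, measurable)
  also have "(\<Sum>j. \<integral>\<^sup>+r. ennreal (cmod (slice (g j) x r)) \<partial>radial_measure TYPE('a)) = (\<Sum>j. ennreal (slice_norm (g j) x))"
    unfolding slice_norm_def using slice_integrable[OF ig]
    by (intro suminf_cong nn_integral_eq_integral) auto
  also have "\<dots> = ennreal (\<Sum>j. slice_norm (g j) x)"
    using sm unfolding g_def by (intro suminf_ennreal2) auto
  also have "(\<integral>\<^sup>+r. ennreal (cmod (slice g0 x r)) \<partial>radial_measure TYPE('a)) = ennreal (slice_norm g0 x)"
    unfolding slice_norm_def using slice_integrable[OF i0] by (intro nn_integral_eq_integral) auto
  finally have "(\<integral>\<^sup>+r. ennreal (cmod (slice F x r)) \<partial>radial_measure TYPE('a)) < \<infinity>"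
    by (rule le_less_trans) simp
  then have "integrable (radial_measure TYPE('a)) (slice F x)" by (intro integrableI_bounded) auto
  then show ?thesis unfolding F_def .
qed

text \<open>\<open>slice_norm_bound\<close> is used with t = s, where the weight |\<xi>|^s cancels
  |\<xi>|^(-s) and leaves the L2 norm of h. Shell j begins at a = 2^j and gains 2^(-j \<kappa> /
  2).\<close>

theorem wave_exceptional_null:
  fixes h :: "'a::euclidean_space \<Rightarrow> complex"
  assumes dec: "\<And>R \<mu>. R > 1 \<Longrightarrow> dimensional_measure \<alpha> (\<mu> :: 'a measure) \<Longrightarrow>
     (\<integral>\<^sup>+ \<omega>. ennreal ((cmod (fourier_measure \<mu> (R *\<^sub>R \<omega>)))\<^sup>2) \<partial>sphere_measure)
       \<le> ennreal C * frostman_const \<alpha> \<mu> * emeasure \<mu> UNIV * ennreal (R powr (- \<beta>))"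
    and \<alpha>: "0 < \<alpha>" "\<alpha> \<le> real DIM('a)" and \<beta>: "\<beta> > real DIM('a) - 2 * s"
    and h: "h \<in> square_integrable" and s: "s < real DIM('a) / 2"
  shows "content_null \<alpha> {x. \<not> integrable (radial_measure TYPE('a)) (slice (\<lambda>\<xi>. of_real (norm \<xi> powr (- s)) * h \<xi>) x)}"
proof -
  note [measurable] = square_integrableD(1)[OF h]
  define K where "K = 2 ^ DIM('a) * 4 powr \<alpha>"
  define D where "D = (2 * pi) powr real DIM('a) * \<bar>C\<bar> * \<bar>K\<bar>\<^sup>2"
  define N where "N = (LINT x|lborel. (cmod (h x))\<^sup>2)"
  define \<kappa> where "\<kappa> = 2 * s + \<beta> - real DIM('a)"
  have \<kappa>: "\<kappa> > 0" using \<beta> by (simp add: \<kappa>_def)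
  have D: "D \<ge> 0" by (simp add: D_def)
  have N: "N \<ge> 0" by (simp add: N_def)
  \<comment> \<open>Chosen so that q^(2j) = 2^(-j \<kappa> / 2), the form asked for by
    \<open>content_null_divergent_series\<close>.\<close>
  define q where "q = 2 powr (- \<kappa> / 4)"
  define B where "B = 4 * sqrt D * sqrt (N / \<kappa>)"
  have "content_null \<alpha> {x. \<not> summable (\<lambda>j. slice_norm (annulus_part s h j) x)}"
  proof (rule content_null_divergent_series[OF \<alpha>, where B = B and q = q])
    fix j
    show "uniformly_continuous_on UNIV (slice_norm (annulus_part s h j))"
      by (rule lipschitz_uniformly_continuous, rule slice_norm_lipschitz[OF annulus_part_integrable[OF h s], where \<rho> = "2 ^ Suc j"])
         (auto simp: annulus_part_def)
    fix \<mu> :: "'a measure" assume \<mu>: "frostman_class \<alpha> (2 ^ DIM('a) * 4 powr \<alpha>) \<mu>"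
    have "(\<integral>\<^sup>+x. ennreal (slice_norm (annulus_part s h j) x) \<partial>\<mu>) \<le> ennreal (4 * sqrt D * sqrt ((2 ^ j) powr (- \<kappa>) / \<kappa> * N))"
    proof (rule slice_norm_bound[OF annulus_part_integrable[OF h s] _ frostman_class_finite[OF \<mu>] _ D _ _ _ N \<kappa>_def \<kappa>])
      show "sets \<mu> = sets borel" using \<mu> by (simp add: frostman_class_def)
      show "(\<integral>\<^sup>+w. ennreal ((cmod (wave_transform \<mu> A (R *\<^sub>R w)))\<^sup>2) \<partial>sphere_measure) \<le> ennreal (D * R powr (- \<beta>))" if "A \<in> sets borel" "R > 1" for A R
        using wave_transform_decay[OF dec \<mu> that] by (simp add: D_def K_def)
      have "(\<integral>\<^sup>+\<xi>. (ennreal (norm \<xi> powr s * cmod (annulus_part s h j \<xi>)))\<^sup>2 \<partial>lborel) \<le> (\<integral>\<^sup>+\<xi>. (ennreal (cmod (h \<xi>)))\<^sup>2 \<partial>lborel)"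
      proof (intro nn_integral_mono power_mono ennreal_leI)
        fix \<xi> :: 'a
        have "norm \<xi> powr s * norm \<xi> powr (- s) \<le> 1" by (simp add: powr_add[symmetric])
        then have "(norm \<xi> powr s * norm \<xi> powr (- s)) * cmod (h \<xi>) \<le> 1 * cmod (h \<xi>)" by (rule mult_right_mono) simp
        then show "norm \<xi> powr s * cmod (annulus_part s h j \<xi>) \<le> cmod (h \<xi>)"
          by (auto simp: annulus_part_def norm_mult mult.assoc)
      qed simp
      then show "(\<integral>\<^sup>+\<xi>. (ennreal (norm \<xi> powr s * cmod (annulus_part s h j \<xi>)))\<^sup>2 \<partial>lborel) \<le> ennreal N"
        unfolding N_def square_integrableD(3)[OF h] .
    qed (auto simp: annulus_part_def)
    also have "4 * sqrt D * sqrt ((2 ^ j) powr (- \<kappa>) / \<kappa> * N) = B * q ^ (2 * j)"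
    proof -
      have "(2 ^ j) powr (- \<kappa>) = 2 powr (real j * (- \<kappa>))"
        by (simp only: powr_realpow[symmetric, of 2 j, simplified] powr_powr)
      also have "\<dots> = (q ^ (2 * j))\<^sup>2"
      proof -
        have "q ^ n = 2 powr (- \<kappa> / 4 * real n)" for n :: nat
          unfolding q_def by (rule powr_power[THEN trans]) (auto simp: mult.commute)
        then show ?thesis unfolding power_mult[symmetric] by (simp add: mult.commute)
      qed
      finally have "sqrt ((2 ^ j) powr (- \<kappa>)) = q ^ (2 * j)" by (simp add: q_def)
      then show ?thesis by (simp add: B_def real_sqrt_mult real_sqrt_divide)
    qed
    finally show "(\<integral>\<^sup>+x. ennreal (slice_norm (annulus_part s h j) x) \<partial>\<mu>) \<le> ennreal (B * q ^ (2 * j))" .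
  next
    show "0 < q" by (simp add: q_def)
    show "q < 1" unfolding q_def using \<kappa> powr_less_mono[of "- \<kappa> / 4" 0 2] by simp
    show "B \<ge> 0" using D N \<kappa> by (simp add: B_def)
  qed simp
  then show ?thesis
    by (rule content_null_subset) (use slice_integrable_of_summable[OF h s] in auto)
qed

section \<open>The exceptional set of the convolution\<close>

lemma integral_gauss_kernel_fourier:
  fixes f :: "'a::euclidean_space \<Rightarrow> complex"
  assumes F: "has_fourier (regular_distribution f) F" and t: "\<tau> > 0"
  shows "(LINT y|lborel. f y * of_real (gauss_kernel \<tau> (x - y))) = (LINT \<xi>|lborel. F \<xi> * gauss_wave \<tau> x \<xi>)"
proof -
  note w = schwartz_gauss_wave[OF t, of x]
  have "regular_distribution f (fourier (gauss_wave \<tau> x)) = (LINT \<xi>|lborel. F \<xi> * gauss_wave \<tau> x \<xi>)"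
    using F w by (simp add: has_fourier_def)
  moreover have "regular_distribution f (fourier (gauss_wave \<tau> x)) = (LINT y|lborel. f y * of_real (gauss_kernel \<tau> (x - y)))"
    using schwartz_fourier[OF w] by (simp add: regular_distribution_def fourier_gauss_wave[OF t])
  ultimately show ?thesis by simp
qed

lemma gauss_kernel_shift_schwartz:
  assumes "\<tau> > 0"
  shows "(\<lambda>y. complex_of_real (gauss_kernel \<tau> (x - y))) \<in> schwartz"
proof -
  have "fourier (gauss_wave \<tau> x) = (\<lambda>y. complex_of_real (gauss_kernel \<tau> (x - y)))"
    by (rule ext) (rule fourier_gauss_wave[OF assms])
  then show ?thesis using schwartz_fourier[OF schwartz_gauss_wave[OF assms, of x]] by simp
qed

lemma square_integrable_norm:
  "f \<in> square_integrable \<Longrightarrow> (\<lambda>y. complex_of_real (cmod (f y))) \<in> square_integrable"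
  by (auto simp: square_integrable_def)

text \<open>A dyadic sample of the integral of \<tau>^(s/2-1) times the Gaussian average of |f|: at
  \<tau> = 4^(-j) the factor \<tau>^(s/2) is 2^(-sj), and d\<tau>/\<tau> has fixed mass on each
  block. The modulus of f is taken because the value of v0 requires absolute convergence.\<close>

definition gauss_part :: "real \<Rightarrow> ('a::euclidean_space \<Rightarrow> complex) \<Rightarrow> nat \<Rightarrow> 'a \<Rightarrow> real" where
  "gauss_part s f j x = 2 powr (- (s * real j)) * (LINT y|lborel. cmod (f y) * gauss_kernel (1 / 4 ^ j) (x - y))"

lemma gauss_part_nonneg [simp]: "gauss_part s f j x \<ge> 0"
  by (simp add: gauss_part_def)

lemma integrable_norm_gauss_kernel:
  assumes f: "f \<in> square_integrable" and t: "\<tau> > 0"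
  shows "integrable lborel (\<lambda>y. cmod (f y) * gauss_kernel \<tau> (x - y))"
proof -
  have "integrable lborel (\<lambda>y. norm (f y * complex_of_real (gauss_kernel \<tau> (x - y))))"
    by (intro integrable_norm square_integrable_mult f schwartz_square_integrable gauss_kernel_shift_schwartz t)
  then show ?thesis by (simp add: norm_mult)
qed

text \<open>From u/p \<le> exp(u/p), raised to the power p.\<close>

lemma exp_neg_le_powr:
  fixes p u :: real
  assumes "p > 0" "u > 0"
  shows "exp (- u) \<le> p powr p * u powr (- p)"
proof -
  have "u / p \<le> exp (u / p)" using exp_ge_add_one_self[of "u / p"] by linarith
  then have "(u / p) powr p \<le> exp (u / p) powr p" using assms by (intro powr_mono2) auto
  also have "\<dots> = exp u" using assms by (simp add: exp_powr_real)
  finally have "u powr p / p powr p \<le> exp u" using assms by (simp add: powr_divide)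
  then show ?thesis using assms by (simp add: exp_minus powr_minus field_simps)
qed

lemma norm_wave_transform_le:
  assumes s [simp, measurable_cong]: "sets \<mu> = sets borel" and fin: "finite_measure \<mu>"
    and K: "emeasure \<mu> UNIV \<le> ennreal K" "K \<ge> 0"
  shows "cmod (wave_transform \<mu> A \<xi>) \<le> K"
proof -
  have "ennreal (cmod (wave_transform \<mu> A \<xi>)) \<le> (\<integral>\<^sup>+x. ennreal (cmod (indicator A x * cis (x \<bullet> \<xi>))) \<partial>\<mu>)"
    unfolding wave_transform_def by (rule norm_integral_le_nn_integral)
  also have "\<dots> \<le> (\<integral>\<^sup>+x. 1 \<partial>\<mu>)" by (intro nn_integral_mono) (auto simp: indicator_def norm_mult)
  also have "\<dots> \<le> ennreal K" using K(1) sets_eq_imp_space_eq[OF s] by simp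
  finally show ?thesis using K(2) by simp
qed

text \<open>The decay \<beta> alone may not make the transform square integrable, so the Gaussian is
  traded for \<tau>^(-p) r^(-2p) with d - \<beta> - 2p < 0. For r \<le> 1 the decay hypothesis says
  nothing and the trivial bound K is used.\<close>

lemma gauss_energy_bound:
  fixes \<mu> :: "'a::euclidean_space measure"
  assumes s [simp, measurable_cong]: "sets \<mu> = sets borel" and fin: "finite_measure \<mu>"
    and K: "emeasure \<mu> UNIV \<le> ennreal K" "K \<ge> 0"
    and E: "\<And>R. R > 1 \<Longrightarrow>
      (\<integral>\<^sup>+w. ennreal ((cmod (wave_transform \<mu> UNIV (R *\<^sub>R w)))\<^sup>2) \<partial>sphere_measure) \<le> ennreal (D * R powr (- \<beta>))" and D: "D \<ge> 0"
    and p: "p > 0" "real DIM('a) - \<beta> - 2 * p < 0" and t: "0 < \<tau>" "\<tau> \<le> 1"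
  shows "(\<integral>\<^sup>+\<xi>. (ennreal (exp (- \<tau> * (norm \<xi>)\<^sup>2) * cmod (wave_transform \<mu> UNIV \<xi>)))\<^sup>2 \<partial>lborel) \<le>
    ennreal ((K\<^sup>2 * measure sphere_measure (UNIV :: 'a set) + D * p powr p / (\<beta> + 2 * p - real DIM('a))) * \<tau> powr (- p))"
proof -
  interpret finite_measure \<mu> by (rule fin)
  define T where "T = wave_transform \<mu> UNIV"
  have [measurable]: "T \<in> borel_measurable borel" unfolding T_def wave_transform_def[abs_def] by measurable
  define S where "S = measure sphere_measure (UNIV :: 'a set)"
  have S: "emeasure sphere_measure (UNIV :: 'a set) = ennreal S" "S \<ge> 0"
    unfolding S_def by (rule sphere.emeasure_eq_measure) simp
  define I where "I r = (\<integral>\<^sup>+w. ennreal ((cmod (T (r *\<^sub>R w)))\<^sup>2) \<partial>(sphere_measure :: 'a measure))" for r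
  have Ismall: "I r \<le> ennreal (K\<^sup>2 * S)" for r
  proof -
    have "I r \<le> (\<integral>\<^sup>+w. ennreal (K\<^sup>2) \<partial>(sphere_measure :: 'a measure))"
      unfolding I_def T_def using norm_wave_transform_le[OF s fin K] by (intro nn_integral_mono ennreal_leI power_mono) auto
    then show ?thesis using S by (simp add: ennreal_mult)
  qed
  have "(\<integral>\<^sup>+\<xi>. (ennreal (exp (- \<tau> * (norm \<xi>)\<^sup>2) * cmod (T \<xi>)))\<^sup>2 \<partial>lborel) =
    (\<integral>\<^sup>+r. (\<integral>\<^sup>+w. (ennreal (exp (- \<tau> * (norm (r *\<^sub>R w))\<^sup>2) * cmod (T (r *\<^sub>R w))))\<^sup>2 \<partial>(sphere_measure :: 'a measure)) \<partial>radial_measure TYPE('a))"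
    by (rule nn_integral_polar_radial) measurable
  also have "\<dots> \<le> (\<integral>\<^sup>+r. ennreal (K\<^sup>2 * S) * indicator {0<..1} r + ennreal (D * p powr p * \<tau> powr (- p)) * ennreal (indicator {1..} r * r powr (- \<beta> - 2 * p)) \<partial>radial_measure TYPE('a))"
  proof (rule nn_integral_mono_AE, rule eventually_mono[OF AE_radial_pos])
    fix r :: real assume r: "r > 0"
    define e where "e = (exp (- \<tau> * r\<^sup>2))\<^sup>2"
    have "(\<integral>\<^sup>+w. (ennreal (exp (- \<tau> * (norm (r *\<^sub>R w))\<^sup>2) * cmod (T (r *\<^sub>R w))))\<^sup>2 \<partial>(sphere_measure :: 'a measure)) = (\<integral>\<^sup>+w. ennreal e * ennreal ((cmod (T (r *\<^sub>R w)))\<^sup>2) \<partial>(sphere_measure :: 'a measure))"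
      by (intro nn_integral_cong_AE eventually_mono[OF AE_sphere_measure_norm])
         (simp add: e_def ennreal_power power_mult_distrib ennreal_mult)
    also have "\<dots> = ennreal e * I r" unfolding I_def by (rule nn_integral_cmult) measurable
    also have "\<dots> \<le> ennreal (K\<^sup>2 * S) * indicator {0<..1} r + ennreal (D * p powr p * \<tau> powr (- p)) * ennreal (indicator {1..} r * r powr (- \<beta> - 2 * p))"
    proof (cases "r \<le> 1")
      case True
      have "ennreal e \<le> 1" unfolding e_def using t by (simp add: power_le_one)
      then have "ennreal e * I r \<le> 1 * ennreal (K\<^sup>2 * S)" by (intro mult_mono Ismall) auto
      also have "\<dots> = ennreal (K\<^sup>2 * S) * indicator {0<..1} r" using True r by simp
      finally show ?thesis by (rule order_trans) simp
    next
      case False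
      have u: "0 < \<tau> * r\<^sup>2" using t r by simp
      \<comment> \<open>Of the two Gaussian factors in the square, one is bounded by 1 and the other
        is traded for a power.\<close>
      have "e \<le> exp (- \<tau> * r\<^sup>2) * 1" unfolding e_def power2_eq_square[of "exp _"] using t by (intro mult_left_mono) auto
      also have "\<dots> \<le> p powr p * (\<tau> * r\<^sup>2) powr (- p)" using exp_neg_le_powr[OF p(1) u] by simp
      also have "(\<tau> * r\<^sup>2) powr (- p) = \<tau> powr (- p) * r powr (- 2 * p)"
      proof -
        have "r\<^sup>2 = r powr 2" using r by simp
        then have "(r\<^sup>2) powr (- p) = r powr (2 * (- p))" by (simp only: powr_powr)
        then show ?thesis using t by (simp add: powr_mult)
      qed
      finally have e: "e \<le> p powr p * (\<tau> powr (- p) * r powr (- 2 * p))" .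
      have "ennreal e * I r \<le> ennreal (p powr p * (\<tau> powr (- p) * r powr (- 2 * p))) * ennreal (D * r powr (- \<beta>))"
        using E[of r] False e unfolding I_def T_def by (intro mult_mono ennreal_leI) auto
      also have "\<dots> = ennreal (p powr p * (\<tau> powr (- p) * r powr (- 2 * p)) * (D * r powr (- \<beta>)))"
        using D by (intro ennreal_mult[symmetric]) auto
      also have "p powr p * (\<tau> powr (- p) * r powr (- 2 * p)) * (D * r powr (- \<beta>)) = (D * p powr p * \<tau> powr (- p)) * (indicator {1..} r * r powr (- \<beta> - 2 * p))"
      proof -
        have e: "- 2 * p + - \<beta> = - \<beta> - 2 * p" by simp
        have "r powr (- 2 * p) * r powr (- \<beta>) = r powr (- \<beta> - 2 * p)" by (simp only: powr_add[symmetric] e)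
        then have "r powr (- \<beta> - 2 * p) = r powr (- 2 * p) * r powr (- \<beta>)" ..
        then show ?thesis using False by simp
      qed
      also have "ennreal \<dots> = ennreal (D * p powr p * \<tau> powr (- p)) * ennreal (indicator {1..} r * r powr (- \<beta> - 2 * p))"
        using D by (intro ennreal_mult) auto
      finally show ?thesis by (rule order_trans) simp
    qed
    finally show "(\<integral>\<^sup>+w. (ennreal (exp (- \<tau> * (norm (r *\<^sub>R w))\<^sup>2) * cmod (T (r *\<^sub>R w))))\<^sup>2 \<partial>(sphere_measure :: 'a measure)) \<le> ennreal (K\<^sup>2 * S) * indicator {0<..1} r + ennreal (D * p powr p * \<tau> powr (- p)) * ennreal (indicator {1..} r * r powr (- \<beta> - 2 * p))" .
  qed
  also have "\<dots> = ennreal (K\<^sup>2 * S) * (\<integral>\<^sup>+r. indicator {0<..1} r \<partial>radial_measure TYPE('a)) + ennreal (D * p powr p * \<tau> powr (- p)) * (\<integral>\<^sup>+r. ennreal (indicator {1..} r * r powr (- \<beta> - 2 * p)) \<partial>radial_measure TYPE('a))"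
    by (subst nn_integral_add, measurable, subst nn_integral_cmult, measurable, subst nn_integral_cmult, measurable)
  also have "(\<integral>\<^sup>+r. ennreal (indicator {1..} r * r powr (- \<beta> - 2 * p)) \<partial>radial_measure TYPE('a)) = ennreal (1 powr (real DIM('a) + (- \<beta> - 2 * p)) / (- (real DIM('a) + (- \<beta> - 2 * p))))"
    using p by (intro nn_integral_radial_powr) auto
  also have "1 powr (real DIM('a) + (- \<beta> - 2 * p)) / (- (real DIM('a) + (- \<beta> - 2 * p))) = 1 / (\<beta> + 2 * p - real DIM('a))" by simp
  also have "ennreal (K\<^sup>2 * S) * (\<integral>\<^sup>+r. indicator {0<..1} r \<partial>radial_measure TYPE('a)) + ennreal (D * p powr p * \<tau> powr (- p)) * ennreal (1 / (\<beta> + 2 * p - real DIM('a)))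
    \<le> ennreal (K\<^sup>2 * S * \<tau> powr (- p)) + ennreal (D * p powr p * \<tau> powr (- p)) * ennreal (1 / (\<beta> + 2 * p - real DIM('a)))"
  proof (rule add_right_mono)
    have "(\<integral>\<^sup>+r. indicator {0<..1} r \<partial>radial_measure TYPE('a)) = (\<integral>\<^sup>+r. ennreal (indicator {0<..} r * r ^ (DIM('a) - 1)) * indicator {0<..1} r \<partial>lborel)"
      by (rule nn_integral_radial) measurable
    also have "\<dots> \<le> (\<integral>\<^sup>+r. indicator {0<..1::real} r \<partial>lborel)"
    proof (rule nn_integral_mono)
      fix r :: real
      show "ennreal (indicator {0<..} r * r ^ (DIM('a) - 1)) * indicator {0<..1} r \<le> indicator {0<..1} r"
      proof (cases "0 < r \<and> r \<le> 1")
        case True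
        then have "r ^ (DIM('a) - 1) \<le> 1" by (intro power_le_one) auto
        then show ?thesis using True by simp
      qed (auto simp: indicator_def)
    qed
    also have "\<dots> = 1" by simp
    finally have W: "(\<integral>\<^sup>+r. indicator {0<..1} r \<partial>radial_measure TYPE('a)) \<le> 1" .
    \<comment> \<open>As \<tau> \<le> 1, the radii up to 1 can be charged to the same power
      \<tau>^(-p).\<close>
    have "1 \<le> \<tau> powr (- p)" using t p(1) powr_mono2'[of "- p" \<tau> 1] by simp
    then have "K\<^sup>2 * S * 1 \<le> K\<^sup>2 * S * \<tau> powr (- p)"
      using S(2) by (intro mult_left_mono) auto
    then have "ennreal (K\<^sup>2 * S) * 1 \<le> ennreal (K\<^sup>2 * S * \<tau> powr (- p))"
      by (simp add: ennreal_leI)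
    moreover have "ennreal (K\<^sup>2 * S) * (\<integral>\<^sup>+r. indicator {0<..1} r \<partial>radial_measure TYPE('a)) \<le> ennreal (K\<^sup>2 * S) * 1"
      by (intro mult_left_mono W) simp
    ultimately show "ennreal (K\<^sup>2 * S) * (\<integral>\<^sup>+r. indicator {0<..1} r \<partial>radial_measure TYPE('a)) \<le> ennreal (K\<^sup>2 * S * \<tau> powr (- p))"
      by (rule order_trans[rotated])
  qed
  also have "\<dots> = ennreal ((K\<^sup>2 * S + D * p powr p / (\<beta> + 2 * p - real DIM('a))) * \<tau> powr (- p))"
    using S(2) D p by (simp add: ennreal_mult[symmetric] ennreal_plus[symmetric] distrib_right del: ennreal_plus)
  finally show ?thesis unfolding T_def S_def .
qed

text \<open>The average of |f| is tested through G, the transform of |f|; Cauchy-Schwarz on the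
  Fourier side costs \<tau>^(-p/2) = 2^(pj) by the energy bound. The weight 2^(-sj) wins if p < s,
  and a positive p < s with 2p > d - \<beta> exists because \<beta> > d - 2s and s > 0.\<close>

theorem gauss_exceptional_null:
  fixes f :: "'a::euclidean_space \<Rightarrow> complex"
  assumes dec: "\<And>R \<mu>. R > 1 \<Longrightarrow> dimensional_measure \<alpha> (\<mu> :: 'a measure) \<Longrightarrow>
     (\<integral>\<^sup>+ \<omega>. ennreal ((cmod (fourier_measure \<mu> (R *\<^sub>R \<omega>)))\<^sup>2) \<partial>sphere_measure)
       \<le> ennreal C * frostman_const \<alpha> \<mu> * emeasure \<mu> UNIV * ennreal (R powr (- \<beta>))"
    and \<alpha>: "0 < \<alpha>" "\<alpha> \<le> real DIM('a)" and \<beta>: "\<beta> > real DIM('a) - 2 * s" and s: "s > 0"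
    and f: "f \<in> square_integrable"
  shows "content_null \<alpha> {x. \<not> summable (\<lambda>j. gauss_part s f j x)}"
proof -
  obtain G where G: "G \<in> square_integrable" "has_fourier (regular_distribution (\<lambda>y. complex_of_real (cmod (f y)))) G"
    using plancherel[OF square_integrable_norm[OF f]] by blast
  note [measurable] = square_integrableD(1)[OF G(1)] square_integrableD(1)[OF f]
  define K where "K = 2 ^ DIM('a) * 4 powr \<alpha>"
  have K: "K \<ge> 0" by (simp add: K_def)
  define D where "D = (2 * pi) powr real DIM('a) * \<bar>C\<bar> * \<bar>K\<bar>\<^sup>2"
  have D: "D \<ge> 0" by (simp add: D_def)
  define N where "N = (LINT x|lborel. (cmod (G x))\<^sup>2)"
  have N: "N \<ge> 0" by (simp add: N_def)
  \<comment> \<open>The midpoint between s and the larger of 0 and (d - \<beta>)/2, both of which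
    lie below s.\<close>
  define p where "p = (s + max 0 ((real DIM('a) - \<beta>) / 2)) / 2"
  have p: "p > 0" "p < s" "real DIM('a) - \<beta> - 2 * p < 0"
    using s \<beta> by (auto simp: p_def max_def field_simps)
  define E where "E = K\<^sup>2 * measure sphere_measure (UNIV :: 'a set) + D * p powr p / (\<beta> + 2 * p - real DIM('a))"
  have E: "E \<ge> 0" using D p by (simp add: E_def)
  define q where "q = 2 powr (- (s - p) / 2)"
  define B where "B = sqrt (N * E)"
  define \<tau> where "\<tau> j = (1 / 4 ^ j :: real)" for j
  have \<tau>: "\<tau> j > 0" "\<tau> j \<le> 1" for j by (auto simp: \<tau>_def divide_le_eq_1)
  have iG: "integrable lborel (\<lambda>\<xi>. G \<xi> * gauss_wave (\<tau> j) x \<xi>)" for j x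
    by (rule square_integrable_mult[OF G(1) schwartz_square_integrable[OF schwartz_gauss_wave[OF \<tau>(1)]]])
  have part: "complex_of_real (gauss_part s f j x) = of_real (2 powr (- (s * real j))) * (LINT \<xi>|lborel. G \<xi> * gauss_wave (\<tau> j) x \<xi>)" for j x
    unfolding gauss_part_def integral_gauss_kernel_fourier[OF G(2) \<tau>(1), symmetric] \<tau>_def[symmetric]
    by (simp flip: integral_complex_of_real)
  show ?thesis
  proof (rule content_null_divergent_series[OF \<alpha>, where B = B and q = q])
    fix j
    define c where "c = 2 powr (- (s * real j))"
    have c: "c \<ge> 0" by (simp add: c_def)
    have i1: "integrable lborel (\<lambda>\<xi>. norm \<xi> * cmod (G \<xi>) * exp (- \<tau> j * (norm \<xi>)\<^sup>2))"
    proof -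
      \<comment> \<open>The Sobolev weight with exponent a = -1 supplies the factor |\<xi>| that a
        Lipschitz bound in x costs.\<close>
      have "integrable lborel (\<lambda>\<xi>. norm (of_real (norm \<xi> powr (- (- 1))) * G \<xi> * gauss_wave (\<tau> j) 0 \<xi>))"
      proof (intro integrable_norm sobolev_integrable_mult[OF G(1)])
        show "\<exists>B. \<forall>x. (1 + norm x) ^ k * norm (gauss_wave (\<tau> j) 0 x) \<le> B" for k
          using schwartz_decay[OF schwartz_gauss_wave[OF \<tau>(1)[of j], of 0], of k] by blast
        show "- 1 < real DIM('a) / 2" by (rule less_le_trans[of "-1" 0]) auto
      qed (intro schwartz_measurable schwartz_gauss_wave \<tau>)
      then show ?thesis by (simp add: norm_mult norm_gauss_wave)
    qed
    show "uniformly_continuous_on UNIV (gauss_part s f j)"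
    proof (rule lipschitz_uniformly_continuous)
      fix x y :: 'a
      have d: "of_real (gauss_part s f j x) - of_real (gauss_part s f j y) = of_real c * (LINT \<xi>|lborel. G \<xi> * gauss_wave (\<tau> j) x \<xi> - G \<xi> * gauss_wave (\<tau> j) y \<xi>)"
        unfolding part Bochner_Integration.integral_diff[OF iG iG] c_def[symmetric] by (rule right_diff_distrib[symmetric])
      have "\<bar>gauss_part s f j x - gauss_part s f j y\<bar> = cmod (of_real (gauss_part s f j x) - of_real (gauss_part s f j y))"
        unfolding of_real_diff[symmetric] norm_of_real ..
      also have "\<dots> = c * cmod (LINT \<xi>|lborel. G \<xi> * gauss_wave (\<tau> j) x \<xi> - G \<xi> * gauss_wave (\<tau> j) y \<xi>)"
        unfolding d norm_mult norm_of_real using c by simp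
      also have "\<dots> \<le> c * (LINT \<xi>|lborel. dist x y * (norm \<xi> * cmod (G \<xi>) * exp (- \<tau> j * (norm \<xi>)\<^sup>2)))"
      proof (intro mult_left_mono c Bochner_Integration.integral_norm_bound_integral)
        show "integrable lborel (\<lambda>\<xi>. G \<xi> * gauss_wave (\<tau> j) x \<xi> - G \<xi> * gauss_wave (\<tau> j) y \<xi>)"
          by (intro Bochner_Integration.integrable_diff iG)
        show "integrable lborel (\<lambda>\<xi>. dist x y * (norm \<xi> * cmod (G \<xi>) * exp (- \<tau> j * (norm \<xi>)\<^sup>2)))"
          by (intro integrable_mult_right i1)
        fix \<xi> :: 'a
        have "G \<xi> * gauss_wave (\<tau> j) x \<xi> - G \<xi> * gauss_wave (\<tau> j) y \<xi> = G \<xi> * of_real (exp (- \<tau> j * (norm \<xi>)\<^sup>2)) * (cis (x \<bullet> \<xi>) - cis (y \<bullet> \<xi>))"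
          by (simp only: gauss_wave_def right_diff_distrib mult.assoc)
        then have "cmod (G \<xi> * gauss_wave (\<tau> j) x \<xi> - G \<xi> * gauss_wave (\<tau> j) y \<xi>) = cmod (G \<xi>) * exp (- \<tau> j * (norm \<xi>)\<^sup>2) * cmod (cis (x \<bullet> \<xi>) - cis (y \<bullet> \<xi>))"
          by (simp only: norm_mult norm_of_real abs_exp_cancel)
        also have "\<dots> \<le> cmod (G \<xi>) * exp (- \<tau> j * (norm \<xi>)\<^sup>2) * (norm (x - y) * norm \<xi>)"
        proof (rule mult_left_mono)
          have "cmod (cis (x \<bullet> \<xi>) - cis (y \<bullet> \<xi>)) \<le> \<bar>(x - y) \<bullet> \<xi>\<bar>"
            unfolding inner_diff_left by (rule norm_cis_diff_le)
          also have "\<dots> \<le> norm (x - y) * norm \<xi>" by (rule Cauchy_Schwarz_ineq2)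
          finally show "cmod (cis (x \<bullet> \<xi>) - cis (y \<bullet> \<xi>)) \<le> norm (x - y) * norm \<xi>" .
        qed simp
        finally show "cmod (G \<xi> * gauss_wave (\<tau> j) x \<xi> - G \<xi> * gauss_wave (\<tau> j) y \<xi>) \<le> dist x y * (norm \<xi> * cmod (G \<xi>) * exp (- \<tau> j * (norm \<xi>)\<^sup>2))"
          by (simp only: dist_norm mult_ac)
      qed
      also have "\<dots> = (c * (LINT \<xi>|lborel. norm \<xi> * cmod (G \<xi>) * exp (- \<tau> j * (norm \<xi>)\<^sup>2))) * dist x y"
        unfolding integral_mult_right_zero by (simp only: mult_ac)
      finally show "\<bar>gauss_part s f j x - gauss_part s f j y\<bar> \<le> (c * (LINT \<xi>|lborel. norm \<xi> * cmod (G \<xi>) * exp (- \<tau> j * (norm \<xi>)\<^sup>2))) * dist x y" .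
    qed
    fix \<mu> :: "'a measure" assume \<mu>: "frostman_class \<alpha> (2 ^ DIM('a) * 4 powr \<alpha>) \<mu>"
    have sets [simp, measurable_cong]: "sets \<mu> = sets borel" using \<mu> by (simp add: frostman_class_def)
    interpret finite_measure \<mu> by (rule frostman_class_finite[OF \<mu>])
    interpret P: pair_sigma_finite \<mu> "lborel :: 'a measure"
      by (simp add: pair_sigma_finite_def sigma_finite_lborel sigma_finite_measure_axioms)
    define T where "T = wave_transform \<mu> UNIV"
    have [measurable]: "T \<in> borel_measurable borel" unfolding T_def wave_transform_def[abs_def] by measurable
    define g where "g \<xi> = G \<xi> * of_real (exp (- \<tau> j * (norm \<xi>)\<^sup>2))" for \<xi>
    have ig: "integrable lborel g"
      using iG[of j 0] by (simp add: g_def[abs_def] gauss_wave_def)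
    have i1: "integrable \<mu> (\<lambda>x. 1 :: complex)" by simp
    have ip: "integrable (\<mu> \<Otimes>\<^sub>M lborel) (\<lambda>(x, \<xi>). 1 * g \<xi> * cis (x \<bullet> \<xi>))"
      by (rule P.integrable_cis_product[OF i1 ig]) measurable
    have e: "(LINT x|\<mu>. complex_of_real (gauss_part s f j x)) = of_real c * (LINT \<xi>|lborel. g \<xi> * T \<xi>)"
    proof -
      have "(LINT x|\<mu>. complex_of_real (gauss_part s f j x)) = of_real c * (LINT x|\<mu>. LINT \<xi>|lborel. 1 * g \<xi> * cis (x \<bullet> \<xi>))"
        unfolding part c_def[symmetric] integral_mult_right_zero g_def gauss_wave_def by (simp only: mult_1 mult.assoc)
      also have "(LINT x|\<mu>. LINT \<xi>|lborel. 1 * g \<xi> * cis (x \<bullet> \<xi>)) = (LINT \<xi>|lborel. LINT x|\<mu>. 1 * g \<xi> * cis (x \<bullet> \<xi>))"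
        by (rule P.Fubini_integral[OF ip, symmetric])
      also have "\<dots> = (LINT \<xi>|lborel. g \<xi> * T \<xi>)"
        by (simp add: T_def wave_transform_def)
      finally show ?thesis .
    qed
    have intp: "integrable \<mu> (\<lambda>x. complex_of_real (gauss_part s f j x))"
      unfolding part using P.integrable_fst[OF ip]
      by (simp only: g_def gauss_wave_def mult_1 mult.assoc case_prod_conv integrable_mult_right)
    have "(\<integral>\<^sup>+x. ennreal (gauss_part s f j x) \<partial>\<mu>) = ennreal (LINT x|\<mu>. gauss_part s f j x)"
      using intp unfolding complex_of_real_integrable_eq by (rule nn_integral_eq_integral) simp
    also have "\<dots> \<le> ennreal (cmod (LINT x|\<mu>. complex_of_real (gauss_part s f j x)))"
      by (intro ennreal_leI) simp
    also have "\<dots> = ennreal c * ennreal (cmod (LINT \<xi>|lborel. g \<xi> * T \<xi>))"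
      unfolding e norm_mult using c by (simp add: ennreal_mult)
    also have "\<dots> \<le> ennreal c * ennreal (sqrt (N * (E * \<tau> j powr (- p))))"
    proof (rule mult_left_mono)
      have "ennreal (cmod (LINT \<xi>|lborel. g \<xi> * T \<xi>)) \<le> (\<integral>\<^sup>+\<xi>. ennreal (cmod (G \<xi>)) * ennreal (exp (- \<tau> j * (norm \<xi>)\<^sup>2) * cmod (T \<xi>)) \<partial>lborel)"
        by (rule order_trans[OF norm_integral_le_nn_integral]) (simp add: g_def norm_mult ennreal_mult mult.assoc)
      also have "\<dots> \<le> ennreal (sqrt (N * (E * \<tau> j powr (- p))))"
      proof (rule nn_integral_Cauchy_Schwarz)
        show "(\<integral>\<^sup>+\<xi>. (ennreal (cmod (G \<xi>)))\<^sup>2 \<partial>lborel) \<le> ennreal N"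
          unfolding N_def square_integrableD(3)[OF G(1)] ..
        show "(\<integral>\<^sup>+\<xi>. (ennreal (exp (- \<tau> j * (norm \<xi>)\<^sup>2) * cmod (T \<xi>)))\<^sup>2 \<partial>lborel) \<le> ennreal (E * \<tau> j powr (- p))"
          unfolding T_def E_def
        proof (rule gauss_energy_bound[OF sets finite_measure_axioms _ K _ D p(1) p(3) \<tau>(1) \<tau>(2)])
          show "emeasure \<mu> UNIV \<le> ennreal K" unfolding K_def by (rule frostman_class_emeasure[OF \<mu>])
          show "(\<integral>\<^sup>+w. ennreal ((cmod (wave_transform \<mu> UNIV (R *\<^sub>R w)))\<^sup>2) \<partial>sphere_measure) \<le> ennreal (D * R powr (- \<beta>))" if "R > 1" for R
            using wave_transform_decay[OF dec \<mu> _ that, of UNIV] by (simp add: D_def K_def)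
        qed
      qed (use N E in auto)
      finally show "ennreal (cmod (LINT \<xi>|lborel. g \<xi> * T \<xi>)) \<le> ennreal (sqrt (N * (E * \<tau> j powr (- p))))" .
    qed simp
    also have "\<dots> = ennreal (c * sqrt (N * (E * \<tau> j powr (- p))))" using c N E by (intro ennreal_mult[symmetric]) auto
    also have "c * sqrt (N * (E * \<tau> j powr (- p))) = B * q ^ (2 * j)"
    proof -
      have qp: "q ^ n = 2 powr (- (s - p) / 2 * real n)" for n :: nat
        unfolding q_def by (rule powr_power[THEN trans]) (auto simp: mult.commute)
      have "\<tau> j = 2 powr (- (2 * real j))"
      proof -
        have "(4::real) ^ j = 2 ^ (2 * j)" by (simp add: power_mult)
        also have "\<dots> = 2 powr (2 * real j)" using powr_realpow[of 2 "2 * j"] by simp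
        finally show ?thesis unfolding \<tau>_def by (simp add: powr_minus_divide)
      qed
      then have "\<tau> j powr (- p) = 2 powr (2 * (real j * p))" by (simp add: powr_powr mult.assoc)
      also have "\<dots> = (2 powr (real j * p))\<^sup>2" unfolding power2_eq_square powr_add[symmetric] by (simp add: mult_ac)
      finally have "sqrt (\<tau> j powr (- p)) = 2 powr (real j * p)" by simp
      then have "c * sqrt (N * (E * \<tau> j powr (- p))) = B * (c * 2 powr (real j * p))"
        by (simp add: B_def real_sqrt_mult)
      also have "c * 2 powr (real j * p) = q ^ (2 * j)"
        unfolding qp c_def powr_add[symmetric] by (rule arg_cong) (simp add: field_simps)
      finally show ?thesis .
    qed
    finally show "(\<integral>\<^sup>+x. ennreal (gauss_part s f j x) \<partial>\<mu>) \<le> ennreal (B * q ^ (2 * j))" .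
  next
    show "0 < q" by (simp add: q_def)
    show "q < 1" unfolding q_def using p powr_less_mono[of "- (s - p) / 2" 0 2] by simp
    show "B \<ge> 0" using N E by (simp add: B_def)
  qed simp
qed

section \<open>Values of Riesz potentials\<close>

text \<open>Lowering the time from a to \<tau> raises the prefactor by at most 4^(d/2) and narrows
  the Gaussian.\<close>

lemma gauss_kernel_dyadic:
  assumes "a / 4 < \<tau>" "\<tau> \<le> a"
  shows "gauss_kernel \<tau> (x::'a::euclidean_space) \<le> (1 / 4) powr (- real DIM('a) / 2) * gauss_kernel a x"
proof -
  have a: "0 < a" "0 < \<tau>" using assms by auto
  have "(2 * \<tau>) powr (- real DIM('a) / 2) \<le> (1 / 4 * (2 * a)) powr (- real DIM('a) / 2)"
    using assms a by (intro powr_mono2') auto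
  also have "\<dots> = (1 / 4) powr (- real DIM('a) / 2) * (2 * a) powr (- real DIM('a) / 2)"
    by (rule powr_mult)
  finally have p: "(2 * \<tau>) powr (- real DIM('a) / 2) \<le> (1 / 4) powr (- real DIM('a) / 2) * (2 * a) powr (- real DIM('a) / 2)" .
  have "(norm x)\<^sup>2 / (4 * a) \<le> (norm x)\<^sup>2 / (4 * \<tau>)"
    using assms a by (intro divide_left_mono) auto
  then have "exp (- (norm x)\<^sup>2 / (4 * \<tau>)) \<le> exp (- (norm x)\<^sup>2 / (4 * a))" by simp
  then show ?thesis
    unfolding gauss_kernel_def mult.assoc[symmetric] by (intro mult_mono p) auto
qed

lemma dyadic_scale_exists:
  fixes \<tau> :: real
  assumes "0 < \<tau>" "\<tau> \<le> 1"
  shows "\<exists>j::nat. 1 / 4 ^ j / 4 < \<tau> \<and> \<tau> \<le> 1 / 4 ^ j"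
proof -
  obtain m where m: "(1 / 4) ^ m < \<tau>" using real_arch_pow_inv[of \<tau> "1 / 4"] assms by auto
  define n where "n = (LEAST n. (1 / 4) ^ n < \<tau>)"
  have n: "(1 / 4) ^ n < \<tau>" unfolding n_def by (rule LeastI) (rule m)
  with assms have "n \<noteq> 0" by (intro notI) simp
  then obtain j where j: "n = Suc j" by (auto simp: gr0_conv_Suc)
  have "\<not> (1 / 4) ^ j < \<tau>" using not_less_Least[of j "\<lambda>n. (1 / 4) ^ n < \<tau>"] j n_def by simp
  then show ?thesis using n j by (intro exI[of _ j]) (auto simp: power_one_over mult.commute)
qed

text \<open>(0,1] splits into blocks (4^(-j)/4, 4^(-j)], on each of which the kernel is dominated by
  the one at the upper end; block j then contributes at most a constant times
  \<open>gauss_part s f j x\<close>.\<close>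

lemma gauss_part_small_scales:
  fixes f :: "'a::euclidean_space \<Rightarrow> complex"
  assumes f: "f \<in> square_integrable" and s: "0 < s" and sm: "summable (\<lambda>j. gauss_part s f j x)"
  shows "(\<integral>\<^sup>+\<tau>. ennreal (indicator {0<..1} \<tau> * \<tau> powr (s / 2 - 1)) *
    (\<integral>\<^sup>+y. ennreal (cmod (f y) * gauss_kernel \<tau> (x - y)) \<partial>lborel) \<partial>lborel) < \<infinity>"
proof -
  note [measurable] = square_integrableD(1)[OF f]
  define H where "H \<tau> = (\<integral>\<^sup>+y. ennreal (cmod (f y) * gauss_kernel \<tau> (x - y)) \<partial>lborel)" for \<tau>
  have [measurable]: "H \<in> borel_measurable borel" unfolding H_def[abs_def] by measurable
  define c where "c = (1 / 4) powr (- real DIM('a) / 2)"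
  have c: "c \<ge> 0" by (simp add: c_def)
  define a where "a j = (1 / 4 ^ j :: real)" for j :: nat
  have a: "a j > 0" "a j \<le> 1" for j by (auto simp: a_def divide_le_eq_1)
  \<comment> \<open>On a block 1/\<tau> < 4 / a j and \<tau>^(s/2) \<le> (a j)^(s/2), and c bounds
    the change of the kernel. The length of the block, at most a j, later cancels the
    division.\<close>
  define w where "w j = 4 * (a j powr (s / 2) / a j) * c" for j
  have w: "w j \<ge> 0" for j using a[of j] c by (simp add: w_def)
  have "(\<integral>\<^sup>+\<tau>. ennreal (indicator {0<..1} \<tau> * \<tau> powr (s / 2 - 1)) * H \<tau> \<partial>lborel) \<le>
    (\<integral>\<^sup>+\<tau>. (\<Sum>j. (ennreal (w j) * H (a j)) * indicator {a j / 4<..a j} \<tau>) \<partial>lborel)"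
  proof (rule nn_integral_mono)
    fix \<tau> :: real
    show "ennreal (indicator {0<..1} \<tau> * \<tau> powr (s / 2 - 1)) * H \<tau> \<le> (\<Sum>j. (ennreal (w j) * H (a j)) * indicator {a j / 4<..a j} \<tau>)"
    proof (cases "0 < \<tau> \<and> \<tau> \<le> 1")
      case True
      then obtain j where j: "a j / 4 < \<tau>" "\<tau> \<le> a j"
        using dyadic_scale_exists[of \<tau>] unfolding a_def by blast
      have "H \<tau> \<le> (\<integral>\<^sup>+y. ennreal c * ennreal (cmod (f y) * gauss_kernel (a j) (x - y)) \<partial>lborel)"
        unfolding H_def
      proof (rule nn_integral_mono)
        fix y :: 'a
        have "cmod (f y) * gauss_kernel \<tau> (x - y) \<le> cmod (f y) * (c * gauss_kernel (a j) (x - y))"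
          unfolding c_def by (intro mult_left_mono gauss_kernel_dyadic j) auto
        then have "ennreal (cmod (f y) * gauss_kernel \<tau> (x - y)) \<le> ennreal (c * (cmod (f y) * gauss_kernel (a j) (x - y)))"
          by (intro ennreal_leI) (simp only: mult.left_commute)
        then show "ennreal (cmod (f y) * gauss_kernel \<tau> (x - y)) \<le> ennreal c * ennreal (cmod (f y) * gauss_kernel (a j) (x - y))"
          using c by (subst (asm) ennreal_mult) auto
      qed
      also have "\<dots> = ennreal c * H (a j)" unfolding H_def by (rule nn_integral_cmult) measurable
      finally have h: "H \<tau> \<le> ennreal c * H (a j)" .
      have "\<tau> powr (s / 2 - 1) = \<tau> powr (s / 2) * (1 / \<tau>)" using True by (simp add: powr_diff)
      also have "\<dots> \<le> a j powr (s / 2) * (4 / a j)"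
      proof (rule mult_mono)
        show "\<tau> powr (s / 2) \<le> a j powr (s / 2)" using True j s by (intro powr_mono2) auto
        show "1 / \<tau> \<le> 4 / a j" using True j(1) a(1)[of j] by (simp add: field_simps)
      qed (use True in auto)
      finally have "\<tau> powr (s / 2 - 1) \<le> 4 * (a j powr (s / 2) / a j)" by (simp add: mult.commute)
      then have "ennreal (indicator {0<..1} \<tau> * \<tau> powr (s / 2 - 1)) * H \<tau> \<le> ennreal (4 * (a j powr (s / 2) / a j)) * (ennreal c * H (a j))"
        using True by (intro mult_mono h) (auto intro!: ennreal_leI)
      also have "\<dots> = (ennreal (w j) * H (a j)) * indicator {a j / 4<..a j} \<tau>"
      proof -
        have "ennreal (w j) = ennreal (4 * (a j powr (s / 2) / a j)) * ennreal c"
          unfolding w_def using a(1)[of j] c by (intro ennreal_mult) auto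
        then show ?thesis using j by (simp add: mult.assoc)
      qed
      also have "\<dots> \<le> (\<Sum>j. (ennreal (w j) * H (a j)) * indicator {a j / 4<..a j} \<tau>)"
        by (rule ennreal_suminf_term_le)
      finally show ?thesis .
    qed (auto simp: indicator_def)
  qed
  also have "\<dots> = (\<Sum>j. (\<integral>\<^sup>+\<tau>. (ennreal (w j) * H (a j)) * indicator {a j / 4<..a j} \<tau> \<partial>lborel))"
    by (rule nn_integral_suminf) measurable
  also have "\<dots> \<le> (\<Sum>j. ennreal (4 * c * gauss_part s f j x))"
  proof (rule suminf_le)
    fix j
    have Hj: "H (a j) = ennreal (LINT y|lborel. cmod (f y) * gauss_kernel (a j) (x - y))"
      unfolding H_def by (rule nn_integral_eq_integral[OF integrable_norm_gauss_kernel[OF f a(1)]]) simp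
    have aj: "a j powr (s / 2) = 2 powr (- (s * real j))"
    proof -
      have "(4::real) ^ j = 2 ^ (2 * j)" by (simp add: power_mult)
      also have "\<dots> = 2 powr (2 * real j)" using powr_realpow[of 2 "2 * j"] by simp
      finally have "a j = 2 powr (- (2 * real j))" unfolding a_def by (simp add: powr_minus_divide)
      then show ?thesis by (simp add: powr_powr mult_ac)
    qed
    have "(\<integral>\<^sup>+\<tau>. (ennreal (w j) * H (a j)) * indicator {a j / 4<..a j} \<tau> \<partial>lborel) = ennreal (w j) * H (a j) * ennreal (a j - a j / 4)"
      using a(1)[of j] by (subst nn_integral_cmult_indicator) auto
    also have "\<dots> \<le> ennreal (w j) * H (a j) * ennreal (a j)"
      using a(1)[of j] by (intro mult_left_mono ennreal_leI) auto
    also have "\<dots> = ennreal (w j * (LINT y|lborel. cmod (f y) * gauss_kernel (a j) (x - y)) * a j)"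
      unfolding Hj using w a(1)[of j] by (simp add: ennreal_mult)
    also have "w j * (LINT y|lborel. cmod (f y) * gauss_kernel (a j) (x - y)) * a j = 4 * c * gauss_part s f j x"
      unfolding w_def gauss_part_def aj a_def[symmetric] using a(1)[of j] by simp
    finally show "(\<integral>\<^sup>+\<tau>. (ennreal (w j) * H (a j)) * indicator {a j / 4<..a j} \<tau> \<partial>lborel) \<le> ennreal (4 * c * gauss_part s f j x)" .
  qed auto
  also have "\<dots> = ennreal (\<Sum>j. 4 * c * gauss_part s f j x)"
    using c by (intro suminf_ennreal2 summable_mult sm) auto
  also have "\<dots> < \<infinity>" by simp
  finally show ?thesis unfolding H_def .
qed

text \<open>Small \<tau> are governed by summability of the Gaussian parts at x. For large \<tau>
  Cauchy-Schwarz uses the L2 norm of the kernel, whose square is at most supremum times mass; so the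
  norm decays like \<tau>^(-d/4), and d/4 > s/2.\<close>

lemma gauss_convolution_integrable:
  fixes f :: "'a::euclidean_space \<Rightarrow> complex"
  assumes f: "f \<in> square_integrable" and s: "0 < s" "s < real DIM('a) / 2"
    and sm: "summable (\<lambda>j. gauss_part s f j x)"
  shows "integrable (gamma_measure s \<Otimes>\<^sub>M lborel) (\<lambda>(\<tau>, y). f y * of_real (gauss_kernel \<tau> (x - y)))"
proof -
  note [measurable] = square_integrableD(1)[OF f]
  define A where "A = (LINT y|lborel. (cmod (f y))\<^sup>2)"
  have A: "A \<ge> 0" by (simp add: A_def)
  define H where "H \<tau> = (\<integral>\<^sup>+y. ennreal (cmod (f y) * gauss_kernel \<tau> (x - y)) \<partial>lborel)" for \<tau>
  have [measurable]: "H \<in> borel_measurable borel" unfolding H_def[abs_def] by measurable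
  define b where "b = (2 * pi) powr (real DIM('a) / 2)"
  have b: "b \<ge> 0" by (simp add: b_def)
  have "(\<integral>\<^sup>+\<tau>. H \<tau> \<partial>gamma_measure s) < \<infinity>"
  proof (rule gamma_measure_split_finite[OF s(1), where q = "real DIM('a) / 4" and C = "sqrt (A * b) * 2 powr (- (real DIM('a) / 4))"])
    show "(\<integral>\<^sup>+\<tau>. ennreal (indicator {0<..1} \<tau> * \<tau> powr (s / 2 - 1)) * H \<tau> \<partial>lborel) < \<infinity>"
      unfolding H_def by (rule gauss_part_small_scales[OF f s(1) sm])
    fix \<tau> :: real assume t: "\<tau> \<ge> 1"
    define k where "k = (2 * \<tau>) powr (- real DIM('a) / 2)"
    have "H \<tau> = (\<integral>\<^sup>+y. ennreal (cmod (f y)) * ennreal (gauss_kernel \<tau> (x - y)) \<partial>lborel)"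
      unfolding H_def by (simp add: ennreal_mult)
    also have "\<dots> \<le> ennreal (sqrt (A * (k * b)))"
    proof (rule nn_integral_Cauchy_Schwarz)
      show "(\<integral>\<^sup>+y. (ennreal (cmod (f y)))\<^sup>2 \<partial>lborel) \<le> ennreal A"
        unfolding A_def square_integrableD(3)[OF f] ..
      have "(\<integral>\<^sup>+y. (ennreal (gauss_kernel \<tau> (x - y)))\<^sup>2 \<partial>lborel) \<le> (\<integral>\<^sup>+y. ennreal k * ennreal (gauss_kernel \<tau> (x - y)) \<partial>lborel)"
        unfolding power2_eq_square k_def using t
        by (intro nn_integral_mono mult_right_mono ennreal_leI gauss_kernel_le) auto
      also have "\<dots> = ennreal k * ennreal b"
        unfolding b_def using t by (subst nn_integral_cmult, measurable, subst nn_integral_gauss_kernel) auto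
      also have "\<dots> = ennreal (k * b)" using b by (intro ennreal_mult[symmetric]) (auto simp: k_def)
      finally show "(\<integral>\<^sup>+y. (ennreal (gauss_kernel \<tau> (x - y)))\<^sup>2 \<partial>lborel) \<le> ennreal (k * b)" .
    qed (use A b in \<open>auto simp: k_def\<close>)
    also have "sqrt (A * (k * b)) = sqrt (A * b) * 2 powr (- (real DIM('a) / 4)) * \<tau> powr (- (real DIM('a) / 4))"
    proof -
      have e: "- (real DIM('a) / 4) + - (real DIM('a) / 4) = - real DIM('a) / 2" by simp
      have "k = ((2 * \<tau>) powr (- (real DIM('a) / 4)))\<^sup>2"
        unfolding k_def power2_eq_square powr_add[symmetric] e ..
      then have "sqrt k = (2 * \<tau>) powr (- (real DIM('a) / 4))" by simp
      also have "\<dots> = 2 powr (- (real DIM('a) / 4)) * \<tau> powr (- (real DIM('a) / 4))"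
        by (rule powr_mult)
      finally show ?thesis by (simp add: real_sqrt_mult)
    qed
    finally show "H \<tau> \<le> ennreal (sqrt (A * b) * 2 powr (- (real DIM('a) / 4)) * \<tau> powr (- (real DIM('a) / 4)))" .
  qed (use s A b in auto)
  moreover have "(\<integral>\<^sup>+p. ennreal (norm ((\<lambda>(\<tau>, y). f y * of_real (gauss_kernel \<tau> (x - y))) p)) \<partial>(gamma_measure s \<Otimes>\<^sub>M lborel)) = (\<integral>\<^sup>+\<tau>. H \<tau> \<partial>gamma_measure s)"
    unfolding H_def by (subst lborel.nn_integral_fst[symmetric]) (auto simp: norm_mult)
  ultimately show ?thesis by (intro integrableI_bounded) auto
qed

text \<open>\<open>gauss_convolution_integrable\<close> licenses Fubini in (\<tau>, y). The Fourier
  side is left as an iterated integral with \<tau> outside, since |\<xi>|^(-s) F need not be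
  integrable in \<xi>.\<close>

lemma riesz_potential_value:
  fixes f :: "'a::euclidean_space \<Rightarrow> complex"
  assumes f: "f \<in> square_integrable" and F: "has_fourier (regular_distribution f) F"
    and s: "0 < s" "s < real DIM('a) / 2" and sm: "summable (\<lambda>j. gauss_part s f j x)"
  shows "integrable lborel (\<lambda>y. riesz_kernel s (x - y) * f y)"
    and "(LINT y|lborel. riesz_kernel s (x - y) * f y) = (LINT \<tau>|gamma_measure s. LINT \<xi>|lborel. F \<xi> * gauss_wave \<tau> x \<xi>)"
proof -
  note [measurable] = square_integrableD(1)[OF f] has_fourier_measurable[OF F]
  have [measurable]: "(riesz_kernel s :: 'a \<Rightarrow> complex) \<in> borel_measurable borel" by (rule riesz_kernel_eq(2)[OF s])
  note i = gauss_convolution_integrable[OF f s sm]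
  have e: "(LINT \<tau>|gamma_measure s. f y * complex_of_real (gauss_kernel \<tau> (x - y))) = gauss_riesz_kernel s (x - y) * f y" for y
    unfolding integral_mult_right_zero gauss_riesz_kernel_def by (rule mult.commute)
  have ae: "AE y in lborel. riesz_kernel s (x - y) * f y = gauss_riesz_kernel s (x - y) * f y"
    using AE_lborel_reflect[OF riesz_kernel_eq(1)[OF s], of x] by eventually_elim simp
  have "integrable lborel (\<lambda>y. gauss_riesz_kernel s (x - y) * f y)"
    using gamma_pair.integrable_snd[OF i] unfolding e .
  then show "integrable lborel (\<lambda>y. riesz_kernel s (x - y) * f y)"
    by (subst integrable_cong_AE[OF _ _ ae]) auto
  have "(LINT y|lborel. riesz_kernel s (x - y) * f y) = (LINT y|lborel. gauss_riesz_kernel s (x - y) * f y)"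
    by (rule integral_cong_AE[OF _ _ ae]) measurable
  also have "\<dots> = (LINT \<tau>|gamma_measure s. LINT y|lborel. f y * complex_of_real (gauss_kernel \<tau> (x - y)))"
    unfolding e[symmetric] by (rule gamma_pair.Fubini_integral[OF i])
  also have "\<dots> = (LINT \<tau>|gamma_measure s. LINT \<xi>|lborel. F \<xi> * gauss_wave \<tau> x \<xi>)"
    by (rule integral_cong_AE, measurable)
       (rule eventually_mono[OF AE_gamma_measure_pos], rule integral_gauss_kernel_fourier[OF F])
  finally show "(LINT y|lborel. riesz_kernel s (x - y) * f y) = (LINT \<tau>|gamma_measure s. LINT \<xi>|lborel. F \<xi> * gauss_wave \<tau> x \<xi>)" .
qed

lemma slice_radial_mult:
  fixes g :: "'a::euclidean_space \<Rightarrow> complex"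
  assumes [measurable]: "u \<in> borel_measurable borel" "g \<in> borel_measurable borel" and r: "r > 0"
  shows "slice (\<lambda>\<xi>. u (norm \<xi>) * g \<xi>) x r = u r * slice g x r"
proof -
  have "slice (\<lambda>\<xi>. u (norm \<xi>) * g \<xi>) x r = slice (\<lambda>\<xi>. u r * g \<xi>) x r"
    using r by (intro slice_local) auto
  then show ?thesis unfolding slice_def by (simp only: mult.assoc integral_mult_right_zero)
qed

lemma gamma_measure_integral_exp:
  assumes s: "s > 0" and r: "(r::real) > 0"
  shows "(LINT \<tau>|gamma_measure s. complex_of_real (exp (- \<tau> * r\<^sup>2))) = of_real (r powr (- s))"
proof -
  have "(LINT \<tau>|gamma_measure s. exp (- \<tau> * r\<^sup>2)) = r powr (- s)"
    using gamma_measure_exp_norm[OF s, of r] r by (subst integral_eq_nn_integral) auto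
  then show ?thesis by simp
qed

text \<open>Integrability is known for the slices as functions of r, after cancellation on each
  sphere, but not for the integrand in \<xi>. Hence for fixed \<tau> the inner integral is first
  written over r, and then \<tau> and r are exchanged.\<close>

lemma gamma_integral_slice:
  fixes F :: "'a::euclidean_space \<Rightarrow> complex"
  assumes F: "F \<in> square_integrable" and s: "0 < s"
    and i: "integrable (radial_measure TYPE('a)) (slice (\<lambda>\<xi>. of_real (norm \<xi> powr (- s)) * F \<xi>) x)"
  shows "(LINT \<tau>|gamma_measure s. LINT \<xi>|lborel. F \<xi> * gauss_wave \<tau> x \<xi>) =
    (LINT r|radial_measure TYPE('a). slice (\<lambda>\<xi>. of_real (norm \<xi> powr (- s)) * F \<xi>) x r)"
proof -
  note [measurable] = square_integrableD(1)[OF F]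
  interpret G: pair_sigma_finite "gamma_measure s" "radial_measure TYPE('a)"
    by (simp add: pair_sigma_finite_def sigma_finite_gamma_measure sigma_finite_radial)
  interpret R: sigma_finite_measure "radial_measure TYPE('a)" by (rule sigma_finite_radial)
  have sl: "slice (\<lambda>\<xi>. of_real (norm \<xi> powr (- s)) * F \<xi>) x r = of_real (r powr (- s)) * slice F x r" if "r > 0" for r
    using slice_radial_mult[of "\<lambda>r. complex_of_real (r powr (- s))" F r x] that by simp
  have "(\<integral>\<^sup>+p. ennreal (norm ((\<lambda>(\<tau>, r). of_real (exp (- \<tau> * r\<^sup>2)) * slice F x r) p)) \<partial>(gamma_measure s \<Otimes>\<^sub>M radial_measure TYPE('a))) =
    (\<integral>\<^sup>+r. (\<integral>\<^sup>+\<tau>. ennreal (norm (of_real (exp (- \<tau> * r\<^sup>2)) * slice F x r)) \<partial>gamma_measure s) \<partial>radial_measure TYPE('a))"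
    by (subst G.nn_integral_snd[symmetric]) auto
  also have "\<dots> = (\<integral>\<^sup>+r. ennreal (norm (slice (\<lambda>\<xi>. of_real (norm \<xi> powr (- s)) * F \<xi>) x r)) \<partial>radial_measure TYPE('a))"
  proof (rule nn_integral_cong_AE, rule eventually_mono[OF AE_radial_pos])
    fix r :: real assume r: "r > 0"
    have "(\<integral>\<^sup>+\<tau>. ennreal (norm (of_real (exp (- \<tau> * r\<^sup>2)) * slice F x r)) \<partial>gamma_measure s) =
      (\<integral>\<^sup>+\<tau>. ennreal (exp (- \<tau> * r\<^sup>2)) * ennreal (norm (slice F x r)) \<partial>gamma_measure s)"
      by (intro nn_integral_cong) (simp add: norm_mult ennreal_mult)
    also have "\<dots> = ennreal (r powr (- s)) * ennreal (norm (slice F x r))"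
      using gamma_measure_exp_norm[OF s, of r] r by (subst nn_integral_multc) auto
    also have "\<dots> = ennreal (norm (slice (\<lambda>\<xi>. of_real (norm \<xi> powr (- s)) * F \<xi>) x r))"
      unfolding sl[OF r] by (simp add: norm_mult ennreal_mult)
    finally show "(\<integral>\<^sup>+\<tau>. ennreal (norm (of_real (exp (- \<tau> * r\<^sup>2)) * slice F x r)) \<partial>gamma_measure s) = ennreal (norm (slice (\<lambda>\<xi>. of_real (norm \<xi> powr (- s)) * F \<xi>) x r))" .
  qed
  also have "\<dots> < \<infinity>" using i by (simp add: integrable_iff_bounded)
  finally have ip: "integrable (gamma_measure s \<Otimes>\<^sub>M radial_measure TYPE('a)) (\<lambda>(\<tau>, r). of_real (exp (- \<tau> * r\<^sup>2)) * slice F x r)"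
    by (intro integrableI_bounded) auto
  have "(LINT \<tau>|gamma_measure s. LINT \<xi>|lborel. F \<xi> * gauss_wave \<tau> x \<xi>) =
    (LINT \<tau>|gamma_measure s. LINT r|radial_measure TYPE('a). of_real (exp (- \<tau> * r\<^sup>2)) * slice F x r)"
  proof (rule integral_cong_AE, measurable, rule eventually_mono[OF AE_gamma_measure_pos])
    fix \<tau> :: real assume t: "\<tau> > 0"
    define g where "g \<xi> = of_real (exp (- \<tau> * (norm \<xi>)\<^sup>2)) * F \<xi>" for \<xi>
    have [measurable]: "g \<in> borel_measurable borel" unfolding g_def[abs_def] by measurable
    have "integrable lborel (\<lambda>\<xi>. F \<xi> * gauss_wave \<tau> 0 \<xi>)"
      by (intro square_integrable_mult[OF F] schwartz_square_integrable schwartz_gauss_wave t)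
    then have ig: "integrable lborel g" by (simp add: g_def[abs_def] gauss_wave_def mult.commute)
    have "(LINT \<xi>|lborel. F \<xi> * gauss_wave \<tau> x \<xi>) = (LINT \<xi>|lborel. g \<xi> * cis (x \<bullet> \<xi>))"
      by (simp only: g_def gauss_wave_def mult_ac)
    also have "\<dots> = (LINT r|radial_measure TYPE('a). slice g x r)" by (rule integral_slice[OF ig, symmetric])
    also have "\<dots> = (LINT r|radial_measure TYPE('a). of_real (exp (- \<tau> * r\<^sup>2)) * slice F x r)"
      unfolding g_def[abs_def]
      by (rule integral_cong_AE, measurable, rule eventually_mono[OF AE_radial_pos])
         (rule slice_radial_mult[where u = "\<lambda>r. complex_of_real (exp (- \<tau> * r\<^sup>2))"], auto)
    finally show "(LINT \<xi>|lborel. F \<xi> * gauss_wave \<tau> x \<xi>) = (LINT r|radial_measure TYPE('a). of_real (exp (- \<tau> * r\<^sup>2)) * slice F x r)" .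
  qed
  also have "\<dots> = (LINT r|radial_measure TYPE('a). LINT \<tau>|gamma_measure s. of_real (exp (- \<tau> * r\<^sup>2)) * slice F x r)"
    by (rule G.Fubini_integral[OF ip, symmetric])
  also have "\<dots> = (LINT r|radial_measure TYPE('a). slice (\<lambda>\<xi>. of_real (norm \<xi> powr (- s)) * F \<xi>) x r)"
  proof (rule integral_cong_AE)
    show "AE r in radial_measure TYPE('a). (LINT \<tau>|gamma_measure s. of_real (exp (- \<tau> * r\<^sup>2)) * slice F x r) = slice (\<lambda>\<xi>. of_real (norm \<xi> powr (- s)) * F \<xi>) x r"
      by (rule eventually_mono[OF AE_radial_pos]) (simp only: integral_mult_left_zero gamma_measure_integral_exp[OF s] sl)
    interpret C: sigma_finite_measure "gamma_measure s" by (rule sigma_finite_gamma_measure)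
    show "(\<lambda>r. LINT \<tau>|gamma_measure s. of_real (exp (- \<tau> * r\<^sup>2)) * slice F x r) \<in> borel_measurable (radial_measure TYPE('a))"
      by measurable
  qed measurable
  finally show ?thesis .
qed

section \<open>Pointwise convergence of solutions\<close>

text \<open>Additivity of a slice presupposes that both sphere integrals exist. A radial Gaussian
  factor makes the integrands integrable on R^d, so they do for almost every r; the factor, a
  nonzero constant on each sphere, is then divided out.\<close>

lemma slice_add_AE:
  fixes g h :: "'a::euclidean_space \<Rightarrow> complex"
  assumes g: "g \<in> square_integrable" and h: "h \<in> square_integrable" and s: "s < real DIM('a) / 2"
  shows "AE r in radial_measure TYPE('a). slice (\<lambda>\<xi>. of_real (norm \<xi> powr (- s)) * (g \<xi> + h \<xi>)) x r =
    slice (\<lambda>\<xi>. of_real (norm \<xi> powr (- s)) * g \<xi>) x r + slice (\<lambda>\<xi>. of_real (norm \<xi> powr (- s)) * h \<xi>) x r"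
proof -
  note [measurable] = square_integrableD(1)[OF g] square_integrableD(1)[OF h]
  define e where "e r = complex_of_real (exp (- 1 * r\<^sup>2))" for r :: real
  have [measurable]: "e \<in> borel_measurable borel" unfolding e_def[abs_def] by measurable
  define G where "G \<xi> = of_real (norm \<xi> powr (- s)) * g \<xi>" for \<xi>
  define H where "H \<xi> = of_real (norm \<xi> powr (- s)) * h \<xi>" for \<xi>
  have [measurable]: "G \<in> borel_measurable borel" "H \<in> borel_measurable borel"
    unfolding G_def[abs_def] H_def[abs_def] by measurable
  have i: "integrable lborel (\<lambda>\<xi>. e (norm \<xi>) * (of_real (norm \<xi> powr (- s)) * k \<xi>) * cis (x \<bullet> \<xi>))"
    if "k \<in> square_integrable" for k
  proof -
    have "integrable lborel (\<lambda>\<xi>. of_real (norm \<xi> powr (- s)) * k \<xi> * gauss_wave 1 x \<xi>)"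
      using schwartz_decay[OF schwartz_gauss_wave[of 1 x]]
      by (intro sobolev_integrable_mult[OF that s] schwartz_measurable schwartz_gauss_wave) auto
    then show ?thesis by (simp add: gauss_wave_def e_def mult_ac)
  qed
  have "AE r in radial_measure TYPE('a). slice (\<lambda>\<xi>. G \<xi> + H \<xi>) x r = slice G x r + slice H x r"
    using AE_integrable_polar[OF i[OF g]] AE_integrable_polar[OF i[OF h]] AE_radial_pos
  proof eventually_elim
    case (elim r)
    note sl = slice_radial_mult[where u = e and x = x, OF _ _ elim(3)]
    have "e r * slice (\<lambda>\<xi>. G \<xi> + H \<xi>) x r = slice (\<lambda>\<xi>. e (norm \<xi>) * (G \<xi> + H \<xi>)) x r"
      by (rule sl[symmetric]) measurable
    also have "\<dots> = slice (\<lambda>\<xi>. e (norm \<xi>) * G \<xi>) x r + slice (\<lambda>\<xi>. e (norm \<xi>) * H \<xi>) x r"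
      unfolding slice_def distrib_left distrib_right G_def H_def
      by (rule Bochner_Integration.integral_add) (rule elim)+
    also have "\<dots> = e r * (slice G x r + slice H x r)"
      unfolding distrib_left by (intro arg_cong2[where f = "(+)"] sl) measurable
    finally show ?case by (simp add: e_def)
  qed
  then show ?thesis unfolding G_def[abs_def] H_def[abs_def] distrib_left .
qed

text \<open>The decay of \<psi> makes the integrand integrable for each N; phase and cutoff are
  radial and leave the sphere integral. The chosen representative \<open>fourier_function T\<close>
  is replaced under the integral.\<close>

lemma truncated_wave_slice:
  fixes P :: "'a::euclidean_space \<Rightarrow> complex"
  assumes P: "P \<in> square_integrable" and s: "s < real DIM('a) / 2" and \<psi>: "\<psi> \<in> schwartz" and N: "N > 0"
    and T: "has_fourier T (\<lambda>\<xi>. of_real (norm \<xi> powr (- s)) * P \<xi>)"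
  shows "truncated_wave \<psi> N t T x = (LINT r|radial_measure TYPE('a).
    of_real (\<psi> (r / N)) * cis (t * r) * slice (\<lambda>\<xi>. of_real (norm \<xi> powr (- s)) * P \<xi>) x r)"
proof -
  note [measurable] = square_integrableD(1)[OF P] has_fourier_measurable[OF has_fourier_fourier_function[OF T]]
  have [measurable]: "\<psi> \<in> borel_measurable borel" by (rule schwartz_measurable[OF \<psi>])
  define u where "u r = of_real (\<psi> (r / N)) * cis (t * r)" for r
  have [measurable]: "u \<in> borel_measurable borel" unfolding u_def[abs_def] by measurable
  have i: "integrable lborel (\<lambda>\<xi>. of_real (norm \<xi> powr (- s)) * P \<xi> * u (norm \<xi>))"
  proof (rule sobolev_integrable_mult[OF P s])
    fix k
    obtain B where B: "B \<ge> 0" "\<And>r. (1 + norm r) ^ k * norm (\<psi> r) \<le> B" using schwartz_decay[OF \<psi>, of k] by blast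
    show "\<exists>B. \<forall>x::'a. (1 + norm x) ^ k * norm (u (norm x)) \<le> B"
    proof (intro exI allI)
      fix x :: 'a
      have "(1 + norm x) ^ k \<le> ((1 + N) * (1 + norm (norm x / N))) ^ k"
        using N by (intro power_mono) (auto simp: field_simps)
      then have "(1 + norm x) ^ k * norm (\<psi> (norm x / N)) \<le> (1 + N) ^ k * (1 + norm (norm x / N)) ^ k * norm (\<psi> (norm x / N))"
        unfolding power_mult_distrib by (rule mult_right_mono) simp
      also have "\<dots> \<le> (1 + N) ^ k * B"
        unfolding mult.assoc using N by (intro mult_left_mono B) auto
      finally show "(1 + norm x) ^ k * norm (u (norm x)) \<le> (1 + N) ^ k * B"
        by (simp add: u_def norm_mult)
    qed
  qed measurable
  then have ig: "integrable lborel (\<lambda>\<xi>. u (norm \<xi>) * (of_real (norm \<xi> powr (- s)) * P \<xi>))"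
    by (simp only: mult.commute)
  have "truncated_wave \<psi> N t T x = (LINT \<xi>|lborel. u (norm \<xi>) * (of_real (norm \<xi> powr (- s)) * P \<xi>) * cis (x \<bullet> \<xi>))"
    unfolding truncated_wave_def
  proof (rule integral_cong_AE)
    show "AE \<xi> in lborel. of_real (\<psi> (norm \<xi> / N)) * fourier_function T \<xi> * cis (x \<bullet> \<xi> + t * norm \<xi>) =
      u (norm \<xi>) * (of_real (norm \<xi> powr (- s)) * P \<xi>) * cis (x \<bullet> \<xi>)"
      using fourier_function_unique[OF T] by eventually_elim (simp add: u_def cis_mult[symmetric])
  qed measurable
  also have "\<dots> = (LINT r|radial_measure TYPE('a). slice (\<lambda>\<xi>. u (norm \<xi>) * (of_real (norm \<xi> powr (- s)) * P \<xi>)) x r)"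
    by (rule integral_slice[OF ig, symmetric])
  also have "\<dots> = (LINT r|radial_measure TYPE('a). u r * slice (\<lambda>\<xi>. of_real (norm \<xi> powr (- s)) * P \<xi>) x r)"
    by (rule integral_cong_AE, measurable, rule eventually_mono[OF AE_radial_pos], rule slice_radial_mult) auto
  finally show ?thesis by (simp add: u_def)
qed

lemma cutoff_limit:
  fixes S :: "real \<Rightarrow> complex"
  assumes \<psi>: "\<psi> \<in> schwartz" and S: "integrable M S" and M [measurable_cong]: "sets M = sets borel"
  shows "((\<lambda>N. LINT r|M. of_real (\<psi> (r / N)) * cis (t * r) * S r) \<longlongrightarrow> of_real (\<psi> 0) * (LINT r|M. cis (t * r) * S r)) at_top"
proof -
  have [measurable]: "\<psi> \<in> borel_measurable borel" by (rule schwartz_measurable[OF \<psi>])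
  note [measurable] = borel_measurable_integrable[OF S]
  obtain B where B: "\<And>r. norm (\<psi> r) \<le> B" using schwartz_decay[OF \<psi>, of 0] by auto
  have "((\<lambda>N. LINT r|M. of_real (\<psi> (r / N)) * cis (t * r) * S r) \<longlongrightarrow> (LINT r|M. of_real (\<psi> 0) * cis (t * r) * S r)) at_top"
  proof (rule integral_dominated_convergence_at_top[where w = "\<lambda>r. B * norm (S r)"])
    show "integrable M (\<lambda>r. B * norm (S r))" by (intro integrable_mult_right integrable_norm S)
    show "\<forall>\<^sub>F N in at_top. AE r in M. norm (of_real (\<psi> (r / N)) * cis (t * r) * S r) \<le> B * norm (S r)"
      using B by (intro always_eventually allI AE_I2) (auto simp: norm_mult intro!: mult_right_mono)
    show "AE r in M. ((\<lambda>N. of_real (\<psi> (r / N)) * cis (t * r) * S r) \<longlongrightarrow> of_real (\<psi> 0) * cis (t * r) * S r) at_top"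
    proof (rule AE_I2)
      fix r :: real
      have "((\<lambda>N. r / N) \<longlongrightarrow> 0) at_top" by real_asymp
      then have "((\<lambda>N. \<psi> (r / N)) \<longlongrightarrow> \<psi> 0) at_top"
        using schwartz_continuous[OF \<psi>] by (intro isCont_tendsto_compose[of 0 \<psi>]) (auto simp: continuous_on_eq_continuous_at)
      then show "((\<lambda>N. of_real (\<psi> (r / N)) * cis (t * r) * S r) \<longlongrightarrow> of_real (\<psi> 0) * cis (t * r) * S r) at_top"
        by (intro tendsto_intros)
    qed
  qed measurable
  then show ?thesis by (simp add: mult.assoc)
qed

lemma oscillation_limit:
  fixes S :: "real \<Rightarrow> complex"
  assumes S: "integrable M S" and M [measurable_cong]: "sets M = sets borel"
  shows "((\<lambda>t. LINT r|M. cis (t * r) * S r) \<longlongrightarrow> (LINT r|M. S r)) (at 0)"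
  unfolding tendsto_at_iff_sequentially comp_def
proof (intro allI impI)
  note [measurable] = borel_measurable_integrable[OF S]
  fix X :: "nat \<Rightarrow> real" assume X: "X \<longlonglongrightarrow> 0"
  show "(\<lambda>n. LINT r|M. cis (X n * r) * S r) \<longlonglongrightarrow> (LINT r|M. S r)"
  proof (rule integral_dominated_convergence[where w = "\<lambda>r. norm (S r)"])
    show "AE r in M. (\<lambda>n. cis (X n * r) * S r) \<longlonglongrightarrow> S r"
    proof (rule AE_I2)
      fix r :: real
      have "(\<lambda>n. cis (X n * r) * S r) \<longlonglongrightarrow> cis (0 * r) * S r"
        unfolding cis_conv_exp by (intro tendsto_intros X)
      then show "(\<lambda>n. cis (X n * r) * S r) \<longlonglongrightarrow> S r" by simp
    qed
  qed (auto simp: norm_mult S)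
qed

lemma not_divergent:
  fixes f :: "'a::euclidean_space \<Rightarrow> complex"
  assumes s: "0 < s" "s < real DIM('a) / 2"
    and \<psi>: "\<psi> \<in> schwartz" "\<psi> 0 = (2 * pi) powr (- real DIM('a) / 2)"
    and f: "f \<in> square_integrable" and F: "has_fourier (regular_distribution f) F" "F \<in> square_integrable"
    and v0: "v0 = riesz_potential s (regular_distribution f)"
    and P: "P \<in> square_integrable" "has_fourier (f_plus v0 v1) (\<lambda>\<xi>. of_real (norm \<xi> powr (- s)) * P \<xi>)"
    and Q: "Q \<in> square_integrable" "has_fourier (f_minus v0 v1) (\<lambda>\<xi>. of_real (norm \<xi> powr (- s)) * Q \<xi>)"
    and PQ: "\<And>\<xi>. P \<xi> + Q \<xi> = F \<xi>"
    and sm: "summable (\<lambda>j. gauss_part s f j x)"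
    and iP: "integrable (radial_measure TYPE('a)) (slice (\<lambda>\<xi>. of_real (norm \<xi> powr (- s)) * P \<xi>) x)"
    and iQ: "integrable (radial_measure TYPE('a)) (slice (\<lambda>\<xi>. of_real (norm \<xi> powr (- s)) * Q \<xi>) x)"
  shows "x \<notin> divergence_set \<psi> s v0 v1"
proof -
  note [measurable] = square_integrableD(1)[OF P(1)] square_integrableD(1)[OF Q(1)] square_integrableD(1)[OF F(2)]
  define SP where "SP = slice (\<lambda>\<xi>. of_real (norm \<xi> powr (- s)) * P \<xi>) x"
  define SQ where "SQ = slice (\<lambda>\<xi>. of_real (norm \<xi> powr (- s)) * Q \<xi>) x"
  define SF where "SF = slice (\<lambda>\<xi>. of_real (norm \<xi> powr (- s)) * F \<xi>) x"
  have [measurable]: "SP \<in> borel_measurable borel" "SQ \<in> borel_measurable borel" "SF \<in> borel_measurable borel"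
    unfolding SP_def SQ_def SF_def by measurable
  define u where "u t = of_real (\<psi> 0) * (LINT r|radial_measure TYPE('a). cis (t * r) * SP r) +
    of_real (\<psi> 0) * (LINT r|radial_measure TYPE('a). cis (- t * r) * SQ r)" for t
  \<comment> \<open>\<psi>(0) equals the convolution factor in \<open>has_value_at\<close>, so the
    limit of the truncations has the right normalisation.\<close>
  define c where "c = of_real (\<psi> 0) * (LINT y|lborel. riesz_kernel s (x - y) * f y)"
  \<comment> \<open>The slices of F are almost everywhere the sums of those of P and Q, so their
    integrability adds no third condition on the point.\<close>
  have ae: "AE r in radial_measure TYPE('a). SF r = SP r + SQ r"
    using slice_add_AE[OF P(1) Q(1) s(2), of x] unfolding SP_def SQ_def SF_def PQ .
  have iF: "integrable (radial_measure TYPE('a)) SF"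
    using Bochner_Integration.integrable_add[OF iP iQ] unfolding SP_def[symmetric] SQ_def[symmetric]
    by (subst integrable_cong_AE[OF _ _ ae]) auto
  have "has_value_at s v0 x c"
    unfolding has_value_at_def c_def \<psi>(2)
    using f v0 riesz_potential_value(1)[OF f F(1) s sm] by blast
  moreover have "\<forall>\<^sub>F t in at 0. has_solution_value \<psi> v0 v1 x t (u t)"
  proof (intro always_eventually allI)
    fix t
    have "((\<lambda>N. (LINT r|radial_measure TYPE('a). of_real (\<psi> (r / N)) * cis (t * r) * SP r) +
      (LINT r|radial_measure TYPE('a). of_real (\<psi> (r / N)) * cis (- t * r) * SQ r)) \<longlongrightarrow> u t) at_top"
      unfolding u_def SP_def SQ_def by (intro tendsto_add cutoff_limit \<psi>(1) iP iQ) simp_all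
    moreover have "\<forall>\<^sub>F N in at_top. (LINT r|radial_measure TYPE('a). of_real (\<psi> (r / N)) * cis (t * r) * SP r) +
      (LINT r|radial_measure TYPE('a). of_real (\<psi> (r / N)) * cis (- t * r) * SQ r) =
      truncated_wave \<psi> N t (f_plus v0 v1) x + truncated_wave \<psi> N (- t) (f_minus v0 v1) x"
      using eventually_gt_at_top[of 0]
      by eventually_elim (simp only: SP_def SQ_def truncated_wave_slice[OF P(1) s(2) \<psi>(1) _ P(2)] truncated_wave_slice[OF Q(1) s(2) \<psi>(1) _ Q(2)])
    ultimately show "has_solution_value \<psi> v0 v1 x t (u t)"
      unfolding has_solution_value_def by (rule Lim_transform_eventually)
  qed
  moreover have "(u \<longlongrightarrow> c) (at 0)"
  proof -
    have lP: "((\<lambda>t. LINT r|radial_measure TYPE('a). cis (t * r) * SP r) \<longlongrightarrow> (LINT r|radial_measure TYPE('a). SP r)) (at 0)"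
      unfolding SP_def by (rule oscillation_limit[OF iP]) simp
    have "((\<lambda>t. LINT r|radial_measure TYPE('a). cis (t * r) * SQ r) \<longlongrightarrow> (LINT r|radial_measure TYPE('a). SQ r)) (at 0)"
      unfolding SQ_def by (rule oscillation_limit[OF iQ]) simp
    moreover have "filterlim uminus (at (0::real)) (at 0)"
      unfolding filterlim_at by (auto intro!: tendsto_eq_intros simp: eventually_at_filter)
    ultimately have lQ: "((\<lambda>t. LINT r|radial_measure TYPE('a). cis (- t * r) * SQ r) \<longlongrightarrow> (LINT r|radial_measure TYPE('a). SQ r)) (at 0)"
      by (rule filterlim_compose)
    have "(u \<longlongrightarrow> of_real (\<psi> 0) * (LINT r|radial_measure TYPE('a). SP r) + of_real (\<psi> 0) * (LINT r|radial_measure TYPE('a). SQ r)) (at 0)"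
      unfolding u_def[abs_def] by (intro tendsto_add tendsto_mult_left lP lQ)
    also have "of_real (\<psi> 0) * (LINT r|radial_measure TYPE('a). SP r) + of_real (\<psi> 0) * (LINT r|radial_measure TYPE('a). SQ r) =
      of_real (\<psi> 0) * (LINT r|radial_measure TYPE('a). SP r + SQ r)"
      using Bochner_Integration.integral_add[OF iP iQ] by (simp only: SP_def SQ_def distrib_left)
    also have "(LINT r|radial_measure TYPE('a). SP r + SQ r) = (LINT r|radial_measure TYPE('a). SF r)"
      using ae by (intro integral_cong_AE) auto
    \<comment> \<open>Both sides equal the iterated Gaussian integral with \<tau> outside: one by
      exchanging \<tau> with y, the other by exchanging \<tau> with r.\<close>
    also have "\<dots> = (LINT y|lborel. riesz_kernel s (x - y) * f y)"
      unfolding SF_def riesz_potential_value(2)[OF f F(1) s sm]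
      by (rule gamma_integral_slice[OF F(2) s(1) iF[unfolded SF_def], symmetric])
    finally show ?thesis unfolding c_def .
  qed
  ultimately show ?thesis unfolding divergence_set_def by blast
qed

theorem proposition1p5:
  fixes s \<alpha> :: real and \<psi> :: "real \<Rightarrow> real"
  assumes "DIM('a::euclidean_space) \<ge> 2"
    and "0 < s" and "s < real DIM('a) / 2"
    and "0 < \<alpha>" and "\<alpha> \<le> real DIM('a)"
    and "\<psi> \<in> schwartz" and "\<And>r. \<psi> r > 0"
    and "\<psi> 0 = (2 * pi) powr (- real DIM('a) / 2)"
    and "decay_exponent TYPE('a) \<alpha> > ereal (real DIM('a) - 2 * s)"
  shows "divergence_dim TYPE('a) \<psi> s \<le> ereal \<alpha>"
proof -
  \<comment> \<open>The supremum exceeds d - 2s, so some admissible \<beta> does, together with its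
    constant C.\<close>
  obtain \<beta> C where \<beta>: "\<beta> > real DIM('a) - 2 * s" and dec: "\<And>R (\<mu>::'a measure). R > 1 \<Longrightarrow> dimensional_measure \<alpha> \<mu> \<Longrightarrow>
     (\<integral>\<^sup>+ \<omega>. ennreal ((cmod (fourier_measure \<mu> (R *\<^sub>R \<omega>)))\<^sup>2) \<partial>sphere_measure)
       \<le> ennreal C * frostman_const \<alpha> \<mu> * emeasure \<mu> UNIV * ennreal (R powr (- \<beta>))"
    using assms(9) unfolding decay_exponent_def less_Sup_iff by auto
  show ?thesis unfolding divergence_dim_def
  proof (rule SUP_least)
    fix v assume v: "v \<in> (homogeneous_sobolev s :: 'a distribution set) \<times> (homogeneous_sobolev (s - 1) :: 'a distribution set)"
    obtain v0 v1 where v01: "v = (v0, v1)" "v0 \<in> homogeneous_sobolev s" "v1 \<in> homogeneous_sobolev (s - 1)"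
      using v by auto
    obtain f where f: "f \<in> square_integrable" and v0: "v0 = riesz_potential s (regular_distribution f)"
      using v01(2) unfolding homogeneous_sobolev_def by auto
    obtain F where F: "F \<in> square_integrable" "has_fourier (regular_distribution f) F"
      using plancherel[OF f] by auto
    obtain P Q where P: "P \<in> square_integrable" "has_fourier (f_plus v0 v1) (\<lambda>\<xi>. of_real (norm \<xi> powr (- s)) * P \<xi>)"
      and Q: "Q \<in> square_integrable" "has_fourier (f_minus v0 v1) (\<lambda>\<xi>. of_real (norm \<xi> powr (- s)) * Q \<xi>)"
      and PQ: "\<And>\<xi>. P \<xi> + Q \<xi> = F \<xi>"
      using wave_data_fourier[OF assms(3) v0 f F(2,1) v01(3)] by auto
    let ?E = "\<lambda>h. {x. \<not> integrable (radial_measure TYPE('a)) (slice (\<lambda>\<xi>. of_real (norm \<xi> powr (- s)) * h \<xi>) x)}"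
    have "divergence_set \<psi> s v0 v1 \<subseteq> {x. \<not> summable (\<lambda>j. gauss_part s f j x)} \<union> (?E P \<union> ?E Q)"
      using not_divergent[OF assms(2,3,6,8) f F(2,1) v0 P Q PQ] by auto
    moreover have "content_null \<alpha> ({x. \<not> summable (\<lambda>j. gauss_part s f j x)} \<union> (?E P \<union> ?E Q))"
      by (intro content_null_Un gauss_exceptional_null[OF dec assms(4,5) \<beta> assms(2) f]
          wave_exceptional_null[OF dec assms(4,5) \<beta> P(1) assms(3)] wave_exceptional_null[OF dec assms(4,5) \<beta> Q(1) assms(3)])
    ultimately have "content_null \<alpha> (divergence_set \<psi> s v0 v1)" by (rule content_null_subset[rotated])
    then show "(case v of (v0, v1) \<Rightarrow> hausdorff_dim (divergence_set \<psi> s v0 v1)) \<le> ereal \<alpha>"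
      unfolding v01(1) prod.case by (rule content_null_hausdorff_dim) (rule assms(4))
  qed
qed

end
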